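(* Let $k$ be a field with $\operatorname{char}(k)\neq2$ and let $G\le\mathcal{S}_n$ act by permutations on $k[x_1,\ldots,x_n]$ and on $\mathbb{Q}[x_1,\ldots,x_n]$. The following are equivalent: (1) The ring $k[x_1,\ldots,x_n]^G$ is quasi-Gorenstein. (2) The character $\operatorname{sgn}/\chi\colon G\to k^\times$ is trivial. (3) The ring $\mathbb{Q}[x_1,\ldots,x_n]^G$ is quasi-Gorenstein, equivalently, Gorenstein.
   Context: The action is by algebra automorphisms over the base field with $\sigma\cdot x_i=x_{\sigma(i)}$. For $S=k[x_1,\ldots,x_n]$ with the standard grading and $\mathfrak n$ the homogeneous maximal ideal of $S^G$, the canonical module is $\omega_{S^G}:=H^n_{\mathfrak n}(S^G)^*$, where the graded dual $M^*$ has $[M^*]_d=\operatorname{Hom}_k([M]_{-d},k)$. The ring $S^G$ is quasi-Gorenstein if $\omega_{S^G}\cong S^G(a)$ as graded $S^G$-modules for some $a\in\mathbb{Z}$, where $[M(a)]_d:=[M]_{a+d}$; similarly over $\mathbb{Q}$. $\operatorname{sgn}\colon\mathcal{S}_n\to k^\times$ is the sign character, restricted to $G$. Let $T\subset G$ be the set of transpositions in $G$, and $\theta:=\prod_{(i,j)\in T}(x_i-x_j)\in S$ (one factor for each transposition; well defined up to sign). The character $\chi\colon G\to k^\times$ is $\chi(\sigma):=\sigma(\theta)/\theta$. *)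

theory Defs
  imports
    "HOL-Algebra.Sym_Groups"
    "HOL-Algebra.Ideal"
    "HOL-Computational_Algebra.Computational_Algebra"
    "HOL-Library.Poly_Mapping"
    "HOL-Library.Extended_Nat"
    "HOL-Library.Function_Algebras"
    "HOL-Library.Set_Algebras"
begin

section \<open>Polynomials and the permutation action\<close>

text \<open>
  A polynomial is a finitely supported function from exponent vectors to coefficients; all
  the variables \<open>x\<^sub>0, x\<^sub>1, \<dots>\<close> live in one type, and \<open>poly_ring n\<close> is
  \<open>k[x\<^sub>1, \<dots>, x\<^sub>n]\<close>.
\<close>

type_synonym 'k mpoly = "(nat \<Rightarrow>\<^sub>0 nat) \<Rightarrow>\<^sub>0 'k"

definition const :: "'k::field \<Rightarrow> 'k mpoly" where
  "const c = Poly_Mapping.single 0 c"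

definition var :: "nat \<Rightarrow> 'k::field mpoly" where
  "var i = Poly_Mapping.single (Poly_Mapping.single i 1) 1"

definition poly_ring :: "nat \<Rightarrow> 'k::field mpoly set" where
  "poly_ring n = {p. \<forall>m\<in>Poly_Mapping.keys p. Poly_Mapping.keys m \<subseteq> {1..n}}"

definition total_degree :: "(nat \<Rightarrow>\<^sub>0 nat) \<Rightarrow> nat" where
  "total_degree m = (\<Sum>i\<in>Poly_Mapping.keys m. Poly_Mapping.lookup m i)"

text \<open>Zero is homogeneous of every degree, and it is the only element of negative degree.\<close>

definition homogeneous :: "int \<Rightarrow> 'k::field mpoly \<Rightarrow> bool" where
  "homogeneous d p \<longleftrightarrow> (\<forall>m\<in>Poly_Mapping.keys p. int (total_degree m) = d)"

definition act :: "(nat \<Rightarrow> nat) \<Rightarrow> 'k::field mpoly \<Rightarrow> 'k mpoly" where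
  "act \<sigma> p = (\<Sum>m\<in>Poly_Mapping.keys p.
     const (Poly_Mapping.lookup p m) *
     (\<Prod>i\<in>Poly_Mapping.keys m. var (\<sigma> i) ^ Poly_Mapping.lookup m i))"

definition invariants :: "nat \<Rightarrow> (nat \<Rightarrow> nat) set \<Rightarrow> 'k::field mpoly set" where
  "invariants n G = {p \<in> poly_ring n. \<forall>\<sigma>\<in>G. act \<sigma> p = p}"

text \<open>
  Each transposition is counted once, through its representation with \<open>i < j\<close>; this fixes
  the sign of \<open>\<theta>\<close>, on which \<open>\<chi>\<close> does not depend.
\<close>

definition theta :: "nat \<Rightarrow> (nat \<Rightarrow> nat) set \<Rightarrow> 'k::field mpoly" where
  "theta n G =
     (\<Prod>(i, j)\<in>{(i, j). 1 \<le> i \<and> i < j \<and> j \<le> n \<and> transpose i j \<in> G}. var i - var j)"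

text \<open>
  The scalar \<open>\<sigma>(\<theta>)/\<theta>\<close>. It exists and is unique for \<open>\<sigma> \<in> G\<close>: conjugation by
  \<open>\<sigma>\<close> permutes the transpositions of \<open>G\<close>, and \<open>\<theta> \<noteq> 0\<close>.
\<close>

definition chi :: "nat \<Rightarrow> (nat \<Rightarrow> nat) set \<Rightarrow> (nat \<Rightarrow> nat) \<Rightarrow> 'k::field" where
  "chi n G \<sigma> = (THE c. act \<sigma> (theta n G) = const c * theta n G)"

definition sgn_char :: "(nat \<Rightarrow> nat) \<Rightarrow> 'k::field" where
  "sgn_char \<sigma> = of_int (sign \<sigma>)"


section \<open>Graded modules over a graded ring of polynomials\<close>

text \<open>
  A graded module \<open>M = \<Oplus>\<^sub>d M\<^sub>d\<close> is given by its homogeneous components and by the operations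
  on them: \<open>gcomp M d\<close> is \<open>M\<^sub>d\<close>, \<open>gadd M d\<close> is the addition of \<open>M\<^sub>d\<close>, and \<open>gscale M e d\<close>
  is the multiplication \<open>R\<^sub>e \<times> M\<^sub>d \<rightarrow> M\<^bsub>e+d\<^esub>\<close>. The ring \<open>R\<close> is a graded subalgebra of a
  polynomial ring, so that \<open>k\<close> acts on \<open>M\<^sub>d\<close> by \<open>gscale M 0 d \<circ> const\<close>.
\<close>

record ('r, 'm) graded_module =
  gcomp :: "int \<Rightarrow> 'm set"
  gadd :: "int \<Rightarrow> 'm \<Rightarrow> 'm \<Rightarrow> 'm"
  gscale :: "int \<Rightarrow> int \<Rightarrow> 'r \<Rightarrow> 'm \<Rightarrow> 'm"

definition ring_as_module :: "'k::field mpoly set \<Rightarrow> ('k mpoly, 'k mpoly) graded_module" where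
  "ring_as_module R =
     \<lparr> gcomp = (\<lambda>d. {p \<in> R. homogeneous d p}),
       gadd = (\<lambda>d p q. p + q),
       gscale = (\<lambda>e d r p. r * p) \<rparr>"

definition shift :: "('r, 'm) graded_module \<Rightarrow> int \<Rightarrow> ('r, 'm) graded_module" where
  "shift M a =
     \<lparr> gcomp = (\<lambda>d. gcomp M (a + d)),
       gadd = (\<lambda>d. gadd M (a + d)),
       gscale = (\<lambda>e d. gscale M e (a + d)) \<rparr>"

text \<open>
  The component of degree \<open>d\<close> of the graded dual is \<open>Hom\<^sub>k(M\<^bsub>-d\<^esub>, k)\<close>, on which \<open>r \<in> R\<^sub>e\<close> acts by
  \<open>(r \<phi>)(x) = \<phi>(r x)\<close>. Functionals are \<open>undefined\<close> outside \<open>M\<^bsub>-d\<^esub>\<close>.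
\<close>

definition graded_dual ::
  "('k::field mpoly, 'm) graded_module \<Rightarrow> ('k mpoly, 'm \<Rightarrow> 'k) graded_module" where
  "graded_dual M =
     \<lparr> gcomp = (\<lambda>d. {\<phi> \<in> extensional (gcomp M (- d)).
          (\<forall>x\<in>gcomp M (- d). \<forall>y\<in>gcomp M (- d). \<phi> (gadd M (- d) x y) = \<phi> x + \<phi> y) \<and>
          (\<forall>c. \<forall>x\<in>gcomp M (- d). \<phi> (gscale M 0 (- d) (const c) x) = c * \<phi> x)}),
       gadd = (\<lambda>d \<phi> \<psi>. \<lambda>x\<in>gcomp M (- d). \<phi> x + \<psi> x),
       gscale = (\<lambda>e d r \<phi>. \<lambda>x\<in>gcomp M (- (e + d)). \<phi> (gscale M e (- (e + d)) r x)) \<rparr>"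

definition graded_iso ::
  "'k::field mpoly set \<Rightarrow> ('k mpoly, 'm) graded_module \<Rightarrow> ('k mpoly, 'n) graded_module \<Rightarrow> bool" where
  "graded_iso R M N \<longleftrightarrow>
     (\<exists>f :: int \<Rightarrow> 'm \<Rightarrow> 'n.
        (\<forall>d. bij_betw (f d) (gcomp M d) (gcomp N d)) \<and>
        (\<forall>d. \<forall>x\<in>gcomp M d. \<forall>y\<in>gcomp M d. f d (gadd M d x y) = gadd N d (f d x) (f d y)) \<and>
        (\<forall>e d. \<forall>r\<in>R. \<forall>x\<in>gcomp M d. homogeneous e r \<longrightarrow>
           f (e + d) (gscale M e d r x) = gscale N e d r (f d x)))"


section \<open>Local cohomology at the homogeneous maximal ideal\<close>

definition ring_on :: "'a::comm_ring_1 set \<Rightarrow> 'a ring" where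
  "ring_on R = \<lparr> carrier = R, mult = (*), one = 1, zero = 0, add = (+) \<rparr>"

definition radical :: "'a::comm_ring_1 set \<Rightarrow> 'a set \<Rightarrow> 'a set" where
  "radical R I = {r \<in> R. \<exists>t::nat. r ^ t \<in> I}"

definition irrelevant_ideal :: "'k::field mpoly set \<Rightarrow> 'k mpoly set" where
  "irrelevant_ideal R = {p \<in> R. Poly_Mapping.lookup p 0 = 0}"

text \<open>
  Local cohomology with support in the homogeneous maximal ideal \<open>\<nn>\<close> of \<open>R\<close> is the cohomology
  of the Cech complex on a finite sequence of homogeneous elements that generates \<open>\<nn>\<close> up to
  radical; up to isomorphism of graded modules it does not depend on the sequence.
  As \<open>R\<close> is a domain, we may leave zero out of the sequence, and every localisation
  \<open>R\<^sub>f\<close> is then a subring of the field of fractions.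
\<close>

definition generates_up_to_radical :: "'k::field mpoly set \<Rightarrow> 'k mpoly list \<Rightarrow> bool" where
  "generates_up_to_radical R fs \<longleftrightarrow>
     (\<forall>f\<in>set fs. f \<in> R \<and> f \<noteq> 0 \<and> (\<exists>d. homogeneous d f)) \<and>
     radical R (genideal (ring_on R) (set fs)) = irrelevant_ideal R"

definition localization_comp ::
  "'k::field mpoly set \<Rightarrow> 'k mpoly \<Rightarrow> int \<Rightarrow> 'k mpoly fract set" where
  "localization_comp R f d =
     {Fraction_Field.Fract r (f ^ t) | r t e.
        r \<in> R \<and> homogeneous e f \<and> homogeneous (d + int t * e) r}"

text \<open>
  The term of cohomological degree \<open>i\<close> is the sum, over the sets \<open>I\<close> of \<open>i\<close> positions of the
  sequence, of the localisations of \<open>R\<close> at \<open>\<Prod>\<^bsub>j\<in>I\<^esub> f\<^sub>j\<close>. A cochain is extended by zero to all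
  other sets of natural numbers.
\<close>

definition cech_cochains ::
  "'k::field mpoly set \<Rightarrow> 'k mpoly list \<Rightarrow> nat \<Rightarrow> int \<Rightarrow> (nat set \<Rightarrow> 'k mpoly fract) set" where
  "cech_cochains R fs i d =
     {c. \<forall>I. if I \<subseteq> {..<length fs} \<and> card I = i
             then c I \<in> localization_comp R (\<Prod>j\<in>I. fs ! j) d
             else c I = 0}"

definition cech_diff ::
  "'k::field mpoly list \<Rightarrow> (nat set \<Rightarrow> 'k mpoly fract) \<Rightarrow> (nat set \<Rightarrow> 'k mpoly fract)" where
  "cech_diff fs c =
     (\<lambda>J. if J \<subseteq> {..<length fs}
          then (\<Sum>j\<in>J. (- 1) ^ card {l \<in> J. l < j} * c (J - {j}))
          else 0)"

definition cech_cocycles ::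
  "'k::field mpoly set \<Rightarrow> 'k mpoly list \<Rightarrow> nat \<Rightarrow> int \<Rightarrow> (nat set \<Rightarrow> 'k mpoly fract) set" where
  "cech_cocycles R fs i d = {c \<in> cech_cochains R fs i d. cech_diff fs c = 0}"

definition cech_coboundaries ::
  "'k::field mpoly set \<Rightarrow> 'k mpoly list \<Rightarrow> nat \<Rightarrow> int \<Rightarrow> (nat set \<Rightarrow> 'k mpoly fract) set" where
  "cech_coboundaries R fs i d =
     (if i = 0 then {0} else cech_diff fs ` cech_cochains R fs (i - 1) d)"

text \<open>
  The elements of degree \<open>d\<close> are the cosets of the coboundaries of degree \<open>d\<close>; sums of cosets
  are sums of sets.
\<close>

definition cech_cohomology ::
  "'k::field mpoly set \<Rightarrow> 'k mpoly list \<Rightarrow> nat \<Rightarrow>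
     ('k mpoly, (nat set \<Rightarrow> 'k mpoly fract) set) graded_module" where
  "cech_cohomology R fs i =
     \<lparr> gcomp = (\<lambda>d. (\<lambda>z. z +o cech_coboundaries R fs i d) ` cech_cocycles R fs i d),
       gadd = (\<lambda>d X Y. X + Y),
       gscale = (\<lambda>e d r X.
         (\<lambda>z I. Fraction_Field.Fract r 1 * z I) ` X + cech_coboundaries R fs i (e + d)) \<rparr>"


section \<open>Quasi-Gorenstein and Gorenstein rings\<close>

text \<open>
  Throughout, \<open>n\<close> is the dimension of \<open>R\<close>, and \<open>(H\<^sup>n\<^sub>\<nn>(R))\<^sup>*\<close> is the canonical module of \<open>R\<close>.
\<close>

definition canonical_module ::
  "nat \<Rightarrow> 'k::field mpoly set \<Rightarrow> 'k mpoly list \<Rightarrow>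
     ('k mpoly, (nat set \<Rightarrow> 'k mpoly fract) set \<Rightarrow> 'k) graded_module" where
  "canonical_module n R fs = graded_dual (cech_cohomology R fs n)"

definition quasi_Gorenstein :: "nat \<Rightarrow> 'k::field mpoly set \<Rightarrow> bool" where
  "quasi_Gorenstein n R \<longleftrightarrow>
     (\<exists>fs. generates_up_to_radical R fs \<and>
       (\<exists>a. graded_iso R (canonical_module n R fs) (shift (ring_as_module R) a)))"

definition krull_dim :: "('a, 'b) ring_scheme \<Rightarrow> enat" where
  "krull_dim A =
     (SUP Ps\<in>{Ps. Ps \<noteq> [] \<and> (\<forall>P\<in>set Ps. primeideal P A) \<and> sorted_wrt (\<subset>) Ps}.
        enat (length Ps - 1))"

definition regular_sequence :: "('a, 'b) ring_scheme \<Rightarrow> 'a list \<Rightarrow> bool" where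
  "regular_sequence A fs \<longleftrightarrow>
     set fs \<subseteq> carrier A \<and> genideal A (set fs) \<noteq> carrier A \<and>
     (\<forall>i<length fs. \<forall>a\<in>carrier A.
        a \<otimes>\<^bsub>A\<^esub> fs ! i \<in> genideal A (set (take i fs)) \<longrightarrow> a \<in> genideal A (set (take i fs)))"

definition depth :: "('a, 'b) ring_scheme \<Rightarrow> 'a set \<Rightarrow> enat" where
  "depth A I = (SUP fs\<in>{fs. regular_sequence A fs \<and> set fs \<subseteq> I}. enat (length fs))"

definition Cohen_Macaulay :: "'k::field mpoly set \<Rightarrow> bool" where
  "Cohen_Macaulay R \<longleftrightarrow> depth (ring_on R) (irrelevant_ideal R) = krull_dim (ring_on R)"

text \<open>A positively graded algebra is Gorenstein if it is Cohen-Macaulay with \<open>\<omega>\<^sub>R \<cong> R(a)\<close>.\<close>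

definition Gorenstein :: "nat \<Rightarrow> 'k::field mpoly set \<Rightarrow> bool" where
  "Gorenstein n R \<longleftrightarrow> Cohen_Macaulay R \<and> quasi_Gorenstein n R"

end

theory Submission
  imports Defs
begin

text \<open>
  Write \<open>S = k[x\<^sub>1, \<dots>, x\<^sub>n]\<close>, let \<open>A\<close> be the ring of symmetric polynomials and \<open>R\<close> the ring of
  invariants of \<open>G\<close>, so that \<open>A \<subseteq> R \<subseteq> S\<close>, and let \<open>S\<^sub>s\<^sub>g\<^sub>n\<close> (below \<open>semi n G\<close>) be the \<open>R\<close>-module of
  the polynomials on which \<open>G\<close> acts through the sign. The heart of the matter is that the
  canonical module of \<open>R\<close> is \<open>S\<^sub>s\<^sub>g\<^sub>n\<close> with its degrees shifted by \<open>n\<close>, for every field with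
  \<open>2 \<noteq> 0\<close> (\<open>canonical_module_invariants\<close>). Hence \<open>R\<close> is quasi-Gorenstein if and only if \<open>S\<^sub>s\<^sub>g\<^sub>n\<close> is
  free of rank one.

  \<^emph>\<open>The canonical module.\<close> Every invariant without constant term has a power in the ideal
  of \<open>R\<close> generated by the elementary symmetric polynomials, so these may be used to compute
  local cohomology: the Cech complexes of two sequences that generate the same ideal up to
  radical have isomorphic cohomology (\<open>independence\<close>), because adding an element \<open>f\<close> of the
  radical changes the complex by its localisation at \<open>f\<close>, which is exact. For
  \<open>e\<^sub>1, \<dots>, e\<^sub>n\<close> the top cohomology is \<open>R\<close> with \<open>e\<^sub>1\<cdots>e\<^sub>n\<close> inverted, modulo the span of the fractions in whose
  denominator some \<open>e\<^sub>i\<close> is missing. As \<open>A\<close> is the polynomial ring in the \<open>e\<^sub>i\<close>, a functional on it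
  is the same as an \<open>A\<close>-linear map \<open>R \<rightarrow> A\<close>: the values on \<open>r/(e\<^sup>s e\<^sub>1\<cdots>e\<^sub>n)\<close> are the coefficients of
  the image of \<open>r\<close>. Finally every homogeneous \<open>A\<close>-linear map \<open>R \<rightarrow> A\<close> is \<open>r \<mapsto> (\<Sum>\<^sub>\<sigma> sgn(\<sigma>) \<sigma>(u r))/\<Delta>\<close> for
  a unique \<open>u \<in> S\<^sub>s\<^sub>g\<^sub>n\<close>, where \<open>\<Delta>\<close> is the Vandermonde polynomial and \<open>\<sigma>\<close> runs over the cosets of \<open>G\<close>
  (\<open>linear_maps_to_sym\<close>, \<open>ctr_determines\<close>). This rests on explicit dual bases of \<open>S\<close> over \<open>A\<close>: the polynomial
  \<open>\<Prod>\<^bsub>i<j\<^esub> (x\<^sub>i - y\<^sub>j)\<close> becomes \<open>\<Delta>\<close> for \<open>y = x\<close>, and it becomes zero if in addition the \<open>x\<^sub>i\<close> are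
  permuted in a nontrivial way (\<open>dual_bases\<close>).

  \<^emph>\<open>The character.\<close> A transposition in \<open>G\<close> negates every \<open>t \<in> S\<^sub>s\<^sub>g\<^sub>n\<close>, so \<open>\<theta>\<close> divides \<open>t\<close>. If
  \<open>\<chi> = sgn\<close>, then \<open>\<theta> \<in> S\<^sub>s\<^sub>g\<^sub>n\<close> and thus \<open>S\<^sub>s\<^sub>g\<^sub>n = \<theta> R\<close>. Conversely, a generator \<open>s\<close> of \<open>S\<^sub>s\<^sub>g\<^sub>n\<close> is divisible by
  \<open>\<theta>\<close> and divides \<open>\<Delta> \<in> S\<^sub>s\<^sub>g\<^sub>n\<close>, and \<open>x\<^sub>i - x\<^sub>j\<close> does not divide it unless the transposition \<open>(i j)\<close>
  is in \<open>G\<close> (\<open>generator_not_glued\<close>); so \<open>s\<close> is a scalar multiple of \<open>\<theta>\<close>, and \<open>\<chi> = sgn\<close>. Both characters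
  take the values \<open>1\<close> and \<open>-1\<close>, and the value \<open>\<chi>(\<sigma>)\<close> is determined by the parity of a
  number of inversions, whatever the field. Therefore the
  condition on the characters is the same over \<open>k\<close> and over the rational numbers.

  \<^emph>\<open>Characteristic zero.\<close> Over the rational numbers \<open>R\<close> is always Cohen-Macaulay
  (\<open>Cohen_Macaulay_invariants\<close>): \<open>e\<^sub>1, \<dots>, e\<^sub>n\<close> is regular on \<open>A\<close>, the dual bases transport this to
  \<open>S\<close>, and averaging over \<open>G\<close> to \<open>R\<close>; and neither dimension nor depth can exceed \<open>n\<close>, because
  a longer chain of primes, or a longer regular sequence, would yield more than \<open>n\<close>
  algebraically independent elements (\<open>chain_bound\<close>).
\<close>

abbreviation lookup where "lookup \<equiv> Poly_Mapping.lookup"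
abbreviation keys where "keys \<equiv> Poly_Mapping.keys"
abbreviation single where "single \<equiv> Poly_Mapping.single"

section \<open>Substitution homomorphisms\<close>

definition mon :: "(nat \<Rightarrow> 'k::field mpoly) \<Rightarrow> (nat \<Rightarrow>\<^sub>0 nat) \<Rightarrow> 'k mpoly" where
  "mon g m = (\<Prod>i\<in>keys m. g i ^ lookup m i)"

definition subst :: "(nat \<Rightarrow> 'k::field mpoly) \<Rightarrow> 'k mpoly \<Rightarrow> 'k mpoly" where
  "subst g p = (\<Sum>m\<in>keys p. const (lookup p m) * mon g m)"

lemma act_eq_subst: "act \<sigma> = subst (\<lambda>i. var (\<sigma> i))"
  by (auto simp: act_def subst_def mon_def fun_eq_iff)

lemma const_0 [simp]: "const 0 = 0"
  and const_1 [simp]: "const 1 = 1"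
  and const_add: "const (a + b) = const a + const b"
  and const_mult: "const (a * b) = const a * const b"
  and const_inj [simp]: "const a = const b \<longleftrightarrow> a = b"
  using inj_single[of 0, THEN injD] by (auto simp: const_def single_add mult_single single_uminus)

lemma const_eq_0_iff [simp]: "const a = 0 \<longleftrightarrow> a = 0"
  using const_inj[of a 0] by (simp del: const_inj)

lemma lookup_const_mult: "lookup (const c * p) m = c * lookup p m"
  unfolding const_def mult_map_scale_conv_mult[symmetric]
  by (simp add: Poly_Mapping.map.rep_eq when_def)

lemma mon_superset:
  assumes "finite A" "keys m \<subseteq> A"
  shows "mon g m = (\<Prod>i\<in>A. g i ^ lookup m i)"
  unfolding mon_def using assms
  by (intro prod.mono_neutral_left) (auto simp: in_keys_iff)

lemma mon_0 [simp]: "mon g 0 = 1"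
  by (simp add: mon_def)

lemma mon_add: "mon g (m + m') = mon g m * mon g m'"
proof -
  have *: "keys (m + m') \<subseteq> keys m \<union> keys m'" by (rule Poly_Mapping.keys_add)
  show ?thesis
    by (simp add: mon_superset[of "keys m \<union> keys m'"] * lookup_add power_add prod.distrib)
qed

lemma mon_single [simp]: "mon g (single i k) = g i ^ k"
  by (cases "k = 0") (auto simp: mon_def)

lemma subst_superset:
  assumes "finite A" "keys p \<subseteq> A"
  shows "subst g p = (\<Sum>m\<in>A. const (lookup p m) * mon g m)"
  unfolding subst_def using assms
  by (intro sum.mono_neutral_left) (auto simp: in_keys_iff)

lemma subst_0 [simp]: "subst g 0 = 0"
  by (simp add: subst_def)

lemma subst_single: "subst g (single m c) = const c * mon g m"
  by (cases "c = 0") (auto simp: subst_def)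

lemma subst_const [simp]: "subst g (const c) = const c"
  using subst_single[of g 0 c] by (simp add: const_def)

lemma subst_1 [simp]: "subst g 1 = 1"
  using subst_const[of g 1] by simp

lemma subst_var [simp]: "subst g (var i) = g i"
  by (simp add: var_def subst_single)

lemma subst_add: "subst g (p + q) = subst g p + subst g q"
proof -
  have *: "keys (p + q) \<subseteq> keys p \<union> keys q" by (rule Poly_Mapping.keys_add)
  show ?thesis
    by (simp add: subst_superset[of "keys p \<union> keys q"] * lookup_add const_add ring_distribs
        sum.distrib)
qed

lemma subst_uminus: "subst g (- p) = - subst g p"
  by (metis add.right_inverse add_eq_0_iff subst_0 subst_add)

lemma subst_diff: "subst g (p - q) = subst g p - subst g q"
  by (metis subst_add subst_uminus uminus_add_conv_diff add.commute)

lemma subst_sum: "subst g (sum f A) = (\<Sum>a\<in>A. subst g (f a))"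
  by (induction A rule: infinite_finite_induct) (auto simp: subst_add)

lemma poly_mapping_decomp: "p = (\<Sum>m\<in>keys p. single m (lookup p m))"
proof (rule poly_mapping_eqI)
  fix k
  have "lookup (\<Sum>m\<in>keys p. single m (lookup p m)) k =
      (\<Sum>m\<in>keys p. (lookup p m when m = k))"
    by (simp add: lookup_sum lookup_single)
  also have "\<dots> = (\<Sum>m\<in>keys p. if m = k then lookup p k else 0)"
    by (intro sum.cong) (auto simp: when_def)
  also have "\<dots> = lookup p k"
    by (auto simp: in_keys_iff)
  finally show "lookup p k = lookup (\<Sum>m\<in>keys p. single m (lookup p m)) k" by simp
qed

lemma subst_mult: "subst g (p * q) = subst g p * subst g q"
proof -
  have "p * q = (\<Sum>m\<in>keys p. \<Sum>m'\<in>keys q. single (m + m') (lookup p m * lookup q m'))"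
    using arg_cong2[OF poly_mapping_decomp[of p] poly_mapping_decomp[of q], of "(*)"]
    by (simp add: sum_product mult_single)
  hence "subst g (p * q) = (\<Sum>m\<in>keys p. \<Sum>m'\<in>keys q.
      (const (lookup p m) * mon g m) * (const (lookup q m') * mon g m'))"
    by (simp add: subst_sum subst_single const_mult mon_add mult_ac)
  thus ?thesis by (simp add: subst_def sum_product)
qed

lemma subst_power: "subst g (p ^ k) = subst g p ^ k"
  by (induction k) (auto simp: subst_mult)

lemma subst_prod: "subst g (prod f A) = (\<Prod>a\<in>A. subst g (f a))"
  by (induction A rule: infinite_finite_induct) (auto simp: subst_mult)

lemmas subst_hom = subst_add subst_uminus subst_diff subst_sum subst_mult subst_power subst_prod

lemma var_power: "var i ^ k = single (single i k) 1"
  by (induction k) (auto simp: var_def mult_single simp flip: single_add)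

lemma mon_var: "mon var m = single m 1"
proof -
  have *: "(\<Prod>i\<in>A. single (h i) (1::'a)) = single (sum h A) 1"
    if "finite A" for A :: "nat set" and h :: "nat \<Rightarrow> nat \<Rightarrow>\<^sub>0 nat"
    using that by (induction A) (auto simp: mult_single)
  show ?thesis
    by (simp add: mon_def var_power * poly_mapping_decomp[symmetric])
qed

lemma subst_id [simp]: "subst var p = p"
  by (subst (2) poly_mapping_decomp)
    (auto simp: subst_def mon_var const_def mult_single intro!: sum.cong)

lemma poly_ring_const [simp, intro]: "const c \<in> poly_ring n"
  by (auto simp: poly_ring_def const_def)

lemma poly_ring_0 [simp, intro]: "0 \<in> poly_ring n"
  and poly_ring_1 [simp, intro]: "1 \<in> poly_ring n"
  by (auto simp: poly_ring_def)

lemma poly_ring_var [simp, intro]: "i \<in> {1..n} \<Longrightarrow> var i \<in> poly_ring n"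
  by (auto simp: poly_ring_def var_def)

lemma poly_ring_add [intro]: "p \<in> poly_ring n \<Longrightarrow> q \<in> poly_ring n \<Longrightarrow> p + q \<in> poly_ring n"
  unfolding poly_ring_def using Poly_Mapping.keys_add[of p q] by blast

lemma poly_ring_mult [intro]: "p \<in> poly_ring n \<Longrightarrow> q \<in> poly_ring n \<Longrightarrow> p * q \<in> poly_ring n"
proof -
  assume p: "p \<in> poly_ring n" and q: "q \<in> poly_ring n"
  have "keys m \<subseteq> {1..n}" if "m \<in> keys (p * q)" for m
  proof -
    obtain a b where "m = a + b" "a \<in> keys p" "b \<in> keys q"
      using \<open>m \<in> keys (p * q)\<close> Poly_Mapping.keys_mult[of p q] by blast
    thus ?thesis using p q Poly_Mapping.keys_add[of a b] by (fastforce simp: poly_ring_def)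
  qed
  thus ?thesis by (auto simp: poly_ring_def)
qed

lemma poly_ring_uminus [intro]: "p \<in> poly_ring n \<Longrightarrow> - p \<in> poly_ring n"
  by (auto simp: poly_ring_def)

lemma poly_ring_diff [intro]: "p \<in> poly_ring n \<Longrightarrow> q \<in> poly_ring n \<Longrightarrow> p - q \<in> poly_ring n"
  using poly_ring_add[of p n "- q"] by (simp add: poly_ring_uminus)

lemma poly_ring_sum: "(\<And>a. a \<in> A \<Longrightarrow> f a \<in> poly_ring n) \<Longrightarrow> sum f A \<in> poly_ring n"
  by (induction A rule: infinite_finite_induct) auto

lemma poly_ring_prod: "(\<And>a. a \<in> A \<Longrightarrow> f a \<in> poly_ring n) \<Longrightarrow> prod f A \<in> poly_ring n"
  by (induction A rule: infinite_finite_induct) auto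

lemma poly_ring_power [intro]: "p \<in> poly_ring n \<Longrightarrow> p ^ k \<in> poly_ring n"
  by (induction k) auto

lemma single_conv_mon: "single m c = const c * mon var m"
  by (simp add: mon_var const_def mult_single)

lemma poly_ring_induct [consumes 1, case_names const var add mult]:
  assumes "p \<in> poly_ring n"
    and const: "\<And>c. P (const c)"
    and var: "\<And>i. i \<in> {1..n} \<Longrightarrow> P (var i)"
    and add: "\<And>p q. p \<in> poly_ring n \<Longrightarrow> q \<in> poly_ring n \<Longrightarrow> P p \<Longrightarrow> P q \<Longrightarrow> P (p + q)"
    and mult: "\<And>p q. p \<in> poly_ring n \<Longrightarrow> q \<in> poly_ring n \<Longrightarrow> P p \<Longrightarrow> P q \<Longrightarrow> P (p * q)"
  shows "P p"
proof -
  have P01: "P 0" "P 1" using const[of 0] const[of 1] by auto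
  have pow: "P (var i ^ k)" if "i \<in> {1..n}" for i k
    using that by (induction k) (auto intro!: mult var P01 poly_ring_power poly_ring_var)
  have prd: "P (\<Prod>i\<in>A. var i ^ e i)" if "A \<subseteq> {1..n}" for A e
    using finite_subset[OF that finite_atLeastAtMost] that
    by (induction A rule: finite_induct)
      (auto intro!: mult P01 pow poly_ring_power poly_ring_prod poly_ring_var simp: subset_iff)
  have sm: "P (\<Sum>m\<in>A. single m (lookup p m))" if "A \<subseteq> keys p" for A
    using finite_subset[OF that finite_keys] that
  proof (induction A rule: finite_induct)
    case (insert m A)
    have m: "keys m \<subseteq> {1..n}" using insert.prems assms(1) by (auto simp: poly_ring_def)
    have "P (single m (lookup p m))"
      unfolding single_conv_mon mon_def using m
      by (intro mult const prd poly_ring_prod poly_ring_power poly_ring_var poly_ring_const) auto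
    moreover have "single m' (lookup p m') \<in> poly_ring n" if "m' \<in> insert m A" for m'
      using insert.prems assms(1) that by (auto simp: poly_ring_def)
    ultimately show ?case using insert
      by (auto intro!: add poly_ring_sum)
  qed (use P01 in auto)
  show ?thesis
    by (subst poly_mapping_decomp) (rule sm, simp)
qed

lemma mpoly_induct [case_names const var add mult]:
  fixes p :: "'k::field mpoly"
  assumes const: "\<And>c. P (const c)"
    and var: "\<And>i. P (var i)"
    and add: "\<And>p q. P p \<Longrightarrow> P q \<Longrightarrow> P (p + q)"
    and mult: "\<And>p q. P p \<Longrightarrow> P q \<Longrightarrow> P (p * q)"
  shows "P p"
proof -
  have P01: "P 0" "P 1" using const[of 0] const[of 1] by auto
  have pow: "P (var i ^ k)" for i k
    by (induction k) (auto intro!: mult var P01)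
  have prd: "P (\<Prod>i\<in>A. var i ^ e i)" for A e
    by (induction A rule: infinite_finite_induct) (auto intro!: mult P01 pow)
  have "P (single m c)" for m c
    unfolding single_conv_mon mon_def by (intro mult const prd)
  hence "P (\<Sum>m\<in>A. single m (lookup p m))" for A
    by (induction A rule: infinite_finite_induct) (auto intro!: add P01)
  thus ?thesis using poly_mapping_decomp[of p] by metis
qed

lemma subst_subst: "subst g (subst h p) = subst (\<lambda>i. subst g (h i)) p"
  by (induction p rule: mpoly_induct) (auto simp: subst_hom)

lemma subst_cong:
  assumes "p \<in> poly_ring n" "\<And>i. i \<in> {1..n} \<Longrightarrow> g i = h i"
  shows "subst g p = subst h p"
  using assms(1) by (induction p rule: poly_ring_induct) (auto simp: subst_hom assms)

lemma subst_in_poly_ring: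
  assumes "p \<in> poly_ring n" "\<And>i. i \<in> {1..n} \<Longrightarrow> g i \<in> poly_ring m"
  shows "subst g p \<in> poly_ring m"
  using assms(1) by (induction p rule: poly_ring_induct) (auto simp: subst_hom assms)

text \<open>
  Modulo \<open>d\<close>, the substitution is a homomorphism that fixes the variables, hence the identity.
\<close>

lemma subst_dvd_diff:
  assumes "\<And>i. d dvd var i - g i"
  shows "d dvd p - subst g p"
proof (induction p rule: mpoly_induct)
  case (add p q)
  have "p + q - subst g (p + q) = (p - subst g p) + (q - subst g q)"
    by (simp add: subst_add)
  thus ?case using add by (metis dvd_add)
next
  case (mult p q)
  have "p * q - subst g (p * q) = p * (q - subst g q) + (p - subst g p) * subst g q"
    by (simp add: subst_mult algebra_simps)
  thus ?case using mult by (metis dvd_add dvd_mult dvd_mult2)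
qed (auto simp: assms)

definition retract :: "nat \<Rightarrow> 'k::field mpoly \<Rightarrow> 'k mpoly" where
  "retract n = subst (\<lambda>i. if i \<in> {1..n} then var i else 0)"

lemma retract_id: "p \<in> poly_ring n \<Longrightarrow> retract n p = p"
  using subst_cong[of p n "\<lambda>i. if i \<in> {1..n} then var i else 0" var]
  by (simp add: retract_def)

lemma retract_in: "retract n p \<in> poly_ring n"
  unfolding retract_def
  by (induction p rule: mpoly_induct) (auto simp: subst_hom)

text \<open>
  The retraction onto \<open>k[x\<^sub>1, \<dots>, x\<^sub>n]\<close> fixes \<open>l\<close> and \<open>l q\<close>, so it fixes \<open>q\<close>.
\<close>

lemma poly_ring_dvd_cofactor:
  assumes "l \<in> poly_ring n" "l * q \<in> poly_ring n" "l \<noteq> 0"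
  shows "q \<in> poly_ring n"
proof -
  have "l * q = retract n l * retract n q"
    using retract_id[OF assms(2)] by (simp add: retract_def subst_mult)
  also have "retract n l = l" by (rule retract_id) fact
  finally have "q = retract n q" using assms(3) by simp
  thus ?thesis using retract_in[of n q] by simp
qed

lemma lookup_0_eq_subst: "subst (\<lambda>_. 0) p = const (lookup p 0)"
proof -
  have "mon (\<lambda>_. 0) m = (0::'a mpoly)" if m: "m \<noteq> 0" for m
  proof -
    obtain i where "i \<in> keys m" using m by (metis equals0I keys_eq_empty)
    thus ?thesis unfolding mon_def by (intro prod_zero) (auto simp: in_keys_iff)
  qed
  hence "subst (\<lambda>_. 0) p = (\<Sum>m\<in>keys p. if m = 0 then const (lookup p 0) else 0)"
    unfolding subst_def by (intro sum.cong) auto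
  thus ?thesis by (auto simp: in_keys_iff)
qed

lemma lookup_0_add: "lookup (p + q) 0 = lookup p 0 + lookup (q :: 'k::field mpoly) 0"
  and lookup_0_mult: "lookup (p * q) 0 = lookup p 0 * lookup (q :: 'k mpoly) 0"
  and lookup_0_power: "lookup (p ^ t) 0 = lookup p 0 ^ t"
proof -
  show "lookup (p + q) 0 = lookup p 0 + lookup q 0" by (rule lookup_add)
  show m: "lookup (p * q) 0 = lookup p 0 * lookup q 0" for p q :: "'k mpoly"
    using subst_mult[of "\<lambda>_. 0" p q] unfolding lookup_0_eq_subst const_mult[symmetric]
    by simp
  show "lookup (p ^ t) 0 = lookup p 0 ^ t"
    by (induction t) (auto simp: m)
qed

lemma keys_var [simp]: "keys (var i :: 'k::field mpoly) = {single i 1}"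
  by (simp add: var_def)

lemma var_neq_0 [simp]: "var i \<noteq> (0 :: 'k::field mpoly)"
  using keys_var[where 'k = 'k, of i] by (metis insert_not_empty keys_zero)

lemma var_inj [simp]: "(var i :: 'k::field mpoly) = var j \<longleftrightarrow> i = j"
proof
  assume "(var i :: 'k mpoly) = var j"
  hence "single i (1::nat) = single j 1" using keys_var[where 'k = 'k] by (metis singleton_inject)
  hence "keys (single i (1::nat)) = keys (single j (1::nat))" by simp
  thus "i = j" by simp
qed simp

section \<open>Divisibility by several primes\<close>

text \<open>
  A substitute for unique factorisation. In the applications \<open>l a\<close> is a linear form that generates the
  kernel of \<open>subst (g a)\<close>, a homomorphism into a domain, so that it is prime; that the other linear forms are
  not in this kernel means that they are not associated to it.
\<close>

lemma prod_dvd_by_kernels: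
  fixes l :: "'a \<Rightarrow> 'k::field mpoly"
  assumes "finite A"
    and "\<And>a p. a \<in> A \<Longrightarrow> subst (g a) p = 0 \<Longrightarrow> l a dvd p"
    and "\<And>a b. a \<in> A \<Longrightarrow> b \<in> A \<Longrightarrow> a \<noteq> b \<Longrightarrow> subst (g a) (l b) \<noteq> 0"
    and "\<And>a. a \<in> A \<Longrightarrow> subst (g a) p = 0"
  shows "(\<Prod>a\<in>A. l a) dvd p"
  using assms
proof (induction A rule: finite_induct)
  case (insert a A)
  have "(\<Prod>a\<in>A. l a) dvd p"
    by (rule insert.IH) (use insert.prems in \<open>blast+\<close>)
  then obtain q where q: "p = (\<Prod>a\<in>A. l a) * q" by (elim dvdE)
  have "subst (g a) p = 0" using insert.prems(3) by auto
  moreover have "subst (g a) (\<Prod>a\<in>A. l a) \<noteq> 0"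
    using insert.hyps insert.prems(2)[of a] by (fastforce simp: subst_prod)
  ultimately have "subst (g a) q = 0" by (simp add: q subst_mult)
  hence "l a dvd q" by (intro insert.prems(1)) auto
  thus ?case using insert.hyps by (simp add: q mult.commute mult_dvd_mono)
qed auto

text \<open>
  The homomorphism that identifies \<open>x\<^sub>j\<close> with \<open>x\<^sub>i\<close>; its kernel is generated by \<open>x\<^sub>i - x\<^sub>j\<close>.
\<close>

definition glue :: "nat \<Rightarrow> nat \<Rightarrow> nat \<Rightarrow> 'k::field mpoly" where
  "glue i j l = (if l = j then var i else var l)"

lemma dvd_if_glue_0: "subst (glue i j) p = 0 \<Longrightarrow> var i - var j dvd p"
proof -
  assume "subst (glue i j) p = 0"
  moreover have "var i - var j dvd var l - (glue i j l :: 'a mpoly)" for l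
  proof -
    have "var j - var i = (var i - var j) * (- 1 :: 'a mpoly)" by simp
    hence "var i - var j dvd (var j - var i :: 'a mpoly)" by (metis dvd_triv_left)
    thus ?thesis by (simp add: glue_def)
  qed
  ultimately show ?thesis using subst_dvd_diff[of "var i - var j" "glue i j" p] by simp
qed

lemma glue_dvd: "var i - var j dvd p \<Longrightarrow> subst (glue i j) p = 0"
  by (auto simp: subst_hom glue_def elim!: dvdE)

lemma glue_diff_neq_0:
  assumes "i \<noteq> j" "a \<noteq> b" "{a, b} \<noteq> {i, j}"
  shows "subst (glue i j) (var a - var b) \<noteq> 0"
  using assms by (auto simp: subst_hom glue_def doubleton_eq_iff)

lemma char_neq_2D: "CHAR('k::field) \<noteq> 2 \<Longrightarrow> (1 :: 'k) \<noteq> - 1"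
proof
  assume "CHAR('k) \<noteq> 2" "(1 :: 'k) = - 1"
  hence "(2 :: 'k) = 0" by (metis add.right_inverse one_add_one)
  hence "CHAR('k) dvd 2" by (metis of_nat_eq_0_iff_char_dvd of_nat_numeral)
  hence "CHAR('k) = 1 \<or> CHAR('k) = 2" using prime_nat_iff[of 2] two_is_prime_nat by blast
  thus False using \<open>CHAR('k) \<noteq> 2\<close> CHAR_not_1'[where 'a = 'k] by auto
qed

text \<open>
  Identifying \<open>x\<^sub>i\<close> and \<open>x\<^sub>j\<close> makes their transposition invisible, so that the image of \<open>p\<close> is its own
  negative.
\<close>

lemma glue_kernel_invariant:
  assumes "subst (\<lambda>l. var (transpose i j l)) p = - (p :: 'k::field mpoly)" "CHAR('k) \<noteq> 2" 
  shows "subst (glue i j) p = 0"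
proof -
  have "subst (glue i j) (subst (\<lambda>l. var (transpose i j l)) p) = subst (glue i j) p"
    unfolding subst_subst by (rule arg_cong[of _ _ "\<lambda>g. subst g p"])
      (auto simp: glue_def transpose_def)
  hence "subst (glue i j) p = - subst (glue i j) p"
    by (simp add: assms(1) subst_uminus)
  hence "const 2 * subst (glue i j) p = 0"
    using const_add[of 1 "1 :: 'k"] by (simp add: eq_neg_iff_add_eq_0 distrib_right)
  moreover have "(2::'k) \<noteq> 0"
    using char_neq_2D[OF assms(2)] eq_neg_iff_add_eq_0[of "1 :: 'k" 1] by simp
  ultimately show ?thesis by simp
qed

section \<open>Homogeneous components\<close>

text \<open>
  The weights \<open>1\<close> give the total degree. The weights \<open>w i = i\<close> give the degree that a monomial in the
  elementary symmetric polynomials has as a polynomial in the variables.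
\<close>

definition weight :: "(nat \<Rightarrow> nat) \<Rightarrow> (nat \<Rightarrow>\<^sub>0 nat) \<Rightarrow> nat" where
  "weight w m = (\<Sum>i\<in>keys m. w i * lookup m i)"

lemma total_degree_eq_weight: "total_degree m = weight (\<lambda>_. 1) m"
  by (simp add: total_degree_def weight_def)

lemma weight_superset:
  assumes "finite A" "keys m \<subseteq> A"
  shows "weight w m = (\<Sum>i\<in>A. w i * lookup m i)"
  unfolding weight_def using assms
  by (intro sum.mono_neutral_left) (auto simp: in_keys_iff)

lemma weight_add: "weight w (m + m') = weight w m + weight w m'"
proof -
  have *: "keys (m + m') \<subseteq> keys m \<union> keys m'" by (rule Poly_Mapping.keys_add)
  show ?thesis
    by (simp add: weight_superset[of "keys m \<union> keys m'"] * lookup_add ring_distribs sum.distrib)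
qed

lemma weight_0 [simp]: "weight w 0 = 0"
  and weight_single [simp]: "weight w (single i k) = w i * k"
  by (auto simp: weight_def)

lemma total_degree_add: "total_degree (m + m') = total_degree m + total_degree m'"
  by (simp add: total_degree_eq_weight weight_add)

lemma homogeneous_0 [simp, intro]: "homogeneous d 0"
  by (simp add: homogeneous_def)

lemma homogeneous_const [simp, intro]: "homogeneous 0 (const c)"
  by (auto simp: homogeneous_def const_def total_degree_def)

lemma homogeneous_1 [simp, intro]: "homogeneous 0 1"
  using homogeneous_const[of 1] by simp

lemma homogeneous_var [simp, intro]: "homogeneous 1 (var i)"
  by (auto simp: homogeneous_def var_def total_degree_def)

lemma homogeneous_add: "homogeneous d p \<Longrightarrow> homogeneous d q \<Longrightarrow> homogeneous d (p + q)"
  unfolding homogeneous_def using Poly_Mapping.keys_add[of p q] by blast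

lemma homogeneous_uminus: "homogeneous d p \<Longrightarrow> homogeneous d (- p)"
  by (simp add: homogeneous_def)

lemma homogeneous_diff: "homogeneous d p \<Longrightarrow> homogeneous d q \<Longrightarrow> homogeneous d (p - q)"
  using homogeneous_add[of d p "- q"] homogeneous_uminus[of d q] by simp

lemma homogeneous_mult:
  assumes "homogeneous d p" "homogeneous e q"
  shows "homogeneous (d + e) (p * q)"
  unfolding homogeneous_def
proof
  fix m assume "m \<in> keys (p * q)"
  then obtain a b where "m = a + b" "a \<in> keys p" "b \<in> keys q"
    using Poly_Mapping.keys_mult[of p q] by blast
  thus "int (total_degree m) = d + e"
    using assms by (auto simp: homogeneous_def total_degree_add)
qed

lemma homogeneous_mult': 
  "homogeneous d p \<Longrightarrow> homogeneous e q \<Longrightarrow> d + e = c \<Longrightarrow> homogeneous c (p * q)"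
  using homogeneous_mult by blast

lemma homogeneous_sum: "(\<And>a. a \<in> A \<Longrightarrow> homogeneous d (f a)) \<Longrightarrow> homogeneous d (sum f A)"
  by (induction A rule: infinite_finite_induct) (auto intro: homogeneous_add)

lemma homogeneous_power: "homogeneous d p \<Longrightarrow> homogeneous (int k * d) (p ^ k)"
  by (induction k) (auto intro!: homogeneous_mult' simp: algebra_simps)

lemma homogeneous_prod:
  "(\<And>a. a \<in> A \<Longrightarrow> homogeneous (d a) (f a)) \<Longrightarrow> homogeneous (sum d A) (prod f A)"
  by (induction A rule: infinite_finite_induct) (auto intro: homogeneous_mult)

lemma homogeneous_unique:
  assumes "homogeneous d p" "homogeneous e p" "p \<noteq> 0" shows "d = e"
proof -
  obtain m where "m \<in> keys p" using assms(3) by (metis equals0I keys_eq_empty)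
  thus ?thesis using assms by (auto simp: homogeneous_def)
qed

lemma homogeneous_mon:
  assumes "\<And>i. i \<in> keys m \<Longrightarrow> homogeneous (int (w i)) (g i)"
  shows "homogeneous (int (weight w m)) (mon g m)"
proof -
  have "homogeneous (\<Sum>i\<in>keys m. int (lookup m i) * int (w i)) (mon g m)"
    unfolding mon_def by (intro homogeneous_prod homogeneous_power assms)
  thus ?thesis by (simp add: weight_def mult.commute)
qed

lemma homogeneous_subst_weight:
  assumes "\<And>m. m \<in> keys p \<Longrightarrow> int (weight w m) = d"
    and "\<And>m i. m \<in> keys p \<Longrightarrow> i \<in> keys m \<Longrightarrow> homogeneous (int (w i)) (g i)"
  shows "homogeneous d (subst g p)"
  unfolding subst_def
proof (intro homogeneous_sum)
  fix m assume m: "m \<in> keys p"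
  have "homogeneous (int (weight w m)) (mon g m)" by (intro homogeneous_mon assms(2)[OF m])
  thus "homogeneous d (const (lookup p m) * mon g m)"
    using assms(1)[OF m] by (intro homogeneous_mult'[OF homogeneous_const]) auto
qed

lemma homogeneous_subst:
  assumes "homogeneous d p" "\<And>i. homogeneous 1 (g i)"
  shows "homogeneous d (subst g p)"
  using assms by (intro homogeneous_subst_weight[where w = "\<lambda>_. 1"])
    (auto simp: homogeneous_def total_degree_eq_weight)

definition hcomp :: "int \<Rightarrow> 'k::field mpoly \<Rightarrow> 'k mpoly" where
  "hcomp d p = Poly_Mapping.mapp (\<lambda>m c. if int (total_degree m) = d then c else 0) p"

lemma lookup_hcomp: "lookup (hcomp d p) m = (if int (total_degree m) = d then lookup p m else 0)"
  by (auto simp: hcomp_def lookup_mapp when_def in_keys_iff)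

lemma homogeneous_hcomp [simp, intro]: "homogeneous d (hcomp d p)"
  by (auto simp: homogeneous_def in_keys_iff lookup_hcomp split: if_splits)

lemma hcomp_0 [simp]: "hcomp d 0 = 0"
  by (rule poly_mapping_eqI) (simp add: lookup_hcomp)

lemma hcomp_add: "hcomp d (p + q) = hcomp d p + hcomp d q"
  by (rule poly_mapping_eqI) (simp add: lookup_hcomp lookup_add)

lemma hcomp_diff: "hcomp d (p - q) = hcomp d p - hcomp d q"
  by (rule poly_mapping_eqI) (simp add: lookup_hcomp lookup_minus)

lemma hcomp_sum: "hcomp d (sum f A) = (\<Sum>a\<in>A. hcomp d (f a))"
  by (induction A rule: infinite_finite_induct) (auto simp: hcomp_add)

lemma hcomp_homogeneous: "homogeneous e p \<Longrightarrow> hcomp d p = (if d = e then p else 0)"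
  by (rule poly_mapping_eqI) (auto simp: lookup_hcomp homogeneous_def in_keys_iff)

lemma hcomp_idem: "homogeneous d p \<Longrightarrow> hcomp d p = p"
  by (simp add: hcomp_homogeneous)

lemma hcomp_eq_0:
  assumes "\<And>m. m \<in> keys p \<Longrightarrow> int (total_degree m) \<noteq> d" shows "hcomp d p = 0"
  using assms by (intro poly_mapping_eqI) (auto simp: lookup_hcomp in_keys_iff)

lemma hcomp_decomp: "p = (\<Sum>d\<in>(\<lambda>m. int (total_degree m)) ` keys p. hcomp d p)"
  by (rule poly_mapping_eqI) (auto simp: lookup_sum lookup_hcomp in_keys_iff)

lemma hcomp_mult:
  assumes "homogeneous e r" shows "hcomp (e + d) (r * p) = r * hcomp d p"
proof -
  have "hcomp (e + d) (r * (p - hcomp d p)) = 0"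
  proof (rule hcomp_eq_0)
    fix m assume "m \<in> keys (r * (p - hcomp d p))"
    then obtain a b where m: "m = a + b" "a \<in> keys r" "b \<in> keys (p - hcomp d p)"
      using Poly_Mapping.keys_mult[of r "p - hcomp d p"] by blast
    have "int (total_degree a) = e" using m assms by (auto simp: homogeneous_def)
    moreover have "int (total_degree b) \<noteq> d"
      using m by (auto simp: in_keys_iff lookup_minus lookup_hcomp)
    ultimately show "int (total_degree m) \<noteq> e + d" by (simp add: m total_degree_add)
  qed
  moreover have "hcomp (e + d) (r * hcomp d p) = r * hcomp d p"
    by (intro hcomp_idem homogeneous_mult assms) auto
  ultimately show ?thesis
    by (simp add: right_diff_distrib hcomp_diff)
qed

lemma hcomp_subst:
  assumes "\<And>i. homogeneous 1 (g i)"
  shows "hcomp d (subst g p) = subst g (hcomp d p)"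
proof -
  let ?D = "(\<lambda>m. int (total_degree m)) ` keys p"
  have "hcomp d (subst g p) = (\<Sum>e\<in>?D. hcomp d (subst g (hcomp e p)))"
    by (subst hcomp_decomp) (simp add: subst_sum hcomp_sum)
  also have "\<dots> = (\<Sum>e\<in>?D. if d = e then subst g (hcomp e p) else 0)"
    by (intro sum.cong refl hcomp_homogeneous homogeneous_subst assms) auto
  also have "\<dots> = subst g (hcomp d p)"
  proof (cases "d \<in> ?D")
    case False
    hence "hcomp d p = 0" by (intro hcomp_eq_0) auto
    thus ?thesis using False by simp
  qed simp
  finally show ?thesis .
qed

lemma poly_ring_hcomp [intro]: "p \<in> poly_ring n \<Longrightarrow> hcomp d p \<in> poly_ring n"
  by (auto simp: poly_ring_def in_keys_iff lookup_hcomp split: if_splits)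

lemma homogeneous_cofactor:
  assumes "homogeneous a l" "l \<noteq> 0" "homogeneous b (l * q)"
  shows "homogeneous (b - a) q"
  unfolding homogeneous_def
proof
  fix m assume m: "m \<in> keys q"
  let ?d = "int (total_degree m)"
  have "hcomp ?d q \<noteq> 0"
    using m by (metis in_keys_iff lookup_hcomp lookup_zero)
  hence "hcomp (a + ?d) (l * q) \<noteq> 0"
    using assms by (simp add: hcomp_mult)
  hence "a + ?d = b" using assms(3) by (auto simp: hcomp_homogeneous split: if_splits)
  thus "?d = b - a" by simp
qed

lemma homogeneous_degree_0:
  assumes "homogeneous 0 p" shows "p = const (lookup p 0)"
proof (rule poly_mapping_eqI)
  fix m
  have "m = 0" if "m \<in> keys p"
  proof -
    have "total_degree m = 0" using assms that by (auto simp: homogeneous_def)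
    hence "lookup m i = 0" for i
      by (cases "i \<in> keys m") (auto simp: total_degree_def in_keys_iff)
    thus ?thesis by (intro poly_mapping_eqI) simp
  qed
  thus "lookup p m = lookup (const (lookup p 0)) m"
    by (auto simp: const_def lookup_single when_def in_keys_iff)
qed

section \<open>The permutation action\<close>

lemma act_hom:
  "act \<sigma> (p + q) = act \<sigma> p + act \<sigma> q" "act \<sigma> (p - q) = act \<sigma> p - act \<sigma> q"
  "act \<sigma> (p * q) = act \<sigma> p * act \<sigma> q" "act \<sigma> (- p) = - act \<sigma> p"
  "act \<sigma> (p ^ k) = act \<sigma> p ^ k" "act \<sigma> (sum f A) = (\<Sum>a\<in>A. act \<sigma> (f a))"
  "act \<sigma> (prod f A) = (\<Prod>a\<in>A. act \<sigma> (f a))" "act \<sigma> (const c) = const c"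
  "act \<sigma> (var i) = var (\<sigma> i)" "act \<sigma> 0 = 0" "act \<sigma> 1 = 1"
  by (auto simp: act_eq_subst subst_hom)

lemma act_id [simp]: "act id p = p"
  by (simp add: act_eq_subst)

lemma act_comp: "act (\<sigma> \<circ> \<tau>) p = act \<sigma> (act \<tau> p)"
  by (simp add: act_eq_subst subst_subst)

lemma hcomp_act: "hcomp d (act \<sigma> p) = act \<sigma> (hcomp d p)"
  unfolding act_eq_subst by (rule hcomp_subst) auto

lemma homogeneous_act: "homogeneous d p \<Longrightarrow> homogeneous d (act \<sigma> p)"
  unfolding act_eq_subst by (rule homogeneous_subst) auto

lemma act_poly_ring: "\<sigma> permutes {1..n} \<Longrightarrow> p \<in> poly_ring n \<Longrightarrow> act \<sigma> p \<in> poly_ring n"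
  unfolding act_eq_subst
  by (rule subst_in_poly_ring[of p n]) (auto simp: permutes_in_image simp del: atLeastAtMost_iff)

lemma act_inv: "\<sigma> permutes {1..n} \<Longrightarrow> act \<sigma> (act (inv' \<sigma>) p) = p"
  "\<sigma> permutes {1..n} \<Longrightarrow> act (inv' \<sigma>) (act \<sigma> p) = p"
  by (simp_all add: permutes_inv_o flip: act_comp)

lemma act_eq_0_iff: "\<sigma> permutes {1..n} \<Longrightarrow> act \<sigma> p = 0 \<longleftrightarrow> p = 0"
  by (metis act_hom(10) act_inv(2))

lemma lookup_0_act: "lookup (act \<sigma> p) 0 = lookup p 0"
proof -
  have "const (lookup (act \<sigma> p) 0) = const (lookup p 0)"
    unfolding lookup_0_eq_subst[symmetric] act_eq_subst subst_subst by simp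
  thus ?thesis by simp
qed

section \<open>Rings of invariants\<close>

lemma invariants_poly_ring: "p \<in> invariants n G \<Longrightarrow> p \<in> poly_ring n"
  and invariants_act: "p \<in> invariants n G \<Longrightarrow> \<sigma> \<in> G \<Longrightarrow> act \<sigma> p = p"
  by (auto simp: invariants_def)

lemma invariantsI: "p \<in> poly_ring n \<Longrightarrow> (\<And>\<sigma>. \<sigma> \<in> G \<Longrightarrow> act \<sigma> p = p) \<Longrightarrow> p \<in> invariants n G"
  by (auto simp: invariants_def)

lemma invariants_const [simp, intro]: "const c \<in> invariants n G"
  and invariants_0 [simp, intro]: "0 \<in> invariants n G"
  and invariants_1 [simp, intro]: "1 \<in> invariants n G"
  by (auto simp: invariants_def act_hom)

lemma invariants_add: "p \<in> invariants n G \<Longrightarrow> q \<in> invariants n G \<Longrightarrow> p + q \<in> invariants n G"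
  and invariants_mult: "p \<in> invariants n G \<Longrightarrow> q \<in> invariants n G \<Longrightarrow> p * q \<in> invariants n G"
  and invariants_uminus: "p \<in> invariants n G \<Longrightarrow> - p \<in> invariants n G"
  and invariants_diff: "p \<in> invariants n G \<Longrightarrow> q \<in> invariants n G \<Longrightarrow> p - q \<in> invariants n G"
  and invariants_power: "p \<in> invariants n G \<Longrightarrow> p ^ k \<in> invariants n G"
  by (auto simp: invariants_def act_hom)

lemma invariants_sum: "(\<And>a. a \<in> A \<Longrightarrow> f a \<in> invariants n G) \<Longrightarrow> sum f A \<in> invariants n G"
  by (induction A rule: infinite_finite_induct) (auto intro: invariants_add)

lemma invariants_prod: "(\<And>a. a \<in> A \<Longrightarrow> f a \<in> invariants n G) \<Longrightarrow> prod f A \<in> invariants n G"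
  by (induction A rule: infinite_finite_induct) (auto intro: invariants_mult)

lemma invariants_hcomp: "p \<in> invariants n G \<Longrightarrow> hcomp d p \<in> invariants n G"
  by (auto simp: invariants_def simp flip: hcomp_act)

lemma invariants_cofactor:
  assumes "l \<in> invariants n G" "l * q \<in> invariants n G" "l \<noteq> 0"
  shows "q \<in> invariants n G"
proof (rule invariantsI)
  show "q \<in> poly_ring n"
    using assms by (intro poly_ring_dvd_cofactor[of l n q]) (auto simp: invariants_poly_ring)
  fix \<sigma> assume "\<sigma> \<in> G"
  hence "l * act \<sigma> q = l * q" using assms by (metis act_hom(3) invariants_act)
  thus "act \<sigma> q = q" using assms(3) by simp
qed

lemma invariants_antimono: "G \<subseteq> H \<Longrightarrow> invariants n H \<subseteq> invariants n G"
  by (auto simp: invariants_def)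

definition perms :: "nat \<Rightarrow> (nat \<Rightarrow> nat) set" where
  "perms n = {\<sigma>. \<sigma> permutes {1..n}}"

lemma perms_iff [simp]: "\<sigma> \<in> perms n \<longleftrightarrow> \<sigma> permutes {1..n}"
  by (simp add: perms_def)

lemma perms_comp: "\<sigma> \<in> perms n \<Longrightarrow> \<tau> \<in> perms n \<Longrightarrow> \<sigma> \<circ> \<tau> \<in> perms n"
  by (simp only: perms_iff permutes_compose)

lemma perms_inv: "\<sigma> \<in> perms n \<Longrightarrow> inv' \<sigma> \<in> perms n"
  by (simp only: perms_iff permutes_inv)

abbreviation sym_polys :: "nat \<Rightarrow> 'k::field mpoly set" where
  "sym_polys n \<equiv> invariants n (perms n)"

section \<open>The fundamental theorem of symmetric polynomials\<close>

definition esym :: "nat \<Rightarrow> nat \<Rightarrow> 'k::field mpoly" where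
  "esym n k = (\<Sum>I | I \<subseteq> {1..n} \<and> card I = k. \<Prod>i\<in>I. var i)"

lemma esym_poly_ring: "esym n k \<in> poly_ring n"
  unfolding esym_def by (intro poly_ring_sum poly_ring_prod) auto

lemma homogeneous_esym: "homogeneous (int k) (esym n k)"
  unfolding esym_def
proof (intro homogeneous_sum)
  fix I :: "nat set" assume "I \<in> {I. I \<subseteq> {1..n} \<and> card I = k}"
  thus "homogeneous (int k) (\<Prod>i\<in>I. var i :: 'a mpoly)"
    using homogeneous_prod[of I "\<lambda>_. 1" "var :: nat \<Rightarrow> 'a mpoly"] by auto
qed

lemma esym_sym: "esym n k \<in> sym_polys n"
proof (rule invariantsI[OF esym_poly_ring])
  fix \<sigma> assume "\<sigma> \<in> perms n"
  hence \<sigma>: "\<sigma> permutes {1..n}" by (simp add: perms_iff)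
  have inj: "inj_on \<sigma> I" for I using permutes_inj[OF \<sigma>] by (rule inj_on_subset) auto
  have b: "bij_betw ((`) \<sigma>) {I. I \<subseteq> {1..n} \<and> card I = k} {I. I \<subseteq> {1..n} \<and> card I = k}"
  proof (rule bij_betw_byWitness[where f' = "(`) (inv' \<sigma>)"])
    show "(`) \<sigma> ` {I. I \<subseteq> {1..n} \<and> card I = k} \<subseteq> {I. I \<subseteq> {1..n} \<and> card I = k}"
      using permutes_image[OF \<sigma>] by (auto simp: card_image[OF inj] simp del: atLeastAtMost_iff)
    have inj': "inj_on (inv' \<sigma>) I" for I
      using permutes_inj[OF permutes_inv[OF \<sigma>]] by (rule inj_on_subset) auto
    show "(`) (inv' \<sigma>) ` {I. I \<subseteq> {1..n} \<and> card I = k} \<subseteq> {I. I \<subseteq> {1..n} \<and> card I = k}"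
      using permutes_image[OF permutes_inv[OF \<sigma>]]
      by (auto simp: card_image[OF inj'] simp del: atLeastAtMost_iff)
  qed (auto simp: image_comp permutes_inv_o[OF \<sigma>])
  have "act \<sigma> (esym n k) = (\<Sum>I | I \<subseteq> {1..n} \<and> card I = k. \<Prod>i\<in>\<sigma> ` I. var i)"
    by (simp add: esym_def act_hom prod.reindex[OF inj])
  also have "\<dots> = esym n k"
    unfolding esym_def by (rule sum.reindex_bij_betw[OF b])
  finally show "act \<sigma> (esym n k) = esym n k" .
qed

lemma esym_top: "esym n n = (\<Prod>i\<in>{1..n}. var i)"
proof -
  have "{I. I \<subseteq> {1..n} \<and> card I = n} = {{1..n}}"
    using card_subset_eq[of "{1..n}"] by auto
  thus ?thesis by (simp add: esym_def)
qed

lemma esym_top_neq_0: "esym n n \<noteq> 0"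
  by (simp add: esym_top)

lemma esym_above: "k > n \<Longrightarrow> esym n k = 0"
proof -
  assume "k > n"
  have "card I \<le> n" if "I \<subseteq> {1..n}" for I
    using card_mono[OF _ that] by simp
  hence "{I. I \<subseteq> {1..n} \<and> card I = k} = {}"
    using \<open>k > n\<close> by (auto simp del: atLeastAtMost_iff) (metis not_le)
  thus ?thesis unfolding esym_def by (simp only: sum.empty)
qed

lemma lookup_esym_0: "k > 0 \<Longrightarrow> lookup (esym n k) 0 = 0"
proof -
  assume "k > 0"
  hence "0 \<notin> keys (esym n k)"
    using homogeneous_esym[of k n] by (auto simp: homogeneous_def total_degree_def)
  thus ?thesis by (simp add: in_keys_iff)
qed

definition kill :: "nat \<Rightarrow> nat \<Rightarrow> 'k::field mpoly" where
  "kill i l = (if l = i then 0 else var l)"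

lemma kill_esym: "subst (kill (Suc n)) (esym (Suc n) k) = esym n k"
proof -
  have "subst (kill (Suc n)) (\<Prod>i\<in>I. var i) =
      (if Suc n \<in> I then 0 else \<Prod>i\<in>I. var i :: 'a mpoly)" if "I \<subseteq> {1..Suc n}" for I
  proof (cases "Suc n \<in> I")
    case True
    thus ?thesis using finite_subset[OF that]
      by (simp add: subst_prod prod_zero_iff) (auto simp: kill_def)
  next
    case False
    hence "(\<Prod>i\<in>I. subst (kill (Suc n)) (var i :: 'a mpoly)) = (\<Prod>i\<in>I. var i)"
      by (intro prod.cong) (auto simp: kill_def)
    thus ?thesis using False by (simp add: subst_prod)
  qed
  hence "subst (kill (Suc n)) (esym (Suc n) k) =
      (\<Sum>I | I \<subseteq> {1..Suc n} \<and> card I = k. if Suc n \<in> I then 0 else \<Prod>i\<in>I. var i :: 'a mpoly)"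
    unfolding esym_def subst_sum by (intro sum.cong) auto
  also have "\<dots> = esym n k"
    unfolding esym_def
  proof (rule sum.mono_neutral_cong_right)
    show "finite {I. I \<subseteq> {1..Suc n} \<and> card I = k}" by simp
    have "I \<subseteq> {1..n} \<longleftrightarrow> I \<subseteq> {1..Suc n} \<and> Suc n \<notin> I" for I
      by (auto simp: subset_iff le_Suc_eq)
    thus "{I. I \<subseteq> {1..n} \<and> card I = k} \<subseteq> {I. I \<subseteq> {1..Suc n} \<and> card I = k}"
      "\<forall>i\<in>{I. I \<subseteq> {1..Suc n} \<and> card I = k} - {I. I \<subseteq> {1..n} \<and> card I = k}.
       (if Suc n \<in> i then 0 else prod var i :: 'a mpoly) = 0"
      "\<And>x. x \<in> {I. I \<subseteq> {1..n} \<and> card I = k} \<Longrightarrow>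
         (if Suc n \<in> x then 0 else prod var x :: 'a mpoly) = prod var x" by auto
  qed
  finally show ?thesis .
qed

lemma kill_dvd: "subst (kill i) p = 0 \<Longrightarrow> var i dvd p"
  using subst_dvd_diff[of "var i" "kill i" p] by (auto simp: kill_def)

lemma kill_in_poly_ring: "p \<in> poly_ring (Suc n) \<Longrightarrow> subst (kill (Suc n)) p \<in> poly_ring n"
  by (rule subst_in_poly_ring) (auto simp: kill_def)

lemma lookup_var_mult: "lookup (var i * p) (single i 1 + m) = lookup p m"
proof -
  have "var i * p = (\<Sum>m'\<in>keys p. single (single i 1 + m') (lookup p m'))"
    by (subst poly_mapping_decomp[of p]) (simp add: var_def sum_distrib_left mult_single)
  also have "lookup \<dots> (single i 1 + m) = (\<Sum>m'\<in>keys p. if m' = m then lookup p m else 0)"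
    unfolding lookup_sum by (intro sum.cong) (auto simp: lookup_single when_def)
  also have "\<dots> = lookup p m" by (auto simp: in_keys_iff)
  finally show ?thesis .
qed

lemma factor_out_var:
  assumes "p \<noteq> 0"
  shows "\<exists>k q. p = var i ^ k * q \<and> subst (kill i) q \<noteq> 0"
proof -
  have "\<exists>k q. p = var i ^ k * q \<and> subst (kill i) q \<noteq> 0"
    if "p \<noteq> 0" "\<forall>m\<in>keys p. total_degree m < D" for D p
    using that
  proof (induction D arbitrary: p)
    case 0
    thus ?case by simp
  next
    case (Suc D)
    show ?case
    proof (cases "subst (kill i) p = 0")
      case True
      then obtain p1 where p1: "p = var i * p1" using kill_dvd[of i p] by (auto elim: dvdE)
      have "total_degree m < D" if "m \<in> keys p1" for m
      proof -
        have "single i 1 + m \<in> keys p"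
          using that lookup_var_mult[of i p1 m] by (simp add: p1 in_keys_iff)
        thus ?thesis using Suc.prems
          by (fastforce simp: total_degree_add total_degree_eq_weight weight_add)
      qed
      moreover have "p1 \<noteq> 0" using Suc.prems p1 by auto
      ultimately obtain k q where "p1 = var i ^ k * q" "subst (kill i) q \<noteq> 0"
        using Suc.IH[of p1] by blast
      thus ?thesis using p1 by (intro exI[of _ "Suc k"] exI[of _ q]) (simp add: mult_ac)
    qed (auto intro!: exI[of _ 0] exI[of _ p])
  qed
  moreover have "\<forall>m\<in>keys p. total_degree m < Suc (Max (total_degree ` keys p))"
    by (auto simp: less_Suc_eq_le)
  ultimately show ?thesis using assms by blast
qed

lemma poly_ring_mono: "n \<le> n' \<Longrightarrow> poly_ring n \<subseteq> poly_ring n'"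
  by (fastforce simp: poly_ring_def)

lemma poly_ring_zero_vars: "p \<in> poly_ring 0 \<Longrightarrow> subst g p = p"
  using subst_cong[of p 0 g var] by simp

text \<open>
  Setting \<open>x\<^bsub>n+1\<^esub> = 0\<close> sends \<open>e\<^bsub>n+1\<^esub>\<close> to \<open>0\<close> and every other \<open>e\<^sub>i\<close> to the elementary symmetric polynomial of
  the same index in one variable less. A relation from which the powers of \<open>e\<^bsub>n+1\<^esub>\<close> are removed
  therefore becomes a nonzero relation in fewer variables.
\<close>

lemma esym_algebraically_independent:
  assumes "q \<in> poly_ring n" "subst (esym n) q = (0 :: 'k::field mpoly)"
  shows "q = 0"
  using assms
proof (induction n arbitrary: q)
  case 0
  thus ?case by (simp add: poly_ring_zero_vars)
next
  case (Suc n)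
  show ?case
  proof (rule ccontr)
    assume "q \<noteq> 0"
    then obtain k q' where q': "q = var (Suc n) ^ k * q'" "subst (kill (Suc n)) q' \<noteq> 0"
      using factor_out_var by blast
    have "q' \<in> poly_ring (Suc n)"
      using Suc.prems(1) unfolding q'(1) by (rule poly_ring_dvd_cofactor[rotated]) auto
    hence *: "subst (kill (Suc n)) q' \<in> poly_ring n" by (rule kill_in_poly_ring)
    have "subst (esym (Suc n)) q' = 0"
      using Suc.prems(2) esym_top_neq_0[of "Suc n"] by (auto simp: q'(1) subst_hom)
    hence "subst (kill (Suc n)) (subst (esym (Suc n)) q') = 0" by simp
    hence "subst (esym n) q' = 0" by (simp add: subst_subst kill_esym)
    also have "esym n = (\<lambda>i. subst (esym n) (kill (Suc n) i) :: 'k mpoly)"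
      by (auto simp: fun_eq_iff kill_def esym_above)
    finally have "subst (esym n) (subst (kill (Suc n)) q') = 0" by (simp add: subst_subst)
    from Suc.IH[OF * this] q'(2) show False by simp
  qed
qed

definition isobaric :: "int \<Rightarrow> 'k::field mpoly \<Rightarrow> bool" where
  "isobaric d q \<longleftrightarrow> (\<forall>m\<in>keys q. int (weight (\<lambda>i. i) m) = d)"

lemma isobaric_add: "isobaric d p \<Longrightarrow> isobaric d q \<Longrightarrow> isobaric d (p + q)"
  unfolding isobaric_def using Poly_Mapping.keys_add[of p q] by blast

lemma isobaric_var_mult: "isobaric d q \<Longrightarrow> isobaric (int i + d) (var i * q)"
  unfolding isobaric_def using Poly_Mapping.keys_mult[of "var i" q]
  by (fastforce simp: weight_add)

lemma homogeneous_subst_esym: "isobaric d q \<Longrightarrow> homogeneous d (subst (esym n) q)"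
  by (rule homogeneous_subst_weight[where w = "\<lambda>i. i"])
    (auto simp: isobaric_def homogeneous_esym)

lemma subst_esym_sym: "q \<in> poly_ring n \<Longrightarrow> subst (esym n) q \<in> sym_polys n"
  by (induction rule: poly_ring_induct)
    (auto simp: subst_hom esym_sym intro: invariants_add invariants_mult)

text \<open>
  Induction on the number of variables, and inside it on the degree. Setting the last variable to zero gives a
  symmetric polynomial in fewer variables; lifting its expression and subtracting, one is left
  with a symmetric polynomial that is divisible by the last variable, hence by the product of
  all variables, and the cofactor has smaller degree.
\<close>

lemma fundamental_theorem_homogeneous:
  assumes "f \<in> sym_polys n" "homogeneous d (f :: 'k::field mpoly)"
  shows "\<exists>q\<in>poly_ring n. isobaric d q \<and> subst (esym n) q = f"
  using assms
proof (induction n arbitrary: f d)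
  case 0
  hence f: "f \<in> poly_ring 0" by (simp add: invariants_poly_ring)
  hence "m = 0" if "m \<in> keys f" for m
    using that by (auto simp: poly_ring_def)
  hence "isobaric d f"
    using 0 by (fastforce simp: homogeneous_def isobaric_def total_degree_def)
  thus ?case using f by (auto simp: poly_ring_zero_vars)
next
  case (Suc n)
  note IH = Suc.IH
  let ?N = "Suc n" and ?z = "subst (kill (Suc n)) :: 'k mpoly \<Rightarrow> 'k mpoly"
  have "\<exists>q\<in>poly_ring ?N. isobaric d q \<and> subst (esym ?N) q = f"
    if "f \<in> sym_polys ?N" "homogeneous d f" "d < int D" for D d and f :: "'k mpoly"
    using that
  proof (induction D arbitrary: f d)
    case 0
    hence "keys f = {}" by (auto simp: homogeneous_def)
    thus ?case by (intro bexI[of _ 0]) (auto simp: isobaric_def)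
  next
    case (Suc D)
    have zf: "?z f \<in> sym_polys n"
    proof (rule invariantsI)
      show "?z f \<in> poly_ring n"
        by (intro kill_in_poly_ring invariants_poly_ring[OF Suc.prems(1)])
      fix \<sigma> assume "\<sigma> \<in> perms n"
      hence \<sigma>: "\<sigma> permutes {1..n}" by (simp add: perms_iff)
      hence \<sigma>': "\<sigma> permutes {1..?N}" by (rule permutes_subset) auto
      have \<sigma>N: "\<sigma> i = ?N \<longleftrightarrow> i = ?N" for i
        using permutes_not_in[OF \<sigma>, of ?N] inj_eq[OF permutes_inj[OF \<sigma>], of i ?N] by simp
      have "act \<sigma> (?z f) = ?z (act \<sigma> f)"
        unfolding act_eq_subst subst_subst
        by (rule arg_cong[of _ _ "\<lambda>g. subst g f"], rule ext) (simp add: kill_def \<sigma>N)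
      thus "act \<sigma> (?z f) = ?z f" using Suc.prems \<sigma>' by (simp add: invariants_act)
    qed
    have "homogeneous d (?z f)"
      by (intro homogeneous_subst Suc.prems) (auto simp: kill_def)
    then obtain q' where q': "q' \<in> poly_ring n" "isobaric d q'" "subst (esym n) q' = ?z f"
      using IH[OF zf] by blast
    have q'_in: "q' \<in> poly_ring ?N" using q'(1) poly_ring_mono[of n ?N] by auto
    define g where "g = f - subst (esym ?N) q'"
    have g: "g \<in> sym_polys ?N" "homogeneous d g"
      unfolding g_def using Suc.prems q' q'_in
      by (auto intro: invariants_diff homogeneous_diff subst_esym_sym homogeneous_subst_esym)
    have zg: "?z g = 0"
      by (simp add: g_def subst_diff subst_subst kill_esym q')
    \<comment> \<open>Exchanging \<open>x\<^sub>i\<close> with the last variable shows that \<open>g\<close> vanishes for \<open>x\<^sub>i = 0\<close> as well.\<close>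
    have "(\<Prod>i\<in>{1..?N}. var i) dvd g"
    proof (rule prod_dvd_by_kernels[where g = kill])
      fix i assume i: "i \<in> {1..?N}"
      let ?\<tau> = "transpose i ?N"
      have \<tau>: "?\<tau> permutes {1..?N}" using i by (intro permutes_swap_id) auto
      hence "act ?\<tau> g = g" using g(1) by (simp add: invariants_act)
      hence "subst (kill i) g = subst (kill i) (act ?\<tau> g)" by simp
      also have "\<dots> = act ?\<tau> (?z g)"
        unfolding act_eq_subst subst_subst
        by (rule arg_cong[of _ _ "\<lambda>h. subst h g"], rule ext) (simp add: kill_def transpose_def)
      finally show "subst (kill i) g = 0" by (simp add: zg act_hom)
    qed (auto simp: kill_dvd kill_def)
    then obtain h where h: "g = esym ?N ?N * h" by (auto simp: esym_top elim: dvdE)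
    have "h \<in> sym_polys ?N"
      using g(1) invariants_cofactor[OF esym_sym _ esym_top_neq_0] unfolding h by blast
    moreover have "homogeneous (d - int ?N) h"
      using g(2) homogeneous_esym esym_top_neq_0 unfolding h by (intro homogeneous_cofactor)
    ultimately obtain q'' where
      q'': "q'' \<in> poly_ring ?N" "isobaric (d - int ?N) q''" "subst (esym ?N) q'' = h"
      using Suc.IH[of h "d - int ?N"] Suc.prems by auto
    show ?case
    proof (intro bexI[of _ "q' + var ?N * q''"] conjI)
      show "isobaric d (q' + var ?N * q'')"
        using isobaric_var_mult[OF q''(2), of ?N] q' by (intro isobaric_add) auto
      show "subst (esym ?N) (q' + var ?N * q'') = f"
        using h by (simp add: subst_hom q'' g_def algebra_simps)
    qed (intro poly_ring_add poly_ring_mult q'_in q'' poly_ring_var, simp)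
  qed
  from this[of f d "nat d + 1"] Suc.prems show ?case by simp
qed

definition in_esym :: "nat \<Rightarrow> 'k::field mpoly \<Rightarrow> 'k mpoly" where
  "in_esym n a = (THE q. q \<in> poly_ring n \<and> subst (esym n) q = a)"

lemma subst_esym_inj:
  "p \<in> poly_ring n \<Longrightarrow> q \<in> poly_ring n \<Longrightarrow> subst (esym n) p = subst (esym n) q \<Longrightarrow> p = q"
  using esym_algebraically_independent[of "p - q" n] by (auto simp: subst_diff)

lemma in_esym_eqI: "q \<in> poly_ring n \<Longrightarrow> subst (esym n) q = a \<Longrightarrow> in_esym n a = q"
  unfolding in_esym_def by (rule the_equality) (auto intro: subst_esym_inj)

lemma fundamental_theorem:
  assumes "a \<in> sym_polys n"
  shows "in_esym n a \<in> poly_ring n" "subst (esym n) (in_esym n a) = a"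
proof -
  let ?D = "(\<lambda>m. int (total_degree m)) ` keys a"
  have "\<exists>q. q \<in> poly_ring n \<and> subst (esym n) q = hcomp d a" for d
    using fundamental_theorem_homogeneous[OF invariants_hcomp[OF assms], of d d] by auto
  then obtain q where q: "\<And>d. q d \<in> poly_ring n" "\<And>d. subst (esym n) (q d) = hcomp d a" by metis
  have 1: "(\<Sum>d\<in>?D. q d) \<in> poly_ring n" by (intro poly_ring_sum q)
  have 2: "subst (esym n) (\<Sum>d\<in>?D. q d) = a"
    unfolding subst_sum q by (rule hcomp_decomp[symmetric])
  show "in_esym n a \<in> poly_ring n" "subst (esym n) (in_esym n a) = a"
    using in_esym_eqI[OF 1 2] 1 2 by simp_all
qed

lemma in_esym_isobaric:
  assumes "a \<in> sym_polys n" "homogeneous d a" shows "isobaric d (in_esym n a)"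
  using fundamental_theorem_homogeneous[OF assms] by (auto simp: in_esym_eqI)

lemma in_esym_0 [simp]: "in_esym n 0 = 0"
  by (rule in_esym_eqI) auto

lemma in_esym_add:
  "a \<in> sym_polys n \<Longrightarrow> b \<in> sym_polys n \<Longrightarrow> in_esym n (a + b) = in_esym n a + in_esym n b"
  and in_esym_mult:
  "a \<in> sym_polys n \<Longrightarrow> b \<in> sym_polys n \<Longrightarrow> in_esym n (a * b) = in_esym n a * in_esym n b"
  by (rule in_esym_eqI; auto simp: subst_hom fundamental_theorem)+

lemma in_esym_const [simp]: "in_esym n (const c) = const c"
  by (rule in_esym_eqI) auto

lemma in_esym_esym: "i \<in> {1..n} \<Longrightarrow> in_esym n (esym n i) = var i"
  by (rule in_esym_eqI) (auto simp del: atLeastAtMost_iff)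

section \<open>The elementary symmetric polynomials generate the irrelevant ideal up to radical\<close>

definition kill_upto :: "nat \<Rightarrow> nat \<Rightarrow> 'k::field mpoly" where
  "kill_upto i l = (if l \<in> {1..i} then 0 else var l)"

lemma kill_upto_poly_ring: "q \<in> poly_ring n \<Longrightarrow> subst (kill_upto i) q \<in> poly_ring n"
  by (rule subst_in_poly_ring) (auto simp: kill_upto_def simp del: atLeastAtMost_iff)

lemma poly_ring_split:
  assumes "q \<in> poly_ring n" "i \<le> n"
  shows "\<exists>b. (\<forall>j. b j \<in> poly_ring n) \<and> q = subst (kill_upto i) q + (\<Sum>j\<in>{1..i}. b j * var j)"
  using assms(1)
proof (induction rule: poly_ring_induct)
  case (const c)
  show ?case by (rule exI[of _ "\<lambda>_. 0"]) auto
next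
  case (var l)
  show ?case
  proof (cases "l \<in> {1..i}")
    case True
    have "(\<Sum>j\<in>{1..i}. (if j = l then 1 else 0) * var j) =
        (\<Sum>j\<in>{1..i}. if j = l then var l else 0 :: 'a mpoly)"
      by (intro sum.cong) auto
    thus ?thesis using True
      by (intro exI[of _ "\<lambda>j. if j = l then 1 else 0"]) (auto simp: kill_upto_def)
  next
    case False
    thus ?thesis by (intro exI[of _ "\<lambda>_. 0"]) (simp add: kill_upto_def del: atLeastAtMost_iff)
  qed
next
  case (add p q)
  then obtain b c where "\<forall>j. b j \<in> poly_ring n" "p = subst (kill_upto i) p + (\<Sum>j\<in>{1..i}. b j * var j)"
    "\<forall>j. c j \<in> poly_ring n" "q = subst (kill_upto i) q + (\<Sum>j\<in>{1..i}. c j * var j)" by blast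
  thus ?case
    by (intro exI[of _ "\<lambda>j. b j + c j"])
      (simp add: subst_add sum.distrib distrib_right poly_ring_add, metis (no_types, lifting) add.assoc add.left_commute)
next
  case (mult p q)
  let ?k = "subst (kill_upto i) :: 'a mpoly \<Rightarrow> 'a mpoly"
  obtain b c where b: "\<forall>j. b j \<in> poly_ring n" "p = ?k p + (\<Sum>j\<in>{1..i}. b j * var j)"
    and c: "\<forall>j. c j \<in> poly_ring n" "q = ?k q + (\<Sum>j\<in>{1..i}. c j * var j)" using mult.IH by blast
  have "p * q = ?k p * q + (\<Sum>j\<in>{1..i}. b j * var j) * q"
    using arg_cong[OF b(2), of "\<lambda>x. x * q"] by (simp add: distrib_right)
  also have "?k p * q = ?k (p * q) + (\<Sum>j\<in>{1..i}. ?k p * c j * var j)"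
    using arg_cong[OF c(2), of "\<lambda>x. ?k p * x"]
    by (simp add: distrib_left subst_mult sum_distrib_left mult.assoc)
  finally have "p * q = ?k (p * q) + (\<Sum>j\<in>{1..i}. (?k p * c j + b j * q) * var j)"
    by (simp add: sum.distrib distrib_right distrib_left sum_distrib_left sum_distrib_right mult_ac add.assoc)
  moreover have "?k p * c j + b j * q \<in> poly_ring n" for j
    using b(1) c(1) mult.hyps by (intro poly_ring_add poly_ring_mult kill_upto_poly_ring) auto
  ultimately show ?case by (intro exI[of _ "\<lambda>j. ?k p * c j + b j * q"]) blast
qed

lemma poly_ring_split_constant:
  assumes "q \<in> poly_ring n"
  shows "\<exists>b. (\<forall>i. b i \<in> poly_ring n) \<and> q = const (lookup q 0) + (\<Sum>i\<in>{1..n}. b i * var i)"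
proof -
  have "subst (kill_upto n) q = subst (\<lambda>_. 0) q"
    by (rule subst_cong[OF assms]) (simp add: kill_upto_def)
  thus ?thesis using poly_ring_split[OF assms order_refl] by (simp add: lookup_0_eq_subst)
qed

lemma lookup_0_subst_esym:
  assumes "q \<in> poly_ring n" shows "lookup (subst (esym n) q) 0 = lookup q 0"
proof -
  have "subst (\<lambda>_. 0) (subst (esym n) q) = subst (\<lambda>i. const (lookup (esym n i) 0)) q"
    unfolding subst_subst by (simp only: lookup_0_eq_subst)
  also have "\<dots> = subst (\<lambda>_. 0) q"
    by (rule subst_cong[OF assms]) (auto simp: lookup_esym_0)
  finally show ?thesis by (simp add: lookup_0_eq_subst)
qed

lemma sym_zero_constant:
  assumes "a \<in> sym_polys n" "lookup a 0 = 0"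
  shows "\<exists>b. (\<forall>i. b i \<in> sym_polys n) \<and> a = (\<Sum>i\<in>{1..n}. b i * esym n i)"
proof -
  let ?q = "in_esym n a"
  have "lookup ?q 0 = 0"
    using lookup_0_subst_esym[of ?q n] assms by (simp add: fundamental_theorem)
  then obtain b where b: "\<forall>i. b i \<in> poly_ring n" "?q = (\<Sum>i\<in>{1..n}. b i * var i)"
    using poly_ring_split_constant[OF fundamental_theorem(1)[OF assms(1)]] by auto
  have "a = subst (esym n) ?q" using assms by (simp add: fundamental_theorem)
  also have "\<dots> = (\<Sum>i\<in>{1..n}. subst (esym n) (b i) * esym n i)"
    using arg_cong[OF b(2), of "subst (esym n)"] by (simp add: subst_hom)
  finally show ?thesis using b by (intro exI[of _ "\<lambda>i. subst (esym n) (b i)"]) (auto intro: subst_esym_sym)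
qed

lemma finite_perms: "finite (perms n)"
  unfolding perms_def by (rule finite_permutations) simp

text \<open>
  Such an \<open>r\<close> is a root of \<open>\<Prod>\<^sub>\<sigma> (T - \<sigma>(r))\<close>, where \<open>\<sigma>\<close> runs over all permutations. The lower
  coefficients of this polynomial are symmetric without constant term, so they lie in the ideal
  generated by the elementary symmetric polynomials, and with them the highest power of \<open>r\<close>.
\<close>

lemma power_in_esym_ideal:
  assumes r: "r \<in> invariants n G" "lookup r 0 = (0::'k::field)" and G: "G \<subseteq> perms n"
  shows "\<exists>t a. (\<forall>i. a i \<in> invariants n G) \<and> r ^ t = (\<Sum>i\<in>{1..n}. a i * esym n i)"
proof -
  let ?P = "perms n"
  \<comment> \<open>The coefficient of \<open>T\<^bsup>n! - k\<^esup>\<close>.\<close>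
  let ?E = "\<lambda>k. \<Sum>X | X \<subseteq> ?P \<and> card X = k. \<Prod>\<sigma>\<in>X. - act \<sigma> r"
  note fin = finite_perms[of n]
  have sub: "sym_polys n \<subseteq> (invariants n G :: 'k mpoly set)" by (rule invariants_antimono[OF G])
  have E: "?E k \<in> sym_polys n" for k
  proof (rule invariantsI)
    show "?E k \<in> poly_ring n"
      using invariants_poly_ring[OF r(1)]
      by (intro poly_ring_sum poly_ring_prod poly_ring_uminus act_poly_ring) auto
    fix \<rho> assume \<rho>': "\<rho> \<in> ?P"
    hence \<rho>: "\<rho> permutes {1..n}" by (simp add: perms_iff)
    have inj: "inj_on ((\<circ>) \<rho>) X" for X :: "(nat \<Rightarrow> nat) set"
      using permutes_inj[OF \<rho>] by (auto simp: inj_on_def fun.inj_map_strong fun_eq_iff dest: injD)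
    have inj': "inj_on ((\<circ>) (inv' \<rho>)) X" for X :: "(nat \<Rightarrow> nat) set"
      using permutes_inj[OF permutes_inv[OF \<rho>]] by (auto simp: inj_on_def fun_eq_iff dest: injD)
    have b: "bij_betw (\<lambda>X. (\<circ>) \<rho> ` X) {X. X \<subseteq> ?P \<and> card X = k} {X. X \<subseteq> ?P \<and> card X = k}"
    proof (rule bij_betw_byWitness[where f' = "\<lambda>X. (\<circ>) (inv' \<rho>) ` X"])
      show "(\<lambda>X. (\<circ>) \<rho> ` X) ` {X. X \<subseteq> ?P \<and> card X = k} \<subseteq> {X. X \<subseteq> ?P \<and> card X = k}"
        using \<rho>' by (auto simp: card_image[OF inj] simp del: perms_iff intro: perms_comp)
      show "(\<lambda>X. (\<circ>) (inv' \<rho>) ` X) ` {X. X \<subseteq> ?P \<and> card X = k} \<subseteq> {X. X \<subseteq> ?P \<and> card X = k}"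
        using perms_inv[OF \<rho>'] by (auto simp: card_image[OF inj'] simp del: perms_iff intro: perms_comp)
    qed (auto simp: image_comp permutes_inv_o[OF \<rho>] comp_assoc[symmetric] image_image)
    have "act \<rho> (?E k) = (\<Sum>X | X \<subseteq> ?P \<and> card X = k. \<Prod>\<sigma>\<in>(\<circ>) \<rho> ` X. - act \<sigma> r)"
      by (simp add: act_hom act_comp prod.reindex[OF inj])
    also have "\<dots> = ?E k" by (rule sum.reindex_bij_betw[OF b])
    finally show "act \<rho> (?E k) = ?E k" .
  qed
  have "lookup (?E k) 0 = 0" if "k > 0" for k
  proof -
    have "lookup (\<Prod>\<sigma>\<in>X. - act \<sigma> r) 0 = 0" if "X \<subseteq> ?P" "card X = k" for X
    proof -
      have "X \<noteq> {}" "finite X" using that \<open>k > 0\<close> by (auto intro: card_ge_0_finite)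
      hence "const (lookup (\<Prod>\<sigma>\<in>X. - act \<sigma> r) 0) = const 0"
        unfolding lookup_0_eq_subst[symmetric] subst_prod
        by (simp add: subst_uminus lookup_0_eq_subst lookup_0_act r card_gt_0_iff)
      thus ?thesis by simp
    qed
    thus ?thesis by (simp add: lookup_sum)
  qed
  hence ex: "\<exists>b. (\<forall>i. b i \<in> sym_polys n) \<and> ?E k = (\<Sum>i\<in>{1..n}. b i * esym n i)" if "k > 0" for k
    using sym_zero_constant[OF E] that by blast
  define b where
    "b k = (SOME b. (\<forall>i. b i \<in> sym_polys n) \<and> ?E k = (\<Sum>i\<in>{1..n}. b i * esym n i))" for k
  have b: "b k i \<in> sym_polys n" "?E k = (\<Sum>i\<in>{1..n}. b k i * esym n i)" if "k > 0" for k i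
    using someI_ex[OF ex[OF that]] unfolding b_def by blast+
  let ?t = "card ?P"
  have "(\<Prod>\<sigma>\<in>?P. r + - act \<sigma> r) = 0"
  proof (rule prod_zero[OF fin])
    show "\<exists>\<sigma>\<in>?P. r + - act \<sigma> r = 0"
      by (rule bexI[of _ id]) (simp_all add: permutes_id)
  qed
  also have "(\<Prod>\<sigma>\<in>?P. r + - act \<sigma> r) = (\<Prod>\<sigma>\<in>?P. - act \<sigma> r + r)"
    by (simp add: add.commute)
  also have "\<dots> = (\<Sum>X\<in>Pow ?P. (\<Prod>\<sigma>\<in>X. - act \<sigma> r) * (\<Prod>\<sigma>\<in>?P - X. r))"
    by (rule prod_add[OF fin])
  also have "\<dots> = (\<Sum>X\<in>Pow ?P. (\<Prod>\<sigma>\<in>X. - act \<sigma> r) * r ^ (?t - card X))"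
    using fin by (intro sum.cong) (auto simp: card_Diff_subset finite_subset)
  also have "\<dots> = (\<Sum>k\<in>{0..?t}. \<Sum>X | X \<in> Pow ?P \<and> card X = k. (\<Prod>\<sigma>\<in>X. - act \<sigma> r) * r ^ (?t - card X))"
    using fin by (intro sum.group[symmetric]) (auto intro: card_mono)
  also have "\<dots> = (\<Sum>k\<in>{0..?t}. ?E k * r ^ (?t - k))"
    by (intro sum.cong) (auto simp: sum_distrib_right)
  also have "\<dots> = ?E 0 * r ^ ?t + (\<Sum>k\<in>{0<..?t}. ?E k * r ^ (?t - k))"
    by (subst sum.head) auto
  also have "{X. X \<subseteq> ?P \<and> card X = 0} = {{}}"
    using fin by (auto dest: finite_subset)
  finally have "r ^ ?t = - (\<Sum>k\<in>{0<..?t}. ?E k * r ^ (?t - k))"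
    by (simp add: add_eq_0_iff)
  also have "\<dots> = (\<Sum>k\<in>{0<..?t}. \<Sum>i\<in>{1..n}. - (b k i * r ^ (?t - k)) * esym n i)"
    by (simp add: b sum_distrib_left sum_distrib_right sum_negf mult_ac)
  also have "\<dots> = (\<Sum>i\<in>{1..n}. (\<Sum>k\<in>{0<..?t}. - (b k i * r ^ (?t - k))) * esym n i)"
    by (subst sum.swap) (simp add: sum_distrib_right)
  finally have "r ^ ?t = \<dots>" .
  moreover have "(\<Sum>k\<in>{0<..?t}. - (b k i * r ^ (?t - k))) \<in> invariants n G" for i
    using b(1) sub r(1) by (intro invariants_sum invariants_uminus invariants_mult invariants_power) auto
  ultimately show ?thesis
    by (intro exI[of _ ?t] exI[of _ "\<lambda>i. \<Sum>k\<in>{0<..?t}. - (b k i * r ^ (?t - k))"]) simp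
qed

section \<open>Products of differences of variables\<close>

definition pairs :: "nat \<Rightarrow> (nat \<times> nat) set" where
  "pairs n = {(i, j). 1 \<le> i \<and> i < j \<and> j \<le> n}"

lemma finite_pairs [simp]: "finite (pairs n)"
  by (rule finite_subset[of _ "{1..n} \<times> {1..n}"]) (auto simp: pairs_def)

definition dprod :: "(nat \<times> nat) set \<Rightarrow> 'k::field mpoly" where
  "dprod E = (\<Prod>(i, j)\<in>E. var i - var j)"

abbreviation vdm :: "nat \<Rightarrow> 'k::field mpoly" where "vdm n \<equiv> dprod (pairs n)"

lemma dprod_poly_ring: "E \<subseteq> {1..n} \<times> {1..n} \<Longrightarrow> dprod E \<in> poly_ring n"
  unfolding dprod_def by (intro poly_ring_prod) (auto intro!: poly_ring_diff poly_ring_var)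

lemma pairs_subset: "pairs n \<subseteq> {1..n} \<times> {1..n}"
  by (auto simp: pairs_def)

lemma homogeneous_dprod: "homogeneous (int (card E)) (dprod E)"
proof -
  have "homogeneous (\<Sum>e\<in>E. 1) (\<Prod>e\<in>E. var (fst e) - var (snd e) :: 'a mpoly)"
    by (intro homogeneous_prod homogeneous_diff) auto
  thus ?thesis by (simp add: dprod_def case_prod_unfold)
qed

lemma dprod_neq_0: "E \<subseteq> pairs n \<Longrightarrow> dprod E \<noteq> 0"
  using finite_subset[OF _ finite_pairs] by (auto simp: dprod_def pairs_def prod_zero_iff)

lemma of_int_eq_const: "of_int z = const (of_int z)"
  by (simp add: const_def single_of_int)

lemma act_of_int [simp]: "act \<sigma> (of_int z) = of_int z"
  by (simp add: of_int_eq_const act_hom)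

definition inversions :: "(nat \<times> nat) set \<Rightarrow> (nat \<Rightarrow> nat) \<Rightarrow> nat" where
  "inversions E \<sigma> = card {(i, j) \<in> E. \<sigma> j < \<sigma> i}"

lemma act_dprod:
  assumes E: "E \<subseteq> pairs n" and \<sigma>: "\<sigma> permutes {1..n}"
    and stable: "\<And>i j. (i, j) \<in> E \<Longrightarrow> (min (\<sigma> i) (\<sigma> j), max (\<sigma> i) (\<sigma> j)) \<in> E"
  shows "act \<sigma> (dprod E) = of_int ((- 1) ^ inversions E \<sigma>) * (dprod E :: 'k::field mpoly)"
proof -
  let ?s = "\<lambda>(i, j). (min (\<sigma> i) (\<sigma> j), max (\<sigma> i) (\<sigma> j))"
  let ?D = "\<lambda>(i, j). var i - var j :: 'k mpoly"
  let ?P = "\<lambda>(i, j). \<sigma> j < \<sigma> i"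
  have fin: "finite E" using E by (rule finite_subset) simp
  have inj\<sigma>: "\<sigma> i = \<sigma> j \<longleftrightarrow> i = j" for i j using permutes_inj[OF \<sigma>] by (rule inj_eq)
  have "inj_on ?s E"
  proof (rule inj_onI)
    fix e e' assume *: "e \<in> E" "e' \<in> E" "?s e = ?s e'"
    obtain i j i' j' where e: "e = (i, j)" "e' = (i', j')" by (cases e, cases e')
    have "i < j" "i' < j'" using * E by (auto simp: e pairs_def)
    moreover have "(i = i' \<and> j = j') \<or> (i = j' \<and> j = i')"
      using *(3) inj\<sigma> by (auto simp: e min_def max_def split: if_splits)
    ultimately show "e = e'" by (auto simp: e)
  qed
  moreover have "?s ` E \<subseteq> E" using stable by auto
  ultimately have b: "bij_betw ?s E E"
    using fin by (auto simp: bij_betw_def endo_inj_surj)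
  have "act \<sigma> (dprod E) = (\<Prod>e\<in>E. (if ?P e then - 1 else 1) * ?D (?s e))"
    unfolding dprod_def act_hom by (rule prod.cong) (auto simp: act_hom min_def max_def)
  also have "\<dots> = (\<Prod>e\<in>E. if ?P e then - 1 else 1) * (\<Prod>e\<in>E. ?D (?s e))"
    by (rule prod.distrib)
  also have "(\<Prod>e\<in>E. ?D (?s e)) = dprod E"
    unfolding dprod_def by (rule prod.reindex_bij_betw[OF b])
  also have "(\<Prod>e\<in>E. if ?P e then - 1 else 1 :: 'k mpoly) = (- 1) ^ inversions E \<sigma>"
  proof -
    have "(\<Prod>e\<in>E. if ?P e then - 1 else 1 :: 'k mpoly) = (\<Prod>e\<in>{e \<in> E. ?P e}. - 1)"
      using fin by (rule prod.inter_filter[symmetric])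
    also have "{e \<in> E. ?P e} = {(i, j) \<in> E. \<sigma> j < \<sigma> i}" by auto
    finally show ?thesis by (simp add: inversions_def)
  qed
  finally show ?thesis by simp
qed

lemma dprod_remove:
  "(i, j) \<in> E \<Longrightarrow> finite E \<Longrightarrow> dprod E = (var i - var j) * dprod (E - {(i, j)})"
  unfolding dprod_def by (subst prod.remove[of E "(i, j)"]) auto

lemma glue_dprod_neq_0:
  assumes "E \<subseteq> pairs n" "(i, j) \<in> pairs n" "(i, j) \<notin> E"
  shows "subst (glue i j) (dprod E) \<noteq> 0"
proof -
  have "subst (glue i j) (var a - var b :: 'a mpoly) \<noteq> 0" if "(a, b) \<in> E" for a b
    using that assms by (intro glue_diff_neq_0) (auto simp: pairs_def doubleton_eq_iff)
  thus ?thesis using finite_subset[OF assms(1)]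
    by (auto simp: dprod_def subst_prod prod_zero_iff)
qed

lemma dprod_dvd:
  assumes "E \<subseteq> pairs n" "\<And>i j. (i, j) \<in> E \<Longrightarrow> subst (glue i j) p = 0"
  shows "dprod E dvd p"
  unfolding dprod_def
proof (rule prod_dvd_by_kernels[where g = "\<lambda>(i, j). glue i j"])
  fix e e' assume "e \<in> E" "e' \<in> E" "e \<noteq> e'"
  thus "subst (case e of (i, j) \<Rightarrow> glue i j) (case e' of (i, j) \<Rightarrow> var i - var j) \<noteq> (0 :: 'a mpoly)"
  proof (cases e, cases e')
    fix a b c d assume *: "e = (a, b)" "e' = (c, d)"
    hence "a < b" "c < d" using \<open>e \<in> E\<close> \<open>e' \<in> E\<close> assms(1) by (auto simp: pairs_def)
    thus ?thesis using \<open>e \<noteq> e'\<close> unfolding *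
      by (simp, intro glue_diff_neq_0) (auto simp: doubleton_eq_iff)
  qed
qed (use assms finite_subset[OF assms(1)] dvd_if_glue_0 in auto)

lemma transpose_perms: "i \<in> {1..n} \<Longrightarrow> j \<in> {1..n} \<Longrightarrow> transpose i j \<in> perms n"
  by (simp only: perms_iff permutes_swap_id)

lemma pairs_stable:
  assumes \<sigma>: "\<sigma> permutes {1..n}" and "(i, j) \<in> pairs n"
  shows "(min (\<sigma> i) (\<sigma> j), max (\<sigma> i) (\<sigma> j)) \<in> pairs n"
proof -
  have "i \<in> {1..n}" "j \<in> {1..n}" "i \<noteq> j" using assms(2) by (auto simp: pairs_def)
  hence "\<sigma> i \<in> {1..n}" "\<sigma> j \<in> {1..n}" "\<sigma> i \<noteq> \<sigma> j"
    using permutes_in_image[OF \<sigma>] inj_eq[OF permutes_inj[OF \<sigma>]] by blast+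
  thus ?thesis by (auto simp: pairs_def min_def max_def)
qed

lemma sign_comp_perms: "\<sigma> \<in> perms n \<Longrightarrow> \<tau> \<in> perms n \<Longrightarrow> sign (\<sigma> \<circ> \<tau>) = sign \<sigma> * sign \<tau>"
  by (rule sign_compose) (auto intro!: permutes_imp_permutation[of "{1..n}"] simp del: atLeastAtMost_iff)

lemma of_int_sign_square [simp]:
  "of_int (sign \<sigma>) * of_int (sign \<sigma>) = (1 :: 'k::comm_ring_1)"
  "of_int (sign \<sigma>) * (of_int (sign \<sigma>) * x) = (x :: 'k)"
  by (simp_all add: sign_def)

text \<open>
  By \<open>act_dprod\<close> the Vandermonde polynomial is multiplied by a sign, and it suffices to find this sign for
  a transposition \<open>(i j)\<close>. Were it \<open>1\<close>, the transposition would negate the cofactor of \<open>x\<^sub>i - x\<^sub>j\<close>, which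
  would then vanish for \<open>x\<^sub>i = x\<^sub>j\<close>.
\<close>

lemma act_vdm:
  assumes char: "CHAR('k::field) \<noteq> 2" and \<sigma>: "\<sigma> \<in> perms n"
  shows "act \<sigma> (vdm n) = of_int (sign \<sigma>) * (vdm n :: 'k mpoly)"
proof -
  have tr: "act (transpose i j) (vdm n) = - (vdm n :: 'k mpoly)" if ij: "(i, j) \<in> pairs n" for i j
  proof -
    let ?t = "transpose i j"
    have t: "?t \<in> perms n" using ij by (intro transpose_perms) (auto simp: pairs_def)
    have "act ?t (vdm n) = of_int ((- 1) ^ inversions (pairs n) ?t) * (vdm n :: 'k mpoly)"
      using t by (intro act_dprod pairs_stable) (auto simp del: atLeastAtMost_iff)
    hence "act ?t (vdm n) = (vdm n :: 'k mpoly) \<or> act ?t (vdm n) = - (vdm n :: 'k mpoly)"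
      by (cases "even (inversions (pairs n) ?t)") simp_all
    moreover have "act ?t (vdm n) \<noteq> (vdm n :: 'k mpoly)"
    proof
      let ?Q = "dprod (pairs n - {(i, j)}) :: 'k mpoly"
      assume eq: "act ?t (vdm n) = (vdm n :: 'k mpoly)"
      have v: "vdm n = (var i - var j) * ?Q" using ij by (intro dprod_remove) auto
      have e: "- (var i - var j) * act ?t ?Q = (var i - var j) * ?Q"
        using eq by (simp add: v act_hom)
      have "(var i - var j) * (act ?t ?Q + ?Q) = 0"
        unfolding distrib_left e[symmetric]
        by (simp only: minus_mult_left[symmetric] add.right_inverse)
      moreover have "var i - var j \<noteq> (0 :: 'k mpoly)" using ij by (auto simp: pairs_def)
      ultimately have "act ?t ?Q = - ?Q"
        by (simp only: mult_eq_0_iff eq_neg_iff_add_eq_0 simp_thms)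
      hence "subst (glue i j) ?Q = 0"
        using char by (intro glue_kernel_invariant) (simp add: act_eq_subst)
      moreover have "subst (glue i j) ?Q \<noteq> 0" using ij by (intro glue_dprod_neq_0[of _ n]) auto
      ultimately show False by simp
    qed
    ultimately show ?thesis by blast
  qed
  have tr': "act (transpose i j) (vdm n) = - (vdm n :: 'k mpoly)"
    if "i \<in> {1..n}" "j \<in> {1..n}" "i \<noteq> j" for i j
    using tr[of i j] tr[of j i] that by (cases "i < j") (auto simp: pairs_def transpose_commute)
  have "\<sigma> permutes {1..n}" "finite {1..n}" using \<sigma> by simp_all
  thus ?thesis
  proof (induction \<sigma> rule: permutes_induct)
    case (swap a b p)
    have "sign (transpose a b \<circ> p) = - sign p"
      using swap sign_comp_perms[of "transpose a b" n p] transpose_perms[of a n b]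
      by (simp add: sign_swap_id perms_def)
    moreover have "act p (vdm n) = of_int (sign p) * (vdm n :: 'k mpoly)"
      using swap by simp
    ultimately show ?case unfolding act_comp
      by (simp only: act_hom act_of_int tr'[OF swap(1-3)] of_int_minus) simp
  qed (simp only: act_id sign_id of_int_1 mult_1)
qed

section \<open>Separating the permutations\<close>

text \<open>
  Expanding \<open>\<Prod>\<^bsub>(a, b) \<in> E\<^esub> (x\<^sub>a - y\<^sub>b)\<close> as a sum of products \<open>g(x) h(y)\<close>, and then permuting the \<open>x\<^sub>a\<close> by
  \<open>\<sigma>\<close> and putting \<open>y = x\<close>. A list is used because the same product may occur several times.
\<close>

lemma separation_list:
  assumes "finite E" "E \<subseteq> {1..n} \<times> {1..n}"
  shows "\<exists>L :: ('k::field mpoly \<times> 'k mpoly) list.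
    (\<forall>(g, h)\<in>set L. g \<in> poly_ring n \<and> h \<in> poly_ring n \<and>
       (\<exists>a b. homogeneous a g \<and> homogeneous b h \<and> a + b = int (card E))) \<and>
    (\<forall>\<sigma>. (\<Sum>(g, h)\<leftarrow>L. act \<sigma> g * h) = (\<Prod>(a, b)\<in>E. var (\<sigma> a) - var b))"
  using assms
proof (induction E rule: finite_induct)
  case empty
  show ?case by (rule exI[of _ "[(1, 1)]"]) (auto simp: act_hom intro!: exI[of _ 0])
next
  case (insert e E)
  obtain a b where e: "e = (a, b)" by (cases e)
  have ab: "a \<in> {1..n}" "b \<in> {1..n}" using insert.prems by (auto simp: e)
  obtain L :: "('k mpoly \<times> 'k mpoly) list" where
    L: "\<And>g h. (g, h) \<in> set L \<Longrightarrow> g \<in> poly_ring n \<and> h \<in> poly_ring n \<and>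
       (\<exists>a b. homogeneous a g \<and> homogeneous b h \<and> a + b = int (card E))"
    "\<And>\<sigma>. (\<Sum>(g, h)\<leftarrow>L. act \<sigma> g * h) = (\<Prod>(a, b)\<in>E. var (\<sigma> a) - var b)"
    using insert.IH insert.prems by fastforce
  let ?L = "map (\<lambda>(g, h). (g * var a, h)) L @ map (\<lambda>(g, h). (g, - (h * var b))) L"
  show ?case
  proof (intro exI[of _ ?L] conjI allI)
    fix \<sigma>
    have "(\<Sum>(g, h)\<leftarrow>?L. act \<sigma> g * h) =
        (\<Sum>(g, h)\<leftarrow>L. act \<sigma> g * h) * var (\<sigma> a) - (\<Sum>(g, h)\<leftarrow>L. act \<sigma> g * h) * var b"
      by (induction L) (auto simp: act_hom algebra_simps split: prod.splits)
    also have "\<dots> = (\<Prod>(a, b)\<in>insert e E. var (\<sigma> a) - var b)"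
      using insert.hyps unfolding L(2) by (simp add: e algebra_simps)
    finally show "(\<Sum>(g, h)\<leftarrow>?L. act \<sigma> g * h) = (\<Prod>(a, b)\<in>insert e E. var (\<sigma> a) - var b)" .
  next
    have "u * var a \<in> poly_ring n \<and> v \<in> poly_ring n \<and>
       (\<exists>c d. homogeneous c (u * var a) \<and> homogeneous d v \<and> c + d = int (card (insert e E)))"
      "u \<in> poly_ring n \<and> - (v * var b) \<in> poly_ring n \<and>
       (\<exists>c d. homogeneous c u \<and> homogeneous d (- (v * var b)) \<and> c + d = int (card (insert e E)))"
      if uv: "(u, v) \<in> set L" for u v
    proof -
      obtain c d where cd: "homogeneous c u" "homogeneous d v" "c + d = int (card E)"
        and in_ring: "u \<in> poly_ring n" "v \<in> poly_ring n" using L(1)[OF uv] by blast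
      have "homogeneous (c + 1) (u * var a)" "homogeneous (d + 1) (- (v * var b))"
        using cd by (auto intro!: homogeneous_mult homogeneous_uminus)
      moreover have "c + 1 + d = int (card (insert e E))" "c + (d + 1) = int (card (insert e E))"
        using cd insert.hyps by auto
      moreover have "u * var a \<in> poly_ring n" "- (v * var b) \<in> poly_ring n"
        by (intro poly_ring_mult poly_ring_uminus poly_ring_var in_ring ab)+
      ultimately show "u * var a \<in> poly_ring n \<and> v \<in> poly_ring n \<and>
       (\<exists>c d. homogeneous c (u * var a) \<and> homogeneous d v \<and> c + d = int (card (insert e E)))"
      "u \<in> poly_ring n \<and> - (v * var b) \<in> poly_ring n \<and>
       (\<exists>c d. homogeneous c u \<and> homogeneous d (- (v * var b)) \<and> c + d = int (card (insert e E)))"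
        using cd in_ring by blast+
    qed
    thus "\<forall>(g, h)\<in>set ?L. g \<in> poly_ring n \<and> h \<in> poly_ring n \<and>
       (\<exists>a b. homogeneous a g \<and> homogeneous b h \<and> a + b = int (card (insert e E)))"
      by auto
  qed
qed

lemma separation:
  assumes "finite E" "E \<subseteq> {1..n} \<times> {1..n}"
  obtains N :: nat and g h :: "nat \<Rightarrow> 'k::field mpoly" where
    "\<And>c. c < N \<Longrightarrow> g c \<in> poly_ring n" "\<And>c. c < N \<Longrightarrow> h c \<in> poly_ring n"
    "\<And>c. c < N \<Longrightarrow> \<exists>a b. homogeneous a (g c) \<and> homogeneous b (h c) \<and> a + b = int (card E)"
    "\<And>\<sigma>. (\<Sum>c<N. act \<sigma> (g c) * h c) = (\<Prod>(a, b)\<in>E. var (\<sigma> a) - var b)"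
proof -
  obtain L :: "('k mpoly \<times> 'k mpoly) list" where
    L: "\<And>e. e \<in> set L \<Longrightarrow> fst e \<in> poly_ring n \<and> snd e \<in> poly_ring n \<and>
       (\<exists>a b. homogeneous a (fst e) \<and> homogeneous b (snd e) \<and> a + b = int (card E))"
    "\<And>\<sigma>. (\<Sum>e\<leftarrow>L. act \<sigma> (fst e) * snd e) = (\<Prod>(a, b)\<in>E. var (\<sigma> a) - var b)"
    using separation_list[OF assms, where 'k = 'k] by (auto simp: case_prod_unfold)
  show ?thesis
  proof (rule that[of "length L" "\<lambda>c. fst (L ! c)" "\<lambda>c. snd (L ! c)"])
    fix \<sigma>
    show "(\<Sum>c<length L. act \<sigma> (fst (L ! c)) * snd (L ! c)) = (\<Prod>(a, b)\<in>E. var (\<sigma> a) - var b)"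
      using L(2)[of \<sigma>] by (simp add: sum_list_sum_nth atLeast0LessThan)
  qed (use L(1)[OF nth_mem] in blast)+
qed

text \<open>
  For \<open>E = {(i, j). i < j}\<close> the product in \<open>separation\<close> is the Vandermonde polynomial if \<open>\<sigma> = id\<close>. A
  permutation \<open>\<sigma> \<noteq> id\<close> has some \<open>i\<close> with \<open>i < \<sigma> i\<close>, and then the factor of \<open>(i, \<sigma> i)\<close> is zero.
\<close>

lemma dual_bases:
  obtains N :: nat and g h :: "nat \<Rightarrow> 'k::field mpoly" where
    "\<And>c. c < N \<Longrightarrow> g c \<in> poly_ring n" "\<And>c. c < N \<Longrightarrow> h c \<in> poly_ring n"
    "\<And>c. c < N \<Longrightarrow>
      \<exists>a b. homogeneous a (g c) \<and> homogeneous b (h c) \<and> a + b = int (card (pairs n))"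
    "\<And>\<sigma>. \<sigma> \<in> perms n \<Longrightarrow> (\<Sum>c<N. act \<sigma> (g c) * h c) = (if \<sigma> = id then vdm n else 0)"
proof -
  obtain N :: nat and g h :: "nat \<Rightarrow> 'k mpoly" where *:
    "\<And>c. c < N \<Longrightarrow> g c \<in> poly_ring n" "\<And>c. c < N \<Longrightarrow> h c \<in> poly_ring n"
    "\<And>c. c < N \<Longrightarrow>
      \<exists>a b. homogeneous a (g c) \<and> homogeneous b (h c) \<and> a + b = int (card (pairs n))"
    "\<And>\<sigma>. (\<Sum>c<N. act \<sigma> (g c) * h c) = (\<Prod>(a, b)\<in>pairs n. var (\<sigma> a) - var b)"
    using separation[OF finite_pairs pairs_subset] by blast
  show ?thesis
  proof (rule that[OF *(1) *(2) *(3)])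
    fix \<sigma> assume "\<sigma> \<in> perms n"
    hence \<sigma>: "\<sigma> permutes {1..n}" by simp
    have "(\<Prod>(a, b)\<in>pairs n. var (\<sigma> a) - var b :: 'k mpoly) = 0" if "\<sigma> \<noteq> id"
    proof -
      obtain i where i: "i \<in> {1..n}" "\<sigma> i > i"
        using permutes_natset_le[OF \<sigma>] \<open>\<sigma> \<noteq> id\<close> by fastforce
      moreover have "\<sigma> i \<in> {1..n}" using permutes_in_image[OF \<sigma>] i by blast
      ultimately have "(i, \<sigma> i) \<in> pairs n" by (auto simp: pairs_def)
      thus ?thesis by (intro prod_zero) (auto intro!: bexI[of _ "(i, \<sigma> i)"])
    qed
    thus "(\<Sum>c<N. act \<sigma> (g c) * h c) = (if \<sigma> = id then vdm n else 0)"
      unfolding *(4) by (auto simp: dprod_def)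
  qed
qed

section \<open>Sums over cosets\<close>

definition perm_grp :: "nat \<Rightarrow> (nat \<Rightarrow> nat) set \<Rightarrow> bool" where
  "perm_grp n G \<longleftrightarrow> G \<subseteq> perms n \<and> id \<in> G \<and> (\<forall>\<sigma>\<in>G. \<forall>\<tau>\<in>G. \<sigma> \<circ> \<tau> \<in> G) \<and> (\<forall>\<sigma>\<in>G. inv' \<sigma> \<in> G)"

lemma perm_grpD:
  assumes "perm_grp n G"
  shows "\<sigma> \<in> G \<Longrightarrow> \<sigma> \<in> perms n" "id \<in> G" "\<sigma> \<in> G \<Longrightarrow> \<tau> \<in> G \<Longrightarrow> \<sigma> \<circ> \<tau> \<in> G"
    "\<sigma> \<in> G \<Longrightarrow> inv' \<sigma> \<in> G" "finite G"
  using assms finite_subset[OF _ finite_perms, of G n] by (auto simp: perm_grp_def simp del: perms_iff)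

lemma perm_grp_trivial: "perm_grp n {id}"
  by (auto simp: perm_grp_def permutes_id)

lemma perms_inv_o:
  "\<sigma> \<in> perms n \<Longrightarrow> \<sigma> \<circ> inv' \<sigma> = id" "\<sigma> \<in> perms n \<Longrightarrow> inv' \<sigma> \<circ> \<sigma> = id"
  "\<sigma> \<in> perms n \<Longrightarrow> \<sigma> \<circ> (inv' \<sigma> \<circ> (\<tau> :: nat \<Rightarrow> nat)) = \<tau>"
  "\<sigma> \<in> perms n \<Longrightarrow> inv' \<sigma> \<circ> (\<sigma> \<circ> (\<tau> :: nat \<Rightarrow> nat)) = \<tau>"
  using permutes_inv_o[of \<sigma> "{1..n}"] by (simp_all flip: comp_assoc)

definition coset :: "(nat \<Rightarrow> nat) set \<Rightarrow> (nat \<Rightarrow> nat) \<Rightarrow> (nat \<Rightarrow> nat) set" where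
  "coset G \<sigma> = (\<circ>) \<sigma> ` G"

text \<open>
  For a function that is constant on the left cosets of \<open>G\<close>, the sum over these cosets. Summing over
  all permutations and dividing by the order of \<open>G\<close> would not do, since that order may vanish in
  the field.
\<close>

definition coset_sum :: "nat \<Rightarrow> (nat \<Rightarrow> nat) set \<Rightarrow> ((nat \<Rightarrow> nat) \<Rightarrow> 'a::comm_monoid_add) \<Rightarrow> 'a" where
  "coset_sum n G F = (\<Sum>X\<in>coset G ` perms n. F (SOME \<sigma>. \<sigma> \<in> X))"

context
  fixes n G assumes G: "perm_grp n G"
begin

lemma coset_absorb:
  assumes "\<sigma> \<in> perms n" "\<tau> \<in> coset G \<sigma>" shows "coset G \<tau> = coset G \<sigma>" "\<tau> \<in> perms n"
proof -
  obtain \<rho> where \<rho>: "\<rho> \<in> G" "\<tau> = \<sigma> \<circ> \<rho>" using assms by (auto simp: coset_def)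
  have "(\<circ>) \<rho> ` G = G"
  proof
    show "(\<circ>) \<rho> ` G \<subseteq> G" using \<rho> perm_grpD(3)[OF G] by auto
    show "G \<subseteq> (\<circ>) \<rho> ` G"
    proof
      fix \<pi> assume "\<pi> \<in> G"
      hence "inv' \<rho> \<circ> \<pi> \<in> G" using \<rho> perm_grpD(3,4)[OF G] by blast
      moreover have "\<pi> = \<rho> \<circ> (inv' \<rho> \<circ> \<pi>)"
        using perms_inv_o(3)[OF perm_grpD(1)[OF G \<rho>(1)], of \<pi>] by (rule sym)
      ultimately show "\<pi> \<in> (\<circ>) \<rho> ` G" by blast
    qed
  qed
  hence "coset G \<tau> = (\<circ>) \<sigma> ` G"
    unfolding coset_def \<rho> by (metis (no_types, lifting) comp_assoc image_cong image_image)
  thus "coset G \<tau> = coset G \<sigma>" by (simp add: coset_def)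
  show "\<tau> \<in> perms n" unfolding \<rho> by (intro perms_comp assms perm_grpD(1)[OF G] \<rho>)
qed

lemma coset_self: "\<sigma> \<in> coset G \<sigma>"
  unfolding coset_def by (rule image_eqI[of _ _ id]) (simp_all add: perm_grpD(2)[OF G])

lemma coset_rep:
  assumes "X \<in> coset G ` perms n"
  shows "(SOME \<sigma>. \<sigma> \<in> X) \<in> X" "(SOME \<sigma>. \<sigma> \<in> X) \<in> perms n" "coset G (SOME \<sigma>. \<sigma> \<in> X) = X"
proof -
  obtain \<sigma> where \<sigma>: "\<sigma> \<in> perms n" "X = coset G \<sigma>" using assms by blast
  have "\<sigma> \<in> X" using coset_self \<sigma> by blast
  thus *: "(SOME \<sigma>. \<sigma> \<in> X) \<in> X" by (rule someI[of "\<lambda>\<sigma>. \<sigma> \<in> X"])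
  thus "(SOME \<sigma>. \<sigma> \<in> X) \<in> perms n" "coset G (SOME \<sigma>. \<sigma> \<in> X) = X"
    using coset_absorb \<sigma> by blast+
qed

lemma coset_sum_invariant:
  assumes F: "\<And>\<sigma> \<tau>. \<sigma> \<in> perms n \<Longrightarrow> \<tau> \<in> G \<Longrightarrow> F (\<sigma> \<circ> \<tau>) = F \<sigma>" and \<rho>: "\<rho> \<in> perms n"
  shows "coset_sum n G (\<lambda>\<sigma>. F (\<rho> \<circ> \<sigma>)) = coset_sum n G F"
proof -
  have const: "F \<sigma> = F \<tau>" if "\<sigma> \<in> perms n" "\<tau> \<in> coset G \<sigma>" for \<sigma> \<tau>
    using that F by (auto simp: coset_def simp del: perms_iff)
  have trans: "(\<circ>) \<pi> ` coset G \<sigma> = coset G (\<pi> \<circ> \<sigma>)" for \<pi> \<sigma>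
    by (simp add: coset_def image_image comp_assoc)
  note r = coset_rep
  show ?thesis
    unfolding coset_sum_def
  proof (rule sum.reindex_bij_witness[where i = "\<lambda>X. (\<circ>) (inv' \<rho>) ` X" and j = "\<lambda>X. (\<circ>) \<rho> ` X"])
    fix X assume X: "X \<in> coset G ` perms n"
    thus "(\<circ>) (inv' \<rho>) ` (\<circ>) \<rho> ` X = X" "(\<circ>) \<rho> ` (\<circ>) (inv' \<rho>) ` X = X"
      by (simp_all only: image_image perms_inv_o(3,4)[OF \<rho>] image_ident)
    show "(\<circ>) \<rho> ` X \<in> coset G ` perms n" "(\<circ>) (inv' \<rho>) ` X \<in> coset G ` perms n"
      using X \<rho> perms_inv[OF \<rho>] by (auto simp: trans simp del: perms_iff intro!: imageI perms_comp)
    have "\<rho> \<circ> (SOME \<sigma>. \<sigma> \<in> X) \<in> (\<circ>) \<rho> ` X" using r(1)[OF X] by blast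
    moreover have Y: "(\<circ>) \<rho> ` X \<in> coset G ` perms n" by fact
    ultimately have "\<rho> \<circ> (SOME \<sigma>. \<sigma> \<in> X) \<in> coset G (SOME \<sigma>. \<sigma> \<in> (\<circ>) \<rho> ` X)"
      using r(3)[OF Y] by simp
    thus "F (SOME \<sigma>. \<sigma> \<in> (\<circ>) \<rho> ` X) = F (\<rho> \<circ> (SOME \<sigma>. \<sigma> \<in> X))"
      using r(2)[OF Y] const by blast
  qed
qed

lemma coset_sum_double: "coset_sum n G (\<lambda>\<sigma>. \<Sum>\<tau>\<in>G. F (\<sigma> \<circ> \<tau>)) = (\<Sum>\<sigma>\<in>perms n. F \<sigma>)"
proof -
  have "(\<Sum>\<sigma>\<in>perms n. F \<sigma>) =
      (\<Sum>X\<in>coset G ` perms n. \<Sum>\<sigma> | \<sigma> \<in> perms n \<and> coset G \<sigma> = X. F \<sigma>)"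
    by (intro sum.group[symmetric] finite_imageI finite_perms) auto
  also have "\<dots> = (\<Sum>X\<in>coset G ` perms n. \<Sum>\<tau>\<in>G. F ((SOME \<sigma>. \<sigma> \<in> X) \<circ> \<tau>))"
  proof (rule sum.cong[OF refl])
    fix X assume X: "X \<in> coset G ` perms n"
    let ?r = "SOME \<sigma>. \<sigma> \<in> X"
    have "{\<sigma>. \<sigma> \<in> perms n \<and> coset G \<sigma> = X} = coset G ?r"
      using coset_rep[OF X] coset_absorb coset_self by blast
    moreover have "inj_on ((\<circ>) ?r) G"
      by (rule inj_on_inverseI[where g = "(\<circ>) (inv' ?r)"])
        (rule perms_inv_o(4)[OF coset_rep(2)[OF X]])
    ultimately show "(\<Sum>\<sigma> | \<sigma> \<in> perms n \<and> coset G \<sigma> = X. F \<sigma>) = (\<Sum>\<tau>\<in>G. F (?r \<circ> \<tau>))"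
      by (simp add: coset_def sum.reindex)
  qed
  finally show ?thesis by (simp add: coset_sum_def)
qed

end

lemma coset_sum_cong:
  assumes "perm_grp n G" "\<And>\<sigma>. \<sigma> \<in> perms n \<Longrightarrow> F \<sigma> = F' \<sigma>"
  shows "coset_sum n G F = coset_sum n G F'"
  unfolding coset_sum_def using coset_rep[OF assms(1)] assms(2) by (intro sum.cong) auto

section \<open>The trace pairing\<close>

text \<open>
  The semi-invariants of the sign character; up to a shift of degrees they will turn out to be the canonical
  module.
\<close>

definition semi :: "nat \<Rightarrow> (nat \<Rightarrow> nat) set \<Rightarrow> 'k::field mpoly set" where
  "semi n G = {t \<in> poly_ring n. \<forall>\<sigma>\<in>G. act \<sigma> t = of_int (sign \<sigma>) * t}"

lemma semi_poly_ring: "t \<in> semi n G \<Longrightarrow> t \<in> poly_ring n"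
  and semi_act: "t \<in> semi n G \<Longrightarrow> \<sigma> \<in> G \<Longrightarrow> act \<sigma> t = of_int (sign \<sigma>) * t"
  by (auto simp: semi_def)

lemma semi_0 [simp]: "0 \<in> semi n G"
  and semi_add: "t \<in> semi n G \<Longrightarrow> t' \<in> semi n G \<Longrightarrow> t + t' \<in> semi n G"
  and semi_diff: "t \<in> semi n G \<Longrightarrow> t' \<in> semi n G \<Longrightarrow> t - t' \<in> semi n G"
  and semi_mult: "r \<in> invariants n G \<Longrightarrow> t \<in> semi n G \<Longrightarrow> r * t \<in> semi n G"
  by (auto simp: semi_def invariants_def act_hom algebra_simps)

lemma semi_hcomp: "t \<in> semi n G \<Longrightarrow> hcomp d t \<in> semi n G"
  using hcomp_mult[of 0 "of_int z" d t for z]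
  by (auto simp: semi_def of_int_eq_const simp flip: hcomp_act)

lemma semi_trivial: "semi n {id} = poly_ring n"
  by (auto simp: semi_def)

text \<open>
  The summand depends only on the coset of \<open>\<sigma>\<close> if \<open>w\<close> is a semi-invariant.
\<close>

definition alt_sum :: "nat \<Rightarrow> (nat \<Rightarrow> nat) set \<Rightarrow> 'k::field mpoly \<Rightarrow> 'k mpoly" where
  "alt_sum n G w = coset_sum n G (\<lambda>\<sigma>. of_int (sign \<sigma>) * act \<sigma> w)"

text \<open>
  The trace from the semi-invariants of \<open>G\<close> to those of the full symmetric group, followed by division by the
  Vandermonde polynomial, of which the latter are the symmetric multiples.
\<close>

definition ctr :: "nat \<Rightarrow> (nat \<Rightarrow> nat) set \<Rightarrow> 'k::field mpoly \<Rightarrow> 'k mpoly" where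
  "ctr n G w = (THE a. vdm n * a = alt_sum n G w)"

definition trace :: "(nat \<Rightarrow> nat) set \<Rightarrow> 'k::field mpoly \<Rightarrow> 'k mpoly" where
  "trace G s = (\<Sum>\<tau>\<in>G. act \<tau> s)"

lemma vdm_neq_0 [simp]: "vdm n \<noteq> 0" by (rule dprod_neq_0) auto

lemma ctr_eqI: "vdm n * a = alt_sum n G w \<Longrightarrow> ctr n G w = a"
  unfolding ctr_def by (rule the_equality) (auto, metis mult_cancel_left vdm_neq_0)

lemma alt_sum_add: "alt_sum n G (v + w) = alt_sum n G v + alt_sum n G w"
  by (simp add: alt_sum_def coset_sum_def act_hom distrib_left sum.distrib)

lemma alt_sum_mult:
  assumes "perm_grp n G" "a \<in> sym_polys n" shows "alt_sum n G (a * w) = a * alt_sum n G w"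
proof -
  have "alt_sum n G (a * w) = coset_sum n G (\<lambda>\<sigma>. a * (of_int (sign \<sigma>) * act \<sigma> w))"
    unfolding alt_sum_def using assms
    by (intro coset_sum_cong) (auto simp: act_hom invariants_act algebra_simps)
  thus ?thesis by (simp add: alt_sum_def coset_sum_def sum_distrib_left)
qed

text \<open>
  Composing with \<open>\<rho>\<close> permutes the cosets and costs the sign of \<open>\<rho>\<close>.
\<close>

lemma alt_sum_alternating:
  assumes G: "perm_grp n G" and w: "w \<in> semi n G" and \<rho>: "\<rho> \<in> perms n"
  shows "act \<rho> (alt_sum n G w) = of_int (sign \<rho>) * alt_sum n G w"
proof -
  let ?F = "\<lambda>\<sigma>. of_int (sign \<sigma>) * act \<sigma> w"
  have "act \<rho> (alt_sum n G w) = coset_sum n G (\<lambda>\<sigma>. act \<rho> (?F \<sigma>))"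
    by (simp add: alt_sum_def coset_sum_def act_hom)
  also have "\<dots> = coset_sum n G (\<lambda>\<sigma>. of_int (sign \<rho>) * ?F (\<rho> \<circ> \<sigma>))"
    using \<rho> by (intro coset_sum_cong G)
      (simp add: act_hom act_comp sign_comp_perms[OF \<rho>] mult.assoc del: perms_iff)
  also have "\<dots> = of_int (sign \<rho>) * coset_sum n G (\<lambda>\<sigma>. ?F (\<rho> \<circ> \<sigma>))"
    by (simp add: coset_sum_def sum_distrib_left)
  also have "coset_sum n G (\<lambda>\<sigma>. ?F (\<rho> \<circ> \<sigma>)) = coset_sum n G ?F"
  proof (rule coset_sum_invariant[OF G _ \<rho>])
    fix \<sigma> \<tau> assume \<sigma>: "\<sigma> \<in> perms n" and \<tau>: "\<tau> \<in> G"
    show "?F (\<sigma> \<circ> \<tau>) = ?F \<sigma>"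
      using sign_comp_perms[OF \<sigma> perm_grpD(1)[OF G \<tau>]] semi_act[OF w \<tau>]
      by (simp add: act_comp act_hom mult.assoc)
  qed
  finally show ?thesis by (simp add: alt_sum_def)
qed

lemma alt_sum_poly_ring:
  assumes "perm_grp n G" "w \<in> poly_ring n" shows "alt_sum n G w \<in> poly_ring n"
  unfolding alt_sum_def coset_sum_def
proof (intro poly_ring_sum)
  fix X assume "X \<in> coset G ` perms n"
  hence "(SOME \<sigma>. \<sigma> \<in> X) \<in> perms n" by (rule coset_rep[OF assms(1)])
  thus "of_int (sign (SOME \<sigma>. \<sigma> \<in> X)) * act (SOME \<sigma>. \<sigma> \<in> X) w \<in> poly_ring n"
    unfolding of_int_eq_const using assms by (intro poly_ring_mult act_poly_ring) auto
qed

lemma homogeneous_alt_sum: "homogeneous d w \<Longrightarrow> homogeneous d (alt_sum n G w)"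
  unfolding alt_sum_def coset_sum_def of_int_eq_const
  by (intro homogeneous_sum homogeneous_mult'[OF homogeneous_const homogeneous_act]) auto

context
  fixes n G and ty :: "'k::field itself"
  assumes G: "perm_grp n G" and char: "CHAR('k) \<noteq> 2"
begin

lemma ctr:
  assumes w: "(w :: 'k mpoly) \<in> semi n G"
  shows "vdm n * ctr n G w = alt_sum n G w" "ctr n G w \<in> sym_polys n"
proof -
  have "vdm n dvd alt_sum n G w"
  proof (rule dprod_dvd[OF order_refl])
    fix i j assume ij: "(i, j) \<in> pairs n"
    hence t: "transpose i j \<in> perms n" by (intro transpose_perms) (auto simp: pairs_def)
    show "subst (glue i j) (alt_sum n G w) = 0"
      using alt_sum_alternating[OF G w t] ij
      by (intro glue_kernel_invariant char) (auto simp: act_eq_subst sign_swap_id pairs_def)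
  qed
  then obtain a where a: "vdm n * a = alt_sum n G w" by (metis dvdE)
  have ctr: "ctr n G w = a" using a by (rule ctr_eqI)
  show "vdm n * ctr n G w = alt_sum n G w" unfolding ctr by (rule a)
  show "ctr n G w \<in> sym_polys n" unfolding ctr
  proof (rule invariantsI)
    have "vdm n * a \<in> poly_ring n"
      unfolding a by (rule alt_sum_poly_ring[OF G semi_poly_ring[OF w]])
    thus "a \<in> poly_ring n"
      by (rule poly_ring_dvd_cofactor[OF dprod_poly_ring[OF pairs_subset]]) simp
    fix \<sigma> assume \<sigma>: "\<sigma> \<in> perms n"
    have "of_int (sign \<sigma>) * (vdm n * act \<sigma> a) = of_int (sign \<sigma>) * (vdm n * a)"
      using alt_sum_alternating[OF G w \<sigma>] act_vdm[OF char \<sigma>]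
      unfolding a[symmetric] act_hom by (simp add: mult.assoc)
    hence "of_int (sign \<sigma>) * (of_int (sign \<sigma>) * (vdm n * act \<sigma> a)) =
        of_int (sign \<sigma>) * (of_int (sign \<sigma>) * (vdm n * a))" by (rule arg_cong)
    thus "act \<sigma> a = a" unfolding of_int_sign_square by simp
  qed
qed

lemma ctr_add:
  assumes "(v :: 'k mpoly) \<in> semi n G" "w \<in> semi n G"
  shows "ctr n G (v + w) = ctr n G v + ctr n G w"
  by (rule ctr_eqI) (simp add: distrib_left ctr assms alt_sum_add)

lemma ctr_0 [simp]: "ctr n G (0 :: 'k mpoly) = 0"
  by (rule ctr_eqI) (simp add: alt_sum_def coset_sum_def act_hom)

lemma ctr_sum:
  assumes "\<And>a. a \<in> A \<Longrightarrow> (f a :: 'k mpoly) \<in> semi n G"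
  shows "ctr n G (sum f A) = (\<Sum>a\<in>A. ctr n G (f a))"
proof -
  have "sum f A \<in> semi n G \<and> ctr n G (sum f A) = (\<Sum>a\<in>A. ctr n G (f a))"
    using assms by (induction A rule: infinite_finite_induct) (auto simp: ctr_add semi_add)
  thus ?thesis ..
qed

lemma ctr_mult:
  assumes "(w :: 'k mpoly) \<in> semi n G" "a \<in> sym_polys n"
  shows "ctr n G (a * w) = a * ctr n G w"
  by (rule ctr_eqI)
    (simp add: alt_sum_mult[OF G assms(2)] ctr(1)[OF assms(1), symmetric] mult.left_commute)

lemma homogeneous_ctr:
  assumes "(w :: 'k mpoly) \<in> semi n G" "homogeneous d w"
  shows "homogeneous (d - int (card (pairs n))) (ctr n G w)"
  using homogeneous_alt_sum[OF assms(2), of n G]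
  unfolding ctr(1)[OF assms(1), symmetric]
  by (intro homogeneous_cofactor[OF homogeneous_dprod]) auto

lemma sym_polys_subset: "sym_polys n \<subseteq> (invariants n G :: 'k mpoly set)"
  using perm_grpD(1)[OF G] by (intro invariants_antimono) blast

lemma trace_invariants:
  assumes "(s :: 'k mpoly) \<in> poly_ring n" shows "trace G s \<in> invariants n G"
proof (rule invariantsI)
  show "trace G s \<in> poly_ring n"
    unfolding trace_def using perm_grpD(1)[OF G] assms
    by (intro poly_ring_sum act_poly_ring) auto
  fix \<sigma> assume \<sigma>: "\<sigma> \<in> G"
  note s = perm_grpD(1)[OF G \<sigma>]
  have "act \<sigma> (trace G s) = (\<Sum>\<tau>\<in>G. act (\<sigma> \<circ> \<tau>) s)"
    by (simp add: trace_def act_hom act_comp)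
  also have "\<dots> = trace G s"
    unfolding trace_def
    by (rule sum.reindex_bij_witness[where i = "(\<circ>) (inv' \<sigma>)" and j = "(\<circ>) \<sigma>"])
      (use \<sigma> perm_grpD(3,4)[OF G] perms_inv_o(3,4)[OF s] in auto)
  finally show "act \<sigma> (trace G s) = trace G s" .
qed

lemma trace_mult:
  assumes "r \<in> invariants n G" shows "trace G (r * s) = r * trace G (s :: 'k mpoly)"
  using assms by (simp add: trace_def act_hom invariants_act sum_distrib_left)

lemma homogeneous_trace: "homogeneous d (s :: 'k mpoly) \<Longrightarrow> homogeneous d (trace G s)"
  unfolding trace_def by (intro homogeneous_sum homogeneous_act)

lemma trace_act:
  assumes "\<sigma> \<in> G" shows "trace G (act \<sigma> s) = trace G (s :: 'k mpoly)"
  unfolding trace_def act_comp[symmetric]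
  by (rule sum.reindex_bij_witness[where i = "\<lambda>\<tau>. \<tau> \<circ> inv' \<sigma>" and j = "\<lambda>\<tau>. \<tau> \<circ> \<sigma>"])
    (use assms perm_grpD(3,4)[OF G] perms_inv_o(1,2)[OF perm_grpD(1)[OF G assms]]
     in \<open>auto simp: comp_assoc\<close>)

end

lemma trace_sum: "trace G (sum f A) = (\<Sum>a\<in>A. trace G (f a))"
  by (simp add: trace_def act_hom sum.swap[of _ A])

lemma alt_sum_trivial: "alt_sum n {id} w = (\<Sum>\<sigma>\<in>perms n. of_int (sign \<sigma>) * act \<sigma> w)"
  using coset_sum_double[OF perm_grp_trivial, of n "\<lambda>\<sigma>. of_int (sign \<sigma>) * act \<sigma> w"]
  by (simp add: alt_sum_def)

text \<open>
  Transitivity of traces: a sum over \<open>G\<close> inside a sum over the cosets of \<open>G\<close> is a sum over all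
  permutations.
\<close>

lemma ctr_trace:
  fixes u :: "'k::field mpoly"
  assumes G: "perm_grp n G" and char: "CHAR('k) \<noteq> 2" and u: "u \<in> semi n G" and s: "s \<in> poly_ring n"
  shows "ctr n G (u * trace G s) = ctr n {id} (u * s)"
proof (rule ctr_eqI)
  have "alt_sum n G (u * trace G s) =
      coset_sum n G (\<lambda>\<sigma>. \<Sum>\<tau>\<in>G. of_int (sign (\<sigma> \<circ> \<tau>)) * act (\<sigma> \<circ> \<tau>) (u * s))"
    unfolding alt_sum_def
  proof (rule coset_sum_cong[OF G])
    fix \<sigma> assume \<sigma>: "\<sigma> \<in> perms n"
    have "of_int (sign (\<sigma> \<circ> \<tau>)) * act (\<sigma> \<circ> \<tau>) (u * s) =
        of_int (sign \<sigma>) * act \<sigma> u * act \<sigma> (act \<tau> s)" if "\<tau> \<in> G" for \<tau>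
      using sign_comp_perms[OF \<sigma> perm_grpD(1)[OF G that]] semi_act[OF u that]
      by (simp add: act_comp act_hom mult.assoc)
    thus "of_int (sign \<sigma>) * act \<sigma> (u * trace G s) =
        (\<Sum>\<tau>\<in>G. of_int (sign (\<sigma> \<circ> \<tau>)) * act (\<sigma> \<circ> \<tau>) (u * s))"
      by (simp add: trace_def act_hom sum_distrib_left mult.assoc)
  qed
  also have "\<dots> = alt_sum n {id} (u * s)"
    unfolding alt_sum_trivial by (rule coset_sum_double[OF G])
  also have "\<dots> = vdm n * ctr n {id} (u * s)"
    using u s by (intro ctr(1)[OF perm_grp_trivial char, symmetric])
      (auto simp: semi_trivial semi_poly_ring)
  finally show "vdm n * ctr n {id} (u * s) = alt_sum n G (u * trace G s)" ..
qed

lemma ctr_act: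
  fixes w :: "'k::field mpoly"
  assumes \<tau>: "\<tau> \<in> perms n" and char: "CHAR('k) \<noteq> 2" and w: "w \<in> poly_ring n"
  shows "ctr n {id} (act \<tau> w) = of_int (sign \<tau>) * ctr n {id} w"
proof (rule ctr_eqI)
  have "alt_sum n {id} (act \<tau> w) =
      (\<Sum>\<sigma>\<in>perms n. of_int (sign \<tau>) * (of_int (sign (\<sigma> \<circ> \<tau>)) * act (\<sigma> \<circ> \<tau>) w))"
    unfolding alt_sum_trivial
    by (intro sum.cong refl) (simp add: sign_comp_perms[OF _ \<tau>] act_comp mult_ac del: perms_iff)
  also have "\<dots> = of_int (sign \<tau>) * (\<Sum>\<sigma>\<in>perms n. of_int (sign (\<sigma> \<circ> \<tau>)) * act (\<sigma> \<circ> \<tau>) w)"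
    by (simp add: sum_distrib_left)
  also have "(\<Sum>\<sigma>\<in>perms n. of_int (sign (\<sigma> \<circ> \<tau>)) * act (\<sigma> \<circ> \<tau>) w) = alt_sum n {id} w"
    unfolding alt_sum_trivial perms_def
    using \<tau> by (intro sum_permutations_compose_right[symmetric]) simp
  also have "\<dots> = vdm n * ctr n {id} w"
    using w by (intro ctr(1)[OF perm_grp_trivial char, symmetric]) (auto simp: semi_trivial)
  finally show "vdm n * (of_int (sign \<tau>) * ctr n {id} w) = alt_sum n {id} (act \<tau> w)"
    by (simp only: mult.left_commute)
qed

section \<open>Linear maps from the invariants to the symmetric polynomials\<close>

text \<open>
  The families \<open>g\<close> and \<open>h\<close> generate \<open>k[x\<^sub>1, \<dots>, x\<^sub>n]\<close> over the symmetric polynomials and behave like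
  dual bases for the form \<open>(s, t) \<mapsto> ctr n {id} (s t)\<close>. The second condition is the reason for the
  third and is used on its own as well.
\<close>

definition dual_family :: "nat \<Rightarrow> nat \<Rightarrow> (nat \<Rightarrow> 'k::field mpoly) \<Rightarrow> (nat \<Rightarrow> 'k mpoly) \<Rightarrow> bool" where
  "dual_family n N g h \<longleftrightarrow>
    (\<forall>c<N. g c \<in> poly_ring n \<and> h c \<in> poly_ring n \<and>
      (\<exists>a b. homogeneous a (g c) \<and> homogeneous b (h c) \<and> a + b = int (card (pairs n)))) \<and>
    (\<forall>\<sigma>\<in>perms n. (\<Sum>c<N. act \<sigma> (g c) * h c) = (if \<sigma> = id then vdm n else 0)) \<and>
    (\<forall>s\<in>poly_ring n. s = (\<Sum>c<N. ctr n {id} (g c * s) * h c))"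

lemma dual_familyD:
  assumes "dual_family n N g h"
  shows "\<And>c. c < N \<Longrightarrow> g c \<in> poly_ring n" "\<And>c. c < N \<Longrightarrow> h c \<in> poly_ring n"
    "\<And>c. c < N \<Longrightarrow>
      \<exists>a b. homogeneous a (g c) \<and> homogeneous b (h c) \<and> a + b = int (card (pairs n))"
    "\<And>s. s \<in> poly_ring n \<Longrightarrow> s = (\<Sum>c<N. ctr n {id} (g c * s) * h c)"
    "\<And>\<sigma>. \<sigma> \<in> perms n \<Longrightarrow> (\<Sum>c<N. act \<sigma> (g c) * h c) = (if \<sigma> = id then vdm n else 0)"
  using assms unfolding dual_family_def by blast+

lemma dual_family_exists:
  assumes char: "CHAR('k::field) \<noteq> 2"
  shows "\<exists>N g h. dual_family n N g (h :: nat \<Rightarrow> 'k mpoly)"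
proof -
  obtain N :: nat and g h :: "nat \<Rightarrow> 'k mpoly" where *:
    "\<And>c. c < N \<Longrightarrow> g c \<in> poly_ring n" "\<And>c. c < N \<Longrightarrow> h c \<in> poly_ring n"
    "\<And>c. c < N \<Longrightarrow>
      \<exists>a b. homogeneous a (g c) \<and> homogeneous b (h c) \<and> a + b = int (card (pairs n))"
    "\<And>\<sigma>. \<sigma> \<in> perms n \<Longrightarrow> (\<Sum>c<N. act \<sigma> (g c) * h c) = (if \<sigma> = id then vdm n else 0)"
    by (rule dual_bases[where 'k = 'k and n = n]) blast
  have "s = (\<Sum>c<N. ctr n {id} (g c * s) * h c)" if s: "s \<in> poly_ring n" for s
  proof -
    \<comment> \<open>Interchanging the sums, all permutations but the identity drop out.\<close>
    have "vdm n * (\<Sum>c<N. ctr n {id} (g c * s) * h c) = (\<Sum>c<N. alt_sum n {id} (g c * s) * h c)"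
      using * s by (simp add: sum_distrib_left semi_trivial poly_ring_mult
          flip: mult.assoc ctr(1)[OF perm_grp_trivial char])
    also have "\<dots> = (\<Sum>\<sigma>\<in>perms n. of_int (sign \<sigma>) * act \<sigma> s * (\<Sum>c<N. act \<sigma> (g c) * h c))"
      by (simp add: alt_sum_trivial sum_distrib_right sum_distrib_left act_hom mult_ac
          sum.swap[of _ "{..<N}"])
    also have "\<dots> = (\<Sum>\<sigma>\<in>perms n. if \<sigma> = id then s * vdm n else 0)"
      by (intro sum.cong refl) (auto simp: *(4) simp del: perms_iff)
    also have "\<dots> = vdm n * s"
      using finite_perms[of n] by (simp add: permutes_id mult.commute)
    finally show "s = (\<Sum>c<N. ctr n {id} (g c * s) * h c)" by simp
  qed
  hence "dual_family n N g h" using * unfolding dual_family_def by blast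
  thus ?thesis by blast
qed

context
  fixes n G and ty :: "'k::field itself"
  assumes G: "perm_grp n G" and char: "CHAR('k) \<noteq> 2"
begin

lemma trace_form_nondegenerate:
  assumes u: "(u :: 'k mpoly) \<in> poly_ring n"
    and 0: "\<And>s. s \<in> poly_ring n \<Longrightarrow> ctr n {id} (u * s) = 0"
  shows "u = 0"
proof -
  obtain N and g h :: "nat \<Rightarrow> 'k mpoly" where d: "dual_family n N g h"
    using dual_family_exists[OF char] by blast
  note * = dual_familyD(1,4)[OF d]
  have "u = (\<Sum>c<N. ctr n {id} (u * g c) * h c)"
    using *(2)[OF u] by (simp add: mult.commute)
  also have "\<dots> = 0" using 0 *(1) by simp
  finally show ?thesis .
qed

lemma ctr_determines:
  assumes u: "(u :: 'k mpoly) \<in> semi n G"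
    and 0: "\<And>r. r \<in> invariants n G \<Longrightarrow> ctr n G (u * r) = 0"
  shows "u = 0"
proof (rule trace_form_nondegenerate)
  fix s :: "'k mpoly" assume s: "s \<in> poly_ring n"
  show "ctr n {id} (u * s) = 0"
    using 0[OF trace_invariants[OF G char s]] ctr_trace[OF G char u s] by simp
qed (use u in \<open>simp add: semi_poly_ring\<close>)

text \<open>
  The Vandermonde polynomial is a combination of traces: apply \<open>\<Sum>\<^bsub>\<sigma> \<in> G\<^esub>\<close> to the second condition of
  \<open>dual_family\<close>.
\<close>

lemma trace_nonzero: "\<exists>s\<in>poly_ring n. trace G s \<noteq> (0 :: 'k mpoly)"
proof (rule ccontr)
  assume *: "\<not> ?thesis"
  obtain N and g h :: "nat \<Rightarrow> 'k mpoly" where d: "dual_family n N g h"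
    using dual_family_exists[OF char] by blast
  note g = dual_familyD(1,5)[OF d]
  have "(\<Sum>c<N. trace G (g c) * h c) = (\<Sum>\<sigma>\<in>G. \<Sum>c<N. act \<sigma> (g c) * h c)"
    by (simp add: trace_def sum_distrib_right sum.swap[of _ G])
  also have "\<dots> = (\<Sum>\<sigma>\<in>G. if \<sigma> = id then vdm n else 0)"
    using perm_grpD(1)[OF G] by (intro sum.cong refl g(2))
  also have "\<dots> = vdm n" using perm_grpD(2,5)[OF G] by simp
  finally show False using * g(1) by (auto simp: vdm_neq_0)
qed

text \<open>
  On a trace the map is forced to be \<open>tr s \<mapsto> \<Sum>\<^sub>c ctr(g\<^sub>c s) \<phi>(tr h\<^sub>c) = ctr(u s)\<close> with
  \<open>u = \<Sum>\<^sub>c \<phi>(tr h\<^sub>c) g\<^sub>c\<close>, by the expansion of \<open>s\<close> in dual bases. As the trace does not change if \<open>s\<close>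
  is permuted by \<open>G\<close>, nondegeneracy makes \<open>u\<close> a semi-invariant. The traces need not exhaust the
  invariants, but they contain every \<open>a r\<close> for a fixed nonzero symmetric \<open>a\<close>, which is enough
  because the symmetric polynomials form a domain.
\<close>

theorem linear_maps_to_sym:
  fixes \<phi> :: "'k mpoly \<Rightarrow> 'k mpoly"
  assumes \<phi>_sym: "\<And>r. r \<in> invariants n G \<Longrightarrow> \<phi> r \<in> sym_polys n"
    and \<phi>_add: "\<And>r r'. r \<in> invariants n G \<Longrightarrow> r' \<in> invariants n G \<Longrightarrow> \<phi> (r + r') = \<phi> r + \<phi> r'"
    and \<phi>_mult: "\<And>a r. a \<in> sym_polys n \<Longrightarrow> r \<in> invariants n G \<Longrightarrow> \<phi> (a * r) = a * \<phi> r"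
    and \<phi>_homogeneous: "\<And>m r. r \<in> invariants n G \<Longrightarrow> homogeneous m r \<Longrightarrow> homogeneous (m + \<delta>) (\<phi> r)"
  shows "\<exists>u\<in>semi n G. homogeneous (\<delta> + int (card (pairs n))) u \<and>
    (\<forall>r\<in>invariants n G. \<phi> r = ctr n G (u * r))"
proof -
  note tr = trace_invariants[OF G char] and sub = sym_polys_subset[OF G char]
  note triv = perm_grp_trivial[of n]
  obtain N and g h :: "nat \<Rightarrow> 'k mpoly" where d: "dual_family n N g h"
    using dual_family_exists[OF char] by blast
  note g = dual_familyD(1)[OF d] and h = dual_familyD(2)[OF d]
    and gh = dual_familyD(3)[OF d] and exp = dual_familyD(4)[OF d]
  have ctr_sym: "ctr n {id} s \<in> sym_polys n" if "s \<in> poly_ring n" for s :: "'k mpoly"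
    using ctr(2)[OF triv char] that by (simp add: semi_trivial)
  have \<phi>_sum: "sum f A \<in> invariants n G \<and> \<phi> (sum f A) = (\<Sum>a\<in>A. \<phi> (f a))"
    if "\<And>a. a \<in> A \<Longrightarrow> f a \<in> invariants n G" for f and A :: "nat set"
  proof -
    have "\<phi> 0 = 0" using \<phi>_add[of 0 0] unfolding add_0_right by (metis add_cancel_right_right invariants_0)
    thus ?thesis using that
      by (induction A rule: infinite_finite_induct) (auto simp: \<phi>_add invariants_add)
  qed
  define u where "u = (\<Sum>c<N. \<phi> (trace G (h c)) * g c)"
  have \<phi>h: "\<phi> (trace G (h c)) \<in> sym_polys n" if "c < N" for c
    using that h by (intro \<phi>_sym tr)
  have u_ring: "u \<in> poly_ring n"
    unfolding u_def using g invariants_poly_ring[OF \<phi>h] by (intro poly_ring_sum poly_ring_mult) auto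
  have u_hom: "homogeneous (\<delta> + int (card (pairs n))) u"
    unfolding u_def
  proof (rule homogeneous_sum)
    fix c assume "c \<in> {..<N}"
    hence c: "c < N" by simp
    obtain a b where ab: "homogeneous a (g c)" "homogeneous b (h c)" "a + b = int (card (pairs n))"
      using gh[OF c] by blast
    have "homogeneous (b + \<delta>) (\<phi> (trace G (h c)))"
      by (rule \<phi>_homogeneous[OF tr[OF h[OF c]] homogeneous_trace[OF G char ab(2)]])
    thus "homogeneous (\<delta> + int (card (pairs n))) (\<phi> (trace G (h c)) * g c)"
      using ab by (intro homogeneous_mult'[of "b + \<delta>" _ a]) auto
  qed
  have \<phi>_trace: "\<phi> (trace G s) = ctr n {id} (u * s)" if s: "s \<in> poly_ring n" for s
  proof -
    have a: "ctr n {id} (g c * s) \<in> sym_polys n" if "c < N" for c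
      using that g s by (intro ctr_sym) auto
    have "\<phi> (trace G s) = \<phi> (\<Sum>c<N. trace G (ctr n {id} (g c * s) * h c))"
      by (subst exp[OF s]) (simp add: trace_sum)
    also have "\<dots> = \<phi> (\<Sum>c<N. ctr n {id} (g c * s) * trace G (h c))"
      using a sub by (intro arg_cong[of _ _ \<phi>] sum.cong refl trace_mult[OF G char]) auto
    also have "\<dots> = (\<Sum>c<N. \<phi> (ctr n {id} (g c * s) * trace G (h c)))"
      using a sub tr h by (intro conjunct2[OF \<phi>_sum] invariants_mult) auto
    also have "\<dots> = (\<Sum>c<N. ctr n {id} (g c * s) * \<phi> (trace G (h c)))"
      using a tr h by (intro sum.cong refl \<phi>_mult) auto
    also have "\<dots> = (\<Sum>c<N. ctr n {id} (\<phi> (trace G (h c)) * (g c * s)))"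
    proof (intro sum.cong refl)
      fix c assume "c \<in> {..<N}"
      hence "ctr n {id} (\<phi> (trace G (h c)) * (g c * s)) = \<phi> (trace G (h c)) * ctr n {id} (g c * s)"
        using g s \<phi>h by (intro ctr_mult[OF triv char]) (auto simp: semi_trivial poly_ring_mult)
      thus "ctr n {id} (g c * s) * \<phi> (trace G (h c)) = ctr n {id} (\<phi> (trace G (h c)) * (g c * s))"
        by (simp only: mult.commute)
    qed
    also have "\<dots> = ctr n {id} (\<Sum>c<N. \<phi> (trace G (h c)) * (g c * s))"
      using g s invariants_poly_ring[OF \<phi>h] by (intro ctr_sum[OF triv char, symmetric])
        (auto simp: semi_trivial intro!: poly_ring_mult)
    also have "\<dots> = ctr n {id} (u * s)" by (simp add: u_def sum_distrib_right mult.assoc)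
    finally show ?thesis .
  qed
  have u_semi: "u \<in> semi n G"
    unfolding semi_def
  proof (intro CollectI conjI ballI u_ring)
    fix \<tau> assume \<tau>: "\<tau> \<in> G"
    note t = perm_grpD(1)[OF G \<tau>]
    have t': "\<tau> permutes {1..n}" "inv' \<tau> permutes {1..n}"
      using t perms_inv[OF t] by auto
    have inv\<tau>: "inv' \<tau> \<in> G" using perm_grpD(4)[OF G \<tau>] .
    have "act \<tau> u - of_int (sign \<tau>) * u = 0"
    proof (rule trace_form_nondegenerate)
      have su: "of_int (sign \<tau>) * u \<in> poly_ring n"
        unfolding of_int_eq_const using u_ring by auto
      thus "act \<tau> u - of_int (sign \<tau>) * u \<in> poly_ring n"
        using u_ring t' by (intro poly_ring_diff act_poly_ring)
      fix s :: "'k mpoly" assume s: "s \<in> poly_ring n"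
      have s': "act (inv' \<tau>) s \<in> poly_ring n" using s t' by (intro act_poly_ring)
      have "ctr n {id} (act \<tau> u * s) = ctr n {id} (act \<tau> (u * act (inv' \<tau>) s))"
        using t' by (simp add: act_hom act_inv)
      also have "\<dots> = of_int (sign \<tau>) * ctr n {id} (u * act (inv' \<tau>) s)"
        using u_ring s' by (intro ctr_act t char) auto
      also have "ctr n {id} (u * act (inv' \<tau>) s) = ctr n {id} (u * s)"
        using \<phi>_trace[OF s'] \<phi>_trace[OF s] trace_act[OF G char inv\<tau>, of s] by simp
      also have "of_int (sign \<tau>) * ctr n {id} (u * s) = ctr n {id} (of_int (sign \<tau>) * (u * s))"
        unfolding of_int_eq_const using u_ring s
        by (intro ctr_mult[OF triv char, symmetric]) (auto simp: semi_trivial)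
      finally have "ctr n {id} (act \<tau> u * s) = ctr n {id} (of_int (sign \<tau>) * u * s)"
        by (simp only: mult.assoc)
      moreover have "ctr n {id} (act \<tau> u * s) = ctr n {id} ((act \<tau> u - of_int (sign \<tau>) * u) * s)
          + ctr n {id} (of_int (sign \<tau>) * u * s)"
        using u_ring su s t'
        by (subst ctr_add[OF triv char, symmetric])
          (auto simp: semi_trivial algebra_simps intro!: poly_ring_mult poly_ring_diff act_poly_ring)
      ultimately show "ctr n {id} ((act \<tau> u - of_int (sign \<tau>) * u) * s) = 0" by simp
    qed
    thus "act \<tau> u = of_int (sign \<tau>) * u" by simp
  qed
  have "\<phi> r = ctr n G (u * r)" if r: "r \<in> invariants n G" for r
  proof -
    obtain s0 :: "'k mpoly" where s0: "s0 \<in> poly_ring n" "trace G s0 \<noteq> 0"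
      using trace_nonzero by blast
    \<comment> \<open>The norm of a nonzero trace is symmetric, and a multiple of that trace by an invariant.\<close>
    define a where "a = (\<Prod>\<sigma>\<in>perms n. act \<sigma> (trace G s0))"
    have tr0: "trace G s0 \<in> invariants n G" by (rule tr[OF s0(1)])
    have a_sym: "a \<in> sym_polys n"
    proof (rule invariantsI)
      show "a \<in> poly_ring n"
        unfolding a_def using invariants_poly_ring[OF tr0]
        by (intro poly_ring_prod act_poly_ring) auto
      fix \<rho> assume \<rho>: "\<rho> \<in> perms n"
      have "act \<rho> a = (\<Prod>\<sigma>\<in>perms n. act (\<rho> \<circ> \<sigma>) (trace G s0))"
        by (simp add: a_def act_hom act_comp)
      also have "\<dots> = a"
        unfolding a_def
        by (rule prod.reindex_bij_witness[where i = "(\<circ>) (inv' \<rho>)" and j = "(\<circ>) \<rho>"])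
          (use \<rho> perms_comp perms_inv perms_inv_o(3,4)[OF \<rho>] in \<open>auto simp del: perms_iff\<close>)
      finally show "act \<rho> a = a" .
    qed
    have a0: "a \<noteq> 0"
      using s0 finite_perms[of n] by (auto simp: a_def prod_zero_iff act_eq_0_iff)
    have "id \<in> perms n" by (simp add: permutes_id)
    hence "a = trace G s0 * (\<Prod>\<sigma>\<in>perms n - {id}. act \<sigma> (trace G s0))"
      unfolding a_def by (subst prod.remove[OF finite_perms, where x = id]) (simp_all only: act_id)
    then obtain c where c: "a = trace G s0 * c" ..
    have c_inv: "c \<in> invariants n G"
    proof (rule invariants_cofactor[OF tr0 _ s0(2)])
      show "trace G s0 * c \<in> invariants n G" unfolding c[symmetric] using a_sym sub by blast
    qed
    have crs: "c * r * s0 \<in> poly_ring n"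
      using invariants_poly_ring[OF c_inv] invariants_poly_ring[OF r] s0 by auto
    have ar: "a * r = trace G (c * r * s0)"
      using trace_mult[OF G char invariants_mult[OF c_inv r], of s0] by (simp add: c mult_ac)
    have "a * \<phi> r = \<phi> (a * r)" using a_sym r by (simp add: \<phi>_mult)
    also have "\<dots> = ctr n {id} (u * (c * r * s0))" unfolding ar by (rule \<phi>_trace[OF crs])
    also have "\<dots> = ctr n G (u * (a * r))"
      unfolding ar by (rule ctr_trace[OF G char u_semi crs, symmetric])
    also have "\<dots> = ctr n G (a * (r * u))" by (simp add: mult_ac)
    also have "\<dots> = a * ctr n G (r * u)"
      using r u_semi a_sym by (intro ctr_mult[OF G char] semi_mult)
    finally show ?thesis using a0 by (simp add: mult.commute)
  qed
  thus ?thesis using u_semi u_hom by blast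
qed

end

section \<open>Graded modules\<close>

definition closed_gm :: "'k::field mpoly set \<Rightarrow> ('k mpoly, 'm) graded_module \<Rightarrow> bool" where
  "closed_gm R M \<longleftrightarrow>
     (\<forall>d. \<forall>x\<in>gcomp M d. \<forall>y\<in>gcomp M d. gadd M d x y \<in> gcomp M d) \<and>
     (\<forall>e d. \<forall>r\<in>R. \<forall>x\<in>gcomp M d. homogeneous e r \<longrightarrow> gscale M e d r x \<in> gcomp M (e + d))"

lemma closed_gmD:
  assumes "closed_gm R M"
  shows "x \<in> gcomp M d \<Longrightarrow> y \<in> gcomp M d \<Longrightarrow> gadd M d x y \<in> gcomp M d"
    "r \<in> R \<Longrightarrow> homogeneous e r \<Longrightarrow> x \<in> gcomp M d \<Longrightarrow> gscale M e d r x \<in> gcomp M (e + d)"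
  using assms unfolding closed_gm_def by blast+

lemma graded_isoI:
  assumes "\<And>d. bij_betw (f d) (gcomp M d) (gcomp N d)"
    "\<And>d x y. x \<in> gcomp M d \<Longrightarrow> y \<in> gcomp M d \<Longrightarrow> f d (gadd M d x y) = gadd N d (f d x) (f d y)"
    "\<And>e d r x. r \<in> R \<Longrightarrow> x \<in> gcomp M d \<Longrightarrow> homogeneous e r \<Longrightarrow>
       f (e + d) (gscale M e d r x) = gscale N e d r (f d x)"
  shows "graded_iso R M N"
  unfolding graded_iso_def using assms by (intro exI[of _ f]) blast

lemma graded_isoE:
  assumes "graded_iso R M N"
  obtains f where "\<And>d. bij_betw (f d) (gcomp M d) (gcomp N d)"
    "\<And>d x y. x \<in> gcomp M d \<Longrightarrow> y \<in> gcomp M d \<Longrightarrow> f d (gadd M d x y) = gadd N d (f d x) (f d y)"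
    "\<And>e d r x. r \<in> R \<Longrightarrow> x \<in> gcomp M d \<Longrightarrow> homogeneous e r \<Longrightarrow>
       f (e + d) (gscale M e d r x) = gscale N e d r (f d x)"
  using assms unfolding graded_iso_def by blast

lemma graded_iso_refl: "graded_iso R M M"
  by (rule graded_isoI[where f = "\<lambda>_ x. x"]) (auto simp: bij_betw_def inj_on_def)

lemma graded_iso_trans:
  assumes "graded_iso R M N" "graded_iso R N P" shows "graded_iso R M P"
proof -
  obtain f where f: "\<And>d. bij_betw (f d) (gcomp M d) (gcomp N d)"
    "\<And>d x y. x \<in> gcomp M d \<Longrightarrow> y \<in> gcomp M d \<Longrightarrow> f d (gadd M d x y) = gadd N d (f d x) (f d y)"
    "\<And>e d r x. r \<in> R \<Longrightarrow> x \<in> gcomp M d \<Longrightarrow> homogeneous e r \<Longrightarrow>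
       f (e + d) (gscale M e d r x) = gscale N e d r (f d x)"
    by (rule graded_isoE[OF assms(1)]) blast
  obtain g where g: "\<And>d. bij_betw (g d) (gcomp N d) (gcomp P d)"
    "\<And>d x y. x \<in> gcomp N d \<Longrightarrow> y \<in> gcomp N d \<Longrightarrow> g d (gadd N d x y) = gadd P d (g d x) (g d y)"
    "\<And>e d r x. r \<in> R \<Longrightarrow> x \<in> gcomp N d \<Longrightarrow> homogeneous e r \<Longrightarrow>
       g (e + d) (gscale N e d r x) = gscale P e d r (g d x)"
    by (rule graded_isoE[OF assms(2)]) blast
  have mem: "f d x \<in> gcomp N d" if "x \<in> gcomp M d" for d x
    using f(1) that by (rule bij_betw_apply)
  show ?thesis
  proof (rule graded_isoI[where f = "\<lambda>d. g d \<circ> f d"])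
    show "bij_betw (g d \<circ> f d) (gcomp M d) (gcomp P d)" for d
      using f(1) g(1) by (rule bij_betw_trans)
  qed (simp_all add: f g mem)
qed

lemma graded_iso_sym:
  assumes "closed_gm R M" "graded_iso R M N" shows "graded_iso R N M"
proof -
  obtain f where f: "\<And>d. bij_betw (f d) (gcomp M d) (gcomp N d)"
    "\<And>d x y. x \<in> gcomp M d \<Longrightarrow> y \<in> gcomp M d \<Longrightarrow> f d (gadd M d x y) = gadd N d (f d x) (f d y)"
    "\<And>e d r x. r \<in> R \<Longrightarrow> x \<in> gcomp M d \<Longrightarrow> homogeneous e r \<Longrightarrow>
       f (e + d) (gscale M e d r x) = gscale N e d r (f d x)"
    by (rule graded_isoE[OF assms(2)]) blast
  define g where "g d = inv_into (gcomp M d) (f d)" for d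
  have fg: "f d (g d y) = y" if "y \<in> gcomp N d" for d y
    unfolding g_def using f(1) that by (rule bij_betw_inv_into_right)
  have gf: "g d (f d x) = x" if "x \<in> gcomp M d" for d x
    unfolding g_def using f(1) that by (rule bij_betw_inv_into_left)
  have gb: "bij_betw (g d) (gcomp N d) (gcomp M d)" for d
    unfolding g_def using f(1) by (rule bij_betw_inv_into)
  have mem: "g d y \<in> gcomp M d" if "y \<in> gcomp N d" for d y
    using gb that by (rule bij_betw_apply)
  show ?thesis
  proof (rule graded_isoI[where f = g])
    fix d x y assume "x \<in> gcomp N d" "y \<in> gcomp N d"
    thus "g d (gadd N d x y) = gadd M d (g d x) (g d y)"
      using gf[OF closed_gmD(1)[OF assms(1) mem mem], of x d y] by (simp add: f fg mem)
  next
    fix e d r x assume "r \<in> R" "x \<in> gcomp N d" "homogeneous e r"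
    thus "g (e + d) (gscale N e d r x) = gscale M e d r (g d x)"
      using gf[OF closed_gmD(2)[OF assms(1) _ _ mem], of r e x d] by (simp add: f fg mem)
  qed (rule gb)
qed

definition qmod :: "(int \<Rightarrow> 'a::ab_group_add set) \<Rightarrow> (int \<Rightarrow> 'a set) \<Rightarrow> ('r \<Rightarrow> 'a \<Rightarrow> 'a) \<Rightarrow>
    ('r, 'a set) graded_module" where
  "qmod Z B sc =
     \<lparr> gcomp = (\<lambda>d. (\<lambda>z. z +o B d) ` Z d),
       gadd = (\<lambda>d X Y. X + Y),
       gscale = (\<lambda>e d r X. sc r ` X + B (e + d)) \<rparr>"

text \<open>
  The dual of \<open>Z/B\<close>, realised by the functionals on \<open>Z\<close> that vanish on \<open>B\<close>; this spares the handling of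
  cosets.
\<close>

definition qdual :: "(int \<Rightarrow> 'a::ab_group_add set) \<Rightarrow> (int \<Rightarrow> 'a set) \<Rightarrow> ('k::field mpoly \<Rightarrow> 'a \<Rightarrow> 'a) \<Rightarrow>
    ('k mpoly, 'a \<Rightarrow> 'k) graded_module" where
  "qdual Z B sc =
     \<lparr> gcomp = (\<lambda>d. {\<mu> \<in> extensional (Z (- d)).
          (\<forall>x\<in>Z (- d). \<forall>y\<in>Z (- d). \<mu> (x + y) = \<mu> x + \<mu> y) \<and>
          (\<forall>c. \<forall>x\<in>Z (- d). \<mu> (sc (const c) x) = c * \<mu> x) \<and>
          (\<forall>x\<in>B (- d). \<mu> x = 0)}),
       gadd = (\<lambda>d \<mu> \<nu>. \<lambda>x\<in>Z (- d). \<mu> x + \<nu> x),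
       gscale = (\<lambda>e d r \<mu>. \<lambda>x\<in>Z (- (e + d)). \<mu> (sc r x)) \<rparr>"

lemma qdual_memD:
  assumes "\<mu> \<in> gcomp (qdual Z B sc) d"
  shows "\<mu> \<in> extensional (Z (- d))"
    "x \<in> Z (- d) \<Longrightarrow> y \<in> Z (- d) \<Longrightarrow> \<mu> (x + y) = \<mu> x + \<mu> y"
    "x \<in> Z (- d) \<Longrightarrow> \<mu> (sc (const c) x) = c * \<mu> x"
    "x \<in> B (- d) \<Longrightarrow> \<mu> x = 0"
  using assms by (auto simp: qdual_def)

lemma qdual_memI:
  assumes "\<mu> \<in> extensional (Z (- d))"
    "\<And>x y. x \<in> Z (- d) \<Longrightarrow> y \<in> Z (- d) \<Longrightarrow> \<mu> (x + y) = \<mu> x + \<mu> y"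
    "\<And>c x. x \<in> Z (- d) \<Longrightarrow> \<mu> (sc (const c) x) = c * \<mu> x"
    "\<And>x. x \<in> B (- d) \<Longrightarrow> \<mu> x = 0"
  shows "\<mu> \<in> gcomp (qdual Z B sc) d"
  using assms by (auto simp: qdual_def)

lemma cech_cohomology_eq_qmod:
  "cech_cohomology R fs i = qmod (cech_cocycles R fs i) (cech_coboundaries R fs i)
     (\<lambda>r z I. Fraction_Field.Fract r 1 * z I)"
  by (simp add: cech_cohomology_def qmod_def)

locale graded_quotient =
  fixes R :: "'k::field mpoly set" and Z B :: "int \<Rightarrow> 'a::ab_group_add set"
    and sc :: "'k mpoly \<Rightarrow> 'a \<Rightarrow> 'a"
  assumes Z_add: "x \<in> Z d \<Longrightarrow> y \<in> Z d \<Longrightarrow> x + y \<in> Z d"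
    and B_0: "0 \<in> B d"
    and B_diff: "x \<in> B d \<Longrightarrow> y \<in> B d \<Longrightarrow> x - y \<in> B d"
    and B_Z: "x \<in> B d \<Longrightarrow> x \<in> Z d"
    and Z_diff: "x \<in> Z d \<Longrightarrow> y \<in> Z d \<Longrightarrow> x - y \<in> Z d"
    and sc_add: "sc r (x + y) = sc r x + sc r y"
    and sc_sc: "sc r (sc s x) = sc (r * s) x"
    and sc_Z: "r \<in> R \<Longrightarrow> homogeneous e r \<Longrightarrow> x \<in> Z d \<Longrightarrow> sc r x \<in> Z (e + d)"
    and sc_B: "r \<in> R \<Longrightarrow> homogeneous e r \<Longrightarrow> x \<in> B d \<Longrightarrow> sc r x \<in> B (e + d)"
    and const_R: "const c \<in> R"
begin

lemma B_add: "x \<in> B d \<Longrightarrow> y \<in> B d \<Longrightarrow> x + y \<in> B d"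
  using B_diff[of x d "0 - y"] B_diff[OF B_0, of y d] by simp

lemma coset_eq: "x +o B d = y +o B d \<longleftrightarrow> x - y \<in> B d"
proof
  assume "x +o B d = y +o B d"
  moreover have "x \<in> x +o B d" using B_0 by (auto simp: elt_set_plus_def intro!: bexI[of _ 0])
  ultimately show "x - y \<in> B d" by (auto simp: elt_set_plus_def)
next
  assume xy: "x - y \<in> B d"
  hence yx: "y - x \<in> B d" using B_diff[OF B_0 xy] by simp
  have "u +o B d \<subseteq> v +o B d" if "u - v \<in> B d" for u v
  proof
    fix z assume "z \<in> u +o B d"
    then obtain b where b: "b \<in> B d" "z = u + b" by (auto simp: elt_set_plus_def)
    hence "z = v + ((u - v) + b)" by simp
    thus "z \<in> v +o B d" using B_add[OF that b(1)] unfolding elt_set_plus_def by blast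
  qed
  thus "x +o B d = y +o B d" using xy yx by blast
qed

lemma coset_add: "(x +o B d) + (y +o B d) = (x + y) +o B d"
proof
  show "(x +o B d) + (y +o B d) \<subseteq> (x + y) +o B d"
  proof
    fix z assume "z \<in> (x +o B d) + (y +o B d)"
    then obtain b c where "b \<in> B d" "c \<in> B d" "z = (x + y) + (b + c)"
      by (auto simp: elt_set_plus_def set_plus_def algebra_simps)
    thus "z \<in> (x + y) +o B d" using B_add by (auto simp: elt_set_plus_def)
  qed
  show "(x + y) +o B d \<subseteq> (x +o B d) + (y +o B d)"
  proof
    fix z assume "z \<in> (x + y) +o B d"
    then obtain b where b: "b \<in> B d" "z = (x + b) + (y + 0)"
      by (auto simp: elt_set_plus_def algebra_simps)
    have "x + b \<in> x +o B d" "y + 0 \<in> y +o B d" using b B_0 by (auto simp: elt_set_plus_def)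
    thus "z \<in> (x +o B d) + (y +o B d)" unfolding b(2) by (rule set_plus_intro)
  qed
qed

lemma coset_scale:
  assumes "r \<in> R" "homogeneous e r"
  shows "sc r ` (x +o B d) + B (e + d) = sc r x +o B (e + d)"
proof
  show "sc r ` (x +o B d) + B (e + d) \<subseteq> sc r x +o B (e + d)"
  proof
    fix z assume "z \<in> sc r ` (x +o B d) + B (e + d)"
    then obtain b c where *: "b \<in> B d" "c \<in> B (e + d)" "z = sc r x + (sc r b + c)"
      by (auto simp: elt_set_plus_def set_plus_def sc_add algebra_simps)
    have "sc r b + c \<in> B (e + d)" using assms * by (intro B_add sc_B)
    thus "z \<in> sc r x +o B (e + d)" using * by (auto simp: elt_set_plus_def)
  qed
  show "sc r x +o B (e + d) \<subseteq> sc r ` (x +o B d) + B (e + d)"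
  proof
    fix z assume "z \<in> sc r x +o B (e + d)"
    then obtain b where b: "b \<in> B (e + d)" "z = sc r x + b" by (auto simp: elt_set_plus_def)
    have "x \<in> x +o B d" using B_0 by (auto simp: elt_set_plus_def intro!: bexI[of _ 0])
    thus "z \<in> sc r ` (x +o B d) + B (e + d)" unfolding b(2) using b(1) by (intro set_plus_intro imageI)
  qed
qed

lemma sc_commute: "sc r (sc s x) = sc s (sc r x)"
  by (simp add: sc_sc mult.commute)

lemma sc_const_Z: "x \<in> Z d \<Longrightarrow> sc (const c) x \<in> Z d"
  using sc_Z[OF const_R homogeneous_const, of x d c] by simp

lemma minus_degree: "r \<in> R \<Longrightarrow> homogeneous e r \<Longrightarrow> x \<in> Z (- (e + d)) \<Longrightarrow> sc r x \<in> Z (- d)"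
  "r \<in> R \<Longrightarrow> homogeneous e r \<Longrightarrow> x \<in> B (- (e + d)) \<Longrightarrow> sc r x \<in> B (- d)"
  using sc_Z[of r e x "- (e + d)"] sc_B[of r e x "- (e + d)"] by simp_all

lemma closed_qdual: "closed_gm R (qdual Z B sc)"
  unfolding closed_gm_def qdual_def
  by (auto simp: Z_add sc_const_Z B_Z minus_degree sc_add distrib_left sc_commute[of _ "const _"])

lemma coset_const_scale:
  "sc (const c) ` (x +o B d) + B (0 + d) = sc (const c) x +o B d"
  using coset_scale[OF const_R homogeneous_const, of c x d] by simp

lemma closed_dual_qmod: "closed_gm R (graded_dual (qmod Z B sc))"
proof -
  have sh: "sc r ` (x +o B (- (e + d))) + B (- d) = sc r x +o B (- d)"
    if "r \<in> R" "homogeneous e r" for r e x d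
    using coset_scale[OF that, of x "- (e + d)"] by simp
  have sh': "sc r ` (x +o B (- e - d)) + B (- d) = sc r x +o B (- d)"
    "x \<in> Z (- e - d) \<Longrightarrow> sc r x \<in> Z (- d)"
    if "r \<in> R" "homogeneous e r" for r e x d
    using sh[OF that, of x d] minus_degree(1)[OF that, of x d] by simp_all
  show ?thesis
    unfolding closed_gm_def graded_dual_def qmod_def
    by (auto simp: coset_add coset_const_scale[simplified] sh sh' Z_add sc_const_Z minus_degree sc_add
        distrib_left sc_commute[of _ "const _"])
qed

lemma dual_qmod_iso: "graded_iso R (graded_dual (qmod Z B sc)) (qdual Z B sc)"
proof (rule graded_isoI[where f = "\<lambda>d \<phi>. \<lambda>x\<in>Z (- d). \<phi> (x +o B (- d))"])
  fix d
  let ?C = "(\<lambda>z. z +o B (- d)) ` Z (- d)"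
  show "bij_betw (\<lambda>\<phi>. \<lambda>x\<in>Z (- d). \<phi> (x +o B (- d)))
      (gcomp (graded_dual (qmod Z B sc)) d) (gcomp (qdual Z B sc) d)"
  proof (rule bij_betw_byWitness[where
        f' = "\<lambda>\<mu>. \<lambda>X\<in>?C. \<mu> (SOME x. x \<in> Z (- d) \<and> X = x +o B (- d))"])
    have rep: "(SOME x. x \<in> Z (- d) \<and> y +o B (- d) = x +o B (- d)) \<in> Z (- d) \<and>
        y +o B (- d) = (SOME x. x \<in> Z (- d) \<and> y +o B (- d) = x +o B (- d)) +o B (- d)"
      if "y \<in> Z (- d)" for y
      by (rule someI_ex) (use that in blast)
    show "\<forall>\<phi>\<in>gcomp (graded_dual (qmod Z B sc)) d.
       (\<lambda>X\<in>?C. (\<lambda>x\<in>Z (- d). \<phi> (x +o B (- d))) (SOME x. x \<in> Z (- d) \<and> X = x +o B (- d))) = \<phi>"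
    proof
      fix \<phi> assume "\<phi> \<in> gcomp (graded_dual (qmod Z B sc)) d"
      hence "\<phi> \<in> extensional ?C" by (simp add: graded_dual_def qmod_def)
      thus "(\<lambda>X\<in>?C. (\<lambda>x\<in>Z (- d). \<phi> (x +o B (- d))) (SOME x. x \<in> Z (- d) \<and> X = x +o B (- d))) = \<phi>"
        by (intro extensionalityI[of _ ?C]) (use rep in auto)
    qed
    have \<mu>_rep: "\<mu> (SOME x. x \<in> Z (- d) \<and> y +o B (- d) = x +o B (- d)) = \<mu> y"
      if \<mu>: "\<mu> \<in> gcomp (qdual Z B sc) d" and y: "y \<in> Z (- d)" for \<mu> y
    proof -
      let ?s = "SOME x. x \<in> Z (- d) \<and> y +o B (- d) = x +o B (- d)"
      have s: "?s \<in> Z (- d)" "y - ?s \<in> B (- d)" using rep[OF y] coset_eq by blast+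
      have "\<mu> ((y - ?s) + ?s) = \<mu> (y - ?s) + \<mu> ?s"
        by (rule qdual_memD(2)[OF \<mu> B_Z[OF s(2)] s(1)])
      also have "\<mu> (y - ?s) = 0" by (rule qdual_memD(4)[OF \<mu> s(2)])
      finally show ?thesis by simp
    qed
    show "\<forall>\<mu>\<in>gcomp (qdual Z B sc) d.
       (\<lambda>x\<in>Z (- d). (\<lambda>X\<in>?C. \<mu> (SOME x. x \<in> Z (- d) \<and> X = x +o B (- d))) (x +o B (- d))) = \<mu>"
    proof
      fix \<mu> assume \<mu>: "\<mu> \<in> gcomp (qdual Z B sc) d"
      hence "\<mu> \<in> extensional (Z (- d))" by (simp add: qdual_def)
      thus "(\<lambda>x\<in>Z (- d). (\<lambda>X\<in>?C. \<mu> (SOME x. x \<in> Z (- d) \<and> X = x +o B (- d))) (x +o B (- d))) = \<mu>"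
        by (intro extensionalityI[of _ "Z (- d)"]) (use \<mu>_rep[OF \<mu>] in auto)
    qed
    show "(\<lambda>\<phi>. \<lambda>x\<in>Z (- d). \<phi> (x +o B (- d))) ` gcomp (graded_dual (qmod Z B sc)) d
        \<subseteq> gcomp (qdual Z B sc) d"
    proof (rule image_subsetI)
      fix \<phi> assume "\<phi> \<in> gcomp (graded_dual (qmod Z B sc)) d"
      hence add: "\<And>x y. x \<in> Z (- d) \<Longrightarrow> y \<in> Z (- d) \<Longrightarrow>
            \<phi> ((x + y) +o B (- d)) = \<phi> (x +o B (- d)) + \<phi> (y +o B (- d))"
        and sca: "\<And>c x. x \<in> Z (- d) \<Longrightarrow> \<phi> (sc (const c) x +o B (- d)) = c * \<phi> (x +o B (- d))"
        by (auto simp: graded_dual_def qmod_def coset_add coset_const_scale[simplified])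
      have Z0: "0 \<in> Z (- d)" using B_Z B_0 by blast
      have "\<phi> (0 +o B (- d)) = \<phi> (0 +o B (- d)) + \<phi> (0 +o B (- d))"
        using add[OF Z0 Z0] by simp
      hence "\<phi> (0 +o B (- d)) = 0" by (metis add_cancel_right_right)
      hence "\<phi> (x +o B (- d)) = 0" if "x \<in> B (- d)" for x
        using coset_eq[of x "- d" 0] that by simp
      thus "(\<lambda>x\<in>Z (- d). \<phi> (x +o B (- d))) \<in> gcomp (qdual Z B sc) d"
        by (auto simp: qdual_def add sca Z_add sc_const_Z B_Z)
    qed
    show "(\<lambda>\<mu>. \<lambda>X\<in>?C. \<mu> (SOME x. x \<in> Z (- d) \<and> X = x +o B (- d))) ` gcomp (qdual Z B sc) d
        \<subseteq> gcomp (graded_dual (qmod Z B sc)) d"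
    proof (rule image_subsetI)
      fix \<mu> assume \<mu>: "\<mu> \<in> gcomp (qdual Z B sc) d"
      hence add: "\<And>x y. x \<in> Z (- d) \<Longrightarrow> y \<in> Z (- d) \<Longrightarrow> \<mu> (x + y) = \<mu> x + \<mu> y"
        and sca: "\<And>c x. x \<in> Z (- d) \<Longrightarrow> \<mu> (sc (const c) x) = c * \<mu> x"
        by (auto simp: qdual_def)
      show "(\<lambda>X\<in>?C. \<mu> (SOME x. x \<in> Z (- d) \<and> X = x +o B (- d))) \<in> gcomp (graded_dual (qmod Z B sc)) d"
        by (auto simp: graded_dual_def qmod_def coset_add coset_const_scale[simplified] \<mu>_rep[OF \<mu>]
            Z_add sc_const_Z add sca)
    qed
  qed
next
  fix d \<phi> \<psi> assume "\<phi> \<in> gcomp (graded_dual (qmod Z B sc)) d" "\<psi> \<in> gcomp (graded_dual (qmod Z B sc)) d"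
  show "(\<lambda>x\<in>Z (- d). gadd (graded_dual (qmod Z B sc)) d \<phi> \<psi> (x +o B (- d))) =
      gadd (qdual Z B sc) d (\<lambda>x\<in>Z (- d). \<phi> (x +o B (- d))) (\<lambda>x\<in>Z (- d). \<psi> (x +o B (- d)))"
    by (auto simp: graded_dual_def qmod_def qdual_def restrict_def fun_eq_iff)
next
  fix e d r \<phi> assume r: "r \<in> R" "homogeneous e r"
  have sh: "sc r ` (x +o B (- (e + d))) + B (- d) = sc r x +o B (- d)" for x
    using coset_scale[OF r, of x "- (e + d)"] by simp
  show "(\<lambda>x\<in>Z (- (e + d)). gscale (graded_dual (qmod Z B sc)) e d r \<phi> (x +o B (- (e + d)))) =
      gscale (qdual Z B sc) e d r (\<lambda>x\<in>Z (- d). \<phi> (x +o B (- d)))"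
    using r sh by (auto simp: graded_dual_def qmod_def qdual_def restrict_def fun_eq_iff minus_degree
        simp del: minus_add_distrib)
qed

end

text \<open>
  The last two hypotheses say that \<open>h\<close> induces an isomorphism \<open>Z'/B' \<rightarrow> Z/B\<close>; the isomorphism of the duals is
  composition with \<open>h\<close>.
\<close>

lemma qdual_iso:
  assumes M: "graded_quotient R Z B sc" and M': "graded_quotient R Z' B' sc'"
    and h_Z: "\<And>d x. x \<in> Z' d \<Longrightarrow> h x \<in> Z d" and h_B: "\<And>d x. x \<in> B' d \<Longrightarrow> h x \<in> B d"
    and h_add: "\<And>x y. h (x + y) = h x + h y"
    and h_sc: "\<And>r x. h (sc' r x) = sc r (h x)"
    and surj: "\<And>d z. z \<in> Z d \<Longrightarrow> \<exists>z'\<in>Z' d. z - h z' \<in> B d"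
    and inj: "\<And>d z'. z' \<in> Z' d \<Longrightarrow> h z' \<in> B d \<Longrightarrow> z' \<in> B' d"
  shows "graded_iso R (qdual Z B sc) (qdual Z' B' (sc' :: 'k::field mpoly \<Rightarrow> _))"
proof -
  interpret M: graded_quotient R Z B sc by fact
  interpret M': graded_quotient R Z' B' sc' by fact
  have h_diff: "h (x - y) = h x - h y" for x y
    by (metis add_diff_cancel diff_add_cancel h_add)
  show ?thesis
  proof (rule graded_isoI[where f = "\<lambda>d \<mu>. \<lambda>x\<in>Z' (- d). \<mu> (h x)"])
    fix d
    \<comment> \<open>A preimage of \<open>z\<close> up to \<open>B\<close>; two choices differ by an element of \<open>B'\<close>, on which \<open>\<nu>\<close> vanishes.\<close>
    define pre where "pre z = (SOME z'. z' \<in> Z' (- d) \<and> z - h z' \<in> B (- d))" for z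
    have pre: "pre z \<in> Z' (- d)" "z - h (pre z) \<in> B (- d)" if "z \<in> Z (- d)" for z
      using someI_ex[of "\<lambda>z'. z' \<in> Z' (- d) \<and> z - h z' \<in> B (- d)"] surj[OF that] unfolding pre_def by blast+
    have \<mu>_eq: "\<mu> x = \<mu> y" if "\<mu> \<in> gcomp (qdual Z B sc) d" "y \<in> Z (- d)" "x - y \<in> B (- d)" for \<mu> x y
    proof -
      have "\<mu> ((x - y) + y) = \<mu> (x - y) + \<mu> y"
        by (rule qdual_memD(2)[OF that(1) M.B_Z[OF that(3)] that(2)])
      also have "\<mu> (x - y) = 0" by (rule qdual_memD(4)[OF that(1,3)])
      finally show ?thesis by simp
    qed
    have \<nu>_eq: "\<nu> x = \<nu> y" if "\<nu> \<in> gcomp (qdual Z' B' sc') d" "x \<in> Z' (- d)" "y \<in> Z' (- d)"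
      "h x - h y \<in> B (- d)" for \<nu> x y
    proof -
      have "x - y \<in> B' (- d)" using that inj[OF M'.Z_diff[OF that(2,3)]] by (simp add: h_diff)
      moreover from this have "\<nu> ((x - y) + y) = \<nu> (x - y) + \<nu> y"
        using that(3) M'.B_Z by (intro qdual_memD(2)[OF that(1)])
      moreover have "\<nu> (x - y) = 0" using calculation(1) by (rule qdual_memD(4)[OF that(1)])
      ultimately show ?thesis by simp
    qed
    show "bij_betw (\<lambda>\<mu>. \<lambda>x\<in>Z' (- d). \<mu> (h x)) (gcomp (qdual Z B sc) d) (gcomp (qdual Z' B' sc') d)"
    proof (rule bij_betw_byWitness[where f' = "\<lambda>\<nu>. \<lambda>z\<in>Z (- d). \<nu> (pre z)"])
      show "\<forall>\<mu>\<in>gcomp (qdual Z B sc) d. (\<lambda>z\<in>Z (- d). (\<lambda>x\<in>Z' (- d). \<mu> (h x)) (pre z)) = \<mu>"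
      proof
        fix \<mu> assume \<mu>: "\<mu> \<in> gcomp (qdual Z B sc) d"
        hence "\<mu> \<in> extensional (Z (- d))" by (simp add: qdual_def)
        thus "(\<lambda>z\<in>Z (- d). (\<lambda>x\<in>Z' (- d). \<mu> (h x)) (pre z)) = \<mu>"
          using pre h_Z \<mu>_eq[OF \<mu>] by (intro extensionalityI[of _ "Z (- d)"]) (auto, metis)
      qed
      show "\<forall>\<nu>\<in>gcomp (qdual Z' B' sc') d. (\<lambda>x\<in>Z' (- d). (\<lambda>z\<in>Z (- d). \<nu> (pre z)) (h x)) = \<nu>"
      proof
        fix \<nu> assume \<nu>: "\<nu> \<in> gcomp (qdual Z' B' sc') d"
        hence "\<nu> \<in> extensional (Z' (- d))" by (simp add: qdual_def)
        moreover have "\<nu> (pre (h x)) = \<nu> x" if "x \<in> Z' (- d)" for x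
          using \<nu>_eq[OF \<nu> that pre(1)[OF h_Z[OF that]] pre(2)[OF h_Z[OF that]]] by simp
        ultimately show "(\<lambda>x\<in>Z' (- d). (\<lambda>z\<in>Z (- d). \<nu> (pre z)) (h x)) = \<nu>"
          using h_Z by (intro extensionalityI[of _ "Z' (- d)"]) auto
      qed
      show "(\<lambda>\<mu>. \<lambda>x\<in>Z' (- d). \<mu> (h x)) ` gcomp (qdual Z B sc) d \<subseteq> gcomp (qdual Z' B' sc') d"
        by (auto simp: qdual_def h_add h_sc h_Z h_B M'.Z_add M'.sc_const_Z M'.B_Z)
      show "(\<lambda>\<nu>. \<lambda>z\<in>Z (- d). \<nu> (pre z)) ` gcomp (qdual Z' B' sc') d \<subseteq> gcomp (qdual Z B sc) d"
      proof (rule image_subsetI)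
        fix \<nu> assume \<nu>: "\<nu> \<in> gcomp (qdual Z' B' sc') d"
        hence add: "\<And>x y. x \<in> Z' (- d) \<Longrightarrow> y \<in> Z' (- d) \<Longrightarrow> \<nu> (x + y) = \<nu> x + \<nu> y"
          and sca: "\<And>c x. x \<in> Z' (- d) \<Longrightarrow> \<nu> (sc' (const c) x) = c * \<nu> x"
          and B0: "\<And>x. x \<in> B' (- d) \<Longrightarrow> \<nu> x = 0"
          by (auto simp: qdual_def)
        have 1: "\<nu> (pre (x + y)) = \<nu> (pre x) + \<nu> (pre y)" if "x \<in> Z (- d)" "y \<in> Z (- d)" for x y
        proof -
          have "\<nu> (pre (x + y)) = \<nu> (pre x + pre y)"
          proof (rule \<nu>_eq[OF \<nu>])
            have "h (pre (x + y)) - h (pre x + pre y) =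
                ((x - h (pre x)) + (y - h (pre y))) - ((x + y) - h (pre (x + y)))"
              by (simp add: h_add algebra_simps)
            also have "\<dots> \<in> B (- d)"
              by (intro M.B_diff M.B_add pre M.Z_add that)
            finally show "h (pre (x + y)) - h (pre x + pre y) \<in> B (- d)" .
          qed (use that in \<open>auto intro!: pre M.Z_add M'.Z_add\<close>)
          thus ?thesis using that by (simp add: add pre)
        qed
        have 2: "\<nu> (pre (sc (const c) x)) = c * \<nu> (pre x)" if "x \<in> Z (- d)" for c x
        proof -
          have "\<nu> (pre (sc (const c) x)) = \<nu> (sc' (const c) (pre x))"
          proof (rule \<nu>_eq[OF \<nu>])
            have "sc (const c) (x - h (pre x)) + sc (const c) (h (pre x)) = sc (const c) x"
              by (simp flip: M.sc_add)
            hence "h (pre (sc (const c) x)) - h (sc' (const c) (pre x)) =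
                sc (const c) (x - h (pre x)) - (sc (const c) x - h (pre (sc (const c) x)))"
              by (simp add: h_sc algebra_simps)
            also have "\<dots> \<in> B (- d)"
              using M.sc_B[OF M.const_R homogeneous_const pre(2)[OF that], of c]
              by (intro M.B_diff pre M.sc_const_Z that) simp
            finally show "h (pre (sc (const c) x)) - h (sc' (const c) (pre x)) \<in> B (- d)" .
          qed (use that in \<open>auto intro!: pre M.sc_const_Z M'.sc_const_Z\<close>)
          thus ?thesis using that by (simp add: sca pre)
        qed
        have 3: "\<nu> (pre x) = 0" if "x \<in> B (- d)" for x
        proof (rule B0)
          have "h (pre x) = x - (x - h (pre x))" by simp
          also have "\<dots> \<in> B (- d)" using that pre(2)[OF M.B_Z[OF that]] by (rule M.B_diff)
          finally show "pre x \<in> B' (- d)" using pre(1)[OF M.B_Z[OF that]] inj by blast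
        qed
        show "(\<lambda>z\<in>Z (- d). \<nu> (pre z)) \<in> gcomp (qdual Z B sc) d"
          by (auto simp: qdual_def 1 2 3 M.Z_add M.sc_const_Z M.B_Z)
      qed
    qed
  next
    fix d \<mu> \<nu>
    show "(\<lambda>x\<in>Z' (- d). gadd (qdual Z B sc) d \<mu> \<nu> (h x)) =
        gadd (qdual Z' B' sc') d (\<lambda>x\<in>Z' (- d). \<mu> (h x)) (\<lambda>x\<in>Z' (- d). \<nu> (h x))"
      by (auto simp: qdual_def restrict_def fun_eq_iff h_Z)
  next
    fix e d r \<mu> assume r: "r \<in> R" "homogeneous e r"
    show "(\<lambda>x\<in>Z' (- (e + d)). gscale (qdual Z B sc) e d r \<mu> (h x)) =
        gscale (qdual Z' B' sc') e d r (\<lambda>x\<in>Z' (- d). \<mu> (h x))"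
      using r h_Z by (auto simp: qdual_def restrict_def fun_eq_iff h_sc M'.minus_degree
          simp del: minus_add_distrib)
  qed
qed

section \<open>Localisations inside the field of fractions\<close>

definition emb :: "'k::field mpoly \<Rightarrow> 'k mpoly fract" where
  "emb r = Fraction_Field.Fract r 1"

lemma emb_0 [simp]: "emb 0 = 0"
  and emb_1 [simp]: "emb 1 = 1"
  and emb_add: "emb (r + s) = emb r + emb s"
  and emb_mult: "emb (r * s) = emb r * emb s"
  and emb_uminus: "emb (- r) = - emb r"
  by (auto simp: emb_def Zero_fract_def One_fract_def)

lemma emb_inj [simp]: "emb r = emb s \<longleftrightarrow> r = s"
  by (simp add: emb_def eq_fract)

lemma emb_eq_0_iff [simp]: "emb r = 0 \<longleftrightarrow> r = 0"
  using emb_inj[of r 0] by (simp del: emb_inj)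

lemma emb_power: "emb (r ^ k) = emb r ^ k"
  by (induction k) (auto simp: emb_mult)

lemma emb_sum: "emb (sum f A) = (\<Sum>a\<in>A. emb (f a))"
  by (induction A rule: infinite_finite_induct) (auto simp: emb_add)

lemma Fract_eq_emb: "Fraction_Field.Fract r s = emb r / emb s"
  by (simp add: emb_def)

locale graded_subring =
  fixes R :: "'k::field mpoly set"
  assumes R_const: "const c \<in> R"
    and R_add: "r \<in> R \<Longrightarrow> s \<in> R \<Longrightarrow> r + s \<in> R"
    and R_uminus: "r \<in> R \<Longrightarrow> - r \<in> R"
    and R_mult: "r \<in> R \<Longrightarrow> s \<in> R \<Longrightarrow> r * s \<in> R"
    and R_hcomp: "r \<in> R \<Longrightarrow> hcomp d r \<in> R"

lemma graded_subring_invariants: "graded_subring (invariants n G)"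
  by unfold_locales (auto intro: invariants_add invariants_uminus invariants_mult invariants_hcomp)

context graded_subring
begin

lemma R_0: "0 \<in> R" and R_1: "1 \<in> R"
  using R_const[of 0] R_const[of 1] by auto

lemma R_power: "r \<in> R \<Longrightarrow> r ^ k \<in> R"
  by (induction k) (auto intro: R_1 R_mult)

lemma R_sum: "(\<And>a. a \<in> A \<Longrightarrow> f a \<in> R) \<Longrightarrow> sum f A \<in> R"
  by (induction A rule: infinite_finite_induct) (auto intro: R_0 R_add)

lemma R_prod: "(\<And>a. a \<in> A \<Longrightarrow> f a \<in> R) \<Longrightarrow> prod f A \<in> R"
  by (induction A rule: infinite_finite_induct) (auto intro: R_1 R_mult)

definition with_denominator :: "'k mpoly \<Rightarrow> int \<Rightarrow> int \<Rightarrow> nat \<Rightarrow> 'k mpoly fract set" where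
  "with_denominator f e d t = {emb r / emb f ^ t | r. r \<in> R \<and> homogeneous (d + int t * e) r}"

lemma localization_comp_eq:
  assumes "homogeneous e f" "f \<noteq> 0"
  shows "localization_comp R f d = (\<Union>t. with_denominator f e d t)"
proof -
  have "homogeneous e' f \<longleftrightarrow> e' = e" for e'
    using assms homogeneous_unique by blast
  thus ?thesis
    unfolding localization_comp_def with_denominator_def
    by (auto simp: Fract_eq_emb emb_power)
qed

lemma with_denominator_mono:
  assumes "y \<in> with_denominator f e d t" "t \<le> t'" "f \<in> R" "f \<noteq> 0" "homogeneous e f"
  shows "y \<in> with_denominator f e d t'"
proof -
  obtain s where s: "t' = t + s" using assms(2) le_Suc_ex by blast
  obtain r where r: "r \<in> R" "homogeneous (d + int t * e) r" "y = emb r / emb f ^ t"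
    using assms(1) by (auto simp: with_denominator_def)
  have "y = emb (r * f ^ s) / emb f ^ t'"
    using assms(4) by (simp add: r s emb_mult emb_power power_add)
  moreover have "homogeneous (d + int t' * e) (r * f ^ s)"
    by (rule homogeneous_mult'[OF r(2) homogeneous_power[OF assms(5), of s]]) (simp add: s algebra_simps)
  ultimately show ?thesis
    using r assms(3) unfolding with_denominator_def by (blast intro: R_mult R_power)
qed

context
  fixes f e assumes f: "f \<in> R" "f \<noteq> 0" "homogeneous e f"
begin

lemma common_denominator:
  assumes "y \<in> localization_comp R f d" "z \<in> localization_comp R f d'"
  obtains t where "y \<in> with_denominator f e d t" "z \<in> with_denominator f e d' t"
proof -
  obtain t t' where "y \<in> with_denominator f e d t" "z \<in> with_denominator f e d' t'"
    using assms unfolding localization_comp_eq[OF f(3,2)] by blast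
  hence "y \<in> with_denominator f e d (max t t')" "z \<in> with_denominator f e d' (max t t')"
    using f by (auto elim!: with_denominator_mono)
  thus ?thesis using that by blast
qed

lemma with_denominator_localization: "y \<in> with_denominator f e d t \<Longrightarrow> y \<in> localization_comp R f d"
  unfolding localization_comp_eq[OF f(3,2)] by blast

lemma localization_0: "0 \<in> localization_comp R f d"
  by (rule with_denominator_localization[of _ _ 0])
    (auto simp: with_denominator_def intro!: exI[of _ 0] R_0)

lemma localization_add:
  assumes "y \<in> localization_comp R f d" "z \<in> localization_comp R f d"
  shows "y + z \<in> localization_comp R f d"
proof -
  obtain t where t: "y \<in> with_denominator f e d t" "z \<in> with_denominator f e d t"
    by (rule common_denominator[OF assms])
  then obtain r s where "r \<in> R" "s \<in> R" "homogeneous (d + int t * e) r" "homogeneous (d + int t * e) s"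
    "y = emb r / emb f ^ t" "z = emb s / emb f ^ t" unfolding with_denominator_def by blast
  hence "y + z \<in> with_denominator f e d t"
    unfolding with_denominator_def
    by (intro CollectI exI[of _ "r + s"]) (auto simp: emb_add add_divide_distrib intro: R_add homogeneous_add)
  thus ?thesis by (rule with_denominator_localization)
qed

lemma localization_mult:
  assumes "y \<in> localization_comp R f d" "r \<in> R" "homogeneous c r"
  shows "emb r * y \<in> localization_comp R f (c + d)"
proof -
  obtain t s where "s \<in> R" "homogeneous (d + int t * e) s" "y = emb s / emb f ^ t"
    using assms unfolding localization_comp_eq[OF f(3,2)] with_denominator_def by blast
  hence "emb r * y \<in> with_denominator f e (c + d) t"
    unfolding with_denominator_def using assms
    by (intro CollectI exI[of _ "r * s"])
      (auto simp: emb_mult add.assoc intro: R_mult homogeneous_mult)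
  thus ?thesis by (rule with_denominator_localization)
qed

lemma localization_uminus: "y \<in> localization_comp R f d \<Longrightarrow> - y \<in> localization_comp R f d"
  using localization_mult[of y d "- 1" 0] R_uminus[OF R_1] homogeneous_uminus[OF homogeneous_1]
  by (simp add: emb_uminus)

lemma localization_sum:
  "(\<And>a. a \<in> A \<Longrightarrow> g a \<in> localization_comp R f d) \<Longrightarrow> sum g A \<in> localization_comp R f d"
  by (induction A rule: infinite_finite_induct) (auto intro: localization_0 localization_add)

lemma localization_sign:
  "y \<in> localization_comp R f d \<Longrightarrow> (- 1) ^ k * y \<in> localization_comp R f d"
  by (cases "even k") (auto intro: localization_uminus)

end

lemma localization_mono:
  assumes f: "f \<in> R" "f \<noteq> 0" "homogeneous e f" and g: "g \<in> R" "g \<noteq> 0" "homogeneous e' g"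
    and y: "y \<in> localization_comp R f d"
  shows "y \<in> localization_comp R (g * f) d"
proof -
  obtain t s where s: "s \<in> R" "homogeneous (d + int t * e) s" "y = emb s / emb f ^ t"
    using y unfolding localization_comp_eq[OF f(3,2)] with_denominator_def by blast
  have "y = emb (g ^ t * s) / emb (g * f) ^ t"
    using g(2) by (simp add: s emb_mult emb_power power_mult_distrib)
  moreover have "homogeneous (d + int t * (e' + e)) (g ^ t * s)"
    by (rule homogeneous_mult'[OF homogeneous_power[OF g(3)] s(2)]) (simp add: algebra_simps)
  ultimately have "y \<in> with_denominator (g * f) (e' + e) d t"
    unfolding with_denominator_def using g s by (blast intro: R_mult R_power)
  thus ?thesis
    using f g by (intro with_denominator_localization[of _ "e' + e"] R_mult homogeneous_mult) auto
qed

end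

section \<open>The homotopy of the Cech complex\<close>

text \<open>
  The differential of the Cech complex on the index set \<open>J\<close>. Arbitrary finite index sets make it possible to
  remove and to add elements of the sequence without renumbering.
\<close>

definition dd :: "nat set \<Rightarrow> (nat set \<Rightarrow> 'a::comm_ring_1) \<Rightarrow> (nat set \<Rightarrow> 'a)" where
  "dd J c = (\<lambda>I. if I \<subseteq> J
     then (\<Sum>j\<in>I. (- 1) ^ card {l \<in> I. l < j} * c (I - {j})) else 0)"

lemma cech_diff_eq: "cech_diff fs = dd {..<length fs}"
  by (simp add: cech_diff_def dd_def fun_eq_iff)

definition sg :: "nat \<Rightarrow> nat set \<Rightarrow> 'a::comm_ring_1" where
  "sg j I = (- 1) ^ card {l \<in> I. l < j}"

lemma dd_sg: "dd J c I = (if I \<subseteq> J then \<Sum>j\<in>I. sg j I * c (I - {j}) else 0)"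
  by (simp add: dd_def sg_def)

lemma sg_insert:
  assumes "finite I" "x \<notin> I"
  shows "sg j (insert x I) = (if x < j then - sg j I else sg j I)"
proof -
  have "{l \<in> insert x I. l < j} = (if x < j then insert x {l \<in> I. l < j} else {l \<in> I. l < j})"
    by auto
  thus ?thesis using assms by (simp add: sg_def)
qed

lemma sg_square [simp]: "sg j I * sg j I = 1" "sg j I * (sg j I * x) = x"
  by (auto simp: sg_def simp flip: power_add mult.assoc)

lemma dd_dd:
  assumes "finite J" shows "dd J (dd J c) = 0"
proof
  fix I
  show "dd J (dd J c) I = 0 I"
  proof (cases "I \<subseteq> J")
    case True
    hence fin: "finite I" using assms by (rule finite_subset)
    let ?t = "\<lambda>j l. sg j I * (sg l (I - {j}) * c (I - {j} - {l}))"
    have anti: "?t j l = - ?t l j" if "j \<in> I" "l \<in> I" "j \<noteq> l" for j l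
    proof -
      define A where "A = I - {j} - {l}"
      have A: "finite A" "j \<notin> A" "l \<notin> A" "I - {j} = insert l A" "I - {l} = insert j A"
        "I = insert j (insert l A)" "I - {l} - {j} = A"
        using that fin by (auto simp: A_def)
      have I: "I = insert l (insert j A)" using A(6) by auto
      have "sg j I * sg l (I - {j}) = - (sg l I * sg j (I - {l}) :: 'a)"
        using A(1-3) that(3) unfolding A(4,5) unfolding I by (cases "j < l") (auto simp: sg_insert)
      moreover have "I - {j} - {l} = A" by (simp add: A_def)
      ultimately show ?thesis by (simp only: A(7) mult.assoc[symmetric] minus_mult_left)
    qed
    have "dd J (dd J c) I = (\<Sum>j\<in>I. \<Sum>l\<in>I - {j}. ?t j l)"
    proof -
      have "dd J (dd J c) I = (\<Sum>j\<in>I. sg j I * dd J c (I - {j}))" using True by (simp add: dd_sg)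
      also have "\<dots> = (\<Sum>j\<in>I. \<Sum>l\<in>I - {j}. ?t j l)"
      proof (intro sum.cong refl)
        fix j
        have "I - {j} \<subseteq> J" using True by blast
        thus "sg j I * dd J c (I - {j}) = (\<Sum>l\<in>I - {j}. ?t j l)"
          by (simp add: dd_sg sum_distrib_left)
      qed
      finally show ?thesis .
    qed
    also have "\<dots> = (\<Sum>(j, l)\<in>{(j, l) \<in> I \<times> I. j \<noteq> l}. ?t j l)"
    proof -
      have "{(j, l) \<in> I \<times> I. j \<noteq> l} = (SIGMA j:I. I - {j})" by auto
      thus ?thesis using fin by (simp add: sum.Sigma)
    qed
    also have "\<dots> = (\<Sum>(j, l)\<in>{(j, l) \<in> I \<times> I. j < l}. ?t j l) + (\<Sum>(j, l)\<in>{(j, l) \<in> I \<times> I. l < j}. ?t j l)"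
      using fin
    proof -
      have "{(j, l) \<in> I \<times> I. j \<noteq> l} = {(j, l) \<in> I \<times> I. j < l} \<union> {(j, l) \<in> I \<times> I. l < j}"
        by auto
      moreover have "finite {(j, l) \<in> I \<times> I. j < l}" "finite {(j, l) \<in> I \<times> I. l < j}"
        by (rule finite_subset[OF _ finite_cartesian_product[OF fin fin]], blast)+
      moreover have "{(j, l) \<in> I \<times> I. j < l} \<inter> {(j, l) \<in> I \<times> I. l < j} = {}" by auto
      ultimately show ?thesis by (simp only: sum.union_disjoint)
    qed
    also have "(\<Sum>(j, l)\<in>{(j, l) \<in> I \<times> I. l < j}. ?t j l) = (\<Sum>(j, l)\<in>{(j, l) \<in> I \<times> I. j < l}. ?t l j)"
      by (rule sum.reindex_bij_witness[where i = prod.swap and j = prod.swap]) auto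
    also have "\<dots> = (\<Sum>(j, l)\<in>{(j, l) \<in> I \<times> I. j < l}. - ?t j l)"
      by (intro sum.cong refl) (use anti in auto)
    finally show ?thesis by (simp add: sum_negf case_prod_unfold)
  qed (simp add: dd_def)
qed

text \<open>
  The contracting homotopy at the index \<open>j\<close>. It is not defined on the Cech complex
  itself: at \<open>I\<close> its value is a fraction in whose denominator \<open>f\<^sub>j\<close> may occur.
\<close>

definition hh :: "nat \<Rightarrow> (nat set \<Rightarrow> 'a::comm_ring_1) \<Rightarrow> (nat set \<Rightarrow> 'a)" where
  "hh j c = (\<lambda>I. if j \<in> I then 0 else sg j I * c (insert j I))"

text \<open>
  At a set \<open>I\<close> that contains \<open>j\<close>, removing \<open>j\<close> is the only contribution. At another set \<open>I\<close>, the sum is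
  up to sign the part of \<open>dd J c (insert j I) = 0\<close> that is left after splitting off \<open>c I\<close>.
\<close>

lemma dd_hh:
  assumes J: "finite J" "j \<in> J" and supp: "\<And>I. \<not> I \<subseteq> J \<Longrightarrow> c I = 0" and cocycle: "dd J c = 0"
  shows "dd J (hh j c) = c"
proof
  fix I
  show "dd J (hh j c) I = c I"
  proof (cases "I \<subseteq> J")
    case True
    hence fin: "finite I" using J(1) by (rule finite_subset)
    show ?thesis
    proof (cases "j \<in> I")
      case jI: True
      have "dd J (hh j c) I = (\<Sum>l\<in>I. sg l I * hh j c (I - {l}))" using True by (simp add: dd_sg)
      also have "\<dots> = (\<Sum>l\<in>I. if l = j then c I else 0)"
      proof (intro sum.cong refl)
        fix l assume "l \<in> I"
        have "sg j (insert j (I - {j})) = (sg j (I - {j}) :: 'a)"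
          using fin by (subst sg_insert) auto
        hence "sg j I = (sg j (I - {j}) :: 'a)" using jI by (simp add: insert_absorb)
        thus "sg l I * hh j c (I - {l}) = (if l = j then c I else 0)"
          using jI by (auto simp: hh_def insert_absorb)
      qed
      also have "\<dots> = c I" using fin jI by simp
      finally show ?thesis .
    next
      case jI: False
      let ?I = "insert j I"
      have "0 = dd J c ?I" by (simp add: cocycle)
      also have "\<dots> = (\<Sum>l\<in>?I. sg l ?I * c (?I - {l}))" using True J by (simp add: dd_sg)
      also have "\<dots> = sg j ?I * c I + (\<Sum>l\<in>I. sg l ?I * c (?I - {l}))"
        using fin jI by simp
      finally have "(\<Sum>l\<in>I. sg l ?I * c (?I - {l})) = - (sg j ?I * c I)"
        by (simp add: eq_neg_iff_add_eq_0 add.commute)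
      moreover have "sg j ?I = (sg j I :: 'a)" using fin jI by (simp add: sg_insert)
      ultimately have *: "(\<Sum>l\<in>I. sg l ?I * c (?I - {l})) = - (sg j I * c I)" by simp
      have "dd J (hh j c) I = (\<Sum>l\<in>I. sg l I * hh j c (I - {l}))" using True by (simp add: dd_sg)
      also have "\<dots> = (\<Sum>l\<in>I. - sg j I * (sg l ?I * c (?I - {l})))"
      proof (intro sum.cong refl)
        fix l assume l: "l \<in> I"
        define A where "A = I - {l}"
        have A: "I = insert l A" "l \<notin> A" "j \<notin> A" "finite A" "j \<noteq> l"
          using l jI fin by (auto simp: A_def)
        have "?I - {l} = insert j A" using A by auto
        moreover have "sg l I * sg j A = - (sg j I * sg l ?I :: 'a)"
          using A(2-5) unfolding A(1) by (cases "l < j") (auto simp: sg_insert)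
        ultimately show "sg l I * hh j c (I - {l}) = - sg j I * (sg l ?I * c (?I - {l}))"
          using jI by (simp add: hh_def A_def[symmetric] A(3) flip: mult.assoc)
      qed
      also have "\<dots> = - sg j I * (\<Sum>l\<in>I. sg l ?I * c (?I - {l}))"
        by (rule sum_distrib_left[symmetric])
      also have "\<dots> = c I" by (simp add: *)
      finally show ?thesis .
    qed
  qed (simp add: dd_def supp)
qed

lemma dd_add: "dd J (b + c) = dd J b + dd J c"
  by (auto simp: dd_def fun_eq_iff distrib_left sum.distrib)

lemma dd_uminus: "dd J (- c) = - dd J c"
  by (auto simp: dd_def fun_eq_iff sum_negf)

lemma dd_diff: "dd J (b - c) = dd J b - dd J c"
  using dd_add[of J b "- c"] by (simp add: dd_uminus)

lemma dd_scale: "dd J (\<lambda>I. a * c I) = (\<lambda>I. a * dd J c I)"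
  by (auto simp: dd_def fun_eq_iff sum_distrib_left mult_ac intro!: sum.cong)

lemma dd_sum: "dd J (\<lambda>I. \<Sum>a\<in>A. c a I) = (\<lambda>I. \<Sum>a\<in>A. dd J (c a) I)"
  by (auto simp: dd_def fun_eq_iff sum_distrib_left sum.swap[of _ A])

lemma dd_0 [simp]: "dd J 0 = 0"
  by (auto simp: dd_def fun_eq_iff)

lemma dd_mono: "I \<subseteq> J \<Longrightarrow> J \<subseteq> J' \<Longrightarrow> dd J' c I = dd J c I"
  by (auto simp: dd_def)

section \<open>Independence of the Cech complex of the sequence\<close>

text \<open>
  The set \<open>U\<close> indexes a long sequence, of which the subsets \<open>J \<subseteq> U\<close> select the sequences to be compared.
\<close>

locale cech = graded_subring R for R :: "'k::field mpoly set" +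
  fixes f :: "nat \<Rightarrow> 'k mpoly" and dg :: "nat \<Rightarrow> int" and U :: "nat set"
  assumes f_R: "j \<in> U \<Longrightarrow> f j \<in> R" and f_neq_0: "j \<in> U \<Longrightarrow> f j \<noteq> 0"
    and f_hom: "j \<in> U \<Longrightarrow> homogeneous (dg j) (f j)"
    and fin_U: "finite U"
begin

abbreviation L :: "nat set \<Rightarrow> int \<Rightarrow> 'k mpoly fract set" where
  "L I d \<equiv> localization_comp R (\<Prod>j\<in>I. f j) d"

lemma prod_facts:
  assumes "I \<subseteq> U"
  shows "(\<Prod>j\<in>I. f j) \<in> R" "(\<Prod>j\<in>I. f j) \<noteq> 0" "homogeneous (sum dg I) (\<Prod>j\<in>I. f j)"
  using assms finite_subset[OF assms fin_U] f_neq_0 f_R f_hom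
  by (auto simp: prod_zero_iff subset_iff intro!: R_prod homogeneous_prod)

lemma L_0: "I \<subseteq> U \<Longrightarrow> 0 \<in> L I d"
  and L_add: "I \<subseteq> U \<Longrightarrow> x \<in> L I d \<Longrightarrow> y \<in> L I d \<Longrightarrow> x + y \<in> L I d"
  and L_uminus: "I \<subseteq> U \<Longrightarrow> x \<in> L I d \<Longrightarrow> - x \<in> L I d"
  and L_sum: "I \<subseteq> U \<Longrightarrow> (\<And>a. a \<in> A \<Longrightarrow> g a \<in> L I d) \<Longrightarrow> sum g A \<in> L I d"
  and L_sg: "I \<subseteq> U \<Longrightarrow> x \<in> L I d \<Longrightarrow> sg j K * x \<in> L I d"
  and L_mult: "I \<subseteq> U \<Longrightarrow> x \<in> L I d \<Longrightarrow> r \<in> R \<Longrightarrow> homogeneous e r \<Longrightarrow> emb r * x \<in> L I (e + d)"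
  unfolding sg_def
  by (rule localization_0[OF prod_facts(1,2,3)] localization_add[OF prod_facts(1,2,3)]
      localization_uminus[OF prod_facts(1,2,3)]
      localization_sum[OF prod_facts(1,2,3)] localization_sign[OF prod_facts(1,2,3)]
      localization_mult[OF prod_facts(1,2,3)]; assumption)+

lemma L_insert: "insert p I \<subseteq> U \<Longrightarrow> x \<in> L I d \<Longrightarrow> x \<in> L (insert p I) d"
proof (cases "p \<in> I")
  case False
  assume "insert p I \<subseteq> U" "x \<in> L I d"
  thus ?thesis
    using False finite_subset[of I U] fin_U prod_facts[of I] f_R[of p] f_neq_0[of p] f_hom[of p]
    by (auto intro: localization_mono)
qed (simp add: insert_absorb)

lemma L_mono: "J \<subseteq> U \<Longrightarrow> I \<subseteq> J \<Longrightarrow> x \<in> L I d \<Longrightarrow> x \<in> L J d"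
proof -
  assume *: "J \<subseteq> U" "I \<subseteq> J" "x \<in> L I d"
  have "x \<in> L (I \<union> A) d" if "finite A" "A \<subseteq> J" for A
    using that by (induction A rule: finite_induct) (use * in \<open>auto intro!: L_insert\<close>)
  from this[of J] show ?thesis using * finite_subset[OF _ fin_U, of J] by (simp add: Un_absorb1)
qed

definition CC :: "nat set \<Rightarrow> nat \<Rightarrow> int \<Rightarrow> (nat set \<Rightarrow> 'k mpoly fract) set" where
  "CC J i d = {c. \<forall>I. if I \<subseteq> J \<and> card I = i then c I \<in> L I d else c I = 0}"

definition ZZ :: "nat set \<Rightarrow> nat \<Rightarrow> int \<Rightarrow> (nat set \<Rightarrow> 'k mpoly fract) set" where
  "ZZ J i d = {c \<in> CC J i d. dd J c = 0}"

definition BB :: "nat set \<Rightarrow> nat \<Rightarrow> int \<Rightarrow> (nat set \<Rightarrow> 'k mpoly fract) set" where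
  "BB J i d = (if i = 0 then {0} else dd J ` CC J (i - 1) d)"

definition sc :: "'k mpoly \<Rightarrow> (nat set \<Rightarrow> 'k mpoly fract) \<Rightarrow> (nat set \<Rightarrow> 'k mpoly fract)" where
  "sc r z = (\<lambda>I. emb r * z I)"

lemma CC_D: "c \<in> CC J i d \<Longrightarrow> I \<subseteq> J \<Longrightarrow> card I = i \<Longrightarrow> c I \<in> L I d"
  "c \<in> CC J i d \<Longrightarrow> \<not> (I \<subseteq> J \<and> card I = i) \<Longrightarrow> c I = 0"
proof -
  assume "c \<in> CC J i d"
  hence "if I \<subseteq> J \<and> card I = i then c I \<in> L I d else c I = 0"
    unfolding CC_def mem_Collect_eq by (rule spec)
  thus "I \<subseteq> J \<Longrightarrow> card I = i \<Longrightarrow> c I \<in> L I d" "\<not> (I \<subseteq> J \<and> card I = i) \<Longrightarrow> c I = 0"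
    by auto
qed

lemma CC_I:
  assumes "\<And>I. I \<subseteq> J \<Longrightarrow> card I = i \<Longrightarrow> c I \<in> L I d" "\<And>I. \<not> (I \<subseteq> J \<and> card I = i) \<Longrightarrow> c I = 0"
  shows "c \<in> CC J i d"
  unfolding CC_def mem_Collect_eq using assms by simp

context
  fixes J assumes J: "J \<subseteq> U"
begin

lemma fin_J: "finite J" using J fin_U by (rule finite_subset)

lemma CC_0: "0 \<in> CC J i d"
  using J by (intro CC_I) (auto intro: L_0)

lemma CC_add: "b \<in> CC J i d \<Longrightarrow> c \<in> CC J i d \<Longrightarrow> b + c \<in> CC J i d"
proof (rule CC_I)
  fix I assume "b \<in> CC J i d" "c \<in> CC J i d" "I \<subseteq> J" "card I = i"
  thus "(b + c) I \<in> L I d" using CC_D(1)[of _ J i d I] J by (simp add: L_add)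
qed (auto simp: CC_D(2))

lemma CC_uminus: "b \<in> CC J i d \<Longrightarrow> - b \<in> CC J i d"
proof (rule CC_I)
  fix I assume "b \<in> CC J i d" "I \<subseteq> J" "card I = i"
  thus "(- b) I \<in> L I d" using CC_D(1)[of _ J i d I] J by (simp add: L_uminus)
qed (auto simp: CC_D(2))

lemma CC_diff: "b \<in> CC J i d \<Longrightarrow> c \<in> CC J i d \<Longrightarrow> b - c \<in> CC J i d"
  using CC_add[of b i d "- c"] CC_uminus[of c i d] by simp

lemma CC_sc: "r \<in> R \<Longrightarrow> homogeneous e r \<Longrightarrow> c \<in> CC J i d \<Longrightarrow> sc r c \<in> CC J i (e + d)"
proof (rule CC_I)
  fix I assume "r \<in> R" "homogeneous e r" "c \<in> CC J i d" "I \<subseteq> J" "card I = i"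
  thus "sc r c I \<in> L I (e + d)" using CC_D(1)[of c J i d I] J by (simp add: sc_def L_mult)
qed (auto simp: CC_D(2) sc_def)

lemma dd_CC:
  assumes "c \<in> CC J i d" shows "dd J c \<in> CC J (Suc i) d"
proof (rule CC_I)
  fix I assume I: "I \<subseteq> J" "card I = Suc i"
  have "c (I - {j}) \<in> L I d" if "j \<in> I" for j
  proof -
    have "c (I - {j}) \<in> L (I - {j}) d" using I that by (intro CC_D(1)[OF assms]) auto
    thus ?thesis using I J by (intro L_mono[of I "I - {j}"]) auto
  qed
  thus "dd J c I \<in> L I d" using I J by (auto simp: dd_sg intro!: L_sum L_sg)
next
  fix I assume I: "\<not> (I \<subseteq> J \<and> card I = Suc i)"
  have "c (I - {j}) = 0" if "I \<subseteq> J" "j \<in> I" for j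
  proof (rule CC_D(2)[OF assms])
    have "finite I" by (rule finite_subset[OF that(1) fin_J])
    thus "\<not> (I - {j} \<subseteq> J \<and> card (I - {j}) = i)"
      using I that card_Suc_Diff1[of I j] by auto
  qed
  thus "dd J c I = 0" by (auto simp: dd_sg)
qed

lemma dd_sc: "dd J (sc r c) = sc r (dd J c)"
  unfolding sc_def by (rule dd_scale)

lemma graded_quotient_cech: "graded_quotient R (ZZ J i) (BB J i) sc"
proof
  fix x y d assume "x \<in> ZZ J i d" "y \<in> ZZ J i d"
  thus "x + y \<in> ZZ J i d" "x - y \<in> ZZ J i d"
    by (auto simp: ZZ_def dd_add dd_diff CC_add CC_diff)
next
  fix d show "0 \<in> BB J i d" using CC_0 dd_0 by (force simp: BB_def)
next
  fix x y d assume "x \<in> BB J i d" "y \<in> BB J i d"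
  thus "x - y \<in> BB J i d"
    by (auto simp: BB_def dd_diff[symmetric] split: if_splits intro!: imageI CC_diff)
next
  fix x d assume "x \<in> BB J i d"
  thus "x \<in> ZZ J i d"
    using dd_CC[of _ "i - 1" d] by (auto simp: BB_def ZZ_def CC_0 dd_dd fin_J split: if_splits)
next
  fix r e x d assume "r \<in> R" "homogeneous e r" "x \<in> ZZ J i d"
  thus "sc r x \<in> ZZ J i (e + d)"
    by (auto simp: ZZ_def CC_sc dd_sc) (simp add: sc_def fun_eq_iff)
next
  fix r e x d assume "r \<in> R" "homogeneous e r" "x \<in> BB J i d"
  thus "sc r x \<in> BB J i (e + d)"
    by (auto simp: BB_def dd_sc[symmetric] CC_sc split: if_splits) (simp add: sc_def fun_eq_iff)
qed (auto simp: sc_def fun_eq_iff emb_mult algebra_simps R_const)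

end

definition in_radical :: "nat set \<Rightarrow> 'k mpoly \<Rightarrow> bool" where
  "in_radical J x \<longleftrightarrow> (\<exists>t a. (\<forall>j\<in>J. a j \<in> R) \<and> x ^ t = (\<Sum>j\<in>J. a j * f j))"

text \<open>
  Membership in the ideal generated by the powers \<open>f\<^sub>j\<^sup>N\<close>.
\<close>

definition pideal :: "nat \<Rightarrow> nat set \<Rightarrow> 'k mpoly \<Rightarrow> bool" where
  "pideal N J x \<longleftrightarrow> (\<exists>a. (\<forall>j\<in>J. a j \<in> R) \<and> x = (\<Sum>j\<in>J. a j * f j ^ N))"

lemma pideal_add: "pideal N J x \<Longrightarrow> pideal N J y \<Longrightarrow> pideal N J (x + y)"
  unfolding pideal_def
proof (elim exE conjE)
  fix a b assume "\<forall>j\<in>J. a j \<in> R" "x = (\<Sum>j\<in>J. a j * f j ^ N)"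
    "\<forall>j\<in>J. b j \<in> R" "y = (\<Sum>j\<in>J. b j * f j ^ N)"
  thus "\<exists>a. (\<forall>j\<in>J. a j \<in> R) \<and> x + y = (\<Sum>j\<in>J. a j * f j ^ N)"
    by (intro exI[of _ "\<lambda>j. a j + b j"]) (auto simp: R_add distrib_right sum.distrib)
qed

lemma pideal_mult: "pideal N J x \<Longrightarrow> r \<in> R \<Longrightarrow> pideal N J (r * x)"
  unfolding pideal_def
proof (elim exE conjE)
  fix a assume "\<forall>j\<in>J. a j \<in> R" "x = (\<Sum>j\<in>J. a j * f j ^ N)" "r \<in> R"
  thus "\<exists>a. (\<forall>j\<in>J. a j \<in> R) \<and> r * x = (\<Sum>j\<in>J. a j * f j ^ N)"
    by (intro exI[of _ "\<lambda>j. r * a j"]) (auto simp: R_mult sum_distrib_left mult_ac)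
qed

lemma pideal_sum: "finite A \<Longrightarrow> (\<And>a. a \<in> A \<Longrightarrow> pideal N J (g a)) \<Longrightarrow> pideal N J (sum g A)"
proof (induction A rule: finite_induct)
  case empty
  show ?case unfolding pideal_def by (rule exI[of _ "\<lambda>_. 0"]) (auto intro: R_0)
qed (auto intro: pideal_add)

lemma pideal_insert: "finite J \<Longrightarrow> pideal N J x \<Longrightarrow> pideal N (insert p J) x"
  unfolding pideal_def
proof (cases "p \<in> J")
  case False
  assume "finite J" "\<exists>a. (\<forall>j\<in>J. a j \<in> R) \<and> x = (\<Sum>j\<in>J. a j * f j ^ N)"
  then obtain a where a: "\<forall>j\<in>J. a j \<in> R" "x = (\<Sum>j\<in>J. a j * f j ^ N)" by blast
  have "(\<Sum>j\<in>J. a j * f j ^ N) = (\<Sum>j\<in>insert p J. (a(p := 0)) j * f j ^ N)"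
    using False \<open>finite J\<close> by (auto intro!: sum.cong)
  thus "\<exists>a. (\<forall>j\<in>insert p J. a j \<in> R) \<and> x = (\<Sum>j\<in>insert p J. a j * f j ^ N)"
    using a R_0 by (intro exI[of _ "a(p := 0)"]) auto
qed (simp add: insert_absorb)

text \<open>
  In a sufficiently high power of a sum of two terms, each term of the binomial expansion contains a high
  power of one of them.
\<close>

lemma power_of_combination:
  assumes "J \<subseteq> U" "\<And>j. j \<in> J \<Longrightarrow> a j \<in> R"
  shows "\<exists>t. pideal N J ((\<Sum>j\<in>J. a j * f j) ^ t)"
proof -
  have "\<exists>t. pideal N J ((\<Sum>j\<in>J. a j * f j) ^ t)" if "finite J" "J \<subseteq> U" "\<And>j. j \<in> J \<Longrightarrow> a j \<in> R"
    using that
  proof (induction J rule: finite_induct)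
    case empty
    show ?case by (intro exI[of _ 1]) (auto simp: pideal_def)
  next
    case (insert p J)
    then obtain t where t: "pideal N J ((\<Sum>j\<in>J. a j * f j) ^ t)" by auto
    let ?x = "\<Sum>j\<in>J. a j * f j" and ?y = "a p * f p"
    have R: "?x \<in> R" "?y \<in> R" "a p \<in> R" "f p \<in> R"
      using insert.prems f_R by (auto intro!: R_sum R_mult)
    have of_nat_const: "of_nat m = const (of_nat m)" for m
      by (simp add: const_def single_of_nat)
    have y: "pideal N (insert p J) (f p ^ N)"
      unfolding pideal_def
      using insert.hyps R_0 R_1
      by (intro exI[of _ "\<lambda>j. if j = p then 1 else 0"]) (auto simp: sum.neutral)
    have "pideal N (insert p J) ((?x + ?y) ^ (t + N))"
      unfolding binomial_ring
    proof (rule pideal_sum)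
      fix k assume "k \<in> {..t + N}"
      show "pideal N (insert p J) (of_nat (t + N choose k) * ?x ^ k * ?y ^ (t + N - k))"
      proof (cases "t \<le> k")
        case True
        have "?x ^ k = ?x ^ (k - t) * ?x ^ t" using True by (simp flip: power_add)
        hence eq: "of_nat (t + N choose k) * ?x ^ k * ?y ^ (t + N - k) =
            (const (of_nat (t + N choose k)) * ?x ^ (k - t) * ?y ^ (t + N - k)) * ?x ^ t"
          unfolding of_nat_const by (simp only: mult_ac)
        show ?thesis
          unfolding eq by (intro pideal_mult pideal_insert insert.hyps t R_mult R_power R_const R)
      next
        case False
        hence "t + N - k = N + (t - k)" by simp
        hence eq: "of_nat (t + N choose k) * ?x ^ k * ?y ^ (t + N - k) =
            (const (of_nat (t + N choose k)) * ?x ^ k * a p ^ N * ?y ^ (t - k)) * f p ^ N"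
          unfolding of_nat_const by (simp only: power_add power_mult_distrib mult_ac)
        show ?thesis
          unfolding eq by (intro pideal_mult y R_mult R_power R_const R)
      qed
    qed simp
    thus ?case using insert.hyps by (auto simp: add.commute)
  qed
  thus ?thesis using assms finite_subset[OF assms(1) fin_U] by blast
qed

text \<open>
  As all \<open>f\<^sub>j\<close> are homogeneous, one may pass to homogeneous components of the coefficients.
\<close>

lemma homogeneous_power_combination:
  assumes J: "J \<subseteq> U" and p: "p \<in> U" and rad: "in_radical J (f p)"
  shows "\<exists>M a. (\<forall>j\<in>J. a j \<in> R \<and> homogeneous (int M * dg p - int N * dg j) (a j)) \<and>
    f p ^ M = (\<Sum>j\<in>J. a j * f j ^ N)"
proof -
  obtain t a where a: "\<forall>j\<in>J. a j \<in> R" "f p ^ t = (\<Sum>j\<in>J. a j * f j)"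
    using rad by (auto simp: in_radical_def)
  obtain s where s: "pideal N J ((\<Sum>j\<in>J. a j * f j) ^ s)"
    using power_of_combination[OF J] a(1) by blast
  then obtain b where b: "\<And>j. j \<in> J \<Longrightarrow> b j \<in> R" "f p ^ (t * s) = (\<Sum>j\<in>J. b j * f j ^ N)"
    unfolding pideal_def a(2)[symmetric] power_mult by blast
  let ?M = "t * s" and ?d = "\<lambda>j. int (t * s) * dg p - int N * dg j"
  have "f p ^ ?M = hcomp (int ?M * dg p) (f p ^ ?M)"
    by (rule hcomp_idem[symmetric, OF homogeneous_power[OF f_hom[OF p]]])
  also have "\<dots> = (\<Sum>j\<in>J. hcomp (int ?M * dg p) (f j ^ N * b j))"
    unfolding b(2) hcomp_sum by (simp add: mult.commute)
  also have "\<dots> = (\<Sum>j\<in>J. hcomp (?d j) (b j) * f j ^ N)"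
  proof (intro sum.cong refl)
    fix j assume "j \<in> J"
    hence "homogeneous (int N * dg j) (f j ^ N)" using J by (intro homogeneous_power f_hom) auto
    from hcomp_mult[OF this, of "?d j" "b j"]
    show "hcomp (int ?M * dg p) (f j ^ N * b j) = hcomp (?d j) (b j) * f j ^ N"
      by (simp add: mult.commute)
  qed
  finally show ?thesis
    using b(1) by (intro exI[of _ ?M] exI[of _ "\<lambda>j. hcomp (?d j) (b j)"]) (auto intro: R_hcomp)
qed

lemma uniform_exponent:
  assumes "finite A" "\<And>I. I \<in> A \<Longrightarrow> \<exists>t. P I t" "\<And>I t t'. I \<in> A \<Longrightarrow> P I t \<Longrightarrow> t \<le> t' \<Longrightarrow> P I (t' :: nat)"
  shows "\<exists>N. \<forall>I\<in>A. P I N"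
  using assms
proof (induction A rule: finite_induct)
  case (insert I A)
  then obtain N t where "\<forall>I\<in>A. P I N" "P I t" by (metis insertI1 insertI2)
  hence "\<forall>I'\<in>insert I A. P I' (max N t)"
    using insert.prems(2) by (metis insertE insertI1 insertI2 max.cobounded1 max.cobounded2)
  thus ?case by blast
qed simp

text \<open>
  After inverting an element \<open>f\<^sub>p\<close> of the radical, the complex becomes exact. For every \<open>N\<close> some power of
  \<open>f\<^sub>p\<close> is \<open>\<Sum>\<^sub>j a\<^sub>j f\<^sub>j\<^sup>N\<close>, which gives a partition \<open>1 = \<Sum>\<^sub>j \<kappa>\<^sub>j\<close> with \<open>\<kappa>\<^sub>j = a\<^sub>j f\<^sub>j\<^sup>N / f\<^sub>p\<^sup>M\<close>. The cochain \<open>\<Sum>\<^sub>j \<kappa>\<^sub>j h\<^sub>j(c)\<close> is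
  a preimage of the cocycle \<open>c\<close>, and the unwanted denominator \<open>f\<^sub>j\<^sup>N\<close> of \<open>h\<^sub>j(c)\<close> is cancelled by \<open>\<kappa>\<^sub>j\<close>.
\<close>

lemma localized_exact:
  assumes J: "insert p J \<subseteq> U" "p \<notin> J" and rad: "in_radical J (f p)"
    and c: "\<And>I. I \<subseteq> J \<Longrightarrow> card I = i \<Longrightarrow> c I \<in> L (insert p I) d"
      "\<And>I. \<not> (I \<subseteq> J \<and> card I = i) \<Longrightarrow> c I = 0"
    and cocycle: "dd J c = 0"
  shows "\<exists>b. (\<forall>I. I \<subseteq> J \<longrightarrow> Suc (card I) = i \<longrightarrow> b I \<in> L (insert p I) d) \<and>
    (\<forall>I. \<not> (I \<subseteq> J \<and> Suc (card I) = i) \<longrightarrow> b I = 0) \<and> dd J b = c"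
proof -
  have fin: "finite J" using J by (intro finite_subset[OF _ fin_U]) auto
  have p: "p \<in> U" and JU: "J \<subseteq> U" using J by auto
  let ?F = "\<lambda>I. \<Prod>j\<in>I. f j"
  let ?D = "\<lambda>I. with_denominator (?F (insert p I)) (sum dg (insert p I)) d"
  have "\<exists>N. \<forall>I\<in>{I. I \<subseteq> J \<and> card I = i}. c I \<in> ?D I N"
  proof (rule uniform_exponent)
    fix I assume I: "I \<in> {I. I \<subseteq> J \<and> card I = i}"
    hence IU: "insert p I \<subseteq> U" using J by auto
    note pf = prod_facts[OF IU]
    show "\<exists>t. c I \<in> ?D I t"
      using c(1)[of I] I unfolding localization_comp_eq[OF pf(3,2)] by blast
    fix t t' :: nat assume "c I \<in> ?D I t" "t \<le> t'"
    thus "c I \<in> ?D I t'" by (rule with_denominator_mono[OF _ _ pf])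
  qed (use fin in auto)
  then obtain N where N: "\<And>I. I \<subseteq> J \<Longrightarrow> card I = i \<Longrightarrow> c I \<in> ?D I N" by blast
  obtain M a where a: "\<And>j. j \<in> J \<Longrightarrow> a j \<in> R"
      "\<And>j. j \<in> J \<Longrightarrow> homogeneous (int M * dg p - int N * dg j) (a j)"
      "f p ^ M = (\<Sum>j\<in>J. a j * f j ^ N)"
    using homogeneous_power_combination[OF JU p rad, of N] by blast
  define \<kappa> where "\<kappa> j = emb (a j) * emb (f j) ^ N / emb (f p) ^ M" for j
  have fp: "emb (f p) \<noteq> 0" using f_neq_0[OF p] by simp
  have "(\<Sum>j\<in>J. \<kappa> j) = emb (f p ^ M) / emb (f p) ^ M"
    unfolding a(3) \<kappa>_def by (simp add: emb_sum emb_mult emb_power sum_divide_distrib)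
  hence \<kappa>_sum: "(\<Sum>j\<in>J. \<kappa> j) = 1" using fp by (simp add: emb_power)
  define b where "b = (\<lambda>I. \<Sum>j\<in>J. \<kappa> j * hh j c I)"
  have "dd J b = (\<lambda>I. \<Sum>j\<in>J. dd J (\<lambda>I. \<kappa> j * hh j c I) I)" unfolding b_def by (rule dd_sum)
  also have "\<dots> = (\<lambda>I. \<Sum>j\<in>J. \<kappa> j * c I)"
  proof (intro ext sum.cong refl)
    fix I j assume "j \<in> J"
    have "c I = 0" if "\<not> I \<subseteq> J" for I using that c(2) by blast
    hence "dd J (hh j c) = c" using \<open>j \<in> J\<close> fin cocycle by (intro dd_hh)
    thus "dd J (\<lambda>I. \<kappa> j * hh j c I) I = \<kappa> j * c I" by (simp add: dd_scale)
  qed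
  also have "\<dots> = c" by (simp add: \<kappa>_sum flip: sum_distrib_right)
  finally have dd: "dd J b = c" .
  have zero: "b I = 0" if "\<not> (I \<subseteq> J \<and> Suc (card I) = i)" for I
  proof -
    have "hh j c I = 0" if j: "j \<in> J" for j
    proof (cases "j \<in> I")
      case False
      have "\<not> (insert j I \<subseteq> J \<and> card (insert j I) = i)"
      proof
        assume *: "insert j I \<subseteq> J \<and> card (insert j I) = i"
        hence "finite I" using fin by (auto dest: finite_subset)
        thus False using * False \<open>\<not> (I \<subseteq> J \<and> Suc (card I) = i)\<close> by auto
      qed
      thus ?thesis using c(2) by (simp add: hh_def)
    qed (simp add: hh_def)
    thus ?thesis by (simp add: b_def)
  qed
  have "b I \<in> L (insert p I) d" if I: "I \<subseteq> J" "Suc (card I) = i" for I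
    unfolding b_def
  proof (rule L_sum)
    show IU: "insert p I \<subseteq> U" using I J by auto
    fix j assume j: "j \<in> J"
    show "\<kappa> j * hh j c I \<in> L (insert p I) d"
    proof (cases "j \<in> I")
      case False
      have finI: "finite I" by (rule finite_subset[OF I(1) fin])
      have pI: "p \<notin> I" "p \<noteq> j" using I J j by auto
      let ?G = "?F (insert p I)" and ?e = "sum dg (insert p I)"
      have "c (insert j I) \<in> ?D (insert j I) N" using I j False finI by (intro N) auto
      then obtain r where r: "r \<in> R" "homogeneous (d + int N * sum dg (insert p (insert j I))) r"
        "c (insert j I) = emb r / emb (?F (insert p (insert j I))) ^ N"
        by (auto simp: with_denominator_def)
      have ins: "insert p (insert j I) = insert j (insert p I)" by auto
      have F1: "?F (insert p (insert j I)) = f j * ?G" unfolding ins using finI False pI by simp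
      have F2: "?G = f p * ?F I" using finI pI by simp
      have nz: "emb (f j) \<noteq> 0" "emb ?G \<noteq> 0" "emb (?F I) \<noteq> 0"
        using prod_facts(2)[OF IU] prod_facts(2)[of I] f_neq_0[of j] IU j JU by auto
      let ?r = "a j * r * ?F I ^ M"
      have "\<kappa> j * c (insert j I) = emb ?r / emb ?G ^ (M + N)"
      proof -
        have "\<kappa> j * c (insert j I) = emb (a j * r) / (emb (f p) ^ M * emb ?G ^ N)"
          unfolding \<kappa>_def r(3) F1 using nz by (simp add: emb_mult power_mult_distrib)
        also have "\<dots> = emb (a j * r) * emb (?F I) ^ M / ((emb (f p) * emb (?F I)) ^ M * emb ?G ^ N)"
          using nz by (simp add: power_mult_distrib)
        also have "emb (f p) * emb (?F I) = emb ?G" unfolding F2 by (simp add: emb_mult)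
        finally show ?thesis by (simp add: power_add emb_mult emb_power)
      qed
      moreover have "?r \<in> R" using a(1)[OF j] r(1) prod_facts(1)[of I] IU by (intro R_mult R_power) auto
      moreover have "homogeneous (d + int (M + N) * ?e) ?r"
      proof (rule homogeneous_mult'[OF homogeneous_mult[OF a(2)[OF j] r(2)]
            homogeneous_power[OF prod_facts(3)[of I], of M]])
        show "I \<subseteq> U" using IU by auto
        show "int M * dg p - int N * dg j + (d + int N * sum dg (insert p (insert j I))) +
            int M * sum dg I = d + int (M + N) * ?e"
          unfolding ins using finI False pI by (simp add: algebra_simps)
      qed
      ultimately have "\<kappa> j * c (insert j I) \<in> with_denominator ?G ?e d (M + N)"
        unfolding with_denominator_def by blast
      hence "\<kappa> j * c (insert j I) \<in> L (insert p I) d"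
        by (rule with_denominator_localization[OF prod_facts[OF IU]])
      hence "sg j I * (\<kappa> j * c (insert j I)) \<in> L (insert p I) d" by (rule L_sg[OF IU])
      thus ?thesis using False by (simp add: hh_def mult_ac)
    qed (simp add: hh_def L_0[OF IU])
  qed
  thus ?thesis using zero dd by blast
qed

abbreviation omega :: "nat set \<Rightarrow> nat \<Rightarrow> ('k mpoly, (nat set \<Rightarrow> 'k mpoly fract) \<Rightarrow> 'k) graded_module" where
  "omega J i \<equiv> qdual (ZZ J i) (BB J i) sc"

text \<open>
  Restriction to the subsets of \<open>J\<close> maps the complex on \<open>insert p J\<close> onto the complex on \<open>J\<close>. Its
  kernel, the cochains on the sets that contain \<open>p\<close>, is the complex of \<open>J\<close> localised at \<open>f\<^sub>p\<close> in a
  shifted degree, which is exact by \<open>localized_exact\<close>. So restriction is an isomorphism in cohomology.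
\<close>

lemma independence_insert:
  assumes J: "insert p J \<subseteq> U" "p \<notin> J" and rad: "in_radical J (f p)"
  shows "graded_iso R (omega J i) (omega (insert p J) i)"
proof (rule qdual_iso[where h = "\<lambda>c I. if I \<subseteq> J then c I else 0"])
  let ?h = "\<lambda>c I. if I \<subseteq> J then c I else 0 :: 'k mpoly fract" and ?J = "insert p J"
  have JU: "J \<subseteq> U" and p: "p \<in> U" using J by auto
  have fin: "finite J" "finite ?J" using finite_subset[OF J(1) fin_U] by auto
  have split: "\<exists>A. I = insert p A \<and> A \<subseteq> J \<and> p \<notin> A" if "I \<subseteq> ?J" "p \<in> I" for I
    using that J(2) by (intro exI[of _ "I - {p}"]) auto
  show "graded_quotient R (ZZ J i) (BB J i) sc" by (rule graded_quotient_cech[OF JU])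
  show "graded_quotient R (ZZ ?J i) (BB ?J i) sc" by (rule graded_quotient_cech[OF J(1)])
  have h_CC: "?h c \<in> CC J i d" if "c \<in> CC ?J i d" for c i d
  proof (rule CC_I)
    fix I assume "I \<subseteq> J" "card I = i"
    thus "?h c I \<in> L I d" using CC_D(1)[OF that, of I] by auto
  next
    fix I assume "\<not> (I \<subseteq> J \<and> card I = i)"
    thus "?h c I = 0" using CC_D(2)[OF that, of I] by auto
  qed
  have h_dd: "dd J (?h c) = ?h (dd ?J c)" for c
  proof
    fix I
    show "dd J (?h c) I = ?h (dd ?J c) I"
      by (auto simp: dd_def intro!: sum.cong)
  qed
  show "?h c \<in> ZZ J i d" if "c \<in> ZZ ?J i d" for c d
    using that h_CC by (auto simp: ZZ_def h_dd)
  show "?h c \<in> BB J i d" if "c \<in> BB ?J i d" for c d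
    using that h_CC by (auto simp: BB_def h_dd[symmetric] split: if_splits)
  show "?h (x + y) = ?h x + ?h y" for x y by auto
  show "?h (sc r x) = sc r (?h x)" for r x by (auto simp: sc_def)
  have cone: "dd ?J b (insert p A) = sg p (insert p A) * b A"
    if "A \<subseteq> J" "\<And>I. \<not> I \<subseteq> J \<Longrightarrow> b I = 0" for A and b :: "nat set \<Rightarrow> 'k mpoly fract"
  proof -
    have pA: "p \<notin> A" "finite A" using that(1) J(2) finite_subset[OF that(1) fin(1)] by auto
    have "dd ?J b (insert p A) = (\<Sum>j\<in>insert p A. sg j (insert p A) * b (insert p A - {j}))"
      using that by (auto simp: dd_sg)
    also have "\<dots> = (\<Sum>j\<in>insert p A. if j = p then sg p (insert p A) * b A else 0)"
    proof (intro sum.cong refl)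
      fix j assume "j \<in> insert p A"
      show "sg j (insert p A) * b (insert p A - {j}) = (if j = p then sg p (insert p A) * b A else 0)"
        using pA J(2) that(2)[of "insert p A - {j}"] by auto
    qed
    also have "\<dots> = sg p (insert p A) * b A" using pA by simp
    finally show ?thesis .
  qed
  show "\<exists>z'\<in>ZZ ?J i d. z - ?h z' \<in> BB J i d" if z: "z \<in> ZZ J i d" for z d
  proof -
    have zC: "z \<in> CC J i d" and dz: "dd J z = 0" using z by (auto simp: ZZ_def)
    have "z I \<in> L (insert p I) d" if "I \<subseteq> J" "card I = i" for I
      using CC_D(1)[OF zC that] that J by (intro L_insert) auto
    then obtain b where b: "\<And>I. I \<subseteq> J \<Longrightarrow> Suc (card I) = i \<Longrightarrow> b I \<in> L (insert p I) d"
      "\<And>I. \<not> (I \<subseteq> J \<and> Suc (card I) = i) \<Longrightarrow> b I = 0" "dd J b = z"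
      using localized_exact[OF J rad _ CC_D(2)[OF zC] dz] by blast
    \<comment> \<open>The coboundary, in the larger complex, of the localised cochain \<open>b\<close>: it extends \<open>z\<close>, and its values
      at the sets that contain \<open>p\<close> lie in the right localisations because \<open>b\<close> does.\<close>
    let ?z = "dd ?J b"
    have zI: "?z I = z I" if "I \<subseteq> J" for I using that b(3) dd_mono[of I J ?J b] by auto
    have cn: "?z (insert p A) = sg p (insert p A) * b A" if "A \<subseteq> J" for A
      using that b(2) by (intro cone) auto
    have "?z \<in> CC ?J i d"
    proof (rule CC_I)
      fix I assume I: "I \<subseteq> ?J" "card I = i"
      show "?z I \<in> L I d"
      proof (cases "p \<in> I")
        case True
        then obtain A where A: "I = insert p A" "A \<subseteq> J" "p \<notin> A" using split[OF I(1) True] by (elim exE conjE)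
        have "finite A" by (rule finite_subset[OF A(2) fin(1)])
        hence "b A \<in> L I d" using A I b(1)[of A] by simp
        thus ?thesis using A I J unfolding A(1) cn[OF A(2)] by (intro L_sg) auto
      next
        case False
        hence "I \<subseteq> J" using I by auto
        thus ?thesis using zI CC_D(1)[OF zC _ I(2)] by simp
      qed
    next
      fix I assume I: "\<not> (I \<subseteq> ?J \<and> card I = i)"
      show "?z I = 0"
      proof (cases "I \<subseteq> ?J")
        case IJ: True
        show ?thesis
        proof (cases "p \<in> I")
          case True
          then obtain A where A: "I = insert p A" "A \<subseteq> J" "p \<notin> A" using split[OF IJ True] by (elim exE conjE)
          have "finite A" by (rule finite_subset[OF A(2) fin(1)])
          hence "b A = 0" using A I IJ b(2)[of A] by simp
          thus ?thesis unfolding A(1) cn[OF A(2)] by simp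
        next
          case False
          hence "I \<subseteq> J" using IJ by auto
          thus ?thesis using zI CC_D(2)[OF zC, of I] I IJ by simp
        qed
      qed (simp add: dd_def)
    qed
    hence "?z \<in> ZZ ?J i d" using fin by (simp add: ZZ_def dd_dd)
    moreover have "z - ?h ?z = 0"
      using zI CC_D(2)[OF zC] by (auto simp: fun_eq_iff)
    moreover have "0 \<in> BB J i d"
      using graded_quotient.B_0[OF graded_quotient_cech[OF JU]] .
    ultimately show ?thesis by (intro bexI[of _ ?z]) simp_all
  qed
  show "z' \<in> BB ?J i d" if z': "z' \<in> ZZ ?J i d" and hz': "?h z' \<in> BB J i d" for z' d
  proof -
    have z'C: "z' \<in> CC ?J i d" and dz': "dd ?J z' = 0" using z' by (auto simp: ZZ_def)
    show ?thesis
    proof (cases i)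
      case 0
      have "z' I = 0" for I
      proof (cases "I = {}")
        case True
        have "?h z' = 0" using hz' by (simp add: BB_def 0)
        from fun_cong[OF this, of I] show ?thesis using True by simp
      next
        case False
        have "finite I" if "I \<subseteq> ?J" by (rule finite_subset[OF that fin(2)])
        thus ?thesis using False 0 by (intro CC_D(2)[OF z'C]) auto
      qed
      thus ?thesis by (simp add: BB_def 0 fun_eq_iff)
    next
      case (Suc m)
      obtain b0 where b0: "b0 \<in> CC J m d" "?h z' = dd J b0" using hz' by (auto simp: BB_def Suc)
      have b0': "b0 \<in> CC ?J m d"
      proof (rule CC_I)
        fix I assume "I \<subseteq> ?J" "card I = m"
        thus "b0 I \<in> L I d"
          using CC_D[OF b0(1), of I] J by (cases "I \<subseteq> J") (auto intro: L_0)
      qed (use CC_D(2)[OF b0(1)] in blast)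
      \<comment> \<open>The cocycle \<open>w\<close> lives on the sets that contain \<open>p\<close>. Removing \<open>p\<close> from them turns it into a cocycle \<open>b\<close>
        of the localised complex, \<open>b = dd J b'\<close>, and \<open>b - dd ?J b'\<close> lives on the sets that contain \<open>p\<close> again.\<close>
      define w where "w = z' - dd ?J b0"
      have wC: "w \<in> CC ?J i d"
        unfolding w_def using z'C dd_CC[OF J(1) b0'] by (intro CC_diff J(1)) (simp_all add: Suc)
      have dw: "dd ?J w = 0" using dz' fin by (simp add: w_def dd_diff dd_dd)
      have wJ: "w I = 0" if "I \<subseteq> J" for I
        using fun_cong[OF b0(2), of I] that dd_mono[OF that subset_insertI, of p b0]
        by (auto simp: w_def)
      define b where "b = hh p w"
      have db: "dd ?J b = w"
        unfolding b_def using fin dw CC_D(2)[OF wC] by (intro dd_hh) auto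
      have bJ: "b I = 0" if "\<not> (I \<subseteq> J \<and> card I = m)" for I
      proof (cases "p \<in> I")
        case False
        have "\<not> (insert p I \<subseteq> ?J \<and> card (insert p I) = i)"
        proof
          assume *: "insert p I \<subseteq> ?J \<and> card (insert p I) = i"
          hence "finite I" using fin by (auto dest: finite_subset)
          thus False using * that False Suc by auto
        qed
        thus ?thesis using CC_D(2)[OF wC] by (simp add: b_def hh_def)
      qed (simp add: b_def hh_def)
      have bL: "b I \<in> L (insert p I) d" if "I \<subseteq> J" "card I = m" for I
      proof -
        have "p \<notin> I" "finite I" using that(1) J(2) finite_subset[OF that(1) fin(1)] by auto
        hence "w (insert p I) \<in> L (insert p I) d" using that Suc by (intro CC_D(1)[OF wC]) auto
        thus ?thesis using \<open>p \<notin> I\<close> that J by (auto simp: b_def hh_def intro!: L_sg)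
      qed
      have "dd J b = 0"
      proof
        fix I show "dd J b I = 0 I"
          using dd_mono[OF _ subset_insertI, of I J p b] wJ[of I] db
          by (cases "I \<subseteq> J") (simp_all, simp add: dd_def)
      qed
      from localized_exact[OF J rad bL bJ this] obtain b' where
        b': "\<And>I. I \<subseteq> J \<Longrightarrow> Suc (card I) = m \<Longrightarrow> b' I \<in> L (insert p I) d"
          "\<And>I. \<not> (I \<subseteq> J \<and> Suc (card I) = m) \<Longrightarrow> b' I = 0" "dd J b' = b" by blast
      have cn: "dd ?J b' (insert p A) = sg p (insert p A) * b' A" if "A \<subseteq> J" for A
        using that b'(2) by (intro cone) auto
      define g where "g = b - dd ?J b'"
      have gJ: "g I = 0" if "\<not> (I \<subseteq> ?J \<and> p \<in> I)" for I
      proof (cases "I \<subseteq> J")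
        case True
        thus ?thesis using b'(3) dd_mono[OF True subset_insertI, of p b'] by (simp add: g_def)
      next
        case False
        hence "\<not> I \<subseteq> ?J" using that by auto
        thus ?thesis using False bJ by (simp add: g_def dd_def)
      qed
      have gp: "g (insert p A) = - (sg p (insert p A) * b' A)" if "A \<subseteq> J" for A
        using that cn[OF that] by (simp add: g_def b_def hh_def)
      have gC: "g \<in> CC ?J m d"
      proof (rule CC_I)
        fix I assume I: "I \<subseteq> ?J" "card I = m"
        show "g I \<in> L I d"
        proof (cases "p \<in> I")
          case True
          then obtain A where A: "I = insert p A" "A \<subseteq> J" "p \<notin> A" using split[OF I(1) True] by (elim exE conjE)
          have "finite A" by (rule finite_subset[OF A(2) fin(1)])
          hence "b' A \<in> L I d" using A I b'(1)[of A] by simp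
          thus ?thesis using A I J unfolding A(1) gp[OF A(2)] by (intro L_uminus L_sg) auto
        next
          case False
          thus ?thesis using gJ I J by (auto intro!: L_0)
        qed
      next
        fix I assume I: "\<not> (I \<subseteq> ?J \<and> card I = m)"
        show "g I = 0"
        proof (cases "I \<subseteq> ?J \<and> p \<in> I")
          case True
          then obtain A where A: "I = insert p A" "A \<subseteq> J" "p \<notin> A" using split[of I] True by (elim exE conjE) auto
          have "finite A" by (rule finite_subset[OF A(2) fin(1)])
          hence "b' A = 0" using A I True b'(2)[of A] by simp
          thus ?thesis unfolding A(1) gp[OF A(2)] by simp
        qed (rule gJ)
      qed
      have "dd ?J g = w" using fin by (simp add: g_def dd_diff dd_dd db)
      hence "z' = dd ?J (g + b0)" by (simp add: dd_add w_def)
      moreover have "g + b0 \<in> CC ?J m d" using gC b0' by (rule CC_add[OF J(1)])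
      ultimately show ?thesis by (auto simp: BB_def Suc)
    qed
  qed
qed

lemma in_radical_mono:
  assumes "in_radical J x" "J \<subseteq> J'" "J' \<subseteq> U" shows "in_radical J' x"
proof -
  obtain t a where a: "\<forall>j\<in>J. a j \<in> R" "x ^ t = (\<Sum>j\<in>J. a j * f j)"
    using assms by (auto simp: in_radical_def)
  have "finite J'" by (rule finite_subset[OF assms(3) fin_U])
  hence "(\<Sum>j\<in>J. a j * f j) = (\<Sum>j\<in>J'. (if j \<in> J then a j else 0) * f j)"
    using assms by (intro sum.mono_neutral_cong_left) auto
  thus ?thesis unfolding in_radical_def
    using a R_0 by (intro exI[of _ t] exI[of _ "\<lambda>j. if j \<in> J then a j else 0"]) auto
qed

theorem independence:
  assumes "J \<union> P \<subseteq> U" "J \<inter> P = {}" "\<And>p. p \<in> P \<Longrightarrow> in_radical J (f p)"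
  shows "graded_iso R (omega J i) (omega (J \<union> P) i)"
proof -
  have "finite P" using assms(1) by (intro finite_subset[OF _ fin_U]) auto
  thus ?thesis using assms
  proof (induction P rule: finite_induct)
    case empty
    show ?case by (simp add: graded_iso_refl)
  next
    case (insert p P)
    have "graded_iso R (omega J i) (omega (J \<union> P) i)"
      using insert.prems by (intro insert.IH) auto
    moreover have "graded_iso R (omega (J \<union> P) i) (omega (insert p (J \<union> P)) i)"
      using insert.prems insert.hyps
      by (intro independence_insert in_radical_mono[of J _ "J \<union> P"]) auto
    ultimately show ?case by (auto intro: graded_iso_trans)
  qed
qed

end

section \<open>Monomials in the elementary symmetric polynomials\<close>

definition vec :: "nat set \<Rightarrow> nat \<Rightarrow> nat \<Rightarrow>\<^sub>0 nat" where
  "vec I M = (\<Sum>i\<in>I. single i M)"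

lemma lookup_vec: "finite I \<Longrightarrow> lookup (vec I M) i = (if i \<in> I then M else 0)"
  unfolding vec_def lookup_sum lookup_single when_def by simp

lemma keys_vec: "finite I \<Longrightarrow> keys (vec I M) \<subseteq> I"
  by (auto simp: in_keys_iff lookup_vec split: if_splits)

lemma vec_add: "vec I (M + N) = vec I M + vec I N"
  by (simp add: vec_def single_add sum.distrib)

lemma mon_vec: "finite I \<Longrightarrow> mon g (vec I M) = (\<Prod>i\<in>I. g i) ^ M"
  by (simp add: mon_superset[OF _ keys_vec] lookup_vec prod_power_distrib)

lemma weight_vec: "finite I \<Longrightarrow> weight (\<lambda>i. i) (vec I M) = M * \<Sum>I"
  by (simp add: weight_superset[OF _ keys_vec] lookup_vec sum_distrib_left mult.commute)

lemma vec_complement: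
  assumes "finite I" "keys s \<subseteq> I"
  obtains M s' where "keys s' \<subseteq> I" "s + s' = vec I M"
proof -
  let ?M = "\<Sum>i\<in>I. lookup s i"
  have le: "lookup s i \<le> ?M" if "i \<in> I" for i using that assms(1) by (intro member_le_sum) auto
  show ?thesis
  proof (rule that[of "vec I ?M - s" ?M])
    show "keys (vec I ?M - s) \<subseteq> I"
      using assms by (auto simp: in_keys_iff lookup_minus lookup_vec split: if_splits)
    show "s + (vec I ?M - s) = vec I ?M"
    proof (rule poly_mapping_eqI)
      fix i
      show "lookup (s + (vec I ?M - s)) i = lookup (vec I ?M) i"
        using assms le[of i] by (auto simp: lookup_add lookup_minus lookup_vec in_keys_iff)
    qed
  qed
qed

lemma lookup_single_mult: "lookup (single m 1 * p) (m + k) = lookup (p :: 'k::field mpoly) k"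
proof -
  have "single m 1 * p = (\<Sum>m'\<in>keys p. single (m + m') (lookup p m'))"
    by (subst poly_mapping_decomp[of p]) (simp add: sum_distrib_left mult_single)
  also have "lookup \<dots> (m + k) = (\<Sum>m'\<in>keys p. if m' = k then lookup p k else 0)"
    unfolding lookup_sum by (intro sum.cong) (auto simp: lookup_single when_def)
  also have "\<dots> = lookup p k" by (auto simp: in_keys_iff)
  finally show ?thesis .
qed

lemma lookup_single_mult_eq_0:
  assumes "lookup k i < lookup m i" shows "lookup (single m 1 * (p :: 'k::field mpoly)) k = 0"
proof (rule ccontr)
  assume "lookup (single m 1 * p) k \<noteq> 0"
  hence "k \<in> keys (single m 1 * p)" by (simp add: in_keys_iff)
  then obtain b where "k = m + b" using Poly_Mapping.keys_mult[of "single m 1" p] by auto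
  thus False using assms by (simp add: lookup_add)
qed

lemma mon_esym_sym: "mon (esym n) s \<in> sym_polys n"
  unfolding mon_def by (intro invariants_prod invariants_power esym_sym)

lemma single_poly_ring: "keys s \<subseteq> {1..n} \<Longrightarrow> single s c \<in> poly_ring n"
  by (auto simp: poly_ring_def)

lemma in_esym_mon: "keys s \<subseteq> {1..n} \<Longrightarrow> in_esym n (mon (esym n) s) = single s 1"
  by (rule in_esym_eqI) (simp_all add: single_poly_ring subst_single)

lemma homogeneous_mon_esym: "homogeneous (int (weight (\<lambda>i. i) s)) (mon (esym n) s)"
  by (rule homogeneous_mon) (rule homogeneous_esym)

lemma esym_neq_0: "i \<in> {1..n} \<Longrightarrow> esym n i \<noteq> (0 :: 'k::field mpoly)"
proof
  assume "i \<in> {1..n}" "esym n i = (0 :: 'k mpoly)"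
  hence "var i = (0 :: 'k mpoly)"
    using esym_algebraically_independent[of "var i :: 'k mpoly" n] by auto
  thus False by simp
qed

lemma mon_esym_neq_0: "keys s \<subseteq> {1..n} \<Longrightarrow> mon (esym n) s \<noteq> 0"
proof -
  assume "keys s \<subseteq> {1..n}"
  hence "esym n i \<noteq> (0 :: 'a mpoly)" if "i \<in> keys s" for i using that by (intro esym_neq_0) blast
  thus ?thesis unfolding mon_def by (auto simp: prod_zero_iff)
qed

lemma finite_bounded_exponents:
  "finite {s. keys s \<subseteq> {1..n} \<and> weight (\<lambda>i. i) s \<le> K}" (is "finite ?S")
proof (rule finite_imageD)
  have "lookup ` ?S \<subseteq> {f. \<forall>i. (i \<in> {1..n} \<longrightarrow> f i \<in> {..K}) \<and> (i \<notin> {1..n} \<longrightarrow> f i = 0)}"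
  proof clarify
    fix s i assume s: "keys s \<subseteq> {1..n}" "weight (\<lambda>i. i) s \<le> K"
    have "lookup s i \<le> K" if "i \<in> {1..n}"
    proof (cases "i \<in> keys s")
      case True
      have "lookup s i \<le> i * lookup s i" using that by simp
      also have "\<dots> \<le> (\<Sum>i\<in>keys s. i * lookup s i)" using True by (intro member_le_sum) auto
      finally show ?thesis using s by (simp add: weight_def)
    qed (simp add: in_keys_iff)
    moreover have "lookup s i = 0" if "i \<notin> {1..n}" using s that by (auto simp: in_keys_iff)
    ultimately show "(i \<in> {1..n} \<longrightarrow> lookup s i \<in> {..K}) \<and> (i \<notin> {1..n} \<longrightarrow> lookup s i = 0)" by blast
  qed
  thus "finite (lookup ` ?S)" by (rule finite_subset) (rule finite_set_of_finite_funs; simp)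
  show "inj_on lookup ?S" by (rule inj_onI) (simp add: poly_mapping_eqI)
qed

lemma card_pairs: "n + card (pairs n) = \<Sum>{1..n}"
proof (induction n)
  case (Suc n)
  have "pairs (Suc n) = pairs n \<union> {1..n} \<times> {Suc n}" by (auto simp: pairs_def)
  moreover have "pairs n \<inter> {1..n} \<times> {Suc n} = {}" by (auto simp: pairs_def)
  ultimately have "card (pairs (Suc n)) = card (pairs n) + n"
    by (simp add: card_Un_disjoint card_cartesian_product)
  thus ?case using Suc.IH by simp
next
  case 0
  have "pairs 0 = {}" by (auto simp: pairs_def)
  thus ?case by simp
qed

section \<open>The canonical module of a ring of invariants\<close>

text \<open>
  The positions \<open>J\<close> of the long sequence carry \<open>e\<^sub>1, \<dots>, e\<^sub>n\<close>, in the order given by \<open>\<epsilon>\<close>.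
\<close>

locale esym_cech = cech "invariants n G :: 'k::field mpoly set" f dg U
  for n G f dg U +
  fixes J :: "nat set" and \<epsilon> :: "nat \<Rightarrow> nat"
  assumes G: "perm_grp n G" and char: "CHAR('k) \<noteq> 2"
    and JU: "J \<subseteq> U" and bij: "bij_betw \<epsilon> J {1..n}"
    and f_esym: "j \<in> J \<Longrightarrow> f j = esym n (\<epsilon> j)"
begin

abbreviation R where "R \<equiv> invariants n G :: 'k mpoly set"

definition EE :: "nat set \<Rightarrow> 'k mpoly" where "EE I = (\<Prod>i\<in>I. esym n i)"

definition wt :: int where "wt = int (\<Sum>{1..n})"

abbreviation E where "E \<equiv> EE {1..n}"

lemma prod_f: "K \<subseteq> J \<Longrightarrow> (\<Prod>j\<in>K. f j) = EE (\<epsilon> ` K)"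
proof -
  assume K: "K \<subseteq> J"
  hence "inj_on \<epsilon> K" using bij by (auto simp: bij_betw_def intro: inj_on_subset)
  moreover have "(\<Prod>j\<in>K. f j) = (\<Prod>j\<in>K. esym n (\<epsilon> j))"
    using K f_esym by (intro prod.cong) auto
  ultimately show ?thesis by (simp add: EE_def prod.reindex)
qed

lemma card_J: "card J = n" "finite J"
  using bij_betw_same_card[OF bij] fin_J[OF JU] by auto

lemma EE_neq_0: "I \<subseteq> {1..n} \<Longrightarrow> EE I \<noteq> 0"
  using finite_subset[of I "{1..n}"] esym_neq_0 by (auto simp: EE_def prod_zero_iff subset_iff)

lemma homogeneous_EE: "homogeneous (int (\<Sum>I)) (EE I)"
proof -
  have "homogeneous (\<Sum>i\<in>I. int i) (\<Prod>i\<in>I. esym n i :: 'k mpoly)"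
    by (intro homogeneous_prod homogeneous_esym)
  thus ?thesis by (simp add: EE_def)
qed

lemma EE_sym: "EE I \<in> sym_polys n"
  unfolding EE_def by (intro invariants_prod esym_sym)

lemma sub: "a \<in> sym_polys n \<Longrightarrow> a \<in> R"
  using sym_polys_subset[OF G char] by blast

lemma loc_iff:
  assumes "I \<subseteq> {1..n}"
  shows "y \<in> localization_comp R (EE I) d \<longleftrightarrow>
    (\<exists>r t. r \<in> R \<and> homogeneous (d + int t * int (\<Sum>I)) r \<and> y = emb r / emb (EE I) ^ t)"
  unfolding localization_comp_eq[OF homogeneous_EE EE_neq_0[OF assms]] with_denominator_def by blast

text \<open>
  Every monomial in the \<open>e\<^sub>i\<close> with \<open>i \<in> I\<close> divides a power of their product.
\<close>

lemma loc_monomial: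
  assumes I: "I \<subseteq> {1..n}" and s: "keys s \<subseteq> I" and r: "r \<in> R" "homogeneous (d + int (weight (\<lambda>i. i) s)) r"
  shows "emb r / emb (mon (esym n) s) \<in> localization_comp R (EE I) d"
proof -
  have fin: "finite I" using I by (rule finite_subset) simp
  obtain M s' where s': "keys s' \<subseteq> I" "s + s' = vec I M" by (rule vec_complement[OF fin s])
  have m: "mon (esym n) s * mon (esym n) s' = EE I ^ M"
    using mon_vec[OF fin, of "esym n" M] by (simp add: EE_def flip: s'(2) mon_add)
  have nz: "mon (esym n) s' \<noteq> (0 :: 'k mpoly)" using mon_esym_neq_0 s'(1) I by blast
  have "emb r / emb (mon (esym n) s) = emb (r * mon (esym n) s') / emb (EE I) ^ M"
    using nz by (simp add: emb_mult flip: emb_power m)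
  moreover have "r * mon (esym n) s' \<in> R" by (intro R_mult r sub mon_esym_sym)
  moreover have "homogeneous (d + int M * int (\<Sum>I)) (r * mon (esym n) s')"
  proof (rule homogeneous_mult'[OF r(2) homogeneous_mon_esym])
    have "weight (\<lambda>i. i) s + weight (\<lambda>i. i) s' = M * \<Sum>I"
      using weight_vec[OF fin, of M] unfolding s'(2)[symmetric] weight_add .
    hence "int (weight (\<lambda>i. i) s) + int (weight (\<lambda>i. i) s') = int M * int (\<Sum>I)"
      by (simp only: of_nat_add[symmetric] of_nat_mult[symmetric])
    thus "d + int (weight (\<lambda>i. i) s) + int (weight (\<lambda>i. i) s') = d + int M * int (\<Sum>I)" by simp
  qed
  ultimately show ?thesis unfolding loc_iff[OF I] by blast
qed

definition top_cochain :: "'k mpoly fract \<Rightarrow> (nat set \<Rightarrow> 'k mpoly fract)" where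
  "top_cochain y = (\<lambda>I. if I = J then y else 0)"

lemma J_iff: "I \<subseteq> J \<and> card I = n \<longleftrightarrow> I = J"
  using card_subset_eq[OF card_J(2), of I] card_J(1) by auto

lemma L_J: "L J d = localization_comp R E d"
  using prod_f[OF order_refl] bij by (simp add: bij_betw_def)

lemma CC_J: "CC J n d = top_cochain ` localization_comp R E d"
proof
  show "CC J n d \<subseteq> top_cochain ` localization_comp R E d"
  proof
    fix c assume c: "c \<in> CC J n d"
    have "c = top_cochain (c J)"
      using CC_D(2)[OF c] J_iff by (auto simp: top_cochain_def fun_eq_iff)
    moreover have "c J \<in> localization_comp R E d"
      using CC_D(1)[OF c order_refl] card_J L_J by simp
    ultimately show "c \<in> top_cochain ` localization_comp R E d" by blast
  qed
  show "top_cochain ` localization_comp R E d \<subseteq> CC J n d"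
  proof (intro image_subsetI CC_I)
    fix y I assume y: "y \<in> localization_comp R E d" and "I \<subseteq> J" "card I = n"
    hence "I = J" using J_iff by blast
    thus "top_cochain y I \<in> L I d" using y by (simp add: top_cochain_def L_J)
  next
    fix y I assume "\<not> (I \<subseteq> J \<and> card I = n)"
    thus "top_cochain y I = 0" unfolding J_iff by (simp add: top_cochain_def)
  qed
qed

lemma ZZ_J: "ZZ J n d = top_cochain ` localization_comp R E d"
proof -
  have "dd J (top_cochain y) = 0" for y
  proof
    fix I
    have "top_cochain y (I - {j}) = 0" if "I \<subseteq> J" "j \<in> I" for j
      using that by (auto simp: top_cochain_def)
    thus "dd J (top_cochain y) I = 0 I" by (auto simp: dd_sg)
  qed
  thus ?thesis by (auto simp: ZZ_def CC_J)
qed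

lemma top_add: "top_cochain (x + y) = top_cochain x + top_cochain y"
  and top_sc: "sc r (top_cochain x) = top_cochain (emb r * x)"
  and top_0: "top_cochain 0 = 0"
  by (auto simp: top_cochain_def fun_eq_iff sc_def)

lemma top_inj: "top_cochain x = top_cochain y \<longleftrightarrow> x = y"
  by (auto simp: top_cochain_def fun_eq_iff split: if_splits)

lemma top_BB:
  assumes j: "j \<in> J" and y: "y \<in> L (J - {j}) d"
  shows "top_cochain y \<in> BB J n d"
proof -
  define c where "c I = (if I = J - {j} then sg j J * y else 0)" for I
  have n: "n \<noteq> 0" using j card_J by (auto simp: card_gt_0_iff)
  have sub': "J - {j} \<subseteq> U" using JU by blast
  have "c \<in> CC J (n - 1) d"
  proof (rule CC_I)
    fix I assume "I \<subseteq> J" "card I = n - 1"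
    show "c I \<in> L I d"
    proof (cases "I = J - {j}")
      case True
      thus ?thesis using L_sg[OF sub' y, of j J] by (simp add: c_def)
    next
      case False
      thus ?thesis using L_0[of I d] \<open>I \<subseteq> J\<close> JU by (simp add: c_def)
    qed
  next
    fix I assume "\<not> (I \<subseteq> J \<and> card I = n - 1)"
    thus "c I = 0" using card_J j by (auto simp: c_def)
  qed
  moreover have "dd J c = top_cochain y"
  proof
    fix I
    show "dd J c I = top_cochain y I"
    proof (cases "I = J")
      case True
      have "dd J c J = (\<Sum>l\<in>J. if l = j then y else 0)"
        unfolding dd_sg if_P[OF order_refl] using j
        by (intro sum.cong refl) (auto simp: c_def)
      thus ?thesis using True j card_J by (simp add: top_cochain_def)
    next
      case False
      have "c (I - {l}) = 0" if "I \<subseteq> J" "l \<in> I" for l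
      proof -
        have "card I < n" using psubset_card_mono[OF card_J(2), of I] that False card_J(1) by auto
        moreover have "finite I" using that(1) card_J(2) by (rule finite_subset)
        moreover from this have "card I > 0" using that(2) by (auto simp: card_gt_0_iff)
        ultimately have "card (I - {l}) \<noteq> card (J - {j})" using that j card_J by auto
        hence "I - {l} \<noteq> J - {j}" by (rule contrapos_nn) (rule arg_cong[of _ _ card])
        thus ?thesis by (simp only: c_def if_False)
      qed
      thus ?thesis using False by (auto simp: dd_sg top_cochain_def)
    qed
  qed
  ultimately have "top_cochain y \<in> dd J ` CC J (n - 1) d" by (intro image_eqI[of _ _ c]) simp_all
  thus ?thesis using n by (simp only: BB_def if_False)
qed

text \<open>
  Together with \<open>top_BB\<close> this identifies the coboundaries of top degree: they are the sums of fractions in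
  which one of the denominators \<open>e\<^sub>i\<close> is missing.
\<close>

lemma BB_top:
  assumes "z \<in> BB J n d"
  obtains y where "\<And>j. j \<in> J \<Longrightarrow> y j \<in> L (J - {j}) d" "z = top_cochain (\<Sum>j\<in>J. y j)"
proof (cases "n = 0")
  case True
  have z: "z = 0" using assms unfolding BB_def if_P[OF True] by simp
  show ?thesis
  proof (rule that[of "\<lambda>_. 0"])
    show "0 \<in> L (J - {j}) d" for j using JU by (intro L_0) blast
    show "z = top_cochain (\<Sum>j\<in>J. 0)" by (simp add: z top_0)
  qed
next
  case False
  then obtain c where c: "c \<in> CC J (n - 1) d" "z = dd J c" using assms by (auto simp: BB_def)
  show ?thesis
  proof (rule that[of "\<lambda>j. sg j J * c (J - {j})"])
    fix j assume j: "j \<in> J"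
    have "c (J - {j}) \<in> L (J - {j}) d" using j card_J by (intro CC_D(1)[OF c(1)]) auto
    thus "sg j J * c (J - {j}) \<in> L (J - {j}) d" using JU by (intro L_sg) auto
  next
    have "z \<in> ZZ J n d" using graded_quotient.B_Z[OF graded_quotient_cech[OF JU] assms] .
    then obtain y where y: "z = top_cochain y" by (auto simp: ZZ_J)
    have "z J = (\<Sum>j\<in>J. sg j J * c (J - {j}))" by (simp add: c dd_sg)
    thus "z = top_cochain (\<Sum>j\<in>J. sg j J * c (J - {j}))" by (simp add: y top_cochain_def)
  qed
qed

subsection \<open>The residue pairing\<close>

text \<open>
  The coefficient of \<open>1/(e\<^sub>1\<cdots>e\<^sub>n)\<close> in \<open>ctr(u r)/(e\<^sub>1\<cdots>e\<^sub>n)\<^bsup>t+1\<^esup>\<close>, in analogy with the residue symbol.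
\<close>

definition res :: "'k mpoly \<Rightarrow> 'k mpoly \<Rightarrow> nat \<Rightarrow> 'k" where
  "res u r t = lookup (in_esym n (ctr n G (u * r))) (vec {1..n} t)"

lemma ur_semi: "u \<in> semi n G \<Longrightarrow> r \<in> R \<Longrightarrow> u * r \<in> semi n G"
  using semi_mult[of r n G u] by (simp add: mult.commute)

lemma in_esym_ctr_mult:
  assumes "u \<in> semi n G" "r \<in> R" "keys s \<subseteq> {1..n}"
  shows "in_esym n (ctr n G (u * (mon (esym n) s * r))) = single s 1 * in_esym n (ctr n G (u * r))"
proof -
  have "ctr n G (u * (mon (esym n) s * r)) = mon (esym n) s * ctr n G (u * r)"
    using ctr_mult[OF G char ur_semi[OF assms(1,2)] mon_esym_sym, of s] by (simp add: mult_ac)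
  thus ?thesis
    using ctr(2)[OF G char ur_semi[OF assms(1,2)]]
    by (simp add: in_esym_mult mon_esym_sym in_esym_mon[OF assms(3)])
qed

lemma E_power: "E ^ t = mon (esym n) (vec {1..n} t)"
  by (simp add: mon_vec EE_def)

lemma res_add_left:
  "u \<in> semi n G \<Longrightarrow> v \<in> semi n G \<Longrightarrow> r \<in> R \<Longrightarrow> res (u + v) r t = res u r t + res v r t"
  unfolding res_def distrib_right
  by (simp add: ctr_add[OF G char] ur_semi in_esym_add ctr(2)[OF G char] lookup_add)

lemma res_add_right:
  "u \<in> semi n G \<Longrightarrow> r \<in> R \<Longrightarrow> r' \<in> R \<Longrightarrow> res u (r + r') t = res u r t + res u r' t"
  unfolding res_def distrib_left
  by (simp add: ctr_add[OF G char] ur_semi in_esym_add ctr(2)[OF G char] lookup_add)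

lemma res_shift:
  assumes "u \<in> semi n G" "r \<in> R" shows "res u (E ^ s * r) (s + t) = res u r t"
  unfolding res_def E_power vec_add
  by (subst in_esym_ctr_mult[OF assms keys_vec]) (simp_all only: finite_atLeastAtMost lookup_single_mult)

lemma res_const: "u \<in> semi n G \<Longrightarrow> r \<in> R \<Longrightarrow> res u (const c * r) t = c * res u r t"
proof -
  assume *: "u \<in> semi n G" "r \<in> R"
  have "ctr n G (u * (const c * r)) = const c * ctr n G (u * r)"
    using ctr_mult[OF G char ur_semi[OF *], of "const c"] by (simp add: mult_ac)
  thus ?thesis
    using ctr(2)[OF G char ur_semi[OF *]] by (simp add: res_def in_esym_mult lookup_const_mult)
qed

text \<open>
  The functional \<open>\<mu>\<close> on the top cohomology and the semi-invariant \<open>u\<close> correspond to each other. Every fraction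
  can be written with a denominator \<open>(e\<^sub>1\<cdots>e\<^sub>n)\<^bsup>t+1\<^esup>\<close> of positive exponent.
\<close>

definition paired :: "int \<Rightarrow> ((nat set \<Rightarrow> 'k mpoly fract) \<Rightarrow> 'k) \<Rightarrow> 'k mpoly \<Rightarrow> bool" where
  "paired d \<mu> u \<longleftrightarrow> (\<forall>r t. r \<in> R \<longrightarrow> homogeneous (- d + int (Suc t) * wt) r \<longrightarrow>
     \<mu> (top_cochain (emb r / emb E ^ Suc t)) = res u r t)"

lemma pairedD:
  "paired d \<mu> u \<Longrightarrow> r \<in> R \<Longrightarrow> homogeneous (- d + int (Suc t) * wt) r \<Longrightarrow>
     \<mu> (top_cochain (emb r / emb E ^ Suc t)) = res u r t"
  unfolding paired_def by blast

lemma pairedI: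
  "(\<And>r t. r \<in> R \<Longrightarrow> homogeneous (- d + int (Suc t) * wt) r \<Longrightarrow>
     \<mu> (top_cochain (emb r / emb E ^ Suc t)) = res u r t) \<Longrightarrow> paired d \<mu> u"
  unfolding paired_def by blast

lemma loc_E_Suc:
  "y \<in> localization_comp R E d \<longleftrightarrow>
    (\<exists>r t. r \<in> R \<and> homogeneous (d + int (Suc t) * wt) r \<and> y = emb r / emb E ^ Suc t)"
proof
  assume "y \<in> localization_comp R E d"
  then obtain r t where r: "r \<in> R" "homogeneous (d + int t * wt) r" "y = emb r / emb E ^ t"
    unfolding loc_iff[OF order_refl] wt_def by blast
  have "y = emb (r * E) / emb E ^ Suc t"
    using EE_neq_0[OF order_refl] by (simp add: r emb_mult)
  moreover have "homogeneous (d + int (Suc t) * wt) (r * E)"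
    by (rule homogeneous_mult'[OF r(2) homogeneous_EE]) (simp add: wt_def algebra_simps)
  ultimately show "\<exists>r t. r \<in> R \<and> homogeneous (d + int (Suc t) * wt) r \<and> y = emb r / emb E ^ Suc t"
    using R_mult[OF r(1) sub[OF EE_sym]] by blast
next
  assume "\<exists>r t. r \<in> R \<and> homogeneous (d + int (Suc t) * wt) r \<and> y = emb r / emb E ^ Suc t"
  thus "y \<in> localization_comp R E d" unfolding loc_iff[OF order_refl] wt_def by blast
qed

lemma ZZ_iff:
  "z \<in> ZZ J n d \<longleftrightarrow> (\<exists>r t. r \<in> R \<and> homogeneous (d + int (Suc t) * wt) r \<and>
      z = top_cochain (emb r / emb E ^ Suc t))" (is "_ \<longleftrightarrow> ?rhs")
proof
  assume "z \<in> ZZ J n d"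
  then obtain y where y: "z = top_cochain y" "y \<in> localization_comp R E d"
    unfolding ZZ_J by (rule imageE)
  from y(2) obtain r t where "r \<in> R" "homogeneous (d + int (Suc t) * wt) r"
    "y = emb r / emb E ^ Suc t"
    unfolding loc_E_Suc by (elim exE conjE)
  thus ?rhs unfolding y(1) by (intro exI conjI arg_cong[of _ _ top_cochain])
next
  assume ?rhs
  then obtain r t where rt: "r \<in> R" "homogeneous (d + int (Suc t) * wt) r"
    "z = top_cochain (emb r / emb E ^ Suc t)" by (elim exE conjE)
  have "emb r / emb E ^ Suc t \<in> localization_comp R E d"
    unfolding loc_E_Suc by (intro exI[of _ r] exI[of _ t] conjI rt(1,2) refl)
  thus "z \<in> ZZ J n d" unfolding ZZ_J rt(3) by (rule imageI)
qed

lemma paired_unique_left: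
  assumes "\<mu> \<in> gcomp (omega J n) d" "\<nu> \<in> gcomp (omega J n) d" "paired d \<mu> u" "paired d \<nu> u"
  shows "\<mu> = \<nu>"
proof (rule extensionalityI[OF qdual_memD(1)[OF assms(1)] qdual_memD(1)[OF assms(2)]])
  fix z assume "z \<in> ZZ J n (- d)"
  then obtain r t where "r \<in> R" "homogeneous (- d + int (Suc t) * wt) r"
    "z = top_cochain (emb r / emb E ^ Suc t)"
    unfolding ZZ_iff by (elim exE conjE)
  thus "\<mu> z = \<nu> z" using assms(3,4) by (simp add: paired_def)
qed

text \<open>
  The residues of all multiples of \<open>r\<close> by monomials in the \<open>e\<^sub>i\<close> are the coefficients of \<open>ctr(u r)\<close>; so they
  determine \<open>ctr(u r)\<close> for all \<open>r\<close>, and hence \<open>u\<close>.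
\<close>

lemma paired_unique_right:
  assumes u: "u \<in> semi n G" "homogeneous (d - int n) u" and v: "v \<in> semi n G" "homogeneous (d - int n) v"
    and p: "paired d \<mu> u" "paired d \<mu> v"
  shows "u = v"
proof -
  let ?w = "u - v"
  have w: "?w \<in> semi n G" "homogeneous (d - int n) ?w"
    using u v by (auto intro: semi_diff homogeneous_diff)
  have 0: "res ?w r t = 0" if "r \<in> R" "homogeneous (- d + int (Suc t) * wt) r" for r t
  proof -
    have "res u r t = res ?w r t + res v r t" using res_add_left[OF w(1) v(1) that(1), of t] by simp
    thus ?thesis using p that by (auto simp: paired_def)
  qed
  have hom0: "ctr n G (?w * r) = 0" if r: "r \<in> R" "homogeneous m r" for r m
  proof (rule ccontr)
    let ?a = "ctr n G (?w * r)"
    assume "?a \<noteq> 0"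
    note wr = ur_semi[OF w(1) r(1)]
    have a: "?a \<in> sym_polys n" by (rule ctr(2)[OF G char wr])
    have "homogeneous (d - int n + m - int (card (pairs n))) ?a"
      by (intro homogeneous_ctr[OF G char wr] homogeneous_mult w r)
    hence iso: "isobaric (d - int n + m - int (card (pairs n))) (in_esym n ?a)"
      by (rule in_esym_isobaric[OF a])
    have "in_esym n ?a \<noteq> 0" using fundamental_theorem(2)[OF a] \<open>?a \<noteq> 0\<close> by auto
    then obtain s where s: "s \<in> keys (in_esym n ?a)" by (metis equals0I keys_eq_empty)
    hence ks: "keys s \<subseteq> {1..n}" using fundamental_theorem(1)[OF a] by (auto simp: poly_ring_def)
    \<comment> \<open>A complementary monomial moves the coefficient at \<open>s\<close> to the exponent vector \<open>(M, \<dots>, M)\<close>.\<close>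
    obtain M s' where s': "keys s' \<subseteq> {1..n}" "s + s' = vec {1..n} M"
      by (rule vec_complement[OF finite_atLeastAtMost ks])
    have "int (weight (\<lambda>i. i) s) = d - int n + m - int (card (pairs n))"
      using iso s by (auto simp: isobaric_def)
    moreover have "int (weight (\<lambda>i. i) s) + int (weight (\<lambda>i. i) s') = int M * wt"
      using weight_vec[of "{1..n}" M] unfolding wt_def s'(2)[symmetric] weight_add
      by (simp only: of_nat_add[symmetric] of_nat_mult[symmetric] finite_atLeastAtMost simp_thms)
    moreover have "int n + int (card (pairs n)) = wt"
      using card_pairs[of n] by (simp add: wt_def flip: of_nat_add)
    \<comment> \<open>Here it matters that the degree is \<open>d - n\<close>: the sum of the degrees of the \<open>e\<^sub>i\<close> exceeds the degree of the
      Vandermonde polynomial by \<open>n\<close>.\<close>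
    ultimately have "int (weight (\<lambda>i. i) s') + m = - d + int (Suc M) * wt"
      by (simp add: algebra_simps)
    hence "homogeneous (- d + int (Suc M) * wt) (mon (esym n) s' * r)"
      by (rule homogeneous_mult'[OF homogeneous_mon_esym r(2)])
    hence "res ?w (mon (esym n) s' * r) M = 0"
      using R_mult[OF sub[OF mon_esym_sym] r(1)] by (intro 0)
    hence "lookup (single s' 1 * in_esym n ?a) (s' + s) = 0"
      unfolding res_def in_esym_ctr_mult[OF w(1) r(1) s'(1)] s'(2)[symmetric]
      by (simp only: add.commute)
    thus False using s unfolding lookup_single_mult by (simp add: in_keys_iff)
  qed
  have "?w = 0"
  proof (rule ctr_determines[OF G char w(1)])
    fix r assume r: "r \<in> R"
    let ?D = "(\<lambda>m. int (total_degree m)) ` keys r"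
    have "ctr n G (?w * r) = ctr n G (\<Sum>d\<in>?D. ?w * hcomp d r)"
      by (subst hcomp_decomp[of r]) (simp add: sum_distrib_left)
    also have "\<dots> = (\<Sum>d\<in>?D. ctr n G (?w * hcomp d r))"
      using r by (intro ctr_sum[OF G char] ur_semi w R_hcomp)
    also have "\<dots> = 0" using r by (intro sum.neutral ballI hom0[OF R_hcomp homogeneous_hcomp])
    finally show "ctr n G (?w * r) = 0" .
  qed
  thus ?thesis by simp
qed

text \<open>
  The residue does not depend on the way in which a fraction is written, since extending it by \<open>e\<^sub>1\<cdots>e\<^sub>n\<close>
  multiplies \<open>ctr(u r)\<close> by the same factor. It vanishes on a fraction without \<open>e\<^sub>i\<close> in the
  denominator: written over \<open>(e\<^sub>1\<cdots>e\<^sub>n)\<^bsup>t+1\<^esup>\<close>, it has a numerator divisible by \<open>e\<^sub>i\<^bsup>t+1\<^esup>\<close>, and then the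
  coefficient of \<open>(e\<^sub>1\<cdots>e\<^sub>n)\<^sup>t\<close> is zero.
\<close>

lemma paired_exists_left:
  assumes u: "u \<in> semi n G"
  shows "\<exists>\<mu>\<in>gcomp (omega J n) d. paired d \<mu> u"
proof -
  have wd: "res u r t = res u r' t'"
    if "r \<in> R" "r' \<in> R" "emb r / emb E ^ Suc t = emb r' / emb E ^ Suc t'" for r r' t t'
  proof -
    have E0: "emb E \<noteq> 0" using EE_neq_0[OF order_refl] by simp
    have "emb r * emb E ^ Suc t' = emb r' * emb E ^ Suc t"
      using that(3) E0 by (simp add: frac_eq_eq)
    hence "emb r * emb E ^ t' = emb r' * emb E ^ t" using E0 by simp
    hence "emb (E ^ t' * r) = emb (E ^ t * r')" by (simp add: emb_mult emb_power mult.commute)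
    hence "E ^ t' * r = E ^ t * r'" by simp
    thus ?thesis
      using res_shift[OF u that(1), of t' t] res_shift[OF u that(2), of t t'] by (simp add: add.commute)
  qed
  define val where "val z = (SOME v. \<exists>r t. r \<in> R \<and> homogeneous (- d + int (Suc t) * wt) r \<and>
      z = top_cochain (emb r / emb E ^ Suc t) \<and> v = res u r t)" for z
  have val: "val (top_cochain (emb r / emb E ^ Suc t)) = res u r t"
    if "r \<in> R" "homogeneous (- d + int (Suc t) * wt) r" for r t
  proof -
    let ?z = "top_cochain (emb r / emb E ^ Suc t)"
    have "\<exists>v r' t'. r' \<in> R \<and> homogeneous (- d + int (Suc t') * wt) r' \<and>
      ?z = top_cochain (emb r' / emb E ^ Suc t') \<and> v = res u r' t'" using that by blast
    from someI_ex[OF this] obtain r' t' where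
      "r' \<in> R" "?z = top_cochain (emb r' / emb E ^ Suc t')" "val ?z = res u r' t'"
      unfolding val_def by blast
    thus ?thesis using wd[of r r' t t'] that by (simp add: top_inj)
  qed
  define \<mu> where "\<mu> = restrict val (ZZ J n (- d))"
  have rep: "\<exists>r t. r \<in> R \<and> homogeneous (- d + int (Suc t) * wt) r \<and>
      z = top_cochain (emb r / emb E ^ Suc t)" if "z \<in> ZZ J n (- d)" for z
    using that by (simp only: ZZ_iff)
  have mem: "top_cochain (emb r / emb E ^ Suc t) \<in> ZZ J n (- d)"
    if "r \<in> R" "homogeneous (- d + int (Suc t) * wt) r" for r t
    unfolding ZZ_iff by (intro exI[of _ r] exI[of _ t] conjI that refl)
  have \<mu>: "\<mu> (top_cochain (emb r / emb E ^ Suc t)) = res u r t"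
    if "r \<in> R" "homogeneous (- d + int (Suc t) * wt) r" for r t
    using val[OF that] mem[OF that] by (simp add: \<mu>_def)
  have E0: "emb E \<noteq> 0" using EE_neq_0[OF order_refl] by simp
  have raise: "\<exists>r'. r' \<in> R \<and> homogeneous (- d + int (Suc (t + s)) * wt) r' \<and>
      emb r / emb E ^ Suc t = emb r' / emb E ^ Suc (t + s)"
    if "r \<in> R" "homogeneous (- d + int (Suc t) * wt) r" for r t s
  proof (intro exI[of _ "r * E ^ s"] conjI)
    show "r * E ^ s \<in> R" by (intro R_mult R_power sub EE_sym that)
    show "homogeneous (- d + int (Suc (t + s)) * wt) (r * E ^ s)"
      by (rule homogeneous_mult'[OF that(2) homogeneous_power[OF homogeneous_EE]])
        (simp add: wt_def algebra_simps)
    show "emb r / emb E ^ Suc t = emb (r * E ^ s) / emb E ^ Suc (t + s)"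
      using E0 by (simp add: emb_mult emb_power power_add)
  qed
  have add: "\<mu> (x + y) = \<mu> x + \<mu> y" if xy: "x \<in> ZZ J n (- d)" "y \<in> ZZ J n (- d)" for x y
  proof -
    obtain r t where r: "r \<in> R" "homogeneous (- d + int (Suc t) * wt) r"
      "x = top_cochain (emb r / emb E ^ Suc t)" using rep[OF xy(1)] by blast
    obtain r' t' where r': "r' \<in> R" "homogeneous (- d + int (Suc t') * wt) r'"
      "y = top_cochain (emb r' / emb E ^ Suc t')" using rep[OF xy(2)] by blast
    obtain a where a: "a \<in> R" "homogeneous (- d + int (Suc (t + t')) * wt) a"
      "x = top_cochain (emb a / emb E ^ Suc (t + t'))" using raise[OF r(1,2), of t'] r(3) by auto
    obtain b where b: "b \<in> R" "homogeneous (- d + int (Suc (t + t')) * wt) b"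
      "y = top_cochain (emb b / emb E ^ Suc (t + t'))"
      using raise[OF r'(1,2), of t] r'(3) by (auto simp: add.commute)
    have "x + y = top_cochain (emb (a + b) / emb E ^ Suc (t + t'))"
      unfolding a(3) b(3) top_add[symmetric] by (simp only: emb_add add_divide_distrib)
    thus ?thesis
      using \<mu>[OF R_add[OF a(1) b(1)] homogeneous_add[OF a(2) b(2)]] \<mu>[OF a(1,2)] \<mu>[OF b(1,2)]
        res_add_right[OF u a(1) b(1)] unfolding a(3) b(3) by simp
  qed
  have "\<mu> \<in> gcomp (omega J n) d"
  proof (rule qdual_memI)
    show "\<mu> \<in> extensional (ZZ J n (- d))" by (simp add: \<mu>_def)
    show "\<And>x y. x \<in> ZZ J n (- d) \<Longrightarrow> y \<in> ZZ J n (- d) \<Longrightarrow> \<mu> (x + y) = \<mu> x + \<mu> y" by (rule add)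
    fix c x assume "x \<in> ZZ J n (- d)"
    then obtain r t where r: "r \<in> R" "homogeneous (- d + int (Suc t) * wt) r"
      "x = top_cochain (emb r / emb E ^ Suc t)" using rep by blast
    have "homogeneous (- d + int (Suc t) * wt) (const c * r)"
      by (rule homogeneous_mult'[OF homogeneous_const r(2)]) simp
    hence "\<mu> (top_cochain (emb (const c * r) / emb E ^ Suc t)) = res u (const c * r) t"
      by (intro \<mu> R_mult R_const r)
    moreover have "sc (const c) x = top_cochain (emb (const c * r) / emb E ^ Suc t)"
      unfolding r(3) top_sc emb_mult by (simp only: times_divide_eq_right)
    ultimately show "\<mu> (sc (const c) x) = c * \<mu> x"
      using \<mu>[OF r(1,2)] res_const[OF u r(1)] r(3) by simp
  next
    fix z assume "z \<in> BB J n (- d)"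
    then obtain y where y: "\<And>j. j \<in> J \<Longrightarrow> y j \<in> L (J - {j}) (- d)" "z = top_cochain (\<Sum>j\<in>J. y j)"
      using BB_top by blast
    have y_mem: "top_cochain (y j) \<in> ZZ J n (- d)" if "j \<in> J" for j
    proof -
      have "y j \<in> L J (- d)" by (rule L_mono[OF JU _ y(1)[OF that]]) auto
      thus ?thesis unfolding ZZ_J L_J[symmetric] by blast
    qed
    have \<mu>0: "\<mu> 0 = 0"
    proof -
      have "0 \<in> ZZ J n (- d)"
        using graded_quotient.B_Z[OF graded_quotient_cech[OF JU] graded_quotient.B_0[OF graded_quotient_cech[OF JU]]] .
      hence "\<mu> (0 + 0) = \<mu> 0 + \<mu> 0" by (intro add)
      thus ?thesis by (simp only: add_0_right add_cancel_right_right)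
    qed
    have zero: "\<mu> (top_cochain (y j)) = 0" if j: "j \<in> J" for j
    proof -
      let ?i = "\<epsilon> j" and ?I = "\<epsilon> ` (J - {j})"
      have i: "?i \<in> {1..n}" using bij j by (auto simp: bij_betw_def)
      have I: "?I = {1..n} - {?i}"
        using bij j by (auto simp: bij_betw_def inj_on_def)
      have "y j \<in> localization_comp R (EE ?I) (- d)" using y(1)[OF j] prod_f[of "J - {j}"] by auto
      then obtain r t where r: "r \<in> R" "homogeneous (- d + int t * int (\<Sum>?I)) r"
        "y j = emb r / emb (EE ?I) ^ t"
        using loc_iff[of ?I "y j" "- d"] I by blast
      have EI: "E = esym n ?i * EE ?I"
        unfolding EE_def I using i by (subst prod.remove[of _ ?i]) auto
      have nz: "esym n ?i \<noteq> (0 :: 'k mpoly)" using i by (rule esym_neq_0)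
      let ?m = "mon (esym n) (single ?i (Suc t))"
      let ?r = "?m * (EE ?I * r)"
      have wtI: "wt = int ?i + int (\<Sum>?I)"
        unfolding wt_def I using i by (subst sum.remove[of _ ?i]) auto
      have "y j = emb ?r / emb E ^ Suc t"
        using nz EE_neq_0[of ?I] I unfolding r(3) EI
        by (simp add: emb_mult emb_power power_mult_distrib)
      moreover have "EE ?I * r \<in> R" by (rule R_mult[OF sub[OF EE_sym] r(1)])
      moreover from this have "?r \<in> R" by (rule R_mult[OF sub[OF mon_esym_sym]])
      moreover have "homogeneous (- d + int (Suc t) * wt) ?r"
        by (rule homogeneous_mult'[OF homogeneous_mon_esym homogeneous_mult[OF homogeneous_EE r(2)]])
          (simp add: wtI algebra_simps)
      ultimately have "\<mu> (top_cochain (y j)) = res u ?r t" using \<mu> by simp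
      also have "\<dots> = lookup (single (single ?i (Suc t)) 1 * in_esym n (ctr n G (u * (EE ?I * r)))) (vec {1..n} t)"
        unfolding res_def using i
        by (subst in_esym_ctr_mult[OF u \<open>EE ?I * r \<in> R\<close>]) (simp_all del: One_nat_def)
      also have "\<dots> = 0"
        by (rule lookup_single_mult_eq_0[of _ ?i]) (use i in \<open>simp add: lookup_vec\<close>)
      finally show ?thesis .
    qed
    have "\<mu> (top_cochain (\<Sum>j\<in>K. y j)) = 0 \<and> top_cochain (\<Sum>j\<in>K. y j) \<in> ZZ J n (- d)"
      if "finite K" "K \<subseteq> J" for K
      using that
    proof (induction K rule: finite_induct)
      case empty
      have "0 \<in> ZZ J n (- d)"
        using graded_quotient.B_Z[OF graded_quotient_cech[OF JU] graded_quotient.B_0[OF graded_quotient_cech[OF JU]]] .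
      thus ?case unfolding sum.empty top_0 by (simp only: \<mu>0 simp_thms)
    next
      case (insert j K)
      have j: "j \<in> J" and K: "\<mu> (top_cochain (\<Sum>j\<in>K. y j)) = 0"
        "top_cochain (\<Sum>j\<in>K. y j) \<in> ZZ J n (- d)" using insert by auto
      have "top_cochain (\<Sum>j\<in>insert j K. y j) = top_cochain (y j) + top_cochain (\<Sum>j\<in>K. y j)"
        unfolding sum.insert[OF insert.hyps] by (rule top_add)
      thus ?case
        using graded_quotient.Z_add[OF graded_quotient_cech[OF JU] y_mem[OF j] K(2)]
          add[OF y_mem[OF j] K(2)] zero[OF j] K(1) by (simp only: add_0_left simp_thms)
    qed
    thus "\<mu> z = 0" using y(2) card_J(2) by blast
  qed
  moreover have "paired d \<mu> u" unfolding paired_def using \<mu> by blast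
  ultimately show ?thesis by blast
qed

text \<open>
  From a functional \<open>\<mu>\<close>, form the polynomial \<open>\<phi>(r) = \<Sum>\<^sub>s \<mu>(r/(e\<^sup>s e\<^sub>1\<cdots>e\<^sub>n)) e\<^sup>s\<close>, where only the
  component of \<open>r\<close> of the fitting degree enters each coefficient. This \<open>\<phi>\<close> is linear over the
  symmetric polynomials: multiplying \<open>r\<close> by \<open>e\<^sub>i\<close> shifts the coefficients, and those at which \<open>e\<^sub>i\<close> does not
  occur vanish because their fractions are coboundaries. So \<open>linear_maps_to_sym\<close> applies.
\<close>

lemma paired_exists_right:
  assumes \<mu>: "\<mu> \<in> gcomp (omega J n) d"
  shows "\<exists>u\<in>semi n G. homogeneous (d - int n) u \<and> paired d \<mu> u"
proof -
  interpret Q: graded_quotient R "ZZ J n" "BB J n" sc by (rule graded_quotient_cech[OF JU])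
  define \<mu>' where "\<mu>' y = \<mu> (top_cochain y)" for y
  let ?L = "localization_comp R E (- d)"
  have \<mu>'_add: "\<mu>' (x + y) = \<mu>' x + \<mu>' y" if "x \<in> ?L" "y \<in> ?L" for x y
    unfolding \<mu>'_def top_add using that by (intro qdual_memD(2)[OF \<mu>]) (auto simp: ZZ_J)
  have \<mu>'_const: "\<mu>' (emb (const c) * x) = c * \<mu>' x" if "x \<in> ?L" for c x
    unfolding \<mu>'_def top_sc[symmetric] using that by (intro qdual_memD(3)[OF \<mu>]) (auto simp: ZZ_J)
  have \<mu>'_0: "\<mu>' 0 = 0" unfolding \<mu>'_def top_0 by (rule qdual_memD(4)[OF \<mu> Q.B_0])
  have \<mu>'_kill: "\<mu>' x = 0" if "i \<in> {1..n}" "x \<in> localization_comp R (EE ({1..n} - {i})) (- d)" for x i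
  proof -
    have "i \<in> \<epsilon> ` J" using that(1) bij by (simp add: bij_betw_def)
    then obtain j where "i = \<epsilon> j" "j \<in> J" by (rule imageE)
    note j = this(2) this(1)[symmetric]
    have "\<epsilon> ` (J - {j}) = {1..n} - {i}"
      using bij j by (auto simp: bij_betw_def inj_on_def)
    hence "x \<in> L (J - {j}) (- d)" using that prod_f[of "J - {j}"] by auto
    hence "top_cochain x \<in> BB J n (- d)" by (rule top_BB[OF j(1)])
    thus ?thesis unfolding \<mu>'_def by (rule qdual_memD(4)[OF \<mu>])
  qed
  define frac where "frac r s = emb (hcomp (int (weight (\<lambda>i. i) s) + wt - d) r) / emb (mon (esym n) s * E)" for r s
  have E_mon: "mon (esym n) s * E = mon (esym n) (s + vec {1..n} 1)" for s
    using E_power[of 1] by (simp add: mon_add)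
  have frac_L: "frac r s \<in> ?L" if "r \<in> R" "keys s \<subseteq> {1..n}" for r s
    unfolding frac_def E_mon
  proof (rule loc_monomial[OF order_refl])
    show "keys (s + vec {1..n} 1) \<subseteq> {1..n}"
      using that Poly_Mapping.keys_add[of s "vec {1..n} 1"] keys_vec[of "{1..n}" 1] by blast
    show "hcomp (int (weight (\<lambda>i. i) s) + wt - d) r \<in> R" using that by (intro R_hcomp)
    have "int (weight (\<lambda>i. i) (s + vec {1..n} 1)) = int (weight (\<lambda>i. i) s) + wt"
      by (simp add: weight_add weight_vec wt_def)
    thus "homogeneous (- d + int (weight (\<lambda>i. i) (s + vec {1..n} 1)))
       (hcomp (int (weight (\<lambda>i. i) s) + wt - d) r)"
      using homogeneous_hcomp[of "int (weight (\<lambda>i. i) s) + wt - d" r] by (simp add: algebra_simps)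
  qed
  define q where "q r s = (if keys s \<subseteq> {1..n} then \<mu>' (frac r s) else 0)" for r s
  have q_supp: "\<exists>m\<in>keys r. int (total_degree m) = int (weight (\<lambda>i. i) s) + wt - d"
    if "q r s \<noteq> 0" for r s
  proof (rule ccontr)
    assume "\<not> ?thesis"
    hence "hcomp (int (weight (\<lambda>i. i) s) + wt - d) r = 0" by (intro hcomp_eq_0) auto
    hence "frac r s = 0" by (simp add: frac_def)
    thus False using that \<mu>'_0 by (simp add: q_def split: if_splits)
  qed
  have fin: "finite {s. q r s \<noteq> 0}" for r
  proof (rule finite_subset)
    let ?K = "nat (int (\<Sum>m\<in>keys r. total_degree m) + \<bar>wt\<bar> + \<bar>d\<bar>)"
    show "{s. q r s \<noteq> 0} \<subseteq> {s. keys s \<subseteq> {1..n} \<and> weight (\<lambda>i. i) s \<le> ?K}"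
    proof clarify
      fix s assume s: "q r s \<noteq> 0"
      obtain m where m: "m \<in> keys r" "int (total_degree m) = int (weight (\<lambda>i. i) s) + wt - d"
        using q_supp[OF s] by blast
      have "total_degree m \<le> (\<Sum>m\<in>keys r. total_degree m)" using m(1) by (intro member_le_sum) auto
      hence "int (total_degree m) \<le> int (\<Sum>m\<in>keys r. total_degree m)" by (simp only: of_nat_le_iff)
      hence "weight (\<lambda>i. i) s \<le> ?K" using m(2) by linarith
      thus "keys s \<subseteq> {1..n} \<and> weight (\<lambda>i. i) s \<le> ?K" using s by (auto simp: q_def split: if_splits)
    qed
  qed (rule finite_bounded_exponents)
  define Q where "Q r = Abs_poly_mapping (q r)" for r
  have lookup_Q: "lookup (Q r) s = q r s" for r s
    unfolding Q_def using fin by simp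
  have Q_ring: "Q r \<in> poly_ring n" for r
    unfolding poly_ring_def
  proof (intro CollectI ballI)
    fix s assume "s \<in> keys (Q r)"
    hence "q r s \<noteq> 0" by (simp add: in_keys_iff lookup_Q)
    thus "keys s \<subseteq> {1..n}" unfolding q_def by (rule contrapos_np) simp
  qed
  have Q_add: "Q (r + r') = Q r + Q r'" if "r \<in> R" "r' \<in> R" for r r'
  proof (rule poly_mapping_eqI)
    fix s
    have eq: "frac (r + r') s = frac r s + frac r' s"
      by (simp add: frac_def hcomp_add emb_add add_divide_distrib)
    show "lookup (Q (r + r')) s = lookup (Q r + Q r') s"
    proof (cases "keys s \<subseteq> {1..n}")
      case True
      have "\<mu>' (frac r s + frac r' s) = \<mu>' (frac r s) + \<mu>' (frac r' s)"
        by (rule \<mu>'_add[OF frac_L[OF that(1) True] frac_L[OF that(2) True]])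
      thus ?thesis using True eq
        by (simp only: lookup_Q lookup_add q_def if_True)
    next
      case False
      thus ?thesis by (simp only: lookup_Q lookup_add q_def if_False add_0_left)
    qed
  qed
  have Q_const: "Q (const c * r) = const c * Q r" if "r \<in> R" for c r
  proof (rule poly_mapping_eqI)
    fix s
    have "hcomp e (const c * r) = const c * hcomp e r" for e
      using hcomp_mult[OF homogeneous_const[of c], of e r] by simp
    hence eq: "frac (const c * r) s = emb (const c) * frac r s" by (simp add: frac_def emb_mult)
    show "lookup (Q (const c * r)) s = lookup (const c * Q r) s"
    proof (cases "keys s \<subseteq> {1..n}")
      case True
      from \<mu>'_const[OF frac_L[OF that True]] show ?thesis using True eq
        by (simp only: lookup_Q lookup_const_mult q_def if_True)
    next
      case False
      thus ?thesis by (simp only: lookup_Q lookup_const_mult q_def if_False mult_zero_right)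
    qed
  qed
  have Q_var: "Q (esym n i * r) = var i * Q r" if r: "r \<in> R" and i: "i \<in> {1..n}" for i r
  proof (rule poly_mapping_eqI)
    fix s
    have hc: "hcomp e (esym n i * r) = esym n i * hcomp (e - int i) r" for e
      using hcomp_mult[OF homogeneous_esym, of i "e - int i" n r] by simp
    show "lookup (Q (esym n i * r)) s = lookup (var i * Q r) s"
    proof (cases "keys s \<subseteq> {1..n}")
      case False
      have "var i * Q r \<in> poly_ring n" using Q_ring i by auto
      hence "s \<notin> keys (var i * Q r)" using False by (auto simp: poly_ring_def)
      thus ?thesis using False by (simp add: lookup_Q q_def in_keys_iff)
    next
      case ks: True
      show ?thesis
      proof (cases "lookup s i = 0")
        \<comment> \<open>The factor \<open>e\<^sub>i\<close> cancels, and the fraction has no \<open>e\<^sub>i\<close> left in its denominator.\<close>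
        case True
        let ?h = "hcomp (int (weight (\<lambda>i. i) s) + wt - d - int i) r"
        let ?I = "{1..n} - {i}"
        have finI: "finite ?I" by simp
        have "vec {1..n} 1 = single i 1 + vec ?I 1"
          unfolding vec_def using i by (subst sum.remove[of _ i]) auto
        hence m: "mon (esym n) s * E = esym n i * mon (esym n) (s + vec ?I 1)"
          unfolding E_mon by (simp add: mon_add mult_ac)
        have "frac (esym n i * r) s = emb ?h / emb (mon (esym n) (s + vec ?I 1))"
          unfolding frac_def hc m using esym_neq_0[OF i, where 'k = 'k] by (simp add: emb_mult)
        also have "\<dots> \<in> localization_comp R (EE ?I) (- d)"
        proof (rule loc_monomial)
          show "keys (s + vec ?I 1) \<subseteq> ?I"
            using ks True Poly_Mapping.keys_add[of s "vec ?I 1"] keys_vec[OF finI, of 1]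
            by (auto simp: in_keys_iff)
          have "wt = int i + int (\<Sum>?I)"
            unfolding wt_def using i by (subst sum.remove[of _ i]) auto
          moreover have "weight (\<lambda>i. i) (vec ?I 1) = \<Sum>?I"
            unfolding weight_vec[OF finI] by (rule mult_1)
          ultimately have eq: "- d + int (weight (\<lambda>i. i) (s + vec ?I 1)) =
              int (weight (\<lambda>i. i) s) + wt - d - int i"
            by (simp only: weight_add of_nat_add)
          show "homogeneous (- d + int (weight (\<lambda>i. i) (s + vec ?I 1))) ?h"
            unfolding eq by (rule homogeneous_hcomp)
        qed (use r in \<open>auto intro: R_hcomp\<close>)
        finally have "q (esym n i * r) s = 0" using ks \<mu>'_kill[OF i] by (simp add: q_def)
        moreover have "lookup (var i * Q r) s = 0"
          unfolding var_def by (rule lookup_single_mult_eq_0[of _ i]) (use True in simp)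
        ultimately show ?thesis by (simp add: lookup_Q)
      next
        case False
        define s' where "s' = s - single i 1"
        have s: "s = single i 1 + s'"
          unfolding s'_def using False
          by (intro poly_mapping_eqI) (auto simp: lookup_add lookup_minus lookup_single when_def)
        have ks': "keys s' \<subseteq> {1..n}"
          using ks by (auto simp: s'_def in_keys_iff lookup_minus lookup_single when_def split: if_splits)
        have "frac (esym n i * r) s = frac r s'"
          unfolding frac_def hc s mon_add using esym_neq_0[OF i, where 'k = 'k]
          by (simp add: emb_mult weight_add algebra_simps)
        hence "q (esym n i * r) s = q r s'" using ks ks' by (simp add: q_def)
        thus ?thesis unfolding lookup_Q s lookup_var_mult by simp
      qed
    qed
  qed
  define \<phi> where "\<phi> r = subst (esym n) (Q r)" for r
  have \<phi>_mult: "\<phi> (a * r) = a * \<phi> r" if a: "a \<in> sym_polys n" and r: "r \<in> R" for a r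
  proof -
    have "\<forall>r\<in>R. \<phi> (subst (esym n) p * r) = subst (esym n) p * \<phi> r" if "p \<in> poly_ring n" for p
      using that
    proof (induction p rule: poly_ring_induct)
      case (const c)
      show ?case by (simp add: \<phi>_def Q_const subst_mult)
    next
      case (var i)
      thus ?case by (simp add: \<phi>_def Q_var subst_mult)
    next
      case (add p p')
      have "\<phi> (subst (esym n) (p + p') * r) = subst (esym n) (p + p') * \<phi> r" if r: "r \<in> R" for r
      proof -
        have "subst (esym n) p * r \<in> R" "subst (esym n) p' * r \<in> R"
          by (rule R_mult[OF sub[OF subst_esym_sym[OF add.hyps(1)]] r],
              rule R_mult[OF sub[OF subst_esym_sym[OF add.hyps(2)]] r])
        from Q_add[OF this] show ?thesis using add.IH r
          by (simp add: \<phi>_def subst_add distrib_right)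
      qed
      thus ?case by blast
    next
      case (mult p p')
      have "\<phi> (subst (esym n) (p * p') * r) = subst (esym n) (p * p') * \<phi> r" if r: "r \<in> R" for r
      proof -
        have "subst (esym n) p' * r \<in> R"
          by (rule R_mult[OF sub[OF subst_esym_sym[OF mult.hyps(2)]] r])
        hence "\<phi> (subst (esym n) p * (subst (esym n) p' * r)) =
            subst (esym n) p * (subst (esym n) p' * \<phi> r)" using mult.IH r by simp
        thus ?thesis by (simp add: subst_mult mult.assoc)
      qed
      thus ?case by blast
    qed
    from this[OF fundamental_theorem(1)[OF a]] show ?thesis using fundamental_theorem(2)[OF a] r by simp
  qed
  have "\<exists>u\<in>semi n G. homogeneous (d - wt + int (card (pairs n))) u \<and> (\<forall>r\<in>R. \<phi> r = ctr n G (u * r))"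
  proof (rule linear_maps_to_sym[OF G char _ _ \<phi>_mult])
    show "\<phi> r \<in> sym_polys n" for r unfolding \<phi>_def by (rule subst_esym_sym[OF Q_ring])
    show "\<phi> (r + r') = \<phi> r + \<phi> r'" if "r \<in> R" "r' \<in> R" for r r'
      using Q_add[OF that] by (simp add: \<phi>_def subst_add)
    show "homogeneous (m + (d - wt)) (\<phi> r)" if "r \<in> R" "homogeneous m r" for m r
      unfolding \<phi>_def
    proof (rule homogeneous_subst_esym)
      show "isobaric (m + (d - wt)) (Q r)"
        unfolding isobaric_def
      proof
        fix s assume "s \<in> keys (Q r)"
        hence "q r s \<noteq> 0" by (simp add: in_keys_iff lookup_Q)
        from q_supp[OF this] show "int (weight (\<lambda>i. i) s) = m + (d - wt)"
          using that(2) by (auto simp: homogeneous_def)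
      qed
    qed
  qed
  then obtain u where u: "u \<in> semi n G" "homogeneous (d - wt + int (card (pairs n))) u"
    "\<And>r. r \<in> R \<Longrightarrow> \<phi> r = ctr n G (u * r)" by blast
  have "int n + int (card (pairs n)) = wt"
    using card_pairs[of n] by (simp add: wt_def flip: of_nat_add)
  hence "d - wt + int (card (pairs n)) = d - int n" by linarith
  hence u_hom: "homogeneous (d - int n) u" using u(2) by (simp only:)
  have "paired d \<mu> u"
    unfolding paired_def
  proof (intro allI impI)
    fix r t assume r: "r \<in> R" "homogeneous (- d + int (Suc t) * wt) r"
    have "res u r t = lookup (in_esym n (\<phi> r)) (vec {1..n} t)" using u(3)[OF r(1)] by (simp add: res_def)
    also have "in_esym n (\<phi> r) = Q r" unfolding \<phi>_def by (rule in_esym_eqI[OF Q_ring refl])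
    also have "lookup (Q r) (vec {1..n} t) = \<mu>' (frac r (vec {1..n} t))"
      using keys_vec[of "{1..n}" t] by (simp add: lookup_Q q_def)
    also have "frac r (vec {1..n} t) = emb r / emb E ^ Suc t"
    proof -
      have "int (weight (\<lambda>i. i) (vec {1..n} t)) + wt - d = - d + int (Suc t) * wt"
        by (simp add: weight_vec wt_def algebra_simps)
      hence "hcomp (int (weight (\<lambda>i. i) (vec {1..n} t)) + wt - d) r = r"
        using hcomp_idem[OF r(2)] by simp
      thus ?thesis unfolding frac_def E_power[symmetric] by (simp add: emb_mult emb_power mult.commute)
    qed
    finally show "\<mu> (top_cochain (emb r / emb E ^ Suc t)) = res u r t" by (simp add: \<mu>'_def)
  qed
  thus ?thesis using u u_hom by blast
qed

theorem omega_semi_invariants: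
  "graded_iso R (omega J n) (shift (ring_as_module (semi n G)) (- int n))"
proof (rule graded_isoI[where
      f = "\<lambda>d \<mu>. THE u. u \<in> semi n G \<and> homogeneous (d - int n) u \<and> paired d \<mu> u"])
  let ?S = "shift (ring_as_module (semi n G)) (- int n) :: ('k mpoly, 'k mpoly) graded_module"
  let ?F = "\<lambda>d \<mu>. THE u. u \<in> semi n G \<and> homogeneous (d - int n) u \<and> paired d \<mu> u"
  have S: "gcomp ?S d = {u \<in> semi n G. homogeneous (d - int n) u}" for d
    by (auto simp: shift_def ring_as_module_def)
  have F_eq: "?F d \<mu> = u" if "u \<in> semi n G" "homogeneous (d - int n) u" "paired d \<mu> u" for d \<mu> u
    using that by (intro the_equality) (auto intro: paired_unique_right)
  have F: "?F d \<mu> \<in> semi n G" "homogeneous (d - int n) (?F d \<mu>)" "paired d \<mu> (?F d \<mu>)"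
    if "\<mu> \<in> gcomp (omega J n) d" for d \<mu>
    using paired_exists_right[OF that] F_eq by auto
  have closed: "closed_gm R (omega J n)"
    by (rule graded_quotient.closed_qdual[OF graded_quotient_cech[OF JU]])
  show "bij_betw (?F d) (gcomp (omega J n) d) (gcomp ?S d)" for d
    unfolding bij_betw_def
  proof
    show "inj_on (?F d) (gcomp (omega J n) d)"
    proof (rule inj_onI)
      fix \<mu> \<nu> assume \<mu>: "\<mu> \<in> gcomp (omega J n) d" and \<nu>: "\<nu> \<in> gcomp (omega J n) d"
        and eq: "?F d \<mu> = ?F d \<nu>"
      show "\<mu> = \<nu>"
        by (rule paired_unique_left[OF \<mu> \<nu> F(3)[OF \<mu>]]) (simp only: eq F(3)[OF \<nu>])
    qed
    show "?F d ` gcomp (omega J n) d = gcomp ?S d"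
    proof
      show "?F d ` gcomp (omega J n) d \<subseteq> gcomp ?S d" using F by (auto simp: S)
      show "gcomp ?S d \<subseteq> ?F d ` gcomp (omega J n) d"
      proof
        fix u assume u: "u \<in> gcomp ?S d"
        then obtain \<mu> where "\<mu> \<in> gcomp (omega J n) d" "paired d \<mu> u"
          using paired_exists_left[of u d] by (auto simp: S)
        thus "u \<in> ?F d ` gcomp (omega J n) d" using F_eq u by (auto simp: S intro!: image_eqI)
      qed
    qed
  qed
  have mem: "top_cochain (emb r / emb E ^ Suc t) \<in> ZZ J n (- d)"
    if "r \<in> R" "homogeneous (- d + int (Suc t) * wt) r" for r t d
    unfolding ZZ_iff by (intro exI[of _ r] exI[of _ t] conjI that refl)
  show "?F d (gadd (omega J n) d \<mu> \<nu>) = gadd ?S d (?F d \<mu>) (?F d \<nu>)"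
    if \<mu>: "\<mu> \<in> gcomp (omega J n) d" and \<nu>: "\<nu> \<in> gcomp (omega J n) d" for d \<mu> \<nu>
  proof -
    have "paired d (gadd (omega J n) d \<mu> \<nu>) (?F d \<mu> + ?F d \<nu>)"
    proof (rule pairedI)
      fix r t assume r: "r \<in> R" "homogeneous (- d + int (Suc t) * wt) r"
      let ?z = "top_cochain (emb r / emb E ^ Suc t)"
      have "gadd (omega J n) d \<mu> \<nu> ?z = \<mu> ?z + \<nu> ?z"
        using mem[OF r] by (simp add: qdual_def)
      also have "\<dots> = res (?F d \<mu>) r t + res (?F d \<nu>) r t"
        by (simp only: pairedD[OF F(3)[OF \<mu>] r] pairedD[OF F(3)[OF \<nu>] r])
      also have "\<dots> = res (?F d \<mu> + ?F d \<nu>) r t"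
        by (rule res_add_left[OF F(1)[OF \<mu>] F(1)[OF \<nu>] r(1), symmetric])
      finally show "gadd (omega J n) d \<mu> \<nu> ?z = res (?F d \<mu> + ?F d \<nu>) r t" .
    qed
    from F_eq[OF semi_add[OF F(1)[OF \<mu>] F(1)[OF \<nu>]] homogeneous_add[OF F(2)[OF \<mu>] F(2)[OF \<nu>]] this]
    show ?thesis by (simp add: shift_def ring_as_module_def)
  qed
  show "?F (e + d) (gscale (omega J n) e d r \<mu>) = gscale ?S e d r (?F d \<mu>)"
    if r: "r \<in> R" and \<mu>: "\<mu> \<in> gcomp (omega J n) d" and hr: "homogeneous e r" for e d r \<mu>
  proof -
    have "paired (e + d) (gscale (omega J n) e d r \<mu>) (r * ?F d \<mu>)"
    proof (rule pairedI)
      fix r' t assume r': "r' \<in> R" "homogeneous (- (e + d) + int (Suc t) * wt) r'"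
      let ?z = "top_cochain (emb r' / emb E ^ Suc t)"
      have "sc r ?z = top_cochain (emb (r * r') / emb E ^ Suc t)"
        unfolding top_sc emb_mult by (simp only: times_divide_eq_right)
      hence "gscale (omega J n) e d r \<mu> ?z = \<mu> (top_cochain (emb (r * r') / emb E ^ Suc t))"
        using mem[OF r'] by (simp add: qdual_def del: minus_add_distrib)
      also have "\<dots> = res (?F d \<mu>) (r * r') t"
      proof -
        have "homogeneous (- d + int (Suc t) * wt) (r * r')"
          by (rule homogeneous_mult'[OF hr r'(2)]) simp
        thus ?thesis by (rule pairedD[OF F(3)[OF \<mu>] R_mult[OF r r'(1)]])
      qed
      also have "\<dots> = res (r * ?F d \<mu>) r' t" by (simp add: res_def mult_ac)
      finally show "gscale (omega J n) e d r \<mu> ?z = res (r * ?F d \<mu>) r' t" .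
    qed
    moreover have "homogeneous (e + d - int n) (r * ?F d \<mu>)"
      by (rule homogeneous_mult'[OF hr F(2)[OF \<mu>]]) simp
    ultimately have "?F (e + d) (gscale (omega J n) e d r \<mu>) = r * ?F d \<mu>"
      using semi_mult[OF r F(1)[OF \<mu>]] by (intro F_eq)
    thus ?thesis by (simp add: shift_def ring_as_module_def)
  qed
qed

end

section \<open>Ideals of subrings of the polynomial ring\<close>

context graded_subring
begin

lemma ring_on_simps:
  "carrier (ring_on R) = R" "mult (ring_on R) = (*)" "one (ring_on R) = 1"
  "zero (ring_on R) = 0" "add (ring_on R) = (+)"
  by (simp_all add: ring_on_def)

lemma cring_ring_on: "cring (ring_on R)"
proof (rule cringI)
  show "abelian_group (ring_on R)"
  proof (rule abelian_groupI)
    fix x assume "x \<in> carrier (ring_on R)"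
    thus "\<exists>y\<in>carrier (ring_on R). y \<oplus>\<^bsub>ring_on R\<^esub> x = \<zero>\<^bsub>ring_on R\<^esub>"
      by (intro bexI[of _ "- x"]) (auto simp: ring_on_simps R_uminus)
  qed (auto simp: ring_on_simps R_add R_0 algebra_simps)
  show "comm_monoid (ring_on R)"
    by (rule comm_monoidI) (auto simp: ring_on_simps R_mult R_1 algebra_simps)
qed (auto simp: ring_on_simps algebra_simps)

lemma ideal_ring_onI:
  assumes "I \<subseteq> R" "0 \<in> I" "\<And>x y. x \<in> I \<Longrightarrow> y \<in> I \<Longrightarrow> x + y \<in> I"
    "\<And>r x. r \<in> R \<Longrightarrow> x \<in> I \<Longrightarrow> r * x \<in> I"
  shows "ideal I (ring_on R)"
proof -
  interpret cring "ring_on R" by (rule cring_ring_on)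
  show ?thesis
  proof (rule idealI)
    show "subgroup I (add_monoid (ring_on R))"
    proof (rule group.subgroupI)
      show "group (add_monoid (ring_on R))" by (rule a_group)
      fix x assume x: "x \<in> I"
      have "inv\<^bsub>add_monoid (ring_on R)\<^esub> x = - x"
        using assms(1) x R_uminus
        by (intro group.inv_equality[OF a_group]) (auto simp: ring_on_simps)
      thus "inv\<^bsub>add_monoid (ring_on R)\<^esub> x \<in> I"
        using assms(4)[OF R_uminus[OF R_1] x] by simp
    qed (use assms in \<open>auto simp: ring_on_simps\<close>)
  next
    fix a x assume "a \<in> I" "x \<in> carrier (ring_on R)"
    thus "x \<otimes>\<^bsub>ring_on R\<^esub> a \<in> I" "a \<otimes>\<^bsub>ring_on R\<^esub> x \<in> I"
      using assms(4)[of x a] by (simp_all add: ring_on_simps mult.commute)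
  qed (rule ring_axioms)
qed

lemma ideal_ring_onD:
  assumes "ideal I (ring_on R)"
  shows "I \<subseteq> R" "0 \<in> I" "\<And>x y. x \<in> I \<Longrightarrow> y \<in> I \<Longrightarrow> x + y \<in> I"
    "\<And>r x. r \<in> R \<Longrightarrow> x \<in> I \<Longrightarrow> r * x \<in> I"
proof -
  interpret ideal I "ring_on R" by fact
  show "I \<subseteq> R" using a_subset by (simp add: ring_on_simps)
  show "0 \<in> I" using additive_subgroup.zero_closed[OF is_additive_subgroup] by (simp add: ring_on_simps)
  show "\<And>x y. x \<in> I \<Longrightarrow> y \<in> I \<Longrightarrow> x + y \<in> I"
    using additive_subgroup.a_closed[OF is_additive_subgroup] by (simp add: ring_on_simps)
  show "\<And>r x. r \<in> R \<Longrightarrow> x \<in> I \<Longrightarrow> r * x \<in> I"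
    using I_l_closed by (simp add: ring_on_simps)
qed

lemma ideal_sum:
  assumes "ideal I (ring_on R)" "\<And>a. a \<in> A \<Longrightarrow> f a \<in> I" shows "sum f A \<in> I"
  using assms(2) by (induction A rule: infinite_finite_induct) (auto intro: ideal_ring_onD[OF assms(1)])

lemma genideal_facts:
  assumes "S \<subseteq> R"
  shows "ideal (genideal (ring_on R) S) (ring_on R)" "S \<subseteq> genideal (ring_on R) S"
    "\<And>I. ideal I (ring_on R) \<Longrightarrow> S \<subseteq> I \<Longrightarrow> genideal (ring_on R) S \<subseteq> I"
proof -
  interpret cring "ring_on R" by (rule cring_ring_on)
  have "S \<subseteq> carrier (ring_on R)" using assms by (simp add: ring_on_simps)
  thus "ideal (genideal (ring_on R) S) (ring_on R)" "S \<subseteq> genideal (ring_on R) S"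
    by (rule genideal_ideal, rule genideal_self)
  show "\<And>I. ideal I (ring_on R) \<Longrightarrow> S \<subseteq> I \<Longrightarrow> genideal (ring_on R) S \<subseteq> I"
    by (rule genideal_minimal)
qed

lemma genideal_combination:
  assumes fs: "set fs \<subseteq> R" and x: "x \<in> genideal (ring_on R) (set fs)"
  shows "\<exists>a. (\<forall>j<length fs. a j \<in> R) \<and> x = (\<Sum>j<length fs. a j * fs ! j)"
proof -
  let ?I = "{x. \<exists>a. (\<forall>j<length fs. a j \<in> R) \<and> x = (\<Sum>j<length fs. a j * fs ! j)}"
  have nth: "fs ! j \<in> R" if "j < length fs" for j using fs that by (auto simp: set_conv_nth)
  have "ideal ?I (ring_on R)"
  proof (rule ideal_ring_onI)
    show "?I \<subseteq> R" using nth by (auto intro!: R_sum R_mult)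
    show "0 \<in> ?I" using R_0 by (auto intro!: exI[of _ "\<lambda>_. 0"])
  next
    fix x y assume "x \<in> ?I" "y \<in> ?I"
    then obtain a b where "\<forall>j<length fs. a j \<in> R" "x = (\<Sum>j<length fs. a j * fs ! j)"
      "\<forall>j<length fs. b j \<in> R" "y = (\<Sum>j<length fs. b j * fs ! j)" by blast
    thus "x + y \<in> ?I"
      by (intro CollectI exI[of _ "\<lambda>j. a j + b j"]) (auto simp: R_add distrib_right sum.distrib)
  next
    fix r x assume "r \<in> R" "x \<in> ?I"
    then obtain a where "r \<in> R" "\<forall>j<length fs. a j \<in> R" "x = (\<Sum>j<length fs. a j * fs ! j)" by blast
    thus "r * x \<in> ?I"
      by (intro CollectI exI[of _ "\<lambda>j. r * a j"]) (auto simp: R_mult sum_distrib_left mult.assoc)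
  qed
  moreover have "set fs \<subseteq> ?I"
  proof
    fix y assume "y \<in> set fs"
    then obtain l where l: "l < length fs" "y = fs ! l" by (auto simp: set_conv_nth)
    have "(\<Sum>j<length fs. (if j = l then 1 else 0) * fs ! j) = (\<Sum>j<length fs. if j = l then fs ! l else 0)"
      by (intro sum.cong) auto
    also have "\<dots> = y" using l by simp
    finally show "y \<in> ?I"
      using R_0 R_1 by (intro CollectI exI[of _ "\<lambda>j. if j = l then 1 else 0"]) auto
  qed
  ultimately have "genideal (ring_on R) (set fs) \<subseteq> ?I" by (rule genideal_facts(3)[OF fs])
  thus ?thesis using x by blast
qed

lemma combination_genideal:
  assumes "set fs \<subseteq> R" "\<And>j. j \<in> A \<Longrightarrow> a j \<in> R" "\<And>j. j \<in> A \<Longrightarrow> f j \<in> set fs"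
  shows "(\<Sum>j\<in>A. a j * f j) \<in> genideal (ring_on R) (set fs)"
  using genideal_facts[OF assms(1)] assms(2,3)
  by (intro ideal_sum ideal_ring_onD(4)[OF genideal_facts(1)[OF assms(1)]]) auto

lemma ideal_irrelevant: "ideal (irrelevant_ideal R) (ring_on R)"
  by (rule ideal_ring_onI)
    (auto simp: irrelevant_ideal_def R_0 R_add R_mult lookup_0_add lookup_0_mult)

end

section \<open>The elementary symmetric polynomials as a system of parameters\<close>

definition es :: "nat \<Rightarrow> 'k::field mpoly list" where "es n = map (esym n) [1..<Suc n]"

lemma length_es [simp]: "length (es n) = n"
  by (simp add: es_def)

lemma es_nth: "i < n \<Longrightarrow> es n ! i = esym n (Suc i)"
  unfolding es_def by (subst nth_map) (auto simp del: upt_Suc)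

lemma set_es: "set (es n) = esym n ` {1..n}"
  by (auto simp: es_def)

lemma es_irrelevant:
  "perm_grp n G \<Longrightarrow> CHAR('k::field) \<noteq> 2 \<Longrightarrow> set (es n) \<subseteq> irrelevant_ideal (invariants n G :: 'k mpoly set)"
  using sym_polys_subset[of n G, where 'k = 'k] esym_sym[of n]
  by (auto simp: set_es irrelevant_ideal_def lookup_esym_0)

lemma es_generates:
  assumes G: "perm_grp n G" and char: "CHAR('k::field) \<noteq> 2"
  shows "generates_up_to_radical (invariants n G :: 'k mpoly set) (es n)"
proof -
  let ?R = "invariants n G :: 'k mpoly set"
  interpret graded_subring ?R by (rule graded_subring_invariants)
  have irr: "set (es n) \<subseteq> irrelevant_ideal ?R" by (rule es_irrelevant[OF G char])
  hence sub: "set (es n) \<subseteq> ?R" by (auto simp: irrelevant_ideal_def)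
  have "radical ?R (genideal (ring_on ?R) (set (es n))) = irrelevant_ideal ?R"
  proof
    show "radical ?R (genideal (ring_on ?R) (set (es n))) \<subseteq> irrelevant_ideal ?R"
    proof
      fix r assume "r \<in> radical ?R (genideal (ring_on ?R) (set (es n)))"
      then obtain t where t: "r \<in> ?R" "r ^ t \<in> genideal (ring_on ?R) (set (es n))"
        by (auto simp: radical_def)
      hence "r ^ t \<in> irrelevant_ideal ?R" using genideal_facts(3)[OF sub ideal_irrelevant irr] by blast
      hence "lookup r 0 ^ t = 0" by (simp add: irrelevant_ideal_def lookup_0_power)
      thus "r \<in> irrelevant_ideal ?R" using t(1) by (simp add: irrelevant_ideal_def)
    qed
    show "irrelevant_ideal ?R \<subseteq> radical ?R (genideal (ring_on ?R) (set (es n)))"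
    proof
      fix r assume r: "r \<in> irrelevant_ideal ?R"
      obtain t a where "\<forall>i. a i \<in> ?R" "r ^ t = (\<Sum>i\<in>{1..n}. a i * esym n i)"
        using power_in_esym_ideal[of r n G] r G by (auto simp: irrelevant_ideal_def perm_grp_def)
      hence "r ^ t \<in> genideal (ring_on ?R) (set (es n))"
        using combination_genideal[OF sub, of "{1..n}" a "esym n"] by (simp add: set_es)
      thus "r \<in> radical ?R (genideal (ring_on ?R) (set (es n)))"
        using r by (auto simp: radical_def irrelevant_ideal_def)
    qed
  qed
  moreover have "\<forall>f\<in>set (es n). f \<in> ?R \<and> f \<noteq> 0 \<and> (\<exists>d. homogeneous d f)"
    using sub esym_neq_0[of _ n] homogeneous_esym[of _ n] by (auto simp: set_es simp del: atLeastAtMost_iff)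
  ultimately show ?thesis by (simp add: generates_up_to_radical_def)
qed

section \<open>The canonical module does not depend on the sequence\<close>

context cech
begin

lemma cech_cohomology_eq:
  assumes fs: "\<forall>j<length fs. f j = fs ! j" and U: "{..<length fs} \<subseteq> U"
  shows "cech_cohomology R fs i = qmod (ZZ {..<length fs} i) (BB {..<length fs} i) sc"
proof -
  have "(\<Prod>j\<in>I. fs ! j) = (\<Prod>j\<in>I. f j)" if "I \<subseteq> {..<length fs}" for I
    using that fs by (intro prod.cong) auto
  hence CC: "cech_cochains R fs i d = CC {..<length fs} i d" for i d
    unfolding cech_cochains_def CC_def by (intro Collect_cong all_cong1) auto
  have "cech_cocycles R fs i = ZZ {..<length fs} i" "cech_coboundaries R fs i = BB {..<length fs} i"
    by (auto simp: fun_eq_iff cech_cocycles_def ZZ_def cech_coboundaries_def BB_def CC cech_diff_eq)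
  moreover have "(\<lambda>r z I. Fraction_Field.Fract r 1 * z I) = sc"
    by (simp add: sc_def emb_def fun_eq_iff)
  ultimately show ?thesis by (simp add: cech_cohomology_eq_qmod)
qed

lemma canonical_module_omega:
  assumes fs: "\<forall>j<length fs. f j = fs ! j" and U: "{..<length fs} \<subseteq> U"
  shows "closed_gm R (canonical_module i R fs)"
    "graded_iso R (canonical_module i R fs) (omega {..<length fs} i)"
  unfolding canonical_module_def cech_cohomology_eq[OF assms]
  by (rule graded_quotient.closed_dual_qmod[OF graded_quotient_cech[OF U]]
      graded_quotient.dual_qmod_iso[OF graded_quotient_cech[OF U]])+

end

text \<open>
  Both the given sequence and \<open>e\<^sub>1, \<dots>, e\<^sub>n\<close> are compared with their concatenation.
\<close>

theorem canonical_module_invariants: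
  assumes G: "perm_grp n G" and char: "CHAR('k::field) \<noteq> 2"
    and fs: "generates_up_to_radical (invariants n G :: 'k mpoly set) fs"
  shows "closed_gm (invariants n G) (canonical_module n (invariants n G :: 'k mpoly set) fs)"
    "graded_iso (invariants n G) (canonical_module n (invariants n G :: 'k mpoly set) fs)
       (shift (ring_as_module (semi n G)) (- int n))"
proof -
  let ?R = "invariants n G :: 'k mpoly set"
  interpret graded_subring ?R by (rule graded_subring_invariants)
  have fs1: "f \<in> ?R" "f \<noteq> 0" "\<exists>d. homogeneous d f" if "f \<in> set fs" for f
    using fs that by (auto simp: generates_up_to_radical_def)
  have fs_R: "set fs \<subseteq> ?R" using fs1 by blast
  have rad: "radical ?R (genideal (ring_on ?R) (set fs)) = irrelevant_ideal ?R"
    using fs by (simp add: generates_up_to_radical_def)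
  let ?r = "length fs"
  define f where "f = (\<lambda>j. (fs @ es n) ! j)"
  define U where "U = {..<?r + n}"
  define J where "J = {?r..<?r + n}"
  have f1: "f j = fs ! j" if "j < ?r" for j using that by (simp add: f_def nth_append)
  hence f1': "\<forall>j<?r. f j = fs ! j" by blast
  have f2: "f j = esym n (Suc (j - ?r))" if "j \<in> J" for j
    using that by (auto simp: f_def nth_append J_def es_nth)
  have UJ: "U = {..<?r} \<union> J" "{..<?r} \<inter> J = {}" by (auto simp: U_def J_def)
  have es1: "esym n i \<in> ?R" for i using sym_polys_subset[OF G char] esym_sym by blast
  have f_all: "f j \<in> ?R \<and> f j \<noteq> 0 \<and> (\<exists>d. homogeneous d (f j))" if "j \<in> U" for j
  proof (cases "j < ?r")
    case True
    thus ?thesis using fs1[of "fs ! j"] f1 by simp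
  next
    case False
    hence j: "j \<in> J" "Suc (j - ?r) \<in> {1..n}" using that by (auto simp: U_def J_def)
    show ?thesis unfolding f2[OF j(1)] using es1 esym_neq_0[OF j(2)] homogeneous_esym by blast
  qed
  define dg where "dg j = (SOME d. homogeneous d (f j))" for j
  have dg: "homogeneous (dg j) (f j)" if "j \<in> U" for j
    unfolding dg_def using f_all[OF that] someI_ex by metis
  interpret cech ?R f dg U
    by unfold_locales (use f_all dg in \<open>auto simp: U_def\<close>)
  have bij: "bij_betw (\<lambda>j. Suc (j - ?r)) J {1..n}"
    by (rule bij_betw_byWitness[where f' = "\<lambda>i. i - 1 + ?r"]) (auto simp: J_def)
  interpret esym_cech n G f dg U J "\<lambda>j. Suc (j - ?r)"
    by unfold_locales (use G char UJ bij f2 in auto)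
  have rad1: "in_radical {..<?r} (f j)" if "j \<in> J" for j
  proof -
    have j: "Suc (j - ?r) \<in> {1..n}" using that by (auto simp: J_def)
    hence "f j \<in> irrelevant_ideal ?R"
      unfolding f2[OF that] using es1 by (simp add: irrelevant_ideal_def lookup_esym_0)
    then obtain t where "f j ^ t \<in> genideal (ring_on ?R) (set fs)"
      unfolding rad[symmetric] radical_def by blast
    from genideal_combination[OF fs_R this] obtain a where
      "\<forall>j<?r. a j \<in> ?R" "f j ^ t = (\<Sum>j<?r. a j * fs ! j)" by blast
    thus ?thesis unfolding in_radical_def
      by (intro exI[of _ t] exI[of _ a]) (simp add: f1)
  qed
  have rad2: "in_radical J (f j)" if "j < ?r" for j
  proof -
    have "f j \<in> genideal (ring_on ?R) (set fs)" using genideal_facts(2)[OF fs_R] that f1 by auto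
    moreover have "f j \<in> ?R" using that fs1(1)[of "fs ! j"] f1 by simp
    ultimately have "f j \<in> irrelevant_ideal ?R"
      unfolding rad[symmetric] radical_def by (auto intro!: exI[of _ 1])
    then obtain t a where ta: "\<forall>i. a i \<in> ?R" "f j ^ t = (\<Sum>i\<in>{1..n}. a i * esym n i)"
      using power_in_esym_ideal[of "f j" n G] G by (auto simp: irrelevant_ideal_def perm_grp_def)
    have "(\<Sum>i\<in>{1..n}. a i * esym n i) = (\<Sum>l\<in>J. a (Suc (l - ?r)) * esym n (Suc (l - ?r)))"
      by (rule sum.reindex_bij_betw[OF bij, symmetric])
    also have "\<dots> = (\<Sum>l\<in>J. a (Suc (l - ?r)) * f l)" by (intro sum.cong refl) (simp add: f2)
    finally show ?thesis unfolding in_radical_def using ta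
      by (intro exI[of _ t] exI[of _ "\<lambda>l. a (Suc (l - ?r))"]) simp
  qed
  have i1: "graded_iso ?R (omega {..<?r} n) (omega U n)"
    unfolding UJ(1) by (rule independence) (use UJ rad1 in auto)
  have "graded_iso ?R (omega J n) (omega (J \<union> {..<?r}) n)"
    by (rule independence) (use UJ rad2 in auto)
  hence "graded_iso ?R (omega J n) (omega U n)" unfolding UJ(1) by (simp only: Un_commute)
  hence i2: "graded_iso ?R (omega U n) (omega J n)"
    by (rule graded_iso_sym[OF graded_quotient.closed_qdual[OF graded_quotient_cech[OF JU]]])
  have sub: "{..<?r} \<subseteq> U" using UJ by blast
  note c = canonical_module_omega[OF f1' sub, of n]
  show "closed_gm ?R (canonical_module n ?R fs)" by (rule c(1))
  show "graded_iso ?R (canonical_module n ?R fs) (shift (ring_as_module (semi n G)) (- int n))"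
    using graded_iso_trans[OF graded_iso_trans[OF graded_iso_trans[OF c(2) i1] i2] omega_semi_invariants] .
qed

text \<open>
  The ring is quasi-Gorenstein for one sequence if and only if it is so for every sequence; that there is a
  sequence at all is \<open>es_generates\<close>.
\<close>

theorem quasi_Gorenstein_iff_semi_free:
  assumes G: "perm_grp n G" and char: "CHAR('k::field) \<noteq> 2"
  shows "quasi_Gorenstein n (invariants n G :: 'k mpoly set) \<longleftrightarrow>
    (\<exists>a. graded_iso (invariants n G) (shift (ring_as_module (invariants n G :: 'k mpoly set)) a)
       (shift (ring_as_module (semi n G)) (- int n)))"
proof -
  let ?R = "invariants n G :: 'k mpoly set" and ?S = "shift (ring_as_module (semi n G)) (- int n)"
  interpret graded_subring ?R by (rule graded_subring_invariants)
  note can = canonical_module_invariants[OF G char]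
  have closed: "closed_gm ?R (shift (ring_as_module ?R) a)" for a
    by (auto simp: closed_gm_def shift_def ring_as_module_def add.left_commute
        intro: R_add R_mult homogeneous_add homogeneous_mult')
  show ?thesis
  proof
    assume "quasi_Gorenstein n ?R"
    then obtain fs a where fs: "generates_up_to_radical ?R fs"
      and iso: "graded_iso ?R (canonical_module n ?R fs) (shift (ring_as_module ?R) a)"
      by (auto simp: quasi_Gorenstein_def)
    show "\<exists>a. graded_iso ?R (shift (ring_as_module ?R) a) ?S"
      using graded_iso_trans[OF graded_iso_sym[OF can(1)[OF fs] iso] can(2)[OF fs]] by blast
  next
    assume "\<exists>a. graded_iso ?R (shift (ring_as_module ?R) a) ?S"
    then obtain a where "graded_iso ?R ?S (shift (ring_as_module ?R) a)"
      using graded_iso_sym[OF closed] by blast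
    hence "graded_iso ?R (canonical_module n ?R (es n)) (shift (ring_as_module ?R) a)"
      using can(2)[OF es_generates[OF G char]] graded_iso_trans by blast
    thus "quasi_Gorenstein n ?R"
      unfolding quasi_Gorenstein_def using es_generates[OF G char] by blast
  qed
qed

section \<open>The character\<close>

definition tpairs :: "nat \<Rightarrow> (nat \<Rightarrow> nat) set \<Rightarrow> (nat \<times> nat) set" where
  "tpairs n G = {(i, j) \<in> pairs n. transpose i j \<in> G}"

lemma theta_eq: "theta n G = dprod (tpairs n G)"
proof -
  have "{(i, j). 1 \<le> i \<and> i < j \<and> j \<le> n \<and> transpose i j \<in> G} = tpairs n G"
    by (auto simp: tpairs_def pairs_def)
  thus ?thesis by (simp add: theta_def dprod_def)
qed

lemma tpairs_subset: "tpairs n G \<subseteq> pairs n"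
  by (auto simp: tpairs_def)

lemma tpairs_stable:
  assumes G: "perm_grp n G" and \<sigma>: "\<sigma> \<in> G" and ij: "(i, j) \<in> tpairs n G"
  shows "(min (\<sigma> i) (\<sigma> j), max (\<sigma> i) (\<sigma> j)) \<in> tpairs n G"
proof -
  note s = perm_grpD(1)[OF G \<sigma>]
  have "\<sigma> \<circ> (transpose i j \<circ> inv' \<sigma>) \<in> G"
    using perm_grpD(3,4)[OF G] \<sigma> ij by (auto simp: tpairs_def)
  also have "\<sigma> \<circ> (transpose i j \<circ> inv' \<sigma>) = transpose (\<sigma> i) (\<sigma> j)"
  proof
    fix x
    have inv: "inv' \<sigma> (\<sigma> y) = y" "\<sigma> (inv' \<sigma> x) = x" for y
      using s by (simp_all add: permutes_inverses)
    have "inv' \<sigma> x = i \<longleftrightarrow> x = \<sigma> i" "inv' \<sigma> x = j \<longleftrightarrow> x = \<sigma> j" using inv by metis+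
    thus "(\<sigma> \<circ> (transpose i j \<circ> inv' \<sigma>)) x = transpose (\<sigma> i) (\<sigma> j) x"
      using inv by (auto simp: transpose_def)
  qed
  finally have "transpose (\<sigma> i) (\<sigma> j) \<in> G" .
  moreover have "(min (\<sigma> i) (\<sigma> j), max (\<sigma> i) (\<sigma> j)) \<in> pairs n"
    using s ij by (intro pairs_stable) (auto simp: tpairs_def)
  ultimately show ?thesis by (auto simp: tpairs_def min_def max_def transpose_commute)
qed

lemma act_theta:
  assumes "perm_grp n G" "\<sigma> \<in> G"
  shows "act \<sigma> (theta n G) = of_int ((- 1) ^ inversions (tpairs n G) \<sigma>) * theta n G"
  unfolding theta_eq using perm_grpD(1)[OF assms] tpairs_stable[OF assms]
  by (intro act_dprod[OF tpairs_subset]) simp_all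

lemma theta_neq_0: "theta n G \<noteq> 0"
  unfolding theta_eq by (rule dprod_neq_0[OF tpairs_subset])

lemma chi_eq:
  assumes "perm_grp n G" "\<sigma> \<in> G"
  shows "chi n G \<sigma> = of_int ((- 1) ^ inversions (tpairs n G) \<sigma>)"
  unfolding chi_def
proof (rule the_equality)
  show "act \<sigma> (theta n G) = const (of_int ((- 1) ^ inversions (tpairs n G) \<sigma>)) * theta n G"
    unfolding act_theta[OF assms] of_int_eq_const ..
  fix c assume "act \<sigma> (theta n G) = const c * theta n G"
  hence "const (of_int ((- 1) ^ inversions (tpairs n G) \<sigma>)) * theta n G = const c * theta n G"
    unfolding act_theta[OF assms] of_int_eq_const .
  thus "c = of_int ((- 1) ^ inversions (tpairs n G) \<sigma>)"
    using theta_neq_0 by (metis const_inj mult_right_cancel)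
qed

lemma of_int_sign_inj:
  assumes "CHAR('k::field) \<noteq> 2"
  shows "(of_int (sign \<sigma>) :: 'k) = of_int ((- 1) ^ k) \<longleftrightarrow> sign \<sigma> = (- 1) ^ k"
  using char_neq_2D[OF assms] by (cases "even k") (auto simp: sign_def)

text \<open>
  The right-hand side does not mention the field.
\<close>

lemma character_trivial_iff:
  assumes "perm_grp n G" "\<sigma> \<in> G" "CHAR('k::field) \<noteq> 2"
  shows "(sgn_char \<sigma> :: 'k) / chi n G \<sigma> = 1 \<longleftrightarrow> sign \<sigma> = (- 1) ^ inversions (tpairs n G) \<sigma>"
proof -
  have "(chi n G \<sigma> :: 'k) \<noteq> 0" unfolding chi_eq[OF assms(1,2)] by simp
  hence "(sgn_char \<sigma> :: 'k) / chi n G \<sigma> = 1 \<longleftrightarrow> (sgn_char \<sigma> :: 'k) = chi n G \<sigma>"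
    by (simp add: divide_eq_1_iff)
  thus ?thesis unfolding chi_eq[OF assms(1,2)] sgn_char_def of_int_sign_inj[OF assms(3)] .
qed

lemma theta_dvd_semi:
  assumes G: "perm_grp n G" and char: "CHAR('k::field) \<noteq> 2" and t: "(t :: 'k mpoly) \<in> semi n G"
  shows "theta n G dvd t"
  unfolding theta_eq
proof (rule dprod_dvd[OF tpairs_subset])
  fix i j assume ij: "(i, j) \<in> tpairs n G"
  hence "act (transpose i j) t = of_int (sign (transpose i j)) * t"
    by (intro semi_act[OF t]) (auto simp: tpairs_def)
  moreover have "i \<noteq> j" using ij by (auto simp: tpairs_def pairs_def)
  ultimately show "subst (glue i j) t = 0"
    by (intro glue_kernel_invariant char) (simp add: act_eq_subst sign_swap_id)
qed

text \<open>
  If \<open>\<theta>\<close> is itself a semi-invariant, then it generates them, as it divides all of them.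
\<close>

lemma semi_free_if_character_trivial:
  assumes G: "perm_grp n G" and char: "CHAR('k::field) \<noteq> 2"
    and triv: "\<And>\<sigma>. \<sigma> \<in> G \<Longrightarrow> sign \<sigma> = (- 1) ^ inversions (tpairs n G) \<sigma>"
  shows "graded_iso (invariants n G)
    (shift (ring_as_module (invariants n G :: 'k mpoly set)) (- int n - int (card (tpairs n G))))
    (shift (ring_as_module (semi n G)) (- int n))"
proof (rule graded_isoI[where f = "\<lambda>_ p. theta n G * p"])
  let ?R = "invariants n G :: 'k mpoly set" and ?T = "int (card (tpairs n G))"
  have th_hom: "homogeneous ?T (theta n G)" unfolding theta_eq by (rule homogeneous_dprod)
  have th_ring: "theta n G \<in> poly_ring n"
    unfolding theta_eq using tpairs_subset pairs_subset by (intro dprod_poly_ring) blast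
  have th_act: "act \<sigma> (theta n G) = of_int (sign \<sigma>) * theta n G" if "\<sigma> \<in> G" for \<sigma>
    unfolding act_theta[OF G that] triv[OF that] ..
  have th_semi: "theta n G * r \<in> semi n G" if "r \<in> ?R" for r
    using that th_ring by (auto simp: semi_def act_hom th_act invariants_act invariants_poly_ring mult.assoc)
  fix d
  have dom: "gcomp (shift (ring_as_module ?R) (- int n - ?T)) d = {r \<in> ?R. homogeneous (- int n - ?T + d) r}"
    and cod: "gcomp (shift (ring_as_module (semi n G)) (- int n)) d = {t \<in> semi n G. homogeneous (- int n + d) t}"
    by (simp_all add: shift_def ring_as_module_def)
  show "bij_betw (\<lambda>p. theta n G * p) (gcomp (shift (ring_as_module ?R) (- int n - ?T)) d)
      (gcomp (shift (ring_as_module (semi n G)) (- int n)) d)"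
    unfolding bij_betw_def dom cod
  proof
    show "inj_on (\<lambda>p. theta n G * p) {r \<in> ?R. homogeneous (- int n - ?T + d) r}"
      using theta_neq_0[of n G] by (auto simp: inj_on_def)
    show "(\<lambda>p. theta n G * p) ` {r \<in> ?R. homogeneous (- int n - ?T + d) r} =
        {t \<in> semi n G. homogeneous (- int n + d) t}"
    proof
      show "(\<lambda>p. theta n G * p) ` {r \<in> ?R. homogeneous (- int n - ?T + d) r} \<subseteq>
        {t \<in> semi n G. homogeneous (- int n + d) t}"
        using th_semi by (auto intro!: homogeneous_mult'[OF th_hom])
      show "{t \<in> semi n G. homogeneous (- int n + d) t} \<subseteq>
        (\<lambda>p. theta n G * p) ` {r \<in> ?R. homogeneous (- int n - ?T + d) r}"
      proof
        fix t assume "t \<in> {t \<in> semi n G. homogeneous (- int n + d) (t :: 'k mpoly)}"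
        hence t: "t \<in> semi n G" "homogeneous (- int n + d) t" by auto
        obtain v where v: "t = theta n G * v" using theta_dvd_semi[OF G char t(1)] by (rule dvdE)
        have "v \<in> ?R"
        proof (rule invariantsI)
          show "v \<in> poly_ring n"
            using semi_poly_ring[OF t(1)] unfolding v
            by (rule poly_ring_dvd_cofactor[OF th_ring _ theta_neq_0])
          fix \<sigma> assume \<sigma>: "\<sigma> \<in> G"
          have "of_int (sign \<sigma>) * (theta n G * act \<sigma> v) = of_int (sign \<sigma>) * (theta n G * v)"
            using semi_act[OF t(1) \<sigma>] unfolding v act_hom th_act[OF \<sigma>] by (simp add: mult.assoc)
          hence "of_int (sign \<sigma>) * (of_int (sign \<sigma>) * (theta n G * act \<sigma> v)) =
              of_int (sign \<sigma>) * (of_int (sign \<sigma>) * (theta n G * v))" by (rule arg_cong)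
          thus "act \<sigma> v = v" unfolding of_int_sign_square using theta_neq_0[of n G, where 'a = 'k] by simp
        qed
        moreover have "homogeneous (- int n - ?T + d) v"
          using homogeneous_cofactor[OF th_hom theta_neq_0 t(2)[unfolded v]] by (simp add: algebra_simps)
        ultimately show "t \<in> (\<lambda>p. theta n G * p) ` {r \<in> ?R. homogeneous (- int n - ?T + d) r}"
          using v by blast
      qed
    qed
  qed
qed (simp_all add: shift_def ring_as_module_def algebra_simps)

lemma alternating_sum_semi:
  assumes G: "perm_grp n G" and g: "g \<in> poly_ring n"
  shows "(\<Sum>\<sigma>\<in>G. of_int (sign \<sigma>) * act \<sigma> g) \<in> semi n G"
  unfolding semi_def
proof (intro CollectI conjI ballI)
  show "(\<Sum>\<sigma>\<in>G. of_int (sign \<sigma>) * act \<sigma> g) \<in> poly_ring n"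
    unfolding of_int_eq_const using perm_grpD(1)[OF G] g
    by (intro poly_ring_sum poly_ring_mult act_poly_ring) auto
  fix \<tau> assume \<tau>: "\<tau> \<in> G"
  note t = perm_grpD(1)[OF G \<tau>]
  have "act \<tau> (\<Sum>\<sigma>\<in>G. of_int (sign \<sigma>) * act \<sigma> g) =
      (\<Sum>\<sigma>\<in>G. of_int (sign \<tau>) * (of_int (sign (\<tau> \<circ> \<sigma>)) * act (\<tau> \<circ> \<sigma>) g))"
    unfolding act_hom
  proof (intro sum.cong refl)
    fix \<sigma> assume "\<sigma> \<in> G"
    thus "act \<tau> (of_int (sign \<sigma>)) * act \<tau> (act \<sigma> g) =
        of_int (sign \<tau>) * (of_int (sign (\<tau> \<circ> \<sigma>)) * act (\<tau> \<circ> \<sigma>) g)"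
      using sign_comp_perms[OF t perm_grpD(1)[OF G]] by (simp add: act_comp mult.assoc)
  qed
  also have "\<dots> = of_int (sign \<tau>) * (\<Sum>\<sigma>\<in>G. of_int (sign (\<tau> \<circ> \<sigma>)) * act (\<tau> \<circ> \<sigma>) g)"
    by (rule sum_distrib_left[symmetric])
  also have "(\<Sum>\<sigma>\<in>G. of_int (sign (\<tau> \<circ> \<sigma>)) * act (\<tau> \<circ> \<sigma>) g) = (\<Sum>\<sigma>\<in>G. of_int (sign \<sigma>) * act \<sigma> g)"
    by (rule sum.reindex_bij_witness[where i = "(\<circ>) (inv' \<tau>)" and j = "(\<circ>) \<tau>"])
      (use \<tau> perm_grpD(3,4)[OF G] perms_inv_o(3,4)[OF t] in auto)
  finally show "act \<tau> (\<Sum>\<sigma>\<in>G. of_int (sign \<sigma>) * act \<sigma> g) =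
      of_int (sign \<tau>) * (\<Sum>\<sigma>\<in>G. of_int (sign \<sigma>) * act \<sigma> g)" .
qed

text \<open>
  Take \<open>separation\<close> for the product \<open>\<Prod> (x\<^sub>a - y\<^sub>b)\<close> over all pairs \<open>a \<noteq> b\<close> except those formed by \<open>i\<close> and \<open>j\<close>. A
  permutation other than \<open>id\<close> and \<open>(i j)\<close> moves some \<open>a\<close> to a \<open>b\<close> whose factor is present and vanishes.
  So the alternating sum over \<open>G\<close> isolates the term of \<open>id\<close> and represents \<open>\<Prod> (x\<^sub>a - x\<^sub>b)\<close> as a combination of
  semi-invariants; \<open>s\<close> divides it, but \<open>x\<^sub>i - x\<^sub>j\<close> does not.
\<close>

lemma generator_not_glued:
  fixes s :: "'k::field mpoly"
  assumes G: "perm_grp n G" and gen: "\<And>t. t \<in> semi n G \<Longrightarrow> s dvd t"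
    and ij: "(i, j) \<in> pairs n" "transpose i j \<notin> G"
  shows "subst (glue i j) s \<noteq> 0"
proof
  assume s0: "subst (glue i j) s = 0"
  define E where "E = {(a, b) \<in> {1..n} \<times> {1..n}. a \<noteq> b \<and> {a, b} \<noteq> {i, j}}"
  have E: "finite E" "E \<subseteq> {1..n} \<times> {1..n}"
    by (rule finite_subset[of _ "{1..n} \<times> {1..n}"]) (auto simp: E_def)
  obtain N and g h :: "nat \<Rightarrow> 'k mpoly" where gh:
    "\<And>c. c < N \<Longrightarrow> g c \<in> poly_ring n" "\<And>c. c < N \<Longrightarrow> h c \<in> poly_ring n"
    "\<And>c. c < N \<Longrightarrow> \<exists>a b. homogeneous a (g c) \<and> homogeneous b (h c) \<and> a + b = int (card E)"
    "\<And>\<sigma>. (\<Sum>c<N. act \<sigma> (g c) * h c) = (\<Prod>(a, b)\<in>E. var (\<sigma> a) - var b)"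
    by (rule separation[OF E, where 'k = 'k]) blast
  have vanish: "(\<Prod>(a, b)\<in>E. var (\<sigma> a) - var b :: 'k mpoly) = 0" if \<sigma>: "\<sigma> \<in> G" "\<sigma> \<noteq> id" for \<sigma>
  proof -
    have p: "\<sigma> permutes {1..n}" using perm_grpD(1)[OF G \<sigma>(1)] by simp
    have "\<exists>a. \<sigma> a \<noteq> a \<and> {a, \<sigma> a} \<noteq> {i, j}"
    proof (rule ccontr)
      assume "\<not> ?thesis"
      hence *: "{a, \<sigma> a} = {i, j}" if "\<sigma> a \<noteq> a" for a using that by blast
      obtain a where "\<sigma> a \<noteq> a" using \<sigma>(2) by (auto simp: fun_eq_iff)
      have inj: "\<sigma> a = \<sigma> b \<longleftrightarrow> a = b" for a b using permutes_inj[OF p] by (rule inj_eq)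
      have "\<sigma> x = transpose i j x" for x
      proof (cases "x = i \<or> x = j")
        case True
        have "\<sigma> x \<noteq> x"
        proof
          assume x: "\<sigma> x = x"
          have "a \<noteq> x" using x \<open>\<sigma> a \<noteq> a\<close> by auto
          moreover have "{a, \<sigma> a} = {i, j}" using * \<open>\<sigma> a \<noteq> a\<close> by blast
          ultimately have "\<sigma> a = x" using True by (auto simp: doubleton_eq_iff)
          thus False using x inj[of a x] \<open>a \<noteq> x\<close> by simp
        qed
        hence "{x, \<sigma> x} = {i, j}" by (rule *)
        thus ?thesis using True by (auto simp: doubleton_eq_iff transpose_def)
      next
        case False
        hence "\<sigma> x = x" using *[of x] by (auto simp: doubleton_eq_iff)
        thus ?thesis using False by (simp add: transpose_def)
      qed
      hence "\<sigma> = transpose i j" by blast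
      thus False using \<sigma>(1) ij(2) by simp
    qed
    then obtain a where a: "\<sigma> a \<noteq> a" "{a, \<sigma> a} \<noteq> {i, j}" by blast
    have "a \<in> {1..n}" using permutes_not_in[OF p] a(1) by blast
    hence "(a, \<sigma> a) \<in> E" using a permutes_in_image[OF p] by (auto simp: E_def simp del: atLeastAtMost_iff)
    thus ?thesis using E(1) by (intro prod_zero) (auto intro!: bexI[of _ "(a, \<sigma> a)"])
  qed
  let ?A = "\<lambda>c. \<Sum>\<sigma>\<in>G. of_int (sign \<sigma>) * act \<sigma> (g c)"
  have "(\<Sum>c<N. ?A c * h c) = (\<Sum>\<sigma>\<in>G. of_int (sign \<sigma>) * (\<Sum>c<N. act \<sigma> (g c) * h c))"
    by (simp add: sum_distrib_right sum_distrib_left mult.assoc sum.swap[of _ G])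
  also have "\<dots> = (\<Sum>\<sigma>\<in>G. if \<sigma> = id then (\<Prod>(a, b)\<in>E. var a - var b) else 0)"
    unfolding gh(4) by (intro sum.cong refl) (auto simp: vanish)
  also have "\<dots> = (\<Prod>(a, b)\<in>E. var a - var b)" using perm_grpD(2,5)[OF G] by simp
  finally have eq: "(\<Sum>c<N. ?A c * h c) = (\<Prod>(a, b)\<in>E. var a - var b)" .
  have "s dvd (\<Sum>c<N. ?A c * h c)"
    using gh(1) by (intro dvd_sum dvd_mult2 gen alternating_sum_semi[OF G]) auto
  then obtain q where q: "(\<Prod>(a, b)\<in>E. var a - var b) = s * q" unfolding eq by (rule dvdE)
  have "subst (glue i j) (\<Prod>(a, b)\<in>E. var a - var b :: 'k mpoly) = 0"
    unfolding q by (simp add: subst_mult s0)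
  hence "(\<Prod>(a, b)\<in>E. subst (glue i j) (var a - var b)) = (0 :: 'k mpoly)"
    unfolding subst_prod by (simp add: case_prod_unfold)
  then obtain a b where "(a, b) \<in> E" "subst (glue i j) (var a - var b) = (0 :: 'k mpoly)"
    using E(1) by (auto simp: prod_zero_iff)
  moreover have "i \<noteq> j" using ij by (auto simp: pairs_def)
  ultimately show False using glue_diff_neq_0[of i j a b, where 'a = 'k] by (auto simp: E_def)
qed

text \<open>
  The image \<open>s\<close> of \<open>1\<close> generates the semi-invariants. It is \<open>\<theta>\<close> times a cofactor \<open>u\<close>, and \<open>u\<close> divides the
  product of the differences \<open>x\<^sub>i - x\<^sub>j\<close> with \<open>(i j)\<close> not in \<open>G\<close>, because \<open>s\<close> divides the
  Vandermonde polynomial. None of these primes divides \<open>s\<close>, so \<open>u\<close> is a unit, and \<open>G\<close> acts on \<open>s\<close> and on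
  \<open>\<theta>\<close> through the same character.
\<close>

lemma character_trivial_if_semi_free:
  assumes G: "perm_grp n G" and char: "CHAR('k::field) \<noteq> 2"
    and iso: "graded_iso (invariants n G) (shift (ring_as_module (invariants n G :: 'k mpoly set)) a)
       (shift (ring_as_module (semi n G)) (- int n))"
    and \<sigma>: "\<sigma> \<in> G"
  shows "sign \<sigma> = (- 1) ^ inversions (tpairs n G) \<sigma>"
proof -
  let ?R = "invariants n G :: 'k mpoly set"
  let ?M = "shift (ring_as_module ?R) a" and ?N = "shift (ring_as_module (semi n G :: 'k mpoly set)) (- int n)"
  obtain f where f': "\<And>d. bij_betw (f d) (gcomp ?M d) (gcomp ?N d)"
    "\<And>e d r x. r \<in> ?R \<Longrightarrow> x \<in> gcomp ?M d \<Longrightarrow> homogeneous e r \<Longrightarrow>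
       f (e + d) (gscale ?M e d r x) = gscale ?N e d r (f d x)"
    by (rule graded_isoE[OF iso]) blast
  have f: "bij_betw (f d) {r \<in> ?R. homogeneous (a + d) r}
       {t \<in> semi n G. homogeneous (- int n + d) (t :: 'k mpoly)}"
    "r \<in> ?R \<Longrightarrow> x \<in> ?R \<Longrightarrow> homogeneous (a + d) x \<Longrightarrow> homogeneous e r \<Longrightarrow>
       f (e + d) (r * x) = r * f d x" for d e r x
    using f'(1)[of d] f'(2)[of r x d e] by (simp_all add: shift_def ring_as_module_def)
  define s where "s = f (- a) 1"
  have "s \<in> {t \<in> semi n G. homogeneous (- int n + - a) t}"
    unfolding s_def by (rule bij_betw_apply[OF f(1)]) auto
  hence s: "s \<in> semi n G" "homogeneous (- int n - a) s" by auto
  have gen_hom: "s dvd t" if t: "t \<in> semi n G" "homogeneous e t" for t e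
  proof -
    have "t \<in> {t \<in> semi n G. homogeneous (- int n + (e + int n)) t}" using t by simp
    hence "t \<in> f (e + int n) ` {r \<in> ?R. homogeneous (a + (e + int n)) r}"
      unfolding bij_betw_imp_surj_on[OF f(1)] .
    then obtain r where r: "r \<in> ?R" "homogeneous (a + (e + int n)) r" "t = f (e + int n) r"
      by blast
    have "f (a + (e + int n) + - a) (r * 1) = r * s"
      unfolding s_def using r by (intro f(2)) auto
    thus ?thesis using r(3) by (simp add: algebra_simps)
  qed
  have gen: "s dvd t" if t: "t \<in> semi n G" for t
  proof (subst hcomp_decomp, rule dvd_sum)
    show "s dvd hcomp e t" for e by (rule gen_hom[OF semi_hcomp[OF t] homogeneous_hcomp])
  qed
  have vdm_semi: "(vdm n :: 'k mpoly) \<in> semi n G"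
    unfolding semi_def
    by (intro CollectI conjI ballI dprod_poly_ring[OF pairs_subset] act_vdm[OF char perm_grpD(1)[OF G]])
  obtain q where q: "vdm n = s * q" using gen[OF vdm_semi] by (rule dvdE)
  obtain u where u: "s = theta n G * u" using theta_dvd_semi[OF G char s(1)] by (rule dvdE)
  let ?D = "pairs n - tpairs n G"
  have "vdm n = theta n G * (dprod ?D :: 'k mpoly)"
    unfolding theta_eq dprod_def
    using prod.subset_diff[OF tpairs_subset finite_pairs, of "\<lambda>(i, j). var i - var j :: 'k mpoly" n G]
    by (simp add: mult.commute)
  hence uq: "u * q = dprod ?D" using q theta_neq_0[of n G, where 'a = 'k] by (simp add: u mult.assoc)
  have "dprod ?D dvd q"
  proof (rule dprod_dvd)
    fix i j assume ij: "(i, j) \<in> ?D"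
    have "subst (glue i j) s \<noteq> 0"
      using ij by (intro generator_not_glued[OF G gen]) (auto simp: tpairs_def)
    hence "subst (glue i j) u \<noteq> 0" by (auto simp: u subst_mult)
    moreover have "dprod ?D = (var i - var j) * dprod (?D - {(i, j)})"
      using ij by (intro dprod_remove) auto
    hence "var i - var j dvd u * q" unfolding uq by (metis dvd_triv_left)
    hence "subst (glue i j) (u * q) = 0" by (rule glue_dvd)
    ultimately show "subst (glue i j) q = 0" by (simp add: subst_mult)
  qed auto
  then obtain q' where q': "q = dprod ?D * q'" by (rule dvdE)
  have "dprod ?D * (u * q') = dprod ?D * (1 :: 'k mpoly)"
    using uq unfolding q' by (simp add: mult_ac)
  hence uq': "u * q' = 1" using dprod_neq_0[of ?D n, where 'a = 'k] by (metis Diff_subset mult_left_cancel)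
  hence u0: "u \<noteq> 0" "q' \<noteq> 0" by auto
  have th_hom: "homogeneous (int (card (tpairs n G))) (theta n G)"
    unfolding theta_eq by (rule homogeneous_dprod)
  define e where "e = - int n - a - int (card (tpairs n G))"
  have ue: "homogeneous e u"
    unfolding e_def by (rule homogeneous_cofactor[OF th_hom theta_neq_0]) (use s(2) u in simp)
  have "homogeneous 0 (u * q')" unfolding uq' by simp
  hence q'e: "homogeneous (0 - e) q'" by (rule homogeneous_cofactor[OF ue u0(1)])
  have nonneg: "0 \<le> d" if hom: "homogeneous d p" and p: "p \<noteq> 0" for d and p :: "'k mpoly"
  proof -
    obtain m where "m \<in> keys p" using p by (metis equals0I keys_eq_empty)
    thus ?thesis using hom by (auto simp: homogeneous_def)
  qed
  have "e = 0" using nonneg[OF ue u0(1)] nonneg[OF q'e u0(2)] by simp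
  then obtain c where c: "u = const c" using homogeneous_degree_0 ue by blast
  have c0: "c \<noteq> 0" using u0 c by auto
  have "of_int (sign \<sigma>) * s = act \<sigma> s" using semi_act[OF s(1) \<sigma>] by simp
  also have "\<dots> = of_int ((- 1) ^ inversions (tpairs n G) \<sigma>) * s"
    unfolding u c act_hom act_theta[OF G \<sigma>] by (simp only: mult.assoc)
  finally have "(of_int (sign \<sigma>) :: 'k mpoly) = of_int ((- 1) ^ inversions (tpairs n G) \<sigma>)"
    using c0 theta_neq_0[of n G, where 'a = 'k] by (simp add: u c del: of_int_power)
  hence "(of_int (sign \<sigma>) :: 'k) = of_int ((- 1) ^ inversions (tpairs n G) \<sigma>)"
    unfolding of_int_eq_const const_inj .
  thus ?thesis using of_int_sign_inj[OF char] by blast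
qed

theorem quasi_Gorenstein_iff_character:
  assumes G: "perm_grp n G" and char: "CHAR('k::field) \<noteq> 2"
  shows "quasi_Gorenstein n (invariants n G :: 'k mpoly set) \<longleftrightarrow>
    (\<forall>\<sigma>\<in>G. sign \<sigma> = (- 1) ^ inversions (tpairs n G) \<sigma>)"
  unfolding quasi_Gorenstein_iff_semi_free[OF assms]
  using semi_free_if_character_trivial[OF assms] character_trivial_if_semi_free[OF assms] by blast

section \<open>Algebraic dependence\<close>

lemma underdetermined_system:
  fixes v :: "'a \<Rightarrow> 'b \<Rightarrow> 'k::field"
  assumes "finite B" "finite A" "card B < card A"
  shows "\<exists>c. (\<exists>a\<in>A. c a \<noteq> 0) \<and> (\<forall>b\<in>B. (\<Sum>a\<in>A. c a * v a b) = 0)"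
  using assms
proof (induction B arbitrary: A v rule: finite_induct)
  case empty
  then obtain a where "a \<in> A" by (metis all_not_in_conv card.empty less_irrefl)
  thus ?case by (intro exI[of _ "\<lambda>_. 1"]) auto
next
  case (insert b B)
  show ?case
  proof (cases "\<forall>a\<in>A. v a b = 0")
    case True
    have "card B < card A" using insert by simp
    then obtain c where "\<exists>a\<in>A. c a \<noteq> 0" "\<forall>b\<in>B. (\<Sum>a\<in>A. c a * v a b) = 0"
      using insert.IH[OF insert.prems(1), of v] by blast
    thus ?thesis using True by (intro exI[of _ c]) auto
  next
    case False
    then obtain a0 where a0: "a0 \<in> A" "v a0 b \<noteq> 0" by blast
    let ?A = "A - {a0}"
    define w where "w a b' = v a b' - v a b / v a0 b * v a0 b'" for a b'
    have "card B < card ?A" "finite ?A" using insert a0 by auto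
    then obtain c where c: "\<exists>a\<in>?A. c a \<noteq> 0" "\<forall>b'\<in>B. (\<Sum>a\<in>?A. c a * w a b') = 0"
      using insert.IH[of ?A w] by blast
    define c0 where "c0 = - (\<Sum>a\<in>?A. c a * (v a b / v a0 b))"
    let ?c = "c(a0 := c0)"
    have sum_eq: "(\<Sum>a\<in>A. ?c a * v a b') = (\<Sum>a\<in>?A. c a * w a b')" for b'
    proof -
      have "(\<Sum>a\<in>A. ?c a * v a b') = c0 * v a0 b' + (\<Sum>a\<in>?A. c a * v a b')"
        using insert.prems(1) a0 by (subst sum.remove[of _ a0]) (auto intro!: sum.cong)
      also have "\<dots> = (\<Sum>a\<in>?A. c a * v a b' - c a * (v a b / v a0 b) * v a0 b')"
        by (simp add: c0_def sum_subtractf sum_distrib_right)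
      finally show ?thesis by (simp add: w_def algebra_simps)
    qed
    have "w a b = 0" for a using a0 by (simp add: w_def)
    hence "\<forall>b'\<in>insert b B. (\<Sum>a\<in>A. ?c a * v a b') = 0" unfolding sum_eq using c(2) by simp
    moreover have "\<exists>a\<in>A. ?c a \<noteq> 0" using c(1) by auto
    ultimately show ?thesis by blast
  qed
qed

definition box :: "nat \<Rightarrow> nat \<Rightarrow> (nat \<Rightarrow>\<^sub>0 nat) set" where
  "box n D = {s. keys s \<subseteq> {1..n} \<and> (\<forall>i. lookup s i < D)}"

lemma box_bij:
  assumes "D > 0"
  shows "bij_betw (\<lambda>s. restrict (lookup s) {1..n}) (box n D) (PiE {1..n} (\<lambda>_. {..<D}))"
proof (rule bij_betw_byWitness[where f' = "\<lambda>g. \<Sum>i\<in>{1..n}. single i (g i)"])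
  have lk: "lookup (\<Sum>i\<in>{1..n}. single i (g i)) j = (if j \<in> {1..n} then g j else 0)" for g :: "nat \<Rightarrow> nat" and j
    unfolding lookup_sum lookup_single when_def by simp
  show "\<forall>s\<in>box n D. (\<Sum>i\<in>{1..n}. single i (restrict (lookup s) {1..n} i)) = s"
  proof
    fix s assume s: "s \<in> box n D"
    show "(\<Sum>i\<in>{1..n}. single i (restrict (lookup s) {1..n} i)) = s"
    proof (rule poly_mapping_eqI)
      fix j
      have "lookup s j = 0" if "j \<notin> {1..n}" using s that by (auto simp: box_def in_keys_iff)
      thus "lookup (\<Sum>i\<in>{1..n}. single i (restrict (lookup s) {1..n} i)) j = lookup s j"
        unfolding lk by (auto simp: restrict_def)
    qed
  qed
  show "\<forall>g\<in>PiE {1..n} (\<lambda>_. {..<D}). restrict (lookup (\<Sum>i\<in>{1..n}. single i (g i))) {1..n} = g"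
  proof
    fix g assume "g \<in> PiE {1..n} (\<lambda>_. {..<D})"
    thus "restrict (lookup (\<Sum>i\<in>{1..n}. single i (g i))) {1..n} = g"
      by (intro extensionalityI[of _ "{1..n}"]) (simp_all only: lk PiE_iff restrict_extensional restrict_apply' if_True)
  qed
  show "(\<lambda>s. restrict (lookup s) {1..n}) ` box n D \<subseteq> PiE {1..n} (\<lambda>_. {..<D})"
    by (auto simp: box_def)
  show "(\<lambda>g. \<Sum>i\<in>{1..n}. single i (g i)) ` PiE {1..n} (\<lambda>_. {..<D}) \<subseteq> box n D"
  proof (rule image_subsetI)
    fix g assume "g \<in> PiE {1..n} (\<lambda>_. {..<D})"
    thus "(\<Sum>i\<in>{1..n}. single i (g i)) \<in> box n D"
      using assms unfolding box_def mem_Collect_eq lk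
      by (intro conjI subsetI allI) (simp_all only: in_keys_iff lk PiE_iff split: if_splits, blast)
  qed
qed

lemma box_card: "D > 0 \<Longrightarrow> finite (box n D) \<and> card (box n D) = D ^ n"
proof -
  assume D: "D > 0"
  have "finite (PiE {1..n} (\<lambda>_. {..<D}))" by (intro finite_PiE) auto
  moreover have "card (PiE {1..n} (\<lambda>_. {..<D})) = D ^ n" by (simp add: card_PiE)
  ultimately show ?thesis
    using bij_betw_finite[OF box_bij[OF D]] bij_betw_same_card[OF box_bij[OF D]] by metis
qed

text \<open>A bound on every single exponent; unlike the total degree it fits the counting of boxes.\<close>

definition exponents_le :: "nat \<Rightarrow> 'k::field mpoly \<Rightarrow> bool" where
  "exponents_le K p \<longleftrightarrow> (\<forall>m\<in>keys p. \<forall>i. lookup m i \<le> K)"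

lemma exponents_le_mult: "exponents_le K p \<Longrightarrow> exponents_le L q \<Longrightarrow> exponents_le (K + L) (p * q)"
  unfolding exponents_le_def
proof (intro ballI allI)
  fix m i
  assume *: "\<forall>m\<in>keys p. \<forall>i. lookup m i \<le> K" "\<forall>m\<in>keys q. \<forall>i. lookup m i \<le> L" and "m \<in> keys (p * q)"
  then obtain a b where "m = a + b" "a \<in> keys p" "b \<in> keys q"
    using Poly_Mapping.keys_mult[of p q] by blast
  thus "lookup m i \<le> K + L" using * by (simp add: lookup_add add_mono)
qed

lemma exponents_le_1: "exponents_le 0 1"
  by (auto simp: exponents_le_def)

lemma exponents_le_power: "exponents_le K p \<Longrightarrow> exponents_le (k * K) (p ^ k)"
  by (induction k) (auto simp: exponents_le_1 exponents_le_mult)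

lemma exponents_le_prod:
  "(\<And>a. a \<in> A \<Longrightarrow> exponents_le (K a) (f a)) \<Longrightarrow> exponents_le (sum K A) (prod f A)"
  by (induction A rule: infinite_finite_induct) (auto simp: exponents_le_1 exponents_le_mult)

lemma exponents_le_mono: "exponents_le K p \<Longrightarrow> K \<le> L \<Longrightarrow> exponents_le L p"
  unfolding exponents_le_def using le_trans by blast

lemma exponents_le_exists: "\<exists>K. exponents_le K p"
proof
  show "exponents_le (\<Sum>m\<in>keys p. total_degree m) p"
    unfolding exponents_le_def
  proof (intro ballI allI)
    fix m i assume m: "m \<in> keys p"
    have "lookup m i \<le> total_degree m"
    proof (cases "i \<in> keys m")
      case True
      thus ?thesis unfolding total_degree_def by (intro member_le_sum) auto
    qed (simp add: in_keys_iff)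
    also have "\<dots> \<le> (\<Sum>m\<in>keys p. total_degree m)" using m by (intro member_le_sum) auto
    finally show "lookup m i \<le> (\<Sum>m\<in>keys p. total_degree m)" .
  qed
qed

text \<open>
  A dimension count: in the products of powers of the \<open>g\<^sub>i\<close> with bounded exponents, the exponents of the
  \<open>n\<close> variables grow only linearly with the bound, so \<open>n + 1\<close> polynomials have too many such products.
\<close>

lemma algebraic_dependence:
  fixes g :: "nat \<Rightarrow> 'k::field mpoly"
  assumes g: "\<And>i. i \<in> {1..Suc n} \<Longrightarrow> g i \<in> poly_ring n"
  shows "\<exists>Q\<in>poly_ring (Suc n). Q \<noteq> 0 \<and> subst g Q = 0"
proof -
  let ?N = "Suc n"
  have "\<forall>i. \<exists>K. exponents_le K (g i)" by (intro allI exponents_le_exists)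
  from choice[OF this] obtain e where e: "\<And>i. exponents_le (e i) (g i)" by blast
  define M where "M = (\<Sum>i\<in>{1..?N}. e i)"
  have eM: "exponents_le M (g i)" if "i \<in> {1..?N}" for i
    unfolding M_def using that by (intro exponents_le_mono[OF e] member_le_sum) auto
  \<comment> \<open>There are \<open>D\<^bsup>n+1\<^esup>\<close> monomials in the \<open>g\<^sub>i\<close> with exponents below \<open>D\<close>. They lie in the span of \<open>K\<^sup>n\<close>
    monomials in the variables, where \<open>K\<close> grows linearly in \<open>D\<close>, and \<open>D\<close> is large enough for \<open>K\<^sup>n < D\<^bsup>n+1\<^esup>\<close>.\<close>
  define D where "D = Suc ((?N * M + 1) ^ n)"
  define K where "K = ?N * (D * M) + 1"
  have D0: "D > 0" and K0: "K > 0" by (auto simp: D_def K_def)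
  have "K \<le> D * (?N * M + 1)" using D0 by (simp add: K_def algebra_simps)
  hence "K ^ n \<le> D ^ n * (?N * M + 1) ^ n" by (metis power_mono power_mult_distrib zero_le)
  also have "\<dots> < D ^ n * D" unfolding D_def by (intro mult_strict_left_mono) auto
  finally have lt: "card (box n K) < card (box ?N D)"
    using box_card[OF D0, of ?N] box_card[OF K0, of n] by (simp add: mult.commute)
  have mon_box: "keys (mon g s) \<subseteq> box n K" if s: "s \<in> box ?N D" for s
  proof -
    have ks: "keys s \<subseteq> {1..?N}" "\<And>i. lookup s i < D" using s by (auto simp: box_def)
    have ms: "mon g s = (\<Prod>i\<in>{1..?N}. g i ^ lookup s i)"
      by (rule mon_superset[OF _ ks(1)]) simp
    have "exponents_le (\<Sum>i\<in>{1..?N}. D * M) (mon g s)"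
      unfolding ms
    proof (rule exponents_le_prod)
      fix i assume "i \<in> {1..?N}"
      thus "exponents_le (D * M) (g i ^ lookup s i)"
        using ks(2)[of i] by (intro exponents_le_mono[OF exponents_le_power[OF eM]] mult_le_mono) auto
    qed
    hence ex: "exponents_le (?N * (D * M)) (mon g s)" by simp
    have "mon g s \<in> poly_ring n"
      unfolding ms using g by (intro poly_ring_prod poly_ring_power)
    thus ?thesis using ex by (auto simp: box_def K_def exponents_le_def poly_ring_def less_Suc_eq_le)
  qed
  obtain c where c: "\<exists>s\<in>box ?N D. c s \<noteq> 0"
    "\<forall>m\<in>box n K. (\<Sum>s\<in>box ?N D. c s * lookup (mon g s) m) = 0"
    using underdetermined_system[of "box n K" "box ?N D" "\<lambda>s. lookup (mon g s)"] lt
      box_card[OF D0, of ?N] box_card[OF K0, of n] by blast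
  define Q where "Q = (\<Sum>s\<in>box ?N D. single s (c s))"
  have fin: "finite (box ?N D)" using box_card[OF D0] by blast
  have "lookup Q s = (if s \<in> box ?N D then c s else 0)" for s
    unfolding Q_def lookup_sum lookup_single when_def using fin by simp
  hence "Q \<noteq> 0" using c(1) by (metis lookup_zero)
  moreover have "Q \<in> poly_ring ?N"
    unfolding Q_def by (intro poly_ring_sum single_poly_ring) (auto simp: box_def)
  moreover have "subst g Q = 0"
  proof (rule poly_mapping_eqI)
    fix m
    have eq: "lookup (subst g Q) m = (\<Sum>s\<in>box ?N D. c s * lookup (mon g s) m)"
      by (simp add: Q_def subst_sum subst_single lookup_sum lookup_const_mult)
    show "lookup (subst g Q) m = lookup 0 m"
    proof (cases "m \<in> box n K")
      case True
      thus ?thesis using c(2) unfolding eq by simp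
    next
      case False
      hence "lookup (mon g s) m = 0" if "s \<in> box ?N D" for s
        using mon_box[OF that] by (auto simp: in_keys_iff)
      thus ?thesis unfolding eq by simp
    qed
  qed
  ultimately show ?thesis by blast
qed

section \<open>A bound for chains of primes and for regular sequences\<close>

context graded_subring
begin

lemma subst_closed:
  assumes "Q \<in> poly_ring m" "\<And>i. i \<in> {1..m} \<Longrightarrow> g i \<in> R" shows "subst g Q \<in> R"
  using assms(1)
  by (induction Q rule: poly_ring_induct) (auto simp: subst_hom assms(2) R_const R_add R_mult)

text \<open>
  The common reason why chains of primes and regular sequences have length at most \<open>n\<close>: elements \<open>f i\<close> of
  \<open>I (Suc i)\<close> that are regular modulo \<open>I i\<close> are algebraically independent. Indeed, a nonzero polynomial in
  \<open>f (l-1), \<dots>, f j\<close> is never in \<open>I j\<close>: cancelling powers of \<open>f j\<close>, which is regular modulo \<open>I j\<close>, and then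
  reducing modulo \<open>I (Suc j)\<close>, which contains \<open>f j\<close>, gives a nonzero polynomial in one element less.
\<close>

lemma chain_bound:
  assumes R: "R \<subseteq> poly_ring n"
    and f: "\<And>i. i < l \<Longrightarrow> f i \<in> R \<and> f i \<in> I (Suc i)"
    and ideal: "\<And>i. i \<le> l \<Longrightarrow> ideal (I i) (ring_on R)"
    and mono: "\<And>i. i < l \<Longrightarrow> I i \<subseteq> I (Suc i)"
    and regular: "\<And>i y. i < l \<Longrightarrow> y \<in> R \<Longrightarrow> f i * y \<in> I i \<Longrightarrow> y \<in> I i"
    and proper: "1 \<notin> I l"
  shows "l \<le> n"
proof (rule ccontr)
  assume "\<not> l \<le> n"
  hence nl: "Suc n \<le> l" by simp
  \<comment> \<open>The reversed order lets the induction remove the variable of highest index.\<close>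
  define g where "g i = f (l - i)" for i
  have gR: "g i \<in> R" if "i \<in> {1..l}" for i unfolding g_def using f that by auto
  have "subst g Q \<notin> I (l - i)" if "i \<le> l" "Q \<in> poly_ring i" "Q \<noteq> 0" for i Q
    using that
  proof (induction i arbitrary: Q)
    case 0
    have "m = 0" if "m \<in> keys Q" for m using 0 that by (auto simp: poly_ring_def)
    hence "homogeneous 0 Q" by (force simp: homogeneous_def total_degree_def)
    then obtain c where c: "Q = const c" using homogeneous_degree_0 by blast
    hence "c \<noteq> 0" using 0 by auto
    show ?case
    proof
      assume "subst g Q \<in> I (l - 0)"
      hence "const (inverse c) * const c \<in> I l"
        using c by (intro ideal_ring_onD(4)[OF ideal] R_const) auto
      thus False using \<open>c \<noteq> 0\<close> proper by (simp flip: const_mult)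
    qed
  next
    case (Suc i)
    let ?j = "l - Suc i"
    have j: "?j < l" "Suc ?j = l - i" "g (Suc i) = f ?j" using Suc.prems by (auto simp: g_def)
    obtain k Q' where Q': "Q = var (Suc i) ^ k * Q'" "subst (kill (Suc i)) Q' \<noteq> 0"
      using factor_out_var[OF Suc.prems(3)] by blast
    have Q'_ring: "Q' \<in> poly_ring (Suc i)"
      using Suc.prems(2) unfolding Q'(1) by (rule poly_ring_dvd_cofactor[rotated]) auto
    have gR': "g i' \<in> R" if "i' \<in> {1..Suc i}" for i' using that Suc.prems(1) by (intro gR) auto
    have Q'R: "subst g Q' \<in> R" by (rule subst_closed[OF Q'_ring gR'])
    have kill_ring: "subst (kill (Suc i)) Q' \<in> poly_ring i" by (rule kill_in_poly_ring[OF Q'_ring])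
    have "var (Suc i) dvd Q' - subst (kill (Suc i)) Q'"
      by (rule subst_dvd_diff) (auto simp: kill_def)
    then obtain Q'' where Q'': "Q' - subst (kill (Suc i)) Q' = var (Suc i) * Q''" by (rule dvdE)
    have "var (Suc i) * Q'' \<in> poly_ring (Suc i)"
      unfolding Q''[symmetric] using Q'_ring kill_ring poly_ring_mono[of i "Suc i"]
      by (intro poly_ring_diff) auto
    hence "Q'' \<in> poly_ring (Suc i)" by (rule poly_ring_dvd_cofactor[rotated]) auto
    hence Q''R: "subst g Q'' \<in> R" by (rule subst_closed[OF _ gR'])
    have pow: "y \<in> I ?j" if "f ?j ^ k * y \<in> I ?j" "y \<in> R" for y k
      using that
    proof (induction k)
      case (Suc k)
      have "f ?j ^ k * y \<in> R" using f[OF j(1)] Suc.prems by (intro R_mult R_power) auto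
      moreover have "f ?j * (f ?j ^ k * y) \<in> I ?j" using Suc.prems by (simp add: mult.assoc)
      ultimately have "f ?j ^ k * y \<in> I ?j" using regular[OF j(1)] by blast
      thus ?case using Suc by blast
    qed simp
    show ?case
    proof
      assume "subst g Q \<in> I ?j"
      hence "f ?j ^ k * subst g Q' \<in> I ?j" unfolding Q'(1) by (simp add: subst_hom j(3))
      hence "subst g Q' \<in> I ?j" by (rule pow[OF _ Q'R])
      hence 1: "subst g Q' \<in> I (l - i)" using mono[OF j(1)] j(2) by auto
      have id: "ideal (I (l - i)) (ring_on R)" by (rule ideal) simp
      have "f ?j \<in> I (l - i)" using f[OF j(1)] j(2) by simp
      hence "(- subst g Q'') * f ?j \<in> I (l - i)"
        using Q''R by (intro ideal_ring_onD(4)[OF id] R_uminus)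
      hence "subst g Q' + (- subst g Q'') * f ?j \<in> I (l - i)" using 1 by (intro ideal_ring_onD(3)[OF id])
      moreover have "subst g Q' + (- subst g Q'') * f ?j = subst g (subst (kill (Suc i)) Q')"
      proof -
        have "subst g (subst (kill (Suc i)) Q') = subst g (Q' - var (Suc i) * Q'')"
          using Q'' by (metis diff_diff_eq2 add_diff_cancel_left' diff_add_cancel)
        thus ?thesis by (simp add: subst_hom j(3))
      qed
      ultimately show False
        using Suc.IH[OF _ kill_ring Q'(2)] Suc.prems(1) by simp
    qed
  qed
  note key = this
  have "\<exists>Q\<in>poly_ring (Suc n). Q \<noteq> 0 \<and> subst g Q = 0"
    using gR nl R by (intro algebraic_dependence) (auto simp: subset_iff)
  then obtain Q where Q: "Q \<in> poly_ring (Suc n)" "Q \<noteq> 0" "subst g Q = 0" by blast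
  have "Q \<in> poly_ring l" using Q(1) poly_ring_mono[OF nl] by blast
  from key[OF order_refl this Q(2)] have "0 \<notin> I 0" using Q(3) by simp
  thus False using ideal_ring_onD(2)[OF ideal[of 0]] by simp
qed

lemma primeideal_ring_onD:
  assumes "primeideal P (ring_on R)"
  shows "ideal P (ring_on R)" "1 \<notin> P" "x \<in> R \<Longrightarrow> y \<in> R \<Longrightarrow> x * y \<in> P \<Longrightarrow> x \<in> P \<or> y \<in> P"
proof -
  interpret primeideal P "ring_on R" by fact
  show id: "ideal P (ring_on R)" by (rule is_ideal)
  show "1 \<notin> P"
  proof
    assume "1 \<in> P"
    hence "R \<subseteq> P" using ideal_ring_onD(4)[OF id, of _ 1] by auto
    hence "P = R" using ideal_ring_onD(1)[OF id] by blast
    thus False using I_notcarr by (simp add: ring_on_simps)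
  qed
  show "x \<in> R \<Longrightarrow> y \<in> R \<Longrightarrow> x * y \<in> P \<Longrightarrow> x \<in> P \<or> y \<in> P"
    using I_prime[of x y] by (simp add: ring_on_simps)
qed

text \<open>
  In a chain of primes, any element of \<open>P\<^bsub>i+1\<^esub>\<close> outside \<open>P\<^sub>i\<close> is regular modulo \<open>P\<^sub>i\<close>.
\<close>

lemma krull_dim_le:
  assumes "R \<subseteq> poly_ring n" shows "krull_dim (ring_on R) \<le> enat n"
  unfolding krull_dim_def
proof (rule SUP_least)
  fix Ps assume "Ps \<in> {Ps. Ps \<noteq> [] \<and> (\<forall>P\<in>set Ps. primeideal P (ring_on R)) \<and> sorted_wrt (\<subset>) Ps}"
  hence Ps: "Ps \<noteq> []" "\<And>i. i < length Ps \<Longrightarrow> primeideal (Ps ! i) (ring_on R)" "sorted_wrt (\<subset>) Ps"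
    by auto
  let ?l = "length Ps - 1"
  have less: "Ps ! i \<subset> Ps ! Suc i" if "i < ?l" for i
    using sorted_wrt_nth_less[OF Ps(3), of i "Suc i"] that by simp
  have "\<exists>x. x \<in> Ps ! Suc i \<and> x \<notin> Ps ! i" if "i < ?l" for i using less[OF that] by blast
  then obtain f where f: "\<And>i. i < ?l \<Longrightarrow> f i \<in> Ps ! Suc i \<and> f i \<notin> Ps ! i" by metis
  have prime: "primeideal (Ps ! i) (ring_on R)" if "i \<le> ?l" for i
    using that Ps(1) by (intro Ps(2)) (cases Ps; auto)
  have fR: "f i \<in> R" if "i < ?l" for i
    using f[OF that] ideal_ring_onD(1)[OF primeideal_ring_onD(1)[OF prime[of "Suc i"]]] that by auto
  have "?l \<le> n"
  proof (rule chain_bound[OF assms, where f = f and I = "(!) Ps"])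
    fix i y assume i: "i < ?l" "y \<in> R" "f i * y \<in> Ps ! i"
    thus "y \<in> Ps ! i" using primeideal_ring_onD(3)[OF prime fR[OF i(1)] i(2) i(3)] f[OF i(1)] by auto
  qed (use f fR less primeideal_ring_onD[OF prime] in auto)
  thus "enat (length Ps - 1) \<le> enat n" by simp
qed

lemma depth_le:
  assumes "R \<subseteq> poly_ring n" shows "depth (ring_on R) J \<le> enat n"
  unfolding depth_def
proof (rule SUP_least)
  fix fs assume "fs \<in> {fs. regular_sequence (ring_on R) fs \<and> set fs \<subseteq> J}"
  hence reg: "regular_sequence (ring_on R) fs" by simp
  have sub: "set fs \<subseteq> R" using reg by (simp add: regular_sequence_def ring_on_simps)
  have sub': "set (take i fs) \<subseteq> R" for i using sub set_take_subset[of i fs] by blast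
  let ?I = "\<lambda>i. genideal (ring_on R) (set (take i fs))"
  note gen = genideal_facts[OF sub']
  have "length fs \<le> n"
  proof (rule chain_bound[OF assms, where f = "(!) fs" and I = ?I])
    fix i assume i: "i < length fs"
    have "fs ! i \<in> set (take (Suc i) fs)" using i by (auto simp: take_Suc_conv_app_nth)
    thus "fs ! i \<in> R \<and> fs ! i \<in> ?I (Suc i)" using i sub gen(2)[of "Suc i"] by auto
    have "set (take i fs) \<subseteq> ?I (Suc i)"
      using gen(2)[of "Suc i"] i by (auto simp: take_Suc_conv_app_nth)
    thus "?I i \<subseteq> ?I (Suc i)" by (rule gen(3)[OF gen(1)])
  next
    fix i y assume i: "i < length fs" "y \<in> R" "fs ! i * y \<in> ?I i"
    thus "y \<in> ?I i" using reg by (auto simp: regular_sequence_def ring_on_simps mult.commute)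
  next
    show "1 \<notin> ?I (length fs)"
    proof
      assume "1 \<in> ?I (length fs)"
      hence "R \<subseteq> ?I (length fs)"
        using ideal_ring_onD(4)[OF gen(1), of _ 1] by fastforce
      hence "?I (length fs) = R" using ideal_ring_onD(1)[OF gen(1)] by blast
      thus False using reg by (simp add: regular_sequence_def ring_on_simps)
    qed
  qed (rule gen(1))
  thus "enat (length fs) \<le> enat n" by simp
qed

end

section \<open>Rings of invariants in characteristic zero are Cohen-Macaulay\<close>

lemma esym_killed:
  assumes "i \<le> n"
  shows "subst (kill_upto i) (esym n (n - i)) \<noteq> (0 :: 'k::field mpoly)"
    "i < n \<Longrightarrow> subst (kill_upto (Suc i)) (esym n (n - i)) = (0 :: 'k mpoly)"
proof -
  have kill: "subst (kill_upto l) (\<Prod>j\<in>K. var j :: 'k mpoly) = (if K \<inter> {1..l} = {} then \<Prod>j\<in>K. var j else 0)"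
    if "finite K" for K l
  proof (cases "K \<inter> {1..l} = {}")
    case True
    have "(\<Prod>j\<in>K. subst (kill_upto l) (var j)) = (\<Prod>j\<in>K. var j :: 'k mpoly)"
      using True by (intro prod.cong) (auto simp: kill_upto_def)
    thus ?thesis using True by (simp add: subst_prod)
  next
    case False
    then obtain j where "j \<in> K" "j \<in> {1..l}" by blast
    thus ?thesis using False that
      by (auto simp: subst_prod prod_zero_iff kill_upto_def intro!: bexI[of _ j])
  qed
  have fin: "finite K" if "K \<in> {K. K \<subseteq> {1..n} \<and> card K = n - i}" for K
    using that finite_subset by auto
  have eq: "subst (kill_upto l) (esym n (n - i)) =
      (\<Sum>K | K \<subseteq> {1..n} \<and> card K = n - i. if K \<inter> {1..l} = {} then \<Prod>j\<in>K. var j else 0 :: 'k mpoly)" for l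
    unfolding esym_def subst_sum by (intro sum.cong refl kill fin)
  show "subst (kill_upto i) (esym n (n - i)) \<noteq> (0 :: 'k mpoly)"
  proof -
    have "K \<inter> {1..i} = {} \<longleftrightarrow> K = {Suc i..n}" if "K \<subseteq> {1..n}" "card K = n - i" for K
    proof
      assume "K \<inter> {1..i} = {}"
      hence "K \<subseteq> {Suc i..n}" using that(1) by force
      moreover have "card K = card {Suc i..n}" using that assms by simp
      ultimately show "K = {Suc i..n}" by (intro card_subset_eq) auto
    qed auto
    hence "subst (kill_upto i) (esym n (n - i)) =
      (\<Sum>K | K \<subseteq> {1..n} \<and> card K = n - i. if K = {Suc i..n} then \<Prod>j\<in>{Suc i..n}. var j else 0 :: 'k mpoly)"
      unfolding eq by (intro sum.cong refl) auto
    also have "\<dots> = (\<Prod>j\<in>{Suc i..n}. var j)" using assms by auto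
    finally show ?thesis by simp
  qed
  show "subst (kill_upto (Suc i)) (esym n (n - i)) = (0 :: 'k mpoly)" if "i < n"
  proof -
    have "K \<inter> {1..Suc i} \<noteq> {}" if "K \<subseteq> {1..n}" "card K = n - i" for K
    proof
      assume "K \<inter> {1..Suc i} = {}"
      hence "K \<subseteq> {Suc (Suc i)..n}" using that(1) by force
      hence "card K \<le> card {Suc (Suc i)..n}" by (intro card_mono) auto
      thus False using that \<open>i < n\<close> by simp
    qed
    thus ?thesis unfolding eq by (intro sum.neutral) auto
  qed
qed

text \<open>
  The primes \<open>(x\<^sub>1, \<dots>, x\<^sub>i) S \<inter> R\<close> form a chain, and \<open>e\<^bsub>n-i\<^esub>\<close> lies in the one with index \<open>i + 1\<close> but not in the one with
  index \<open>i\<close>: every product of \<open>n - i\<close> distinct variables involves one of \<open>x\<^sub>1, \<dots>, x\<^bsub>i+1\<^esub>\<close>, but one of them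
  avoids \<open>x\<^sub>1, \<dots>, x\<^sub>i\<close>.
\<close>

lemma krull_dim_invariants_ge:
  assumes G: "perm_grp n G" and char: "CHAR('k::field) \<noteq> 2"
  shows "enat n \<le> krull_dim (ring_on (invariants n G :: 'k mpoly set))"
proof -
  let ?R = "invariants n G :: 'k mpoly set"
  interpret graded_subring ?R by (rule graded_subring_invariants)
  define P where "P i = {p \<in> ?R. subst (kill_upto i) p = 0}" for i
  have "primeideal (P i) (ring_on ?R)" for i
  proof (rule primeidealI)
    show "ideal (P i) (ring_on ?R)"
      by (rule ideal_ring_onI) (auto simp: P_def subst_hom R_0 R_add R_mult)
    have "1 \<in> ?R" "1 \<notin> P i" by (auto simp: P_def R_1)
    thus "carrier (ring_on ?R) \<noteq> P i" by (auto simp: ring_on_simps)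
    fix x y assume "x \<in> carrier (ring_on ?R)" "y \<in> carrier (ring_on ?R)" "x \<otimes>\<^bsub>ring_on ?R\<^esub> y \<in> P i"
    thus "x \<in> P i \<or> y \<in> P i" by (auto simp: P_def ring_on_simps subst_mult)
  qed (rule cring_ring_on)
  moreover have "P i \<subset> P (Suc i)" if "i < n" for i
  proof
    have "kill_upto (Suc i) = (\<lambda>l. subst (kill_upto (Suc i)) (kill_upto i l :: 'k mpoly))"
      by (auto simp: kill_upto_def fun_eq_iff)
    hence "subst (kill_upto (Suc i)) p = subst (kill_upto (Suc i)) (subst (kill_upto i) (p :: 'k mpoly))" for p
      unfolding subst_subst by (rule arg_cong)
    note factor = this
    show "P i \<subseteq> P (Suc i)"
    proof
      fix p assume p: "p \<in> P i"
      have "subst (kill_upto (Suc i)) p = 0" by (subst factor) (use p in \<open>simp add: P_def\<close>)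
      thus "p \<in> P (Suc i)" using p by (simp add: P_def)
    qed
    have "esym n (n - i) \<in> ?R" using sym_polys_subset[OF G char] esym_sym by blast
    hence "esym n (n - i) \<in> P (Suc i)" "esym n (n - i) \<notin> P i"
      using esym_killed[of i n, where 'k = 'k] that by (auto simp: P_def)
    thus "P i \<noteq> P (Suc i)" by blast
  qed
  hence "P i \<subset> P j" if "i < j" "j \<le> n" for i j
    using that
  proof (induction j)
    case (Suc j)
    have step: "P j \<subset> P (Suc j)" using Suc.prems by (intro \<open>\<And>i. i < n \<Longrightarrow> P i \<subset> P (Suc i)\<close>) simp
    show ?case
    proof (cases "i = j")
      case False
      hence "P i \<subset> P j" using Suc by simp
      thus ?thesis using step by (rule psubset_trans)
    qed (simp add: step)
  qed simp
  hence "sorted_wrt (\<subset>) (map P [0..<Suc n])"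
    by (auto simp: sorted_wrt_iff_nth_less simp del: upt_Suc)
  ultimately have "map P [0..<Suc n] \<in> {Ps. Ps \<noteq> [] \<and> (\<forall>P\<in>set Ps. primeideal P (ring_on ?R)) \<and> sorted_wrt (\<subset>) Ps}"
    by auto
  hence "enat (length (map P [0..<Suc n]) - 1) \<le> krull_dim (ring_on ?R)"
    unfolding krull_dim_def by (rule SUP_upper)
  thus ?thesis by simp
qed

text \<open>
  Through \<open>in_esym\<close> this is the regularity of the variables in a polynomial ring.
\<close>

lemma esym_regular_on_sym:
  fixes a :: "'k::field mpoly"
  assumes a: "a \<in> sym_polys n" and b: "\<And>j. j \<in> {1..i} \<Longrightarrow> b j \<in> sym_polys n" and i: "i < n"
    and eq: "a * esym n (Suc i) = (\<Sum>j\<in>{1..i}. b j * esym n j)"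
  shows "\<exists>c. (\<forall>j. c j \<in> sym_polys n) \<and> a = (\<Sum>j\<in>{1..i}. c j * esym n j)"
proof -
  let ?q = "in_esym n a" and ?k = "subst (kill_upto i) :: 'k mpoly \<Rightarrow> 'k mpoly"
  have in_esym_sum: "in_esym n (\<Sum>j\<in>A. b j * esym n j) = (\<Sum>j\<in>A. in_esym n (b j) * var j)"
    if "A \<subseteq> {1..i}" for A
    using finite_subset[OF that finite_atLeastAtMost] that
  proof (induction A rule: finite_induct)
    case (insert j A)
    have j: "j \<in> {1..i}" "j \<in> {1..n}" using insert.prems i by auto
    have "(\<Sum>j\<in>A. b j * esym n j) \<in> sym_polys n"
      using insert.prems b by (intro invariants_sum invariants_mult esym_sym) auto
    thus ?case using insert j(1)
      by (simp add: in_esym_add in_esym_mult in_esym_esym[OF j(2)] esym_sym b invariants_mult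
          del: atLeastAtMost_iff)
  qed simp
  have "?q * var (Suc i) = in_esym n (a * esym n (Suc i))"
    using a i by (simp add: in_esym_mult esym_sym in_esym_esym)
  also have "\<dots> = (\<Sum>j\<in>{1..i}. in_esym n (b j) * var j)" unfolding eq by (rule in_esym_sum) simp
  finally have "?k (?q * var (Suc i)) = ?k (\<Sum>j\<in>{1..i}. in_esym n (b j) * var j)" by simp
  also have "\<dots> = 0"
    unfolding subst_sum subst_mult by (intro sum.neutral) (simp add: kill_upto_def)
  finally have "?k ?q = 0" by (simp add: subst_mult kill_upto_def)
  then obtain c where c: "\<forall>j. c j \<in> poly_ring n" "?q = (\<Sum>j\<in>{1..i}. c j * var j)"
    using poly_ring_split[OF fundamental_theorem(1)[OF a], of i] i by auto
  have "a = subst (esym n) ?q" using fundamental_theorem(2)[OF a] by simp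
  also have "\<dots> = (\<Sum>j\<in>{1..i}. subst (esym n) (c j) * esym n j)"
    using arg_cong[OF c(2), of "subst (esym n)"] by (simp add: subst_hom)
  finally show ?thesis
    using c(1) subst_esym_sym by (intro exI[of _ "\<lambda>j. subst (esym n) (c j)"]) blast
qed

lemma trace_of_invariant:
  assumes "a \<in> invariants n G" shows "trace G a = const (of_nat (card G)) * a"
  using assms by (simp add: trace_def invariants_act const_def single_of_nat)

text \<open>
  The maps \<open>a \<mapsto> ctr(g\<^sub>c a)\<close> are linear over the symmetric polynomials. They carry a relation over the
  invariants to relations over the symmetric polynomials, where the sequence is regular; the
  dual bases then put \<open>a\<close> into the ideal generated by \<open>e\<^sub>1, \<dots>, e\<^sub>i\<close> in the polynomial ring. Averaging over \<open>G\<close>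
  brings the coefficients back to the invariants, and this is where characteristic zero enters.
\<close>

lemma es_regular_sequence:
  assumes G: "perm_grp n G" and char: "CHAR('k::field_char_0) \<noteq> 2"
  shows "regular_sequence (ring_on (invariants n G :: 'k mpoly set)) (es n)"
proof -
  let ?R = "invariants n G :: 'k mpoly set"
  interpret graded_subring ?R by (rule graded_subring_invariants)
  note triv = perm_grp_trivial[of n]
  have irr: "set (es n) \<subseteq> irrelevant_ideal ?R" by (rule es_irrelevant[OF G char])
  hence sub: "set (es n) \<subseteq> ?R" by (auto simp: irrelevant_ideal_def)
  have "1 \<notin> genideal (ring_on ?R) (set (es n))"
    using genideal_facts(3)[OF sub ideal_irrelevant irr] by (auto simp: irrelevant_ideal_def)
  hence proper: "genideal (ring_on ?R) (set (es n)) \<noteq> carrier (ring_on ?R)"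
    using R_1 by (auto simp: ring_on_simps)
  have take_es: "set (take i (es n)) = esym n ` {1..i}" if "i \<le> n" for i
    unfolding es_def using that by (simp add: take_map del: upt_Suc) (auto simp del: upt_Suc)
  have "a \<in> genideal (ring_on ?R) (set (take i (es n)))"
    if i: "i < n" and a: "a \<in> ?R" and ae: "a * es n ! i \<in> genideal (ring_on ?R) (set (take i (es n)))" for i a
  proof -
    have sub_i: "set (take i (es n)) \<subseteq> ?R" using sub set_take_subset[of i "es n"] by blast
    have len: "length (take i (es n)) = i" using i by simp
    obtain b0 where b0: "\<forall>j<i. b0 j \<in> ?R" "a * es n ! i = (\<Sum>j<i. b0 j * take i (es n) ! j)"
      using genideal_combination[OF sub_i ae] unfolding len by blast
    define b where "b j = b0 (j - 1)" for j
    have bR: "b j \<in> ?R" if "j \<in> {1..i}" for j using b0(1) that by (auto simp: b_def)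
    have "(\<Sum>j<i. b0 j * take i (es n) ! j) = (\<Sum>j<i. b (Suc j) * esym n (Suc j))"
      using i by (intro sum.cong) (auto simp: b_def es_nth)
    also have "\<dots> = (\<Sum>j\<in>{1..i}. b j * esym n j)"
      by (rule sum.reindex_bij_witness[where i = "\<lambda>j. j - 1" and j = Suc]) auto
    finally have eq: "a * esym n (Suc i) = (\<Sum>j\<in>{1..i}. b j * esym n j)"
      using b0(2) i by (simp add: es_nth)
    obtain N and g h :: "nat \<Rightarrow> 'k mpoly" where d: "dual_family n N g h"
      using dual_family_exists[OF char] by blast
    note g = dual_familyD(1)[OF d] and h = dual_familyD(2)[OF d]
    have a_ring: "a \<in> poly_ring n" using a by (rule invariants_poly_ring)
    let ?c = "\<lambda>c. ctr n {id} (g c * a)"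
    have mem: "g c * x \<in> semi n {id}" if "c < N" "x \<in> ?R" for c x
      unfolding semi_trivial by (rule poly_ring_mult[OF g[OF that(1)] invariants_poly_ring[OF that(2)]])
    have "\<exists>C. (\<forall>j. C j \<in> sym_polys n) \<and> ?c c = (\<Sum>j\<in>{1..i}. C j * esym n j)" if c: "c < N" for c
    proof (rule esym_regular_on_sym[OF _ _ i])
      show "?c c \<in> sym_polys n" by (rule ctr(2)[OF triv char mem[OF c a]])
      show "ctr n {id} (g c * b j) \<in> sym_polys n" if "j \<in> {1..i}" for j
        by (rule ctr(2)[OF triv char mem[OF c bR[OF that]]])
      have "?c c * esym n (Suc i) = ctr n {id} (esym n (Suc i) * (g c * a))"
        using ctr_mult[OF triv char mem[OF c a] esym_sym, of "Suc i"] by (simp add: mult.commute)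
      also have "esym n (Suc i) * (g c * a) = (\<Sum>j\<in>{1..i}. esym n j * (g c * b j))"
        using arg_cong[OF eq, of "\<lambda>x. g c * x"] by (simp add: sum_distrib_left mult_ac)
      also have "ctr n {id} \<dots> = (\<Sum>j\<in>{1..i}. ctr n {id} (esym n j * (g c * b j)))"
      proof (rule ctr_sum[OF triv char])
        fix j assume j: "j \<in> {1..i}"
        show "esym n j * (g c * b j) \<in> semi n {id}"
          using mem[OF c bR[OF j]] unfolding semi_trivial by (rule poly_ring_mult[OF esym_poly_ring])
      qed
      also have "\<dots> = (\<Sum>j\<in>{1..i}. ctr n {id} (g c * b j) * esym n j)"
      proof (intro sum.cong refl)
        fix j assume j: "j \<in> {1..i}"
        show "ctr n {id} (esym n j * (g c * b j)) = ctr n {id} (g c * b j) * esym n j"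
          using ctr_mult[OF triv char mem[OF c bR[OF j]] esym_sym, of j] by (simp add: mult.commute)
      qed
      finally show "?c c * esym n (Suc i) = (\<Sum>j\<in>{1..i}. ctr n {id} (g c * b j) * esym n j)" .
    qed
    hence "\<forall>c. \<exists>C. c < N \<longrightarrow> (\<forall>j. C j \<in> sym_polys n) \<and> ?c c = (\<Sum>j\<in>{1..i}. C j * esym n j)" by blast
    from choice[OF this] obtain C where C: "\<And>c j. c < N \<Longrightarrow> C c j \<in> sym_polys n"
      "\<And>c. c < N \<Longrightarrow> ?c c = (\<Sum>j\<in>{1..i}. C c j * esym n j)" by blast
    define B where "B j = (\<Sum>c<N. C c j * h c)" for j
    have B: "B j \<in> poly_ring n" for j
      unfolding B_def using C(1) h by (intro poly_ring_sum poly_ring_mult) (auto intro: invariants_poly_ring)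
    have "a = (\<Sum>c<N. ?c c * h c)" by (rule dual_familyD(4)[OF d a_ring])
    also have "\<dots> = (\<Sum>c<N. \<Sum>j\<in>{1..i}. esym n j * (C c j * h c))"
    proof (intro sum.cong refl)
      fix c assume "c \<in> {..<N}"
      hence "c < N" by simp
      show "?c c * h c = (\<Sum>j\<in>{1..i}. esym n j * (C c j * h c))"
        unfolding C(2)[OF \<open>c < N\<close>] sum_distrib_right by (simp only: mult_ac)
    qed
    also have "\<dots> = (\<Sum>j\<in>{1..i}. esym n j * B j)"
      unfolding B_def sum_distrib_left by (rule sum.swap)
    finally have aB: "a = (\<Sum>j\<in>{1..i}. esym n j * B j)" .
    have eR: "esym n j \<in> ?R" for j using sym_polys_subset[OF G char] esym_sym by blast
    have "trace G a = (\<Sum>j\<in>{1..i}. esym n j * trace G (B j))"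
      by (subst aB) (simp add: trace_sum trace_mult[OF G char eR])
    hence "const (of_nat (card G)) * a = (\<Sum>j\<in>{1..i}. esym n j * trace G (B j))"
      by (simp add: trace_of_invariant[OF a])
    moreover have "card G \<noteq> 0" using perm_grpD(2,5)[OF G] by auto
    hence "a = const (inverse (of_nat (card G))) * (const (of_nat (card G)) * a)"
      by (simp flip: mult.assoc const_mult)
    ultimately have "a = (\<Sum>j\<in>{1..i}. (const (inverse (of_nat (card G))) * trace G (B j)) * esym n j)"
      by (simp add: sum_distrib_left mult_ac)
    also have "\<dots> \<in> genideal (ring_on ?R) (set (take i (es n)))"
      using take_es[of i] i
      by (intro combination_genideal[OF sub_i] R_mult R_const trace_invariants[OF G char B]) auto
    finally show ?thesis .
  qed
  thus ?thesis using sub proper by (auto simp: regular_sequence_def ring_on_simps)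
qed

theorem Cohen_Macaulay_invariants:
  assumes G: "perm_grp n G" and char: "CHAR('k::field_char_0) \<noteq> 2"
  shows "Cohen_Macaulay (invariants n G :: 'k mpoly set)"
proof -
  let ?R = "invariants n G :: 'k mpoly set"
  interpret graded_subring ?R by (rule graded_subring_invariants)
  have R: "?R \<subseteq> poly_ring n" by (auto simp: invariants_def)
  have "krull_dim (ring_on ?R) = enat n"
    using krull_dim_le[OF R] krull_dim_invariants_ge[OF G char] by (rule antisym)
  moreover have "enat n \<le> depth (ring_on ?R) (irrelevant_ideal ?R)"
    unfolding depth_def
    using es_regular_sequence[OF G char] es_irrelevant[OF G char]
    by (intro SUP_upper2[of "es n"]) auto
  hence "depth (ring_on ?R) (irrelevant_ideal ?R) = enat n"
    using depth_le[OF R] by (intro antisym)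
  ultimately show ?thesis by (simp add: Cohen_Macaulay_def)
qed

section \<open>The characterisation\<close>

lemma perm_grp_subgroup:
  assumes "subgroup G (sym_group n)" shows "perm_grp n G"
proof -
  interpret subgroup G "sym_group n" by fact
  have sub: "\<sigma> permutes {1..n}" if "\<sigma> \<in> G" for \<sigma> using mem_carrier[OF that] by (simp add: sym_group_def)
  have "inv' \<sigma> \<in> G" if "\<sigma> \<in> G" for \<sigma>
    using m_inv_closed[OF that] sym_group_inv_equality[OF mem_carrier[OF that]] by simp
  moreover have "\<sigma> \<circ> \<tau> \<in> G" if "\<sigma> \<in> G" "\<tau> \<in> G" for \<sigma> \<tau>
    using m_closed[OF that] by (simp add: sym_group_def)
  moreover have "id \<in> G" using one_closed by (simp add: sym_group_def)
  moreover have "G \<subseteq> perms n" using sub by (intro subsetI) simp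
  ultimately show ?thesis unfolding perm_grp_def by (intro conjI ballI)
qed

theorem theorem5p1:
  fixes n :: nat and G :: "(nat \<Rightarrow> nat) set"
  assumes "subgroup G (sym_group n)"
    and "CHAR('k::field) \<noteq> 2"
  shows "(quasi_Gorenstein n (invariants n G :: 'k mpoly set) \<longleftrightarrow>
            (\<forall>\<sigma>\<in>G. (sgn_char \<sigma> :: 'k) / chi n G \<sigma> = 1))
       \<and> ((\<forall>\<sigma>\<in>G. (sgn_char \<sigma> :: 'k) / chi n G \<sigma> = 1) \<longleftrightarrow>
            quasi_Gorenstein n (invariants n G :: rat mpoly set))
       \<and> (quasi_Gorenstein n (invariants n G :: rat mpoly set) \<longleftrightarrow>
            Gorenstein n (invariants n G :: rat mpoly set))"
proof -
  have G: "perm_grp n G" by (rule perm_grp_subgroup[OF assms(1)])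
  have char_rat: "CHAR(rat) \<noteq> 2" by simp
  have "(\<forall>\<sigma>\<in>G. (sgn_char \<sigma> :: 'k) / chi n G \<sigma> = 1) \<longleftrightarrow>
      (\<forall>\<sigma>\<in>G. sign \<sigma> = (- 1) ^ inversions (tpairs n G) \<sigma>)"
    using character_trivial_iff[OF G _ assms(2)] by blast
  thus ?thesis
    using quasi_Gorenstein_iff_character[OF G assms(2)] quasi_Gorenstein_iff_character[OF G char_rat]
      Cohen_Macaulay_invariants[OF G char_rat]
    by (simp add: Gorenstein_def)
qed

end
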